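(* Assume that (A) for each $x\in\mathbb R$, $h(x):=\lim_{q\downarrow0}h_q(x)$ exists; (B) either there exists a measurable function $H$ such that $|h_q(x)|\le H(x)$, $x\in\mathbb R$, and $\sup_{t\ge0}\eta(H(\epsilon_t),\,t<\zeta)<\infty$; or the mapping $q\mapsto h_q(x)$ is monotone for all $x\in\mathbb R$. For $a>0$ and $x\in\mathbb R$ the measure $\mathbb P^{\leftarrow a}_x$ admits the representation $$\mathbb E^{\leftarrow a}_x\big[F(X_s,s<g_\infty)\,f(g_\infty)\,G(X_{v+g_\infty},v\le u)\big]=\frac1{V_{0,a}(x)}\,\mathbb E_x\Big[\int_0^adL_t\,F(X_s,s<t)\,f(t)\,\eta\big(G(\epsilon_s,s\le u)\,h(\epsilon_u),\ 0<u<\zeta\big)\Big],$$ for any $u>0$, any bounded measurable functionals $F,G:\mathbb D\to\mathbb R$, and any measurable $f:[0,\infty)\to[0,\infty)$.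
   Context: $\mathbb D$ is the space of càdlàg paths $[0,\infty)\to\mathbb R\cup\{\Delta\}$ absorbed at the cemetery $\Delta$ at the lifetime $\zeta$; $X$ is the coordinate process with natural filtration $(\mathcal F_t)$. Under $(\mathbb P_x)_{x\in\mathbb R}$, with $\mathbb P=\mathbb P_0$, $X$ is a "nice" Markov process on $\mathbb R$ in the sense of Chapter IV of Bertoin's book "Lévy Processes" (càdlàg, strong Markov, with a local time at $0$ and an associated Itô excursion theory). Let $T_0=\inf\{t\ge0:X_t=0\}$ and assume $\mathbb P_x(T_0<\infty)>0$ for all $x\in\mathbb R$. Let $L=(L_t)_{t\ge0}$ be the local time of $X$ at $0$; there is $\beta\ge0$ with $\beta L_t=\int_0^t\mathbf 1_{\{X_s=0\}}ds$. Set $V_{s,t}(x)=\mathbb E_x[\int_s^tdL_u]$. $\mathcal E^*$ is the set of càdlàg excursions $\epsilon$ with lifetime $\zeta=\zeta(\epsilon)>0$, $\epsilon(t)\ne0$ iff $t\in(0,\zeta)$. $\eta$ is the $\sigma$-finite excursion measure of $X$ from $0$ on $\mathcal E^*$, for which the compensation formula holds: if $(\ell_i,r_i)$ are the excursion intervals of $X$ away from $0$ and $\epsilon_i$ the corresponding excursions, then $\mathbb E[\sum_iF_{\ell_i}((X_t:t\le\ell_i),\epsilon_i)]=\mathbb E[\int_0^\infty dL_u\int_{\mathcal E^*}\eta(d\epsilon)F_u((X_t:t\le u),\epsilon)]$ for functionals $F_u$ that are adapted and left-continuous in $u$. Under $\eta$ the process $\epsilon$ is Markov with the semigroup of $X$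 killed at $T_0$. $\eta(F)$ or $\eta(F,\,B)$ denotes the integral of $F$ (over $B$) with respect to $\eta$. $\mathbf e_q$ is an independent exponential random variable with parameter $q>0$, and $$h_q(x)=\frac{\mathbb P_x(T_0>\mathbf e_q)}{q\beta+\eta(1-e^{-q\zeta})},\qquad x\in\mathbb R,\ q>0.$$ With $g_t=\sup\{s\le t:X_s=0\}$, $\mathbb P^{\leftarrow a}_x$ (with expectation $\mathbb E^{\leftarrow a}_x$) is the measure such that $\mathbb P^{\leftarrow a}_x(A;T<\zeta)=\lim_{q\downarrow0}\mathbb P_x(A;T<\mathbf e_q\mid g_{\mathbf e_q}<a)$ for all stopping times $T$ and $A\in\mathcal F_T$, whose existence the paper establishes under (A) and (B). Finally $g_\infty=\sup\{t\ge0:X_t=0\}$.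
   Formalization: The left-hand expectation is restricted to the event that g_∞ + u is less than the lifetime ζ (otherwise the identity fails, e.g. for positive recurrent X with F=f=G=1), and g_t, g_∞ are taken to be +∞ when the path has no zero; for signed F, G the left side is assumed integrable. *)

theory Defs
  imports "HOL-Probability.Probability"
begin

section \<open>The path space\<close>

text \<open>
  A path is a function of time with values in \<open>\<real> \<union> {\<Delta>}\<close>; the cemetery \<open>\<Delta>\<close> is \<^const>\<open>None\<close>
  and is an isolated point.  Only times \<open>t \<ge> 0\<close> matter, so paths are extensional on \<open>{0..}\<close>.
  Random times take values in \<open>[0,\<infinity>]\<close>, i.e. in \<^typ>\<open>ennreal\<close>.
\<close>

type_synonym path = "real \<Rightarrow> real option"

definition paths :: "path set" where
  "paths = {\<omega> \<in> extensional {0..}.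
     (\<forall>s t. 0 \<le> s \<and> s \<le> t \<and> \<omega> s = None \<longrightarrow> \<omega> t = None) \<and>
     (\<forall>t\<ge>0. \<omega> t \<noteq> None \<longrightarrow>
        (\<forall>\<^sub>F s in at_right t. \<omega> s \<noteq> None) \<and>
        ((\<lambda>s. the (\<omega> s)) \<longlongrightarrow> the (\<omega> t)) (at_right t)) \<and>
     (\<forall>t>0. (\<forall>s\<in>{0..<t}. \<omega> s \<noteq> None) \<longrightarrow>
        (\<exists>l. ((\<lambda>s. the (\<omega> s)) \<longlongrightarrow> l) (at_left t)))}"

abbreviation pos :: "real \<Rightarrow> path \<Rightarrow> real" where
  "pos t \<omega> \<equiv> the (\<omega> t)"

definition lifetime :: "path \<Rightarrow> ennreal" where
  "lifetime \<omega> = Inf (ennreal ` {t. 0 \<le> t \<and> \<omega> t = None})"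

definition nat_filt :: "ennreal \<Rightarrow> path measure" where
  "nat_filt t = sigma paths
     {{\<omega> \<in> paths. \<omega> s \<in> Some ` B} | s B. 0 \<le> s \<and> ennreal s \<le> t \<and> B \<in> sets (borel :: real measure)}"

abbreviation path_space :: "path measure" where
  "path_space \<equiv> nat_filt \<top>"

definition shift :: "real \<Rightarrow> path \<Rightarrow> path" where
  "shift t \<omega> = (\<lambda>s\<in>{0..}. \<omega> (t + s))"

lemma space_nat_filt [simp]: "space (nat_filt t) = paths"
  unfolding nat_filt_def by (rule space_measure_of) auto

lemma filtration_nat_filt: "filtration paths nat_filt"
proof
  fix s t :: ennreal assume "s \<le> t"
  let ?G = "\<lambda>t. {{\<omega> \<in> paths. \<omega> r \<in> Some ` B} | r B.
    0 \<le> r \<and> ennreal r \<le> t \<and> B \<in> sets (borel :: real measure)}"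
  have sub: "?G t \<subseteq> Pow paths" for t
    by auto
  have "?G s \<subseteq> ?G t"
    using \<open>s \<le> t\<close> by (blast intro: order_trans)
  then show "sets (nat_filt s) \<subseteq> sets (nat_filt t)"
    unfolding nat_filt_def by (simp add: sets_measure_of[OF sub] sigma_sets_mono')
qed simp

text \<open>The killed path encodes \<open>(X\<^sub>s, s < t)\<close> as an element of the path space,
  and the stopped path encodes \<open>(X\<^sub>s, s \<le> t)\<close>
  (killing just after \<open>t\<close> would not give a right-continuous path).\<close>

definition kill :: "real \<Rightarrow> path \<Rightarrow> path" where
  "kill t \<omega> = (\<lambda>s\<in>{0..}. if s < t then \<omega> s else None)"

definition stop :: "real \<Rightarrow> path \<Rightarrow> path" where
  "stop t \<omega> = (\<lambda>s\<in>{0..}. \<omega> (min s t))"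

section \<open>Zeros\<close>

definition zeros :: "path \<Rightarrow> real set" where
  "zeros \<omega> = {t. 0 \<le> t \<and> \<omega> t = Some 0}"

definition hit0 :: "path \<Rightarrow> ennreal" where
  "hit0 \<omega> = Inf (ennreal ` zeros \<omega>)"

text \<open>
  \<open>last_zero t \<omega> = sup {s \<le> t. X\<^sub>s = 0}\<close>, with value \<open>\<infinity>\<close> if there is no such \<open>s\<close>.  Hence
  \<open>last_zero t \<omega> < a\<close> says that there is a zero up to time \<open>t\<close> and that the last one is before
  \<open>a\<close>.  With \<open>t = \<infinity>\<close> this is the last zero of the whole path.
\<close>

definition last_zero :: "ennreal \<Rightarrow> path \<Rightarrow> ennreal" where
  "last_zero t \<omega> =
     (let Z = {s \<in> zeros \<omega>. ennreal s \<le> t} in if Z = {} then \<top> else Sup (ennreal ` Z))"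

section \<open>Excursions\<close>

text \<open>Excursions are paths that never reach \<open>\<Delta>\<close>: they sit at \<open>0\<close> from their length on.
  Their length (the \<open>\<zeta>(\<epsilon>)\<close> under the excursion measure) is therefore not \<^const>\<open>lifetime\<close>.\<close>

definition exc_length :: "path \<Rightarrow> ennreal" where
  "exc_length \<epsilon> = Inf (ennreal ` {t. 0 < t \<and> \<epsilon> t = Some 0})"

definition excursions :: "path set" where
  "excursions = {\<epsilon> \<in> paths. (\<forall>t\<ge>0. \<epsilon> t \<noteq> None) \<and> 0 < exc_length \<epsilon> \<and>
     (\<forall>t\<ge>0. \<epsilon> t \<noteq> Some 0 \<longleftrightarrow> 0 < t \<and> ennreal t < exc_length \<epsilon>)}"

abbreviation exc_space :: "path measure" where
  "exc_space \<equiv> restrict_space path_space excursions"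

text \<open>Left end points of the excursion intervals, i.e. of the connected components of the
  complement of the closed zero set.\<close>

definition left_ends :: "path \<Rightarrow> real set" where
  "left_ends \<omega> = {l \<in> closure (zeros \<omega>). \<exists>r>l. \<forall>s\<in>{l<..<r}. \<omega> s \<noteq> Some 0}"

definition excursion_at :: "real \<Rightarrow> path \<Rightarrow> path" where
  "excursion_at l \<omega> =
     (\<lambda>t\<in>{0..}. if \<exists>s\<in>{l<..l + t}. \<omega> s = Some 0 then Some 0 else \<omega> (l + t))"

section \<open>Nice Markov processes with a local time at 0\<close>

definition init_law :: "(real \<Rightarrow> path measure) \<Rightarrow> real measure \<Rightarrow> path measure" where
  "init_law P \<mu> = \<mu> \<bind> P"

text \<open>
  Right-continuous version of the natural filtration, where for every initial law \<open>\<mu>\<close> the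
  \<open>\<sigma>\<close>-algebra at time \<open>s\<close> is completed with its own null sets.  (Hitting times of \<open>0\<close> are
  in general not measurable for the uncompleted natural filtration.  Null sets of the final
  \<open>\<sigma>\<close>-algebra are not added at earlier times.)
\<close>

definition usual_filt :: "(real \<Rightarrow> path measure) \<Rightarrow> ennreal \<Rightarrow> path measure" where
  "usual_filt P t = sigma paths
     {A. \<forall>\<mu>\<in>space (prob_algebra borel). \<forall>s. t < s \<or> s = \<top> \<longrightarrow>
           A \<in> sets (completion (restr_to_subalg (init_law P \<mu>) (nat_filt s)))}"

definition local_time_measure :: "(real \<Rightarrow> path \<Rightarrow> real) \<Rightarrow> path \<Rightarrow> real measure" where
  "local_time_measure L \<omega> = interval_measure (\<lambda>t. L (max 0 t) \<omega>)"

text \<open>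
  \<open>P x\<close> is the law started from \<open>x\<close>, \<open>L\<close> the local time at \<open>0\<close>, \<open>\<beta>\<close> its drift coefficient and
  \<open>\<eta>\<close> the excursion measure.  ``Almost surely'' refers to every initial law.
\<close>

locale nice_markov_process =
  fixes P :: "real \<Rightarrow> path measure"
    and L :: "real \<Rightarrow> path \<Rightarrow> real"
    and \<beta> :: real
    and \<eta> :: "path measure"
  assumes kernel: "P \<in> borel \<rightarrow>\<^sub>M prob_algebra path_space"
    and start: "\<And>x. AE \<omega> in P x. \<omega> 0 = Some x"
    and conservative: "\<And>x. AE \<omega> in P x. \<forall>t\<ge>0. \<omega> t \<noteq> None"
    and strong_markov:
      "\<And>\<mu> T A B. \<lbrakk>\<mu> \<in> space (prob_algebra borel); stopping_time (usual_filt P) T;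
          A \<in> sets (filtration.pre_sigma paths (usual_filt P) T); B \<in> sets path_space\<rbrakk> \<Longrightarrow>
        emeasure (completion (init_law P \<mu>))
            {\<omega> \<in> A. T \<omega> < \<top> \<and> shift (enn2real (T \<omega>)) \<omega> \<in> B}
          = (\<integral>\<^sup>+\<omega>. indicator {\<omega> \<in> A. T \<omega> < \<top>} \<omega>
                  * emeasure (P (pos (enn2real (T \<omega>)) \<omega>)) B \<partial>init_law P \<mu>)"
    \<comment> \<open>local time\<close>
    and local_time_adapted: "\<And>t. 0 \<le> t \<Longrightarrow> L t \<in> borel_measurable (usual_filt P (ennreal t))"
    and local_time_paths:
      "\<And>\<mu>. \<mu> \<in> space (prob_algebra borel) \<Longrightarrow> AE \<omega> in init_law P \<mu>.
         L 0 \<omega> = 0 \<and> continuous_on {0..} (\<lambda>t. L t \<omega>) \<and> mono_on {0..} (\<lambda>t. L t \<omega>)"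
    and local_time_support:
      "\<And>\<mu>. \<mu> \<in> space (prob_algebra borel) \<Longrightarrow> AE \<omega> in init_law P \<mu>.
         {t. 0 \<le> t \<and> (\<forall>e>0. L (max 0 (t - e)) \<omega> < L (t + e) \<omega>)} = closure (zeros \<omega>)"
    and local_time_additive:
      "\<And>\<mu> T. \<lbrakk>\<mu> \<in> space (prob_algebra borel); stopping_time (usual_filt P) T\<rbrakk> \<Longrightarrow>
         AE \<omega> in init_law P \<mu>. T \<omega> < \<top> \<longrightarrow>
           (\<forall>t\<ge>0. L (enn2real (T \<omega>) + t) \<omega>
                    = L (enn2real (T \<omega>)) \<omega> + L t (shift (enn2real (T \<omega>)) \<omega>))"
    and beta_nonneg: "0 \<le> \<beta>"
    and beta_local_time:
      "\<And>\<mu>. \<mu> \<in> space (prob_algebra borel) \<Longrightarrow> AE \<omega> in init_law P \<mu>.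
         \<forall>t\<ge>0. \<beta> * L t \<omega> = measure lborel (zeros \<omega> \<inter> {0..t})"
    \<comment> \<open>excursion measure\<close>
    and sets_exc: "sets \<eta> = sets exc_space"
    and sigma_finite_exc: "sigma_finite_measure \<eta>"
    and excursions_of_process:
      "AE \<omega> in P 0. \<forall>l\<in>left_ends \<omega>. excursion_at l \<omega> \<in> excursions"
    and compensation:
      "\<And>F :: real \<Rightarrow> path \<Rightarrow> path \<Rightarrow> real.
        \<lbrakk>\<And>u \<omega> \<epsilon>. 0 \<le> F u \<omega> \<epsilon>;
         \<And>u. 0 \<le> u \<Longrightarrow>
           (\<lambda>(\<omega>, \<epsilon>). F u \<omega> \<epsilon>) \<in> borel_measurable (nat_filt (ennreal u) \<Otimes>\<^sub>M exc_space);
         \<And>u \<omega> \<epsilon>. \<lbrakk>0 < u; \<omega> \<in> paths; \<epsilon> \<in> excursions\<rbrakk> \<Longrightarrow>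
           ((\<lambda>v. F v \<omega> \<epsilon>) \<longlongrightarrow> F u \<omega> \<epsilon>) (at_left u)\<rbrakk> \<Longrightarrow>
        (\<integral>\<^sup>+\<omega>. (\<integral>\<^sup>+l. ennreal (F l \<omega> (excursion_at l \<omega>)) \<partial>count_space (left_ends \<omega>)) \<partial>P 0)
          = (\<integral>\<^sup>+\<omega>. (\<integral>\<^sup>+u\<in>{0..}. (\<integral>\<^sup>+\<epsilon>. ennreal (F u \<omega> \<epsilon>) \<partial>\<eta>) \<partial>local_time_measure L \<omega>) \<partial>P 0)"
    and exc_markov:
      "\<And>s t A C. \<lbrakk>0 < s; 0 \<le> t; A \<in> sets (nat_filt (ennreal s)); C \<in> sets borel\<rbrakk> \<Longrightarrow>
        emeasure \<eta> {\<epsilon> \<in> excursions. \<epsilon> \<in> A \<and> ennreal (s + t) < exc_length \<epsilon> \<and> pos (s + t) \<epsilon> \<in> C}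
          = (\<integral>\<^sup>+\<epsilon>. indicator {\<epsilon> \<in> A. ennreal s < exc_length \<epsilon>} \<epsilon>
                * emeasure (completion (P (pos s \<epsilon>)))
                    {\<omega> \<in> paths. \<omega> t \<in> Some ` C \<and> ennreal t < hit0 \<omega>} \<partial>\<eta>)"

context nice_markov_process
begin

lemma space_P [simp]: "space (P x) = paths"
proof -
  have "sets (P x) = sets path_space"
    using measurable_space[OF kernel, of x] by (simp add: space_prob_algebra)
  then show ?thesis
    by (simp add: sets_eq_imp_space_eq[of "P x" path_space])
qed

lemma init_law_return [simp]: "init_law P (return borel x) = P x"
  unfolding init_law_def
  by (rule bind_return[OF measurable_prob_algebraD[OF kernel]]) simp

lemma usual_filt_generator:
  "{A. \<forall>\<mu>\<in>space (prob_algebra borel). \<forall>s. t < s \<or> s = \<top> \<longrightarrow>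
      A \<in> sets (completion (restr_to_subalg (init_law P \<mu>) (nat_filt s)))} \<subseteq> Pow paths"
proof
  fix A assume *: "A \<in> {A. \<forall>\<mu>\<in>space (prob_algebra borel). \<forall>s. t < s \<or> s = \<top> \<longrightarrow>
      A \<in> sets (completion (restr_to_subalg (init_law P \<mu>) (nat_filt s)))}"
  have "return borel (0::real) \<in> space (prob_algebra borel)"
    by (simp add: space_prob_algebra prob_space_return)
  with * have "A \<in> sets (completion (restr_to_subalg (init_law P (return borel 0)) path_space))"
    by blast
  then show "A \<in> Pow paths"
    using sets.sets_into_space by (fastforce simp: space_restr_to_subalg)
qed

lemma filtration_usual_filt: "filtration paths (usual_filt P)"
proof
  show "space (usual_filt P t) = paths" for t
    unfolding usual_filt_def using usual_filt_generator by (rule space_measure_of)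
  show "sets (usual_filt P s) \<subseteq> sets (usual_filt P t)" if "s \<le> t" for s t
    unfolding usual_filt_def sets_measure_of[OF usual_filt_generator]
    by (rule sigma_sets_mono') (use that in \<open>auto dest: le_less_trans\<close>)
qed

end

section \<open>Conditioning on the last zero before an exponential time\<close>

definition exp_law :: "real \<Rightarrow> real measure" where
  "exp_law q = density lborel (\<lambda>t. ennreal (exponential_density q t))"

text \<open>The joint law of the process started from \<open>x\<close> and of an independent exponential time.\<close>

definition with_exp_time :: "(real \<Rightarrow> path measure) \<Rightarrow> real \<Rightarrow> real \<Rightarrow> (path \<times> real) measure" where
  "with_exp_time P x q = completion (P x \<Otimes>\<^sub>M exp_law q)"

definition one_minus_exp :: "real \<Rightarrow> ennreal \<Rightarrow> real" where
  "one_minus_exp q z = (if z = \<top> then 1 else 1 - exp (- q * enn2real z))"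

definition hq :: "(real \<Rightarrow> path measure) \<Rightarrow> real \<Rightarrow> path measure \<Rightarrow> real \<Rightarrow> real \<Rightarrow> real" where
  "hq P \<beta> \<eta> q x =
     \<P>(z in with_exp_time P x q. ennreal (snd z) < hit0 (fst z))
       / (q * \<beta> + enn2real (\<integral>\<^sup>+\<epsilon>. ennreal (one_minus_exp q (exc_length \<epsilon>)) \<partial>\<eta>))"

definition hlim :: "(real \<Rightarrow> path measure) \<Rightarrow> real \<Rightarrow> path measure \<Rightarrow> real \<Rightarrow> real" where
  "hlim P \<beta> \<eta> x = Lim (at_right 0) (\<lambda>q. hq P \<beta> \<eta> q x)"

definition V :: "(real \<Rightarrow> path measure) \<Rightarrow> (real \<Rightarrow> path \<Rightarrow> real) \<Rightarrow> real \<Rightarrow> real \<Rightarrow> real \<Rightarrow> ennreal" where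
  "V P L s t x = (\<integral>\<^sup>+\<omega>. emeasure (local_time_measure L \<omega>) {s..t} \<partial>P x)"

definition is_last_zero_law ::
    "(real \<Rightarrow> path measure) \<Rightarrow> real \<Rightarrow> real \<Rightarrow> path measure \<Rightarrow> bool" where
  "is_last_zero_law P a x Q \<longleftrightarrow>
     prob_space Q \<and> sets Q = sets path_space \<and>
     (\<forall>T. stopping_time nat_filt T \<longrightarrow>
       (\<forall>A\<in>sets (filtration.pre_sigma paths nat_filt T).
         ((\<lambda>q. \<P>(z in with_exp_time P x q.
                  fst z \<in> A \<and> T (fst z) < ennreal (snd z)
                  \<bar> last_zero (ennreal (snd z)) (fst z) < ennreal a))
           \<longlongrightarrow> measure Q {\<omega> \<in> A. T \<omega> < lifetime \<omega>}) (at_right 0)))"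

end

theory Submission
  imports Defs
begin

text \<open>Write \<open>g\<^sub>s\<close> for the last zero up to time \<open>s\<close>, \<open>e\<^sub>q\<close> for the independent exponential time, \<open>T\<^sub>0\<close> for the first zero and
\<open>\<kappa>\<^sub>q = q \<beta> + \<eta>(1 - e\<^sup>-\<^sup>q\<^sup>\<zeta>)\<close>.  The conditional expectation, given that the last zero before \<open>e\<^sub>q\<close> is below \<open>a\<close>, of the functional
evaluated at that last zero is computed in closed form, and its limit for \<open>q\<close> tending to \<open>0\<close> is
identified with the expectation under the limit law.

\<^emph>\<open>The closed form.\<close>  For a functional \<open>\<Gamma>\<close> of the path after the last zero and of its age, and a
process \<open>\<phi>\<close> adapted to the past, the expectation of \<open>\<phi>\<close> at the last zero before \<open>e\<^sub>q\<close> times \<open>\<Gamma>\<close> is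
the product of \<open>\<kappa>\<^sub>q\<close>, of the same expectation under \<open>P 0\<close> with \<open>\<phi> = 1\<close>, and of the potential
\<open>E\<^sub>x \<integral> e\<^sup>-\<^sup>q\<^sup>v \<phi>\<^sub>v dL\<^sub>v\<close> (\<open>last_exit_formula\<close>, \<open>last_exit_formula_kappa\<close>).  Both sides are measures in \<open>\<phi>\<close>,
so it suffices to treat \<open>\<phi> = 1\<^sub>A 1\<^sub>[\<^sub>r\<^sub>,\<^sub>\<infinity>\<^sub>)\<close> with \<open>A\<close> known at time \<open>r\<close>: the Markov property at \<open>r\<close> and the
strong Markov property at the next zero factorise both sides in the same way.  The compensation
formula and the Markov property of \<open>\<eta>\<close> evaluate the factor under \<open>P 0\<close> as a multiple of
\<open>\<eta>(G h\<^sub>q(\<epsilon>\<^sub>u), u < \<zeta>)\<close> (\<open>exit_weight_excursion\<close>, \<open>exc_tail_markov\<close>).  Dividing by the case \<open>\<Gamma> = 1\<close>, \<open>\<phi> = 1\<^sub>[\<^sub>0\<^sub>,\<^sub>a\<^sub>)\<close>, which is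
the probability of the conditioning event, cancels \<open>\<kappa>\<^sub>q\<close> (\<open>cond_int_exit\<close>).  The assumed alternative (B)
serves to pass to the limit in \<open>\<eta>(G h\<^sub>q(\<epsilon>\<^sub>u), u < \<zeta>)\<close>: the integrand is dominated by \<open>H(\<epsilon>\<^sub>u)\<close>, or by
\<open>h\<^sub>1(\<epsilon>\<^sub>u) + h(\<epsilon>\<^sub>u)\<close> if \<open>h\<^sub>q\<close> is monotone in \<open>q\<close>; the latter is integrable since \<open>\<eta>(h\<^sub>q(\<epsilon>\<^sub>u), u < \<zeta>) \<le> e\<^sup>q\<^sup>u\<close>
(\<open>hq_limit_long_exc\<close>).

\<^emph>\<open>The limit law.\<close>  Its defining property speaks of events known at a time \<open>T\<close> on which the path is
still alive at \<open>T\<close>, whereas the functional depends on the lifetime and on the whole zero set.  Put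
\<open>b = a + u\<close>.  A path alive at \<open>b\<close> has almost surely no zero after \<open>a\<close>, so that the functional is known
at time \<open>b\<close> and the defining property applies (\<open>late_limit\<close>, \<open>late_last_zero\<close>).  On paths that die
in \<open>(0,b]\<close> the exponential density is nearly constant, and the limit law is a constant multiple of
the law of the process killed at a Lebesgue distributed time of \<open>(0,b]\<close> before which its last zero
is below \<open>a\<close> (\<open>kill_law\<close>).  The two contributions add up to the limit of the conditional
expectations (\<open>final_limit\<close>).

\<^emph>\<open>Measurability.\<close>  First and last zeros need not be measurable for the natural filtration.  They are
universally measurable, because the projection of a measurable set of pairs of a point and a time
is (\<open>measurable_projection\<close>); this is proved by Souslin schemes and Choquet's capacitability argument.\<close>

abbreviation bm :: "'a measure => ('a => 'b::topological_space) set" where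
 "bm M \<equiv> borel_measurable M"

abbreviation ind :: "'a set => 'a => 'b::zero_neq_one" where
 "ind \<equiv> indicator"

abbreviation filt :: "real => path measure" where
 "filt t \<equiv> nat_filt (ennreal t)"

abbreviation longer :: "real => path set" where
 "longer u \<equiv> {ex. ennreal u < exc_length ex}"

text \<open>The term \<open>NN x. f \<partial>M\<close> is the integral \<open>\<integral>\<^sup>+x. f \<partial>M\<close>.\<close>

syntax "_NN" :: "pttrn => ennreal => 'a measure => ennreal" ("NN(2 _./ _)/ \<partial>_" [60,61] 110)
translations "NN x. f \<partial>M" => "CONST nn_integral M (\<lambda>x. f)"

section \<open>Measurable projection and universal completion\<close>

definition compact_rectangles :: "'a measure => real set => ('a \<times> real) set set" where
 "compact_rectangles M I = {A \<times> K | A K. A \<in> sets M & compact K & K \<subseteq> I}"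

definition determined_below :: "nat => ((nat => nat) => 'b) => bool" where
 "determined_below n f \<longleftrightarrow> (\<forall>\<sigma> \<tau>. (\<forall>i<n. \<sigma> i = \<tau> i) --> f \<sigma> = f \<tau>)"

lemma determined_belowD: "determined_below n f ==> (!!i. i < n ==> \<sigma> i = \<tau> i) ==> f \<sigma> = f \<tau>"
 unfolding determined_below_def by blast

text \<open>The component \<open>D n \<sigma>\<close> depends on the first \<open>n\<close> entries of \<open>\<sigma>\<close>, so a scheme is a countable tree of rectangles
although its branches \<open>\<sigma>\<close> are uncountably many.\<close>

definition analytic_scheme ::
  "'a measure => real set => (nat => (nat => nat) => ('a \<times> real) set) => bool" where
 "analytic_scheme M I D \<longleftrightarrow>
   (\<forall>n \<sigma>. D n \<sigma> \<in> compact_rectangles M I) & (\<forall>n. determined_below n (D n))"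

definition analytic_sets :: "'a measure => real set => ('a \<times> real) set set" where
 "analytic_sets M I = {(\<Union>\<sigma>. \<Inter>n. D n \<sigma>) | D. analytic_scheme M I D}"

lemma rectangle_subset: "R \<in> compact_rectangles M I ==> R \<subseteq> space M \<times> I"
 unfolding compact_rectangles_def using sets.sets_into_space by fastforce

lemma rectangle_Int:
 "R \<in> compact_rectangles M I ==> S \<in> compact_rectangles M I ==> R Int S \<in> compact_rectangles M I"
proof -
 assume "R \<in> compact_rectangles M I" "S \<in> compact_rectangles M I"
 then obtain A K B J where *: "R = A \<times> K" "A \<in> sets M" "compact K" "K \<subseteq> I"
   "S = B \<times> J" "B \<in> sets M" "compact J" "J \<subseteq> I"
  unfolding compact_rectangles_def by auto
 then have "R Int S = (A Int B) \<times> (K Int J)" by auto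
 moreover have "A Int B \<in> sets M" "compact (K Int J)" "K Int J \<subseteq> I"
  using * by (auto intro: compact_Int)
 ultimately show ?thesis unfolding compact_rectangles_def by blast
qed

lemma rectangle_analytic: "R \<in> compact_rectangles M I ==> R \<in> analytic_sets M I"
 unfolding analytic_sets_def analytic_scheme_def determined_below_def
 by (intro CollectI exI[of _ "%_ _. R"]) auto

text \<open>The first entry of the sequence selects a member of the family, its tail a branch of the scheme of that member.\<close>

lemma analytic_UN:
 fixes B :: "nat => ('a \<times> real) set"
 assumes I: "compact I" and B: "!!m. B m \<in> analytic_sets M I"
 shows "(\<Union>m. B m) \<in> analytic_sets M I"
proof -
 have "\<forall>m. \<exists>D. B m = (\<Union>\<sigma>. \<Inter>n. D n \<sigma>) & analytic_scheme M I D"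
  using B unfolding analytic_sets_def by blast
 then obtain D where D: "!!m. B m = (\<Union>\<sigma>. \<Inter>n. D m n \<sigma>)" "!!m. analytic_scheme M I (D m)"
  by metis
 define D' where
  "D' n \<sigma> = (case n of 0 => space M \<times> I | Suc k => D (\<sigma> 0) k (%i. \<sigma> (Suc i)))" for n \<sigma>
 have D'0: "D' 0 \<sigma> = space M \<times> I" and D'S: "D' (Suc n) \<sigma> = D (\<sigma> 0) n (%i. \<sigma> (Suc i))" for n \<sigma>
  by (auto simp: D'_def)
 have rect: "D' n \<sigma> \<in> compact_rectangles M I" for n \<sigma>
  using D(2) I unfolding analytic_scheme_def
  by (cases n) (auto simp: D'0 D'S compact_rectangles_def)
 have det: "determined_below n (D' n)" for n
  unfolding determined_below_def
 proof (intro allI impI)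
  fix \<sigma> \<tau> :: "nat => nat" assume eq: "\<forall>i<n. \<sigma> i = \<tau> i"
  show "D' n \<sigma> = D' n \<tau>"
  proof (cases n)
   case (Suc k)
   have det: "determined_below k (D (\<sigma> 0) k)"
    using D(2) unfolding analytic_scheme_def by blast
   have "D (\<sigma> 0) k (%i. \<sigma> (Suc i)) = D (\<sigma> 0) k (%i. \<tau> (Suc i))"
    by (rule determined_belowD[OF det]) (use eq Suc in auto)
   then show ?thesis using eq Suc by (simp add: D'S)
  qed (simp add: D'0)
 qed
 have "(\<Union>m. B m) = (\<Union>\<sigma>. \<Inter>n. D' n \<sigma>)"
 proof (intro set_eqI iffI)
  fix p assume "p \<in> (\<Union>m. B m)"
  then obtain m \<sigma> where p: "!!n. p \<in> D m n \<sigma>"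
   using D(1) by auto
  then have "p \<in> space M \<times> I"
   using D(2)[of m] rectangle_subset unfolding analytic_scheme_def by blast
  then have "p \<in> D' n (case_nat m \<sigma>)" for n
   using p by (cases n) (auto simp: D'0 D'S)
  then show "p \<in> (\<Union>\<sigma>. \<Inter>n. D' n \<sigma>)" by blast
 next
  fix p assume "p \<in> (\<Union>\<sigma>. \<Inter>n. D' n \<sigma>)"
  then obtain \<sigma> where p: "!!n. p \<in> D' n \<sigma>" by auto
  have "p \<in> D (\<sigma> 0) n (%i. \<sigma> (Suc i))" for n
   using p[of "Suc n"] by (simp add: D'S)
  then have "p \<in> B (\<sigma> 0)" unfolding D(1) by blast
  then show "p \<in> (\<Union>m. B m)" by blast
 qed
 then show ?thesis
  unfolding analytic_sets_def analytic_scheme_def using rect det by blast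
qed

lemma prod_encode_less: "i < n ==> prod_encode (m, i) < prod_encode (m, n)"
proof (induction n)
 case (Suc n)
 have "prod_encode (m, n) < prod_encode (m, Suc n)"
  by (simp add: prod_encode_def)
 then show ?case using Suc by (metis less_Suc_eq less_trans)
qed simp

text \<open>By the pairing function one sequence codes a branch in each of countably many schemes.
Pairing increases in its second argument, so that the component at level \<open>k\<close> looks at entries below \<open>k\<close> only.\<close>

lemma analytic_INT:
 fixes B :: "nat => ('a \<times> real) set"
 assumes B: "!!m. B m \<in> analytic_sets M I"
 shows "(\<Inter>m. B m) \<in> analytic_sets M I"
proof -
 have "\<forall>m. \<exists>D. B m = (\<Union>\<sigma>. \<Inter>n. D n \<sigma>) & analytic_scheme M I D"
  using B unfolding analytic_sets_def by blast
 then obtain D where D: "!!m. B m = (\<Union>\<sigma>. \<Inter>n. D m n \<sigma>)" "!!m. analytic_scheme M I (D m)"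
  by metis
 define D' where
  "D' k \<sigma> = D (fst (prod_decode k)) (snd (prod_decode k))
         (%i. \<sigma> (prod_encode (fst (prod_decode k), i)))" for k \<sigma>
 have rect: "D' n \<sigma> \<in> compact_rectangles M I" for n \<sigma>
  using D(2) unfolding analytic_scheme_def D'_def by blast
 have det: "determined_below k (D' k)" for k
  unfolding determined_below_def
 proof (intro allI impI)
  fix \<sigma> \<tau> :: "nat => nat" assume eq: "\<forall>i<k. \<sigma> i = \<tau> i"
  obtain m n where mn: "prod_decode k = (m, n)" by fastforce
  then have k: "k = prod_encode (m, n)" by (metis prod_decode_inverse)
  have det: "determined_below n (D m n)"
   using D(2) unfolding analytic_scheme_def by blast
  have "\<sigma> (prod_encode (m, i)) = \<tau> (prod_encode (m, i))" if "i < n" for i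
   using eq prod_encode_less[OF that, of m] unfolding k by blast
  then show "D' k \<sigma> = D' k \<tau>"
   unfolding D'_def mn fst_conv snd_conv by (rule determined_belowD[OF det])
 qed
 have "(\<Inter>m. B m) = (\<Union>\<sigma>. \<Inter>n. D' n \<sigma>)"
 proof (intro set_eqI iffI)
  fix p assume "p \<in> (\<Inter>m. B m)"
  then have "\<forall>m. \<exists>\<sigma>. \<forall>n. p \<in> D m n \<sigma>"
   unfolding D(1) by simp
  then obtain s where s: "!!m n. p \<in> D m n (s m)" by metis
  define \<sigma> where "\<sigma> j = s (fst (prod_decode j)) (snd (prod_decode j))" for j
  have "p \<in> D' k \<sigma>" for k
   unfolding D'_def \<sigma>_def using s by simp
  then show "p \<in> (\<Union>\<sigma>. \<Inter>n. D' n \<sigma>)" by blast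
 next
  fix p assume "p \<in> (\<Union>\<sigma>. \<Inter>n. D' n \<sigma>)"
  then obtain \<sigma> where p: "!!n. p \<in> D' n \<sigma>" by auto
  have "p \<in> D m n (%i. \<sigma> (prod_encode (m, i)))" for m n
   using p[of "prod_encode (m, n)"] by (simp add: D'_def)
  then show "p \<in> (\<Inter>m. B m)" unfolding D(1) by blast
 qed
 then show ?thesis
  unfolding analytic_sets_def analytic_scheme_def using rect det by blast
qed

text \<open>The sets that are analytic together with their complements form a \<open>\<sigma>\<close>-algebra.  It contains the rectangles, as the
complement of a half-line is a countable union of closed half-lines.\<close>

lemma borel_sets_analytic:
 fixes I :: "real set"
 assumes I: "compact I" and B: "B \<in> sets (M \<Otimes>\<^sub>M borel)"
 shows "B Int (space M \<times> I) \<in> analytic_sets M I"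
proof -
 let ?\<Omega> = "space M \<times> (UNIV :: real set)" and ?F = "space M \<times> I"
 define S where
  "S = {B. B \<subseteq> ?\<Omega> & B Int ?F \<in> analytic_sets M I & ?F - B \<in> analytic_sets M I}"
 have rect: "A \<times> K \<in> analytic_sets M I" if "A \<in> sets M" "compact K" "K \<subseteq> I" for A K
  using that by (intro rectangle_analytic) (auto simp: compact_rectangles_def)
 have empty: "{} \<in> analytic_sets M I"
  using rect[of "{}" "{}"] by simp
 interpret S: sigma_algebra ?\<Omega> S
  unfolding sigma_algebra_iff2
 proof (intro conjI ballI allI impI)
  show "S \<subseteq> Pow ?\<Omega>" by (auto simp: S_def)
  show "{} \<in> S" using empty rect[of "space M" I] I by (auto simp: S_def)
 next
  fix s assume "s \<in> S"
  moreover have "(?\<Omega> - s) Int ?F = ?F - s" "?F - (?\<Omega> - s) = s Int ?F" by auto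
  ultimately show "?\<Omega> - s \<in> S" by (auto simp: S_def)
 next
  fix A :: "nat => ('a \<times> real) set" assume A: "range A \<subseteq> S"
  have "(\<Union>i. A i) Int ?F = (\<Union>i. A i Int ?F)" "?F - (\<Union>i. A i) = (\<Inter>i. ?F - A i)" by auto
  then show "(\<Union>i. A i) \<in> S"
   using A analytic_UN[OF I, of "%i. A i Int ?F" M] analytic_INT[of "%i. ?F - A i" M I]
   by (auto simp: S_def image_subset_iff)
 qed
 have left: "A \<times> UNIV \<in> S" if A: "A \<in> sets M" for A
 proof -
  have "A \<subseteq> space M" using A sets.sets_into_space by auto
  then have "A \<times> UNIV Int ?F = A \<times> I" "?F - A \<times> UNIV = (space M - A) \<times> I" by auto
  then show ?thesis
   using rect[of A I] rect[of "space M - A" I] A I \<open>A \<subseteq> space M\<close> by (auto simp: S_def)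
 qed
 have right: "space M \<times> C \<in> S" if "C \<in> sets borel" for C
 proof -
  have "C \<in> sigma_sets UNIV (range (%x. {..x}))"
   using that unfolding borel_eq_atMost by simp
  then show ?thesis
  proof (induction rule: sigma_sets.induct)
   case (Basic C)
   then obtain x where x: "C = {..x}" by auto
   have 1: "space M \<times> C Int ?F = space M \<times> (I Int {..x})" using x by auto
   have 2: "?F - space M \<times> C = (\<Union>n. space M \<times> (I Int {x + 1 / Suc n..}))"
   proof (intro set_eqI iffI)
    fix p assume "p \<in> ?F - space M \<times> C"
    then have p: "fst p \<in> space M" "snd p \<in> I" "x < snd p" using x by auto
    then obtain n where "1 / Suc n < snd p - x"
     by (meson diff_gt_0_iff_gt nat_approx_posE)
    then have "p \<in> space M \<times> (I Int {x + 1 / Suc n..})"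
     using p by (cases p) auto
    then show "p \<in> (\<Union>n. space M \<times> (I Int {x + 1 / Suc n..}))" by blast
   next
    fix p assume "p \<in> (\<Union>n. space M \<times> (I Int {x + 1 / Suc n..}))"
    then obtain n where n: "fst p \<in> space M" "snd p \<in> I" "x + 1 / Suc n <= snd p" by auto
    have "0 < 1 / real (Suc n)" by simp
    then have "x < snd p" using n by linarith
    then show "p \<in> ?F - space M \<times> C" using n x by (cases p) auto
   qed
   show ?case
    unfolding S_def using 1 2 I
    by (auto intro!: rect analytic_UN compact_Int_closed)
  next
   case Empty then show ?case using S.empty_sets by simp
  next
   case (Compl C)
   have "space M \<times> (UNIV - C) = ?\<Omega> - space M \<times> C" by auto
   then show ?case using S.compl_sets[OF Compl.IH] by simp
  next
   case (Union C)
   have "space M \<times> (\<Union>i. C i) = (\<Union>i. space M \<times> C i)" by auto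
   then show ?case using S.countable_UN[of "%i. space M \<times> C i" UNIV] Union by auto
  qed
 qed
 have "sets (M \<Otimes>\<^sub>M borel) \<subseteq> S"
  unfolding sets_pair_measure space_borel
 proof (rule S.sigma_sets_subset, safe)
  fix A C assume *: "A \<in> sets M" "C \<in> sets (borel :: real measure)"
  have "A \<times> C = (A \<times> UNIV) Int (space M \<times> C)"
   using sets.sets_into_space[OF *(1)] by auto
  then show "A \<times> C \<in> S" using S.Int[OF left[OF *(1)] right[OF *(2)]] by simp
 qed
 then show ?thesis using B by (auto simp: S_def)
qed

lemma fst_rectangle: "R \<in> compact_rectangles M I ==> fst ` R \<in> sets M"
 unfolding compact_rectangles_def by (auto simp: fst_image_times)

lemma rectangle_INT:
 fixes k :: nat
 shows "(!!n. R n \<in> compact_rectangles M I) ==> (\<Inter>n\<le>k. R n) \<in> compact_rectangles M I"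
proof (induction k)
 case (Suc k)
 have "(\<Inter>n\<le>Suc k. R n) = (\<Inter>n\<le>k. R n) Int R (Suc k)" by (auto simp: atMost_Suc)
 then show ?case using Suc by (simp add: rectangle_Int)
qed simp

text \<open>Koenig's lemma: below the bound \<open>N\<close> the tree branches finitely, so arbitrarily long finite branches through \<open>p\<close>
yield an infinite one.\<close>

lemma koenig_scheme:
 assumes D: "!!n. determined_below n (D n)"
  and p: "!!k. \<exists>\<tau>. (\<forall>i<k. \<tau> i <= N i) & (\<forall>n\<le>k. p \<in> D n \<tau>)"
 shows "\<exists>\<sigma>. \<forall>n. p \<in> D n \<sigma>"
proof -
 define P where "P k \<sigma> \<longleftrightarrow>
  (\<forall>j\<ge>k. \<exists>\<tau>. (\<forall>i<j. \<tau> i <= N i) & (\<forall>i<k. \<tau> i = \<sigma> i) & (\<forall>n\<le>j. p \<in> D n \<tau>))" for k \<sigma>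
 have "\<exists>s. \<forall>k. P k (s k) & (\<forall>i<k. s (Suc k) i = s k i)"
 proof (rule dependent_nat_choice)
  show "\<exists>\<sigma>. P 0 \<sigma>" using p by (auto simp: P_def)
 next
  fix \<sigma> k assume P: "P k \<sigma>"
  have "\<exists>v. P (Suc k) (\<sigma>(k := v))"
  proof (rule ccontr)
   assume "\<nexists>v. P (Suc k) (\<sigma>(k := v))"
   then have "\<forall>v. \<exists>j\<ge>Suc k. ~ (\<exists>\<tau>. (\<forall>i<j. \<tau> i <= N i) &
     (\<forall>i<Suc k. \<tau> i = (\<sigma>(k := v)) i) & (\<forall>n\<le>j. p \<in> D n \<tau>))"
    unfolding P_def by blast
   then obtain j where j': "\<forall>v. j v \<ge> Suc k & ~ (\<exists>\<tau>. (\<forall>i<j v. \<tau> i <= N i) &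
     (\<forall>i<Suc k. \<tau> i = (\<sigma>(k := v)) i) & (\<forall>n\<le>j v. p \<in> D n \<tau>))"
    unfolding Bex_def by (elim choice[elim_format] exE) (rule that)
   have j: "j v \<ge> Suc k" "~ (\<exists>\<tau>. (\<forall>i<j v. \<tau> i <= N i) &
     (\<forall>i<Suc k. \<tau> i = (\<sigma>(k := v)) i) & (\<forall>n\<le>j v. p \<in> D n \<tau>))" for v
    using spec[OF j', of v] by (rule conjunct1, rule conjunct2)
   define J where "J = Max (j ` {..N k})"
   have J: "j v <= J" if "v <= N k" for v
    using that unfolding J_def by (intro Max_ge) auto
   have "Suc k <= J" using J[of 0] j(1)[of 0] by simp
   from P[unfolded P_def, rule_format, OF Suc_leD[OF this]]
   obtain \<tau> where \<tau>: "\<forall>i<J. \<tau> i <= N i" "\<forall>i<k. \<tau> i = \<sigma> i" "\<forall>n\<le>J. p \<in> D n \<tau>"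
    by blast
   have "\<tau> k <= N k" using \<tau>(1) \<open>Suc k <= J\<close> by simp
   then have le: "j (\<tau> k) <= J" by (rule J)
   have "(\<forall>i<j (\<tau> k). \<tau> i <= N i) & (\<forall>i<Suc k. \<tau> i = (\<sigma>(k := \<tau> k)) i) & (\<forall>n\<le>j (\<tau> k). p \<in> D n \<tau>)"
    using \<tau> le by (auto simp: less_Suc_eq)
   with j(2)[of "\<tau> k"] show False by blast
  qed
  then show "\<exists>\<sigma>'. P (Suc k) \<sigma>' & (\<forall>i<k. \<sigma>' i = \<sigma> i)"
   by (metis fun_upd_apply less_irrefl)
 qed
 then obtain s where s: "!!k. P k (s k)" "!!k i. i < k ==> s (Suc k) i = s k i" by blast
 define \<sigma> where "\<sigma> i = s (Suc i) i" for i
 have stable: "s k i = \<sigma> i" if "i < k" for k i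
  using that
 proof (induction k)
  case (Suc k) then show ?case using s(2)[of i k] by (cases "i = k") (auto simp: \<sigma>_def)
 qed simp
 have "p \<in> D n \<sigma>" for n
 proof -
  obtain \<tau> where \<tau>: "\<forall>i<n. \<tau> i = s n i" "\<forall>m\<le>n. p \<in> D m \<tau>"
   using s(1)[of n] unfolding P_def by blast
  have "D n \<tau> = D n \<sigma>" using \<tau>(1) stable by (intro determined_belowD[OF D]) auto
  then show ?thesis using \<tau>(2) by auto
 qed
 then show ?thesis by blast
qed

text \<open>Choquet's argument.  Continuity from below of the outer measure allows to bound the entries of the branches one
after the other while the projection keeps outer measure above \<open>c\<close>.  The bounded tree has finitely many nodes at each
level, hence gives a decreasing sequence of finite unions of rectangles, and compactness of the sections lets
projection commute with its intersection.\<close>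

lemma analytic_capacitable:
 assumes M: "finite_measure M" and B: "B \<in> analytic_sets M I"
  and c: "c < outer_measure_of M (fst ` B)"
 shows "\<exists>C\<in>sets M. C \<subseteq> fst ` B & c <= emeasure M C"
proof -
 interpret finite_measure M by fact
 obtain D where BD: "B = (\<Union>\<sigma>. \<Inter>n. D n \<sigma>)" and D: "analytic_scheme M I D"
  using B unfolding analytic_sets_def by blast
 then have rect: "D n \<sigma> \<in> compact_rectangles M I" and det: "determined_below n (D n)" for n \<sigma>
  unfolding analytic_scheme_def by auto
 define bd where "bd k N = {\<sigma>. \<forall>i<k. \<sigma> i <= N i}" for k and N :: "nat => nat"
 define b where "b k N = fst ` (\<Union>\<sigma>\<in>bd k N. \<Inter>n. D n \<sigma>)" for k N
 have sub: "b k N \<subseteq> space M" for k N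
  using rectangle_subset[OF rect] unfolding b_def by fastforce
 have "\<exists>N. \<forall>k. c < outer_measure_of M (b k (N k)) & (\<forall>i<k. N (Suc k) i = N k i)"
 proof (rule dependent_nat_choice)
  show "\<exists>N. c < outer_measure_of M (b 0 N)"
   using c by (simp add: b_def bd_def BD)
 next
  fix N k assume c: "c < outer_measure_of M (b k N)"
  (* the sets increase with the bound on entry k, to the set without that bound *)
  define A where "A m = b (Suc k) (N(k := m))" for m
  have "incseq A"
   unfolding A_def b_def bd_def incseq_def
   by (intro allI impI image_mono UN_mono) (auto simp: less_Suc_eq)
  moreover have "(\<Union>m. A m) = b k N"
  proof -
   have "(\<Union>m. bd (Suc k) (N(k := m))) = bd k N"
    by (auto simp: bd_def less_Suc_eq)
   then show ?thesis unfolding A_def b_def by (metis UN_UN_flatten image_UN)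
  qed
  ultimately have "(SUP m. outer_measure_of M (A m)) = outer_measure_of M (b k N)"
   using SUP_outer_measure_of_incseq[of A M] sub by (auto simp: A_def)
  with c obtain m where "c < outer_measure_of M (A m)"
   by (metis less_SUP_iff)
  then show "\<exists>N'. c < outer_measure_of M (b (Suc k) N') & (\<forall>i<k. N' i = N i)"
   by (intro exI[of _ "N(k := m)"]) (auto simp: A_def)
 qed
 then obtain N' where N': "!!k. c < outer_measure_of M (b k (N' k))"
   "!!k i. i < k ==> N' (Suc k) i = N' k i" by blast
 define N where "N i = N' (Suc i) i" for i
 have stable: "N' k i = N i" if "i < k" for k i
  using that
 proof (induction k)
  case (Suc k) then show ?case using N'(2)[of i k] by (cases "i = k") (auto simp: N_def)
 qed simp
 have "b k (N' k) = b k N" for k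
  unfolding b_def bd_def using stable by auto
 with N' have cN: "c < outer_measure_of M (b k N)" for k by metis
 define C where "C k = (\<Union>\<sigma>\<in>bd k N. \<Inter>n\<le>k. D n \<sigma>)" for k
 define fin where "fin k = {\<sigma>. (\<forall>i<k. \<sigma> i <= N i) & (\<forall>i\<ge>k. \<sigma> i = 0)}" for k
 have finite: "finite (fin k)" for k
 proof -
  have "fin k \<subseteq> {\<sigma>. \<forall>i. (i \<in> {..<k} --> \<sigma> i \<in> {..(\<Sum>i<k. N i)}) & (i \<notin> {..<k} --> \<sigma> i = 0)}"
  proof
   fix \<sigma> assume \<sigma>: "\<sigma> \<in> fin k"
   have "\<sigma> i <= (\<Sum>i<k. N i)" if "i < k" for i
   proof -
    have "\<sigma> i <= N i" using \<sigma> that by (auto simp: fin_def)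
    also have "N i <= (\<Sum>i<k. N i)" using that by (intro member_le_sum) auto
    finally show ?thesis .
   qed
   then show "\<sigma> \<in> {\<sigma>. \<forall>i. (i \<in> {..<k} --> \<sigma> i \<in> {..(\<Sum>i<k. N i)}) & (i \<notin> {..<k} --> \<sigma> i = 0)}"
    using \<sigma> by (auto simp: fin_def)
  qed
  then show ?thesis
   by (rule finite_subset) (intro finite_set_of_finite_funs; simp)
 qed
 have rINT: "(\<Inter>n\<le>k. D n \<sigma>) \<in> compact_rectangles M I" for k \<sigma>
  by (rule rectangle_INT) (rule rect)
 have C_fin: "C k = (\<Union>\<sigma>\<in>fin k. \<Inter>n\<le>k. D n \<sigma>)" for k
 proof -
  have "\<exists>\<tau>\<in>fin k. (\<Inter>n\<le>k. D n \<sigma>) = (\<Inter>n\<le>k. D n \<tau>)" if "\<sigma> \<in> bd k N" for \<sigma>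
  proof (intro bexI[of _ "%i. if i < k then \<sigma> i else 0"])
   have "D n \<sigma> = D n (%i. if i < k then \<sigma> i else 0)" if "n <= k" for n
    using that by (intro determined_belowD[OF det]) auto
   then show "(\<Inter>n\<le>k. D n \<sigma>) = (\<Inter>n\<le>k. D n (%i. if i < k then \<sigma> i else 0))" by auto
  qed (use that in "auto simp: bd_def fin_def")
  note cut = this
  have sub: "fin k \<subseteq> bd k N" by (auto simp: fin_def bd_def)
  show ?thesis
   unfolding C_def
  proof (intro equalityI subsetI)
   fix p assume "p \<in> (\<Union>\<sigma>\<in>bd k N. \<Inter>n\<le>k. D n \<sigma>)"
   then obtain \<sigma> where \<sigma>: "\<sigma> \<in> bd k N" "p \<in> (\<Inter>n\<le>k. D n \<sigma>)" by (rule UN_E)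
   obtain \<tau> where \<tau>: "\<tau> \<in> fin k" "(\<Inter>n\<le>k. D n \<sigma>) = (\<Inter>n\<le>k. D n \<tau>)"
    using cut[OF \<sigma>(1)] by blast
   show "p \<in> (\<Union>\<sigma>\<in>fin k. \<Inter>n\<le>k. D n \<sigma>)"
    by (rule UN_I[where a = \<tau>]) (use \<sigma>(2) \<tau> in simp_all)
  next
   fix p assume "p \<in> (\<Union>\<sigma>\<in>fin k. \<Inter>n\<le>k. D n \<sigma>)"
   then obtain \<sigma> where \<sigma>: "\<sigma> \<in> fin k" "p \<in> (\<Inter>n\<le>k. D n \<sigma>)" by (rule UN_E)
   show "p \<in> (\<Union>\<sigma>\<in>bd k N. \<Inter>n\<le>k. D n \<sigma>)"
    by (rule UN_I[where a = \<sigma>]) (use subsetD[OF sub \<sigma>(1)] \<sigma>(2) in simp_all)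
  qed
 qed
 have C_dec: "C (Suc k) \<subseteq> C k" for k
  unfolding C_def by (intro UN_mono INT_anti_mono) (auto simp: bd_def)
 have C_dec': "C n \<subseteq> C m" if "m <= n" for m n
  using that C_dec lift_Suc_antimono_le by metis
 have pC: "fst ` C k \<in> sets M" for k
  unfolding C_fin image_UN using finite fst_rectangle[OF rINT]
  by (intro sets.finite_UN) auto
 (* the limit set is measurable; compactness of the sections places it inside the projection of B *)
 define E where "E = (\<Inter>k. fst ` C k)"
 have E_sub: "E \<subseteq> fst ` B"
 proof
  fix wt assume wt: "wt \<in> E"
  define S where "S k = {t. (wt, t) \<in> C k}" for k
  have "\<Inter>(range S) ~= {}"
  proof (rule compact_nest)
   show "compact (S k)" for k
   proof -
    have "S k = (\<Union>\<sigma>\<in>fin k. {t. (wt, t) \<in> (\<Inter>n\<le>k. D n \<sigma>)})"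
     unfolding S_def C_fin by (simp only: UN_iff) blast
    moreover have cmp: "compact {t. (wt, t) \<in> R}" if R: "R \<in> compact_rectangles M I" for R :: "('a \<times> real) set"
    proof -
     obtain A K where AK: "R = A \<times> K" "compact K"
      using R unfolding compact_rectangles_def by blast
     then have "{t. (wt, t) \<in> R} = (if wt \<in> A then K else {})" by auto
     then show ?thesis using AK by simp
    qed
    ultimately show ?thesis
     by (simp only:) (intro compact_UN ballI finite cmp[OF rINT])
   qed
   show "S k ~= {}" for k using wt unfolding E_def S_def by fastforce
   show "S n \<subseteq> S m" if "m <= n" for m n
    using C_dec'[OF that] unfolding S_def by auto
  qed
  then obtain t where t: "!!k. (wt, t) \<in> C k" by (auto simp: S_def)
  have "\<exists>\<sigma>. \<forall>n. (wt, t) \<in> D n \<sigma>"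
  proof (rule koenig_scheme[where D = D, OF det])
   show "\<exists>\<tau>. (\<forall>i<k. \<tau> i <= N i) & (\<forall>n\<le>k. (wt, t) \<in> D n \<tau>)" for k
    using t[of k] unfolding C_def bd_def by auto
  qed
  then have "(wt, t) \<in> B" unfolding BD by blast
  then show "wt \<in> fst ` B" by force
 qed
 have "c <= emeasure M (fst ` C k)" for k
 proof -
  have "b k N \<subseteq> fst ` C k"
   unfolding b_def C_def by (intro image_mono UN_mono INT_anti_mono) auto
  then have "outer_measure_of M (b k N) <= outer_measure_of M (fst ` C k)"
   by (rule outer_measure_of_mono)
  then show ?thesis using cN[of k] pC[of k] by simp
 qed
 moreover have "(INF k. emeasure M (fst ` C k)) = emeasure M E"
  unfolding E_def using pC C_dec
  by (intro INF_emeasure_decseq) (auto simp: decseq_Suc_iff image_mono emeasure_eq_measure)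
 ultimately have "c <= emeasure M E" by (metis INF_greatest)
 moreover have "E \<in> sets M" unfolding E_def using pC by auto
 ultimately show ?thesis using E_sub by blast
qed

text \<open>Inner approximation by measurable sets from the preceding lemma sandwiches the projection up to a null set.\<close>

theorem measurable_projection_finite:
 fixes I :: "real set"
 assumes M: "finite_measure M" and I: "compact I"
  and B: "B \<in> sets (M \<Otimes>\<^sub>M borel)" "B \<subseteq> space M \<times> I"
 shows "fst ` B \<in> sets (completion M)"
proof -
 interpret finite_measure M by fact
 have an: "B \<in> analytic_sets M I"
  using borel_sets_analytic[OF I B(1)] B(2) by (simp add: inf_absorb1)
 have sub: "fst ` B \<subseteq> space M" using B(2) by auto
 obtain H where H: "H \<in> sets M" "fst ` B \<subseteq> H" "outer_measure_of M (fst ` B) = emeasure M H"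
  using outer_measure_of_attain[OF sub] by blast
 have fm: "A \<in> fmeasurable (completion M)" if "A \<in> sets M" for A
  using that by (auto simp: fmeasurable_def less_top[symmetric])
 have "fst ` B \<in> fmeasurable (completion M)"
  unfolding completion.fmeasurable_inner_outer
 proof (intro allI impI)
  fix e :: real assume e: "0 < e"
  have "\<exists>C\<in>sets M. C \<subseteq> fst ` B & measure M H - e < measure M C"
  proof (cases "measure M H < e")
   case True then show ?thesis by (intro bexI[of _ "{}"]) auto
  next
   case False
   have "ennreal (measure M H - e / 2) < emeasure M H"
    using e False by (simp add: emeasure_eq_measure ennreal_lessI)
   then obtain C where C: "C \<in> sets M" "C \<subseteq> fst ` B" "ennreal (measure M H - e / 2) <= emeasure M C"
    using analytic_capacitable[OF M an] H(3) by metis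
   then have "measure M H - e / 2 <= measure M C"
    by (simp add: emeasure_eq_measure)
   then show ?thesis using C e by (intro bexI[of _ C]) auto
  qed
  then obtain C where C: "C \<in> sets M" "C \<subseteq> fst ` B" "measure M H - e < measure M C" by blast
  moreover have "measure M C <= measure M H"
   using C H by (intro finite_measure_mono) auto
  ultimately show "\<exists>T\<in>fmeasurable (completion M). \<exists>U\<in>fmeasurable (completion M).
    T \<subseteq> fst ` B & fst ` B \<subseteq> U & \<bar>measure (completion M) T - measure (completion M) U\<bar> < e"
   using H by (intro bexI[of _ C] bexI[of _ H]) (auto simp: fm)
 qed
 then show ?thesis by (rule fmeasurableD)
qed

text \<open>The universal completion.  Unlike a completion it refers to no measure, so its measurable functions can be composed
with kernels and be integrated against every law at once.\<close>

definition ucompl :: "'a measure => 'a measure" where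
 "ucompl M = sigma (space M)
   {A. A \<subseteq> space M & (\<forall>K. finite_measure K & sets K = sets M --> A \<in> sets (completion K))}"

lemma space_ucompl [simp]: "space (ucompl M) = space M"
 unfolding ucompl_def by (rule space_measure_of) auto

lemma sets_ucompl:
 "A \<in> sets (ucompl M) \<longleftrightarrow>
   A \<subseteq> space M & (\<forall>K. finite_measure K --> sets K = sets M --> A \<in> sets (completion K))"
proof -
 let ?S = "{A. A \<subseteq> space M & (\<forall>K. finite_measure K & sets K = sets M --> A \<in> sets (completion K))}"
 have "sigma_algebra (space M) ?S"
  unfolding sigma_algebra_iff2
 proof (intro conjI ballI allI impI)
  fix s assume s: "s \<in> ?S"
  have "space M - s \<in> sets (completion K)" if "finite_measure K" "sets K = sets M" for K
  proof -
   have "space K - s \<in> sets (completion K)"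
    using s that sets.compl_sets[of s "completion K"] by simp
   then show ?thesis using sets_eq_imp_space_eq[OF that(2)] by simp
  qed
  then show "space M - s \<in> ?S" by blast
 next
  fix A :: "nat => _" assume A: "range A \<subseteq> ?S"
  show "(\<Union>i. A i) \<in> ?S" using A by blast
 qed auto
 then have "sets (ucompl M) = ?S"
  unfolding ucompl_def by (simp add: sigma_algebra.sets_measure_of_eq)
 then show ?thesis by blast
qed

lemma sets_ucomplI [intro]: "A \<in> sets M ==> A \<in> sets (ucompl M)"
 unfolding sets_ucompl using sets.sets_into_space by auto

lemma measurable_ucomplI: "f \<in> M \<rightarrow>\<^sub>M N ==> f \<in> ucompl M \<rightarrow>\<^sub>M N"
 unfolding measurable_def by auto

lemma measurable_ucompl_completion:
 assumes f: "f \<in> ucompl M \<rightarrow>\<^sub>M N" and K: "finite_measure K" "sets K = sets M"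
 shows "f \<in> completion K \<rightarrow>\<^sub>M N"
proof (rule measurableI)
 have sp: "space K = space M" using K(2) by (rule sets_eq_imp_space_eq)
 show "f x \<in> space N" if "x \<in> space (completion K)" for x
  using that measurable_space[OF f] sp by simp
 show "f -` A Int space (completion K) \<in> sets (completion K)" if "A \<in> sets N" for A
  using measurable_sets[OF f that] K sp unfolding sets_ucompl by simp
qed

lemma measurable_ucompl_lift:
 assumes f: "f \<in> ucompl M \<rightarrow>\<^sub>M N"
 shows "f \<in> ucompl M \<rightarrow>\<^sub>M ucompl N"
proof (rule measurableI)
 show "f x \<in> space (ucompl N)" if "x \<in> space (ucompl M)" for x
  using that measurable_space[OF f] by simp
 fix A assume A: "A \<in> sets (ucompl N)"
 show "f -` A Int space (ucompl M) \<in> sets (ucompl M)"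
  unfolding sets_ucompl
 proof (intro conjI allI impI)
  fix K :: "'a measure" assume K: "finite_measure K" "sets K = sets M"
  have sp: "space K = space M" using K(2) by (rule sets_eq_imp_space_eq)
  have fK: "f \<in> completion K \<rightarrow>\<^sub>M N" by (rule measurable_ucompl_completion[OF f K])
  let ?L = "distr (completion K) N f"
  have "finite_measure (completion K)"
   using finite_measure.emeasure_finite[OF K(1)] by (intro finite_measureI) simp
  then have "finite_measure ?L" by (rule finite_measure.finite_measure_distr[OF _ fK])
  then have "A \<in> sets (completion ?L)" using A unfolding sets_ucompl by simp
  moreover have "f \<in> completion K \<rightarrow>\<^sub>M completion ?L"
  proof (rule completion.measurable_completion2)
   show fL: "f \<in> completion K \<rightarrow>\<^sub>M ?L" using fK by simp
   show "null_sets ?L \<subseteq> null_sets (distr (completion K) ?L f)"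
    by (auto simp: null_sets_def emeasure_distr fK fL)
  qed
  ultimately have "f -` A Int space (completion K) \<in> sets (completion K)"
   by (rule measurable_sets[rotated])
  then show "f -` A Int space (ucompl M) \<in> sets (completion K)" using sp by simp
 qed auto
qed

lemma measurable_ucomplI2:
 assumes "!!x. x \<in> space M ==> f x \<in> space N"
  and "!!K. finite_measure K ==> sets K = sets M ==> f \<in> completion K \<rightarrow>\<^sub>M N"
 shows "f \<in> ucompl M \<rightarrow>\<^sub>M N"
proof (rule measurableI)
 fix A assume A: "A \<in> sets N"
 show "f -` A Int space (ucompl M) \<in> sets (ucompl M)"
  unfolding sets_ucompl
 proof (intro conjI allI impI)
  fix K :: "'a measure" assume K: "finite_measure K" "sets K = sets M"
  have "space K = space M" using K(2) by (rule sets_eq_imp_space_eq)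
  then show "f -` A Int space (ucompl M) \<in> sets (completion K)"
   using measurable_sets[OF assms(2)[OF K] A] by simp
 qed auto
qed (use assms(1) in auto)

text \<open>In a completion, measurability is insensitive to changes on null sets.\<close>

lemma completion_measurable_AE:
 assumes g: "g \<in> completion K \<rightarrow>\<^sub>M N" and eq: "AE x in K. f x = g x"
  and f: "!!x. x \<in> space K ==> f x \<in> space N"
 shows "f \<in> completion K \<rightarrow>\<^sub>M N"
proof (rule measurableI)
 fix A assume A: "A \<in> sets N"
 show "f -` A Int space (completion K) \<in> sets (completion K)"
 proof (rule completion.in_sets_AE)
  show "g -` A Int space (completion K) \<in> sets (completion K)"
   using g A by (rule measurable_sets)
  show "AE x in completion K. x \<in> g -` A Int space (completion K) \<longleftrightarrow> x \<in> f -` A Int space (completion K)"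
   using AE_completion[OF eq] by eventually_elim auto
 qed auto
qed (use f in auto)

lemma ucompl_AE_borel:
 fixes f :: "'a => ennreal"
 assumes "f \<in> bm (ucompl M)" "finite_measure K" "sets K = sets M"
 obtains g where "g \<in> bm M" "AE x in K. f x = g x"
proof -
 have "f \<in> bm (completion K)"
  using assms by (rule measurable_ucompl_completion)
 from completion_ex_borel_measurable[OF this] that show ?thesis
  using measurable_cong_sets[OF assms(3) refl] by blast
qed

theorem measurable_projection:
 fixes I :: "real set"
 assumes I: "compact I" and B: "B \<in> sets (M \<Otimes>\<^sub>M borel)" "B \<subseteq> space M \<times> I"
 shows "fst ` B \<in> sets (ucompl M)"
 unfolding sets_ucompl
proof (intro conjI allI impI)
 show "fst ` B \<subseteq> space M" using B(2) by auto
 fix K :: "'a measure" assume K: "finite_measure K" "sets K = sets M"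
 have "space K = space M" using K(2) by (rule sets_eq_imp_space_eq)
 moreover have "sets (K \<Otimes>\<^sub>M borel) = sets (M \<Otimes>\<^sub>M (borel :: real measure))"
  using K(2) by (rule sets_pair_measure_cong) simp
 ultimately show "fst ` B \<in> sets (completion K)"
  using B by (intro measurable_projection_finite[OF K(1) I]) auto
qed

text \<open>For a given law on \<open>N\<close>, the integrand may be replaced by a measurable one that agrees with it almost everywhere for
the mixture of the kernel, hence for almost every member of the kernel.\<close>

lemma nn_integral_kernel_ucompl:
 fixes Y :: "'a => ennreal"
 assumes K: "K \<in> N \<rightarrow>\<^sub>M prob_algebra M" and Y: "Y \<in> bm (ucompl M)"
 shows "(%y. NN x. Y x \<partial>K y) \<in> bm (ucompl N)"
proof (rule measurable_ucomplI2)
 fix R :: "'b measure" assume R: "finite_measure R" "sets R = sets N"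
 have KR: "K \<in> R \<rightarrow>\<^sub>M prob_algebra M" "K \<in> R \<rightarrow>\<^sub>M subprob_algebra M"
  using K R(2) measurable_prob_algebraD[OF K] by (simp_all cong: measurable_cong_sets)
 show "(%y. NN x. Y x \<partial>K y) \<in> bm (completion R)"
 proof (cases "space R = {}")
  case True
  then show ?thesis by (auto simp: measurable_def)
 next
  case False
  have sets: "sets (R \<bind> K) = sets M"
   using sets_bind[of R K M] False sets_kernel[OF KR(2)] by auto
  have "finite_measure (R \<bind> K)"
  proof (rule finite_measureI)
   have "emeasure (R \<bind> K) (space (R \<bind> K)) = (NN y. emeasure (K y) (space M) \<partial>R)"
    using sets_eq_imp_space_eq[OF sets] by (simp add: emeasure_bind[OF False KR(2)])
   also have "... = (NN y. 1 \<partial>R)"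
   proof (rule nn_integral_cong)
    fix y assume "y \<in> space R"
    then have "K y \<in> space (prob_algebra M)" using KR(1) by (rule measurable_space[rotated])
    then show "emeasure (K y) (space M) = 1"
     using prob_space.emeasure_space_1[of "K y"] sets_eq_imp_space_eq[of "K y" M]
     by (simp add: space_prob_algebra)
   qed
   finally show "emeasure (R \<bind> K) (space (R \<bind> K)) ~= \<infinity>"
    using finite_measure.emeasure_finite[OF R(1)] by simp
  qed
  then obtain Y' where Y': "Y' \<in> bm M" "AE x in R \<bind> K. Y x = Y' x"
   using ucompl_AE_borel[OF Y _ sets] by blast
  have "AE y in R. AE x in K y. Y x = Y' x"
  proof -
   obtain Z where Z: "Z \<in> sets M" "emeasure (R \<bind> K) Z = 0" "{x \<in> space M. Y x ~= Y' x} \<subseteq> Z"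
    using Y'(2) sets sets_eq_imp_space_eq[OF sets] by (auto elim!: AE_E)
   have "(NN y. emeasure (K y) Z \<partial>R) = 0"
    using Z by (simp add: emeasure_bind[OF False KR(2)])
   then have "AE y in R. emeasure (K y) Z = 0"
    using Z(1) KR(2) by (subst (asm) nn_integral_0_iff_AE) auto
   with AE_space show ?thesis
   proof eventually_elim
    fix y assume y: "y \<in> space R" "emeasure (K y) Z = 0"
    have Ky: "sets (K y) = sets M" using sets_kernel[OF KR(2) y(1)] .
    show "AE x in K y. Y x = Y' x"
    proof (rule AE_I')
     show "Z \<in> null_sets (K y)" using y(2) Z(1) Ky by (auto simp: null_sets_def)
     show "{x \<in> space (K y). Y x ~= Y' x} \<subseteq> Z"
      using Z(3) sets_eq_imp_space_eq[OF Ky] by simp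
    qed
   qed
  qed
  then have "AE y in R. (NN x. Y x \<partial>K y) = (NN x. Y' x \<partial>K y)"
   by eventually_elim (rule nn_integral_cong_AE)
  moreover have "(%y. NN x. Y' x \<partial>K y) \<in> bm R"
   by (rule measurable_compose[OF KR(2) nn_integral_measurable_subprob_algebra[OF Y'(1)]])
  ultimately show ?thesis
   by (intro completion_measurable_AE[where f = "%y. NN x. Y x \<partial>K y" and g = "%y. NN x. Y' x \<partial>K y"]
     measurable_completion) simp_all
 qed
qed simp

text \<open>A null set of the first factor spans a null rectangle; completing that factor before forming the product is
therefore harmless once the product is completed.\<close>

lemma completion_pair_sets:
 assumes M: "prob_space M" and N: "prob_space N" and E: "E \<in> sets (completion M \<Otimes>\<^sub>M N)"
 shows "E \<in> sets (completion (M \<Otimes>\<^sub>M N))"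
  and "emeasure (completion (M \<Otimes>\<^sub>M N)) E = emeasure (completion M \<Otimes>\<^sub>M N) E"
proof -
 interpret M: prob_space M by fact
 interpret N: prob_space N by fact
 interpret MN: pair_prob_space M N ..
 have fst: "fst \<in> completion (M \<Otimes>\<^sub>M N) \<rightarrow>\<^sub>M completion M"
 proof (rule completion.measurable_completion2)
  show f: "fst \<in> completion (M \<Otimes>\<^sub>M N) \<rightarrow>\<^sub>M M" by (rule measurable_completion) simp
  have "emeasure (M \<Otimes>\<^sub>M N) (fst -` A Int space (M \<Otimes>\<^sub>M N)) = emeasure M A" if "A \<in> sets M" for A
  proof -
   have "fst -` A Int space (M \<Otimes>\<^sub>M N) = A \<times> space N"
    using sets.sets_into_space[OF that] by (auto simp: space_pair_measure)
   then show ?thesis using that by (simp add: N.emeasure_pair_measure_Times N.emeasure_space_1)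
  qed
  then show "null_sets M \<subseteq> null_sets (distr (completion (M \<Otimes>\<^sub>M N)) M fst)"
   using f measurable_sets[OF measurable_fst, of _ M N]
   by (auto simp: null_sets_def emeasure_distr)
 qed
 have snd: "snd \<in> completion (M \<Otimes>\<^sub>M N) \<rightarrow>\<^sub>M N" by (rule measurable_completion) simp
 have id: "(%z. z) \<in> completion (M \<Otimes>\<^sub>M N) \<rightarrow>\<^sub>M completion M \<Otimes>\<^sub>M N"
  using measurable_Pair[OF fst snd] by simp
 have space: "space (completion M \<Otimes>\<^sub>M N) = space (M \<Otimes>\<^sub>M N)"
  by (simp add: space_pair_measure)
 have sets: "A \<in> sets (completion (M \<Otimes>\<^sub>M N))" if "A \<in> sets (completion M \<Otimes>\<^sub>M N)" for A
  using measurable_sets[OF id that] sets.sets_into_space[OF that] space by (simp add: inf_absorb1)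
 show "E \<in> sets (completion (M \<Otimes>\<^sub>M N))" using E by (rule sets)
 let ?L = "distr (completion (M \<Otimes>\<^sub>M N)) (completion M \<Otimes>\<^sub>M N) (%z. z)"
 have sf: "sigma_finite_measure (completion M)"
 proof -
  have "finite_measure (completion M)" by (rule finite_measureI) (simp add: M.emeasure_space_1)
  then show ?thesis by (simp add: finite_measure_def)
 qed
 have "completion M \<Otimes>\<^sub>M N = ?L"
 proof (rule pair_measure_eqI[OF sf N.sigma_finite_measure_axioms])
  fix A B assume A: "A \<in> sets (completion M)" and B: "B \<in> sets N"
  have AB: "A \<times> B \<in> sets (completion M \<Otimes>\<^sub>M N)" using A B by simp
  let ?A = "main_part M A"
  have mA: "?A \<in> sets M" using A by simp
  have "AE z in completion (M \<Otimes>\<^sub>M N). z \<in> A \<times> B \<longleftrightarrow> z \<in> ?A \<times> B"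
  proof -
   obtain Z where Z: "Z \<in> null_sets M" "null_part M A \<subseteq> Z" using null_part[OF A] by auto
   have "Z \<times> space N \<in> null_sets (M \<Otimes>\<^sub>M N)"
    using Z(1) by (auto simp: null_sets_def N.emeasure_pair_measure_Times)
   moreover have "A = ?A \<union> null_part M A" using main_part_null_part_Un[OF A] by simp
   ultimately have "AE z in M \<Otimes>\<^sub>M N. z \<in> A \<times> B \<longleftrightarrow> z \<in> ?A \<times> B"
    using Z(2) by (intro AE_I'[of "Z \<times> space N"]) (auto simp: space_pair_measure)
   then show ?thesis by (rule AE_completion)
  qed
  then have "emeasure (completion (M \<Otimes>\<^sub>M N)) (A \<times> B) = emeasure (completion (M \<Otimes>\<^sub>M N)) (?A \<times> B)"
   using sets[OF AB] mA B by (intro emeasure_eq_AE) auto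
  then show "emeasure (completion M) A * emeasure N B = emeasure ?L (A \<times> B)"
   using A B AB mA id sets.sets_into_space[OF AB] space
   by (simp add: emeasure_distr inf_absorb1 N.emeasure_pair_measure_Times)
 qed simp
 then have "emeasure (completion M \<Otimes>\<^sub>M N) E = emeasure ?L E" by simp
 then show "emeasure (completion (M \<Otimes>\<^sub>M N)) E = emeasure (completion M \<Otimes>\<^sub>M N) E"
  using E id sets.sets_into_space[OF E] space by (simp add: emeasure_distr inf_absorb1)
qed

abbreviation prod_space :: "(path \<times> real) measure" where
 "prod_space \<equiv> ucompl path_space \<Otimes>\<^sub>M borel"

section \<open>Measurability on the path space\<close>

lemma pathsD:
 assumes "w \<in> paths"
 shows "w \<in> extensional {0..}"
  and "!!s t. 0 <= s ==> s <= t ==> w s = None ==> w t = None"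
  and "!!t. 0 <= t ==> w t ~= None ==> \<forall>\<^sub>F s in at_right t. w s ~= None"
  and "!!t. 0 <= t ==> w t ~= None ==> ((%s. the (w s)) \<longlongrightarrow> the (w t)) (at_right t)"
  and "!!t. 0 < t ==> (!!s. 0 <= s ==> s < t ==> w s ~= None) ==>
      \<exists>l. ((%s. the (w s)) \<longlongrightarrow> l) (at_left t)"
 using assms unfolding paths_def by auto

lemma pathsI:
 assumes "w \<in> extensional {0..}"
  and "!!s t. 0 <= s ==> s <= t ==> w s = None ==> w t = None"
  and "!!t. 0 <= t ==> w t ~= None ==> \<forall>\<^sub>F s in at_right t. w s ~= None"
  and "!!t. 0 <= t ==> w t ~= None ==> ((%s. the (w s)) \<longlongrightarrow> the (w t)) (at_right t)"
  and "!!t. 0 < t ==> (!!s. 0 <= s ==> s < t ==> w s ~= None) ==>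
      \<exists>l. ((%s. the (w s)) \<longlongrightarrow> l) (at_left t)"
 shows "w \<in> paths"
 unfolding paths_def using assms by auto

lemma eventually_at_right_lt: "s < (t::real) ==> \<forall>\<^sub>F r in at_right s. s < r & r < t"
 using eventually_at_right[of s t] by auto

lemma eventually_at_left_gt: "s < (t::real) ==> \<forall>\<^sub>F r in at_left t. s < r & r < t"
 using eventually_at_left[of s t] by auto

lemma kill_paths: "w \<in> paths ==> kill t w \<in> paths"
proof (rule pathsI)
 assume w: "w \<in> paths"
 note d = pathsD[OF w]
 show "kill t w \<in> extensional {0..}" by (simp add: kill_def)
 show "kill t w s' = None" if "0 <= s" "s <= s'" "kill t w s = None" for s s'
  using d(2)[of s s'] that by (auto simp: kill_def split: if_splits)
 fix s :: real
 {
  assume s: "0 <= s" "kill t w s ~= None"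
  then have s': "s < t" "w s ~= None" "kill t w s = w s" by (auto simp: kill_def split: if_splits)
  have eq: "\<forall>\<^sub>F r in at_right s. kill t w r = w r"
   using eventually_at_right_lt[OF s'(1)] by eventually_elim (use s in "auto simp: kill_def")
  show "\<forall>\<^sub>F r in at_right s. kill t w r ~= None"
   using eq d(3)[OF s(1) s'(2)] by eventually_elim simp
  have "\<forall>\<^sub>F r in at_right s. the (w r) = the (kill t w r)"
   using eq by eventually_elim simp
  with d(4)[OF s(1) s'(2)]
  show "((%r. the (kill t w r)) \<longlongrightarrow> the (kill t w s)) (at_right s)"
   unfolding s'(3) by (rule Lim_transform_eventually)
 }
 {
  assume s: "0 < s" and al: "!!r. 0 <= r ==> r < s ==> kill t w r ~= None"
  have al': "r < t & w r ~= None" if "0 <= r" "r < s" for r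
   using al[OF that] that by (auto simp: kill_def split: if_splits)
  obtain l where l: "((%s. the (w s)) \<longlongrightarrow> l) (at_left s)" using d(5)[OF s] al' by blast
  have "\<forall>\<^sub>F r in at_left s. the (w r) = the (kill t w r)"
   using eventually_at_left_gt[OF s] by eventually_elim (use al' in "auto simp: kill_def")
  from Lim_transform_eventually[OF l this]
  show "\<exists>l. ((%r. the (kill t w r)) \<longlongrightarrow> l) (at_left s)" by blast
 }
qed

lemma stop_paths: "0 <= t ==> w \<in> paths ==> stop t w \<in> paths"
proof (rule pathsI)
 assume w: "w \<in> paths" and t: "0 <= t"
 note d = pathsD[OF w]
 show "stop t w \<in> extensional {0..}" by (simp add: stop_def)
 show "stop t w s' = None" if "0 <= s" "s <= s'" "stop t w s = None" for s s'
  using d(2)[of "min s t" "min s' t"] that t by (auto simp: stop_def)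
 fix s :: real
 {
  assume s: "0 <= s" "stop t w s ~= None"
  have ev: "(\<forall>\<^sub>F r in at_right s. stop t w r ~= None) &
    ((%r. the (stop t w r)) \<longlongrightarrow> the (stop t w s)) (at_right s)"
  proof (cases "s < t")
   case True
   then have s': "stop t w s = w s" using s by (auto simp: stop_def)
   have eq: "\<forall>\<^sub>F r in at_right s. stop t w r = w r"
    using eventually_at_right_lt[OF True] by eventually_elim (use s in "auto simp: stop_def")
   have "\<forall>\<^sub>F r in at_right s. stop t w r ~= None"
    using eq d(3)[OF s(1)] s(2) unfolding s' by (auto elim: eventually_elim2)
   moreover have "\<forall>\<^sub>F r in at_right s. the (w r) = the (stop t w r)"
    using eq by eventually_elim simp
   moreover have "((%r. the (w r)) \<longlongrightarrow> the (w s)) (at_right s)"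
    using d(4)[OF s(1)] s(2) unfolding s' by blast
   ultimately show ?thesis
    unfolding s' using Lim_transform_eventually by (intro conjI)
  next
   case False
   have const: "stop t w r = stop t w s" if "s < r" for r
    using s(1) False that by (simp add: stop_def min_absorb2)
   have eq: "\<forall>\<^sub>F r in at_right s. stop t w r = stop t w s"
    using eventually_at_right_less const by (rule eventually_mono)
   have "\<forall>\<^sub>F r in at_right s. stop t w r ~= None"
    by (rule eventually_mono[OF eq]) (simp add: s(2))
   moreover have "((%r. the (stop t w r)) \<longlongrightarrow> the (stop t w s)) (at_right s)"
   proof (rule tendsto_eventually)
    show "\<forall>\<^sub>F r in at_right s. the (stop t w r) = the (stop t w s)"
     using eq by eventually_elim simp
   qed
   ultimately show ?thesis by blast
  qed
  then show "\<forall>\<^sub>F r in at_right s. stop t w r ~= None"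
   "((%r. the (stop t w r)) \<longlongrightarrow> the (stop t w s)) (at_right s)" by blast+
 }
 {
  assume s: "0 < s" and al: "!!r. 0 <= r ==> r < s ==> stop t w r ~= None"
  show "\<exists>l. ((%r. the (stop t w r)) \<longlongrightarrow> l) (at_left s)"
  proof (cases "s <= t")
   case True
   have al': "w r ~= None" if "0 <= r" "r < s" for r
    using al[OF that] that True by (auto simp: stop_def)
   obtain l where l: "((%s. the (w s)) \<longlongrightarrow> l) (at_left s)" using d(5)[OF s] al' by blast
   have "\<forall>\<^sub>F r in at_left s. the (w r) = the (stop t w r)"
    using eventually_at_left_gt[OF s] by eventually_elim (use True in "auto simp: stop_def")
   from Lim_transform_eventually[OF l this] show ?thesis by blast
  next
   case False
   then have "t < s" by simp
   from eventually_at_left_gt[OF this]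
   have "\<forall>\<^sub>F r in at_left s. the (stop t w r) = the (w t)"
    by eventually_elim (use t in "auto simp: stop_def min_def")
   from tendsto_eventually[OF this] show ?thesis by blast
  qed
 }
qed

lemma shift_paths: "0 <= t ==> w \<in> paths ==> shift t w \<in> paths"
proof (rule pathsI)
 assume w: "w \<in> paths" and t: "0 <= t"
 note d = pathsD[OF w]
 show "shift t w \<in> extensional {0..}" by (simp add: shift_def)
 show "shift t w s' = None" if "0 <= s" "s <= s'" "shift t w s = None" for s s'
  using d(2)[of "t + s" "t + s'"] that t by (auto simp: shift_def)
 have right: "at_right s = filtermap (%x. x - t) (at_right (t + s))" for s
  by (simp add: filtermap_at_right_shift)
 fix s :: real
 {
  assume s: "0 <= s" "shift t w s ~= None"
  then have s': "w (t + s) ~= None" "shift t w s = w (t + s)" by (auto simp: shift_def)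
  have ts: "0 <= t + s" using s t by simp
  have eq: "\<forall>\<^sub>F r in at_right (t + s). shift t w (r - t) = w r"
   using eventually_at_right_lt[OF less_add_one, of "t + s"]
   by eventually_elim (use s in "auto simp: shift_def")
  show "\<forall>\<^sub>F r in at_right s. shift t w r ~= None"
   unfolding right[of s] eventually_filtermap using eq d(3)[OF ts s'(1)] by eventually_elim simp
  have "\<forall>\<^sub>F r in at_right (t + s). the (w r) = the (shift t w (r - t))"
   using eq by eventually_elim simp
  with d(4)[OF ts s'(1)]
  show "((%r. the (shift t w r)) \<longlongrightarrow> the (shift t w s)) (at_right s)"
   unfolding s'(2) right[of s] filterlim_filtermap by (rule Lim_transform_eventually)
 }
 {
  assume s: "0 < s" and al: "!!r. 0 <= r ==> r < s ==> shift t w r ~= None"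
  have al': "w r ~= None" if r: "0 <= r" "r < t + s" for r
  proof (cases "r < t")
   case False
   then show ?thesis using al[of "r - t"] r by (auto simp: shift_def)
  next
   case True
   show ?thesis
   proof
    assume "w r = None"
    then have "w t = None" using d(2)[of r t] r True by simp
    then show False using al[of 0] s by (simp add: shift_def)
   qed
  qed
  obtain l where l: "((%s. the (w s)) \<longlongrightarrow> l) (at_left (t + s))"
   using d(5)[of "t + s"] al' s t by (metis add_nonneg_pos)
  have "filterlim (%r. t + r) (at_left (t + s)) (at_left s)"
   unfolding filterlim_at
   by (auto intro!: tendsto_intros eventually_at_leftI[of 0] simp: s)
  from filterlim_compose[OF l this]
  have lim: "((%r. the (w (t + r))) \<longlongrightarrow> l) (at_left s)" .
  have "\<forall>\<^sub>F r in at_left s. the (w (t + r)) = the (shift t w r)"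
   using eventually_at_left_gt[OF s] by eventually_elim (auto simp: shift_def)
  from Lim_transform_eventually[OF lim this]
  show "\<exists>l. ((%r. the (shift t w r)) \<longlongrightarrow> l) (at_left s)" by blast
 }
qed

lemma nat_filt_generator_sub:
 "{{w \<in> paths. w s \<in> Some ` B} | s B. 0 <= s & ennreal s <= t & B \<in> sets (borel :: real measure)}
   \<subseteq> Pow paths"
 by auto

lemma sets_nat_filtI:
 "0 <= s ==> ennreal s <= t ==> B \<in> sets borel ==> {w \<in> paths. w s \<in> Some ` B} \<in> sets (nat_filt t)"
 unfolding nat_filt_def by (subst sets_measure_of[OF nat_filt_generator_sub]) (rule sigma_sets.Basic, blast)

text \<open>Maps into the path space are tested on the coordinates.\<close>

lemma measurable_nat_filtI:
 assumes "!!x. x \<in> space M ==> f x \<in> paths"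
  and "!!s B. 0 <= s ==> ennreal s <= t ==> B \<in> sets borel ==> {x \<in> space M. f x s \<in> Some ` B} \<in> sets M"
 shows "f \<in> M \<rightarrow>\<^sub>M nat_filt t"
 unfolding nat_filt_def
proof (rule measurable_measure_of[OF nat_filt_generator_sub])
 show "f \<in> space M \<rightarrow> paths" using assms(1) by auto
 fix A assume "A \<in> {{w \<in> paths. w s \<in> Some ` B} | s B. 0 <= s & ennreal s <= t & B \<in> sets (borel :: real measure)}"
 then obtain s B where A: "A = {w \<in> paths. w s \<in> Some ` B}" "0 <= s" "ennreal s <= t" "B \<in> sets borel"
  by auto
 have "f -` A Int space M = {x \<in> space M. f x s \<in> Some ` B}" using assms(1) A by auto
 then show "f -` A Int space M \<in> sets M" using assms(2) A by simp
qed

lemma sets_nat_filt_mono: "s <= t ==> sets (nat_filt s) \<subseteq> sets (nat_filt t)"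
 using filtration.sets_F_mono[OF filtration_nat_filt] .

lemma measurable_alive [measurable]:
 assumes "0 <= s" "ennreal s <= t"
 shows "{w \<in> paths. w s ~= None} \<in> sets (nat_filt t)"
proof -
 have "{w \<in> paths. w s ~= None} = {w \<in> paths. w s \<in> Some ` (UNIV :: real set)}" by auto
 then show ?thesis using sets_nat_filtI[OF assms, of UNIV] by simp
qed

lemma measurable_pos:
 assumes "0 <= s" "ennreal s <= t"
 shows "pos s \<in> bm (nat_filt t)"
proof (rule measurableI)
 fix B :: "real set" assume B: "B \<in> sets borel"
 have "pos s -` B Int space (nat_filt t) = {w \<in> paths. w s \<in> Some ` B} \<union>
   (if the None \<in> B then space (nat_filt t) - {w \<in> paths. w s ~= None} else {})"
  by (auto simp: image_iff) (metis option.collapse)+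
 also have "... \<in> sets (nat_filt t)"
 proof (rule sets.Un[OF sets_nat_filtI[OF assms B]])
  show "(if the None \<in> B then space (nat_filt t) - {w \<in> paths. w s ~= None} else {}) \<in> sets (nat_filt t)"
   using sets.compl_sets[OF measurable_alive[OF assms]] by (simp del: not_None_eq)
 qed
 finally show "pos s -` B Int space (nat_filt t) \<in> sets (nat_filt t)" .
qed simp

lemma alive_iff:
 assumes w: "w \<in> paths" and s: "0 <= s"
 shows "w s ~= None \<longleftrightarrow> (\<exists>q\<in>\<rat>. s < q & w q ~= None)"
proof (rule iffI)
 assume "\<exists>q\<in>\<rat>. s < q & w q ~= None"
 then obtain q where "s < q" "w q ~= None" by blast
 then show "w s ~= None" using pathsD(2)[OF w s, of q] by (metis less_imp_le)
next
 assume "w s ~= None"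
 then have "\<forall>\<^sub>F r in at_right s. w r ~= None" using pathsD(3)[OF w s] by blast
 then obtain t where t: "s < t" "!!r. s < r ==> r < t ==> w r ~= None"
  unfolding eventually_at_right_field by blast
 obtain q where "q \<in> \<rat>" "s < q" "q < t" using Rats_dense_in_real[OF t(1)] by blast
 then show "\<exists>q\<in>\<rat>. s < q & w q ~= None" using t(2) by blast
qed

text \<open>Right-continuity: the position at time \<open>s\<close> is the limit of the positions at the next points of finer and finer grids,
each of which is jointly measurable.\<close>

lemma measurable_coordinate_pair:
 assumes B: "B \<in> sets borel"
 shows "{z \<in> paths \<times> UNIV. 0 <= snd z & fst z (snd z) \<in> Some ` B} \<in> sets (path_space \<Otimes>\<^sub>M borel)"
proof -
 let ?M = "path_space \<Otimes>\<^sub>M (borel :: real measure)"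
 define al where "al = {z \<in> paths \<times> UNIV. 0 <= snd z & fst z (snd z) ~= None}"
 have "al = (\<Union>q\<in>\<rat> Int {0<..}. {w \<in> paths. w q ~= None} \<times> {0..<q})"
 proof (intro set_eqI iffI)
  fix z assume "z \<in> al"
  then show "z \<in> (\<Union>q\<in>\<rat> Int {0<..}. {w \<in> paths. w q ~= None} \<times> {0..<q})"
   using alive_iff[of "fst z" "snd z"] unfolding al_def by (cases z) fastforce
 next
  fix z assume "z \<in> (\<Union>q\<in>\<rat> Int {0<..}. {w \<in> paths. w q ~= None} \<times> {0..<q})"
  then show "z \<in> al"
   using alive_iff[of "fst z" "snd z"] unfolding al_def by (cases z) auto
 qed
 also have "... \<in> sets ?M"
 proof (rule sets.countable_UN''[OF countable_Int1[OF countable_rat]])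
  fix q :: real assume "q \<in> \<rat> Int {0<..}"
  then show "{w \<in> paths. w q ~= None} \<times> {0..<q} \<in> sets ?M"
   by (intro pair_measureI measurable_alive) auto
 qed
 finally have al: "al \<in> sets ?M" .
 define r :: "nat => real => real" where "r n s = (real_of_int \<lfloor>max 0 s * Suc n\<rfloor> + 1) / Suc n" for n s
 have r: "s < r n s" "r n s <= s + 1 / Suc n" "0 <= r n s" if "0 <= s" for n and s :: real
 proof -
  have *: "real_of_int \<lfloor>s * Suc n\<rfloor> <= s * Suc n" "s * Suc n < real_of_int \<lfloor>s * Suc n\<rfloor> + 1" by linarith+
  show "s < r n s" using *(2) that unfolding r_def by (simp add: less_divide_eq)
  then show "0 <= r n s" using that by simp
  have "(real_of_int \<lfloor>s * Suc n\<rfloor> + 1) / Suc n <= (s * Suc n + 1) / Suc n"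
   using *(1) by (intro divide_right_mono) auto
  also have "... = s + 1 / Suc n" by (simp add: add_divide_distrib)
  finally show "r n s <= s + 1 / Suc n" using that unfolding r_def by simp
 qed
 define wt where "wt n z = ind al z * pos (r n (snd z)) (fst z)" for n z
 have wt: "wt n \<in> bm ?M" for n
 proof -
  have "(%z. pos (max 0 ((real_of_int \<lfloor>max 0 (snd z) * Suc n\<rfloor> + 1) / Suc n)) (fst z)) \<in> bm ?M"
  proof (rule measurable_compose_countable[where f = "%k z. pos (max 0 ((real_of_int k + 1) / Suc n)) (fst z)"])
   show "(%z. pos (max 0 ((real_of_int k + 1) / Suc n)) (fst z)) \<in> bm ?M" for k
    by (rule measurable_compose[OF measurable_fst measurable_pos]) auto
   show "(%z. \<lfloor>max 0 (snd z) * Suc n\<rfloor>) \<in> ?M \<rightarrow>\<^sub>M count_space UNIV" by measurable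
  qed
  moreover have "max 0 ((real_of_int \<lfloor>max 0 (s :: real) * Suc n\<rfloor> + 1) / Suc n) = r n s" for s
  proof -
   have "0 <= real_of_int \<lfloor>max 0 s * Suc n\<rfloor>" by simp
   then have "0 <= (real_of_int \<lfloor>max 0 s * Suc n\<rfloor> + 1) / Suc n" by (intro divide_nonneg_nonneg) auto
   then show ?thesis unfolding r_def by (rule max_absorb2)
  qed
  ultimately show ?thesis unfolding wt_def using al by (intro borel_measurable_times) auto
 qed
 define v where "v z = ind al z * pos (snd z) (fst z)" for z
 have "(%n. wt n z) \<longlonglongrightarrow> v z" if "z \<in> space ?M" for z
 proof (cases "z \<in> al")
  case True
  then have z: "fst z \<in> paths" "0 <= snd z" "fst z (snd z) ~= None" unfolding al_def by auto
  have "(%n. r n (snd z)) \<longlonglongrightarrow> snd z"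
  proof (rule tendsto_sandwich[of "%_. snd z" _ _ "%n. snd z + 1 / Suc n"])
   have "(%n. snd z + 1 / Suc n) \<longlonglongrightarrow> snd z + 0"
    by (intro tendsto_intros LIMSEQ_Suc[OF lim_1_over_n])
   then show "(%n. snd z + 1 / Suc n) \<longlonglongrightarrow> snd z" by simp
  qed (use r(1,2)[OF z(2)] in \<open>auto intro!: always_eventually less_imp_le\<close>)
  then have "filterlim (%n. r n (snd z)) (at_right (snd z)) sequentially"
   unfolding filterlim_at using r(1)[OF z(2)] by (auto simp: less_imp_neq[symmetric])
  then have "(%n. pos (r n (snd z)) (fst z)) \<longlonglongrightarrow> pos (snd z) (fst z)"
   using pathsD(4)[OF z] by (rule filterlim_compose[rotated])
  then show ?thesis using True by (simp add: wt_def v_def)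
 qed (simp add: wt_def v_def)
 then have v: "v \<in> bm ?M"
  using wt by (rule borel_measurable_LIMSEQ_real)
 have "{z \<in> paths \<times> UNIV. 0 <= snd z & fst z (snd z) \<in> Some ` B} = al Int (v -` B Int space ?M)"
  by (auto simp: al_def v_def space_pair_measure image_iff indicator_def split: if_splits)
 then show ?thesis using al measurable_sets[OF v B] by auto
qed

lemma measurable_eval:
 assumes W: "W \<in> M \<rightarrow>\<^sub>M path_space" and \<tau>: "\<tau> \<in> bm M"
  and B: "B \<in> sets borel"
 shows "{x \<in> space M. 0 <= \<tau> x & W x (\<tau> x) \<in> Some ` B} \<in> sets M"
proof -
 have "(%x. (W x, \<tau> x)) \<in> M \<rightarrow>\<^sub>M path_space \<Otimes>\<^sub>M borel"
  using W \<tau> by (rule measurable_Pair)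
 from measurable_sets[OF this measurable_coordinate_pair[OF B]]
 show ?thesis using measurable_space[OF W]
  by (auto intro!: arg_cong2[where f = "(\<in>)"] elim!: back_subst[where P = "%A. A \<in> sets M"])
qed

lemma measurable_shift:
 assumes W: "W \<in> M \<rightarrow>\<^sub>M path_space" and \<tau>: "\<tau> \<in> bm M"
  and "!!x. x \<in> space M ==> 0 <= \<tau> x"
 shows "(%x. shift (\<tau> x) (W x)) \<in> M \<rightarrow>\<^sub>M path_space"
proof (rule measurable_nat_filtI)
 show "shift (\<tau> x) (W x) \<in> paths" if "x \<in> space M" for x
  using that assms(3) measurable_space[OF W] by (intro shift_paths) auto
 fix s :: real and B :: "real set" assume s: "0 <= s" "B \<in> sets borel"
 have "{x \<in> space M. shift (\<tau> x) (W x) s \<in> Some ` B} =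
   {x \<in> space M. 0 <= \<tau> x + s & W x (\<tau> x + s) \<in> Some ` B}"
  using s assms(3) by (auto simp: shift_def)
 also have "... \<in> sets M" using W \<tau> s by (intro measurable_eval) auto
 finally show "{x \<in> space M. shift (\<tau> x) (W x) s \<in> Some ` B} \<in> sets M" .
qed

lemma measurable_stop:
 assumes W: "W \<in> M \<rightarrow>\<^sub>M path_space" and \<tau>: "\<tau> \<in> bm M"
  and "!!x. x \<in> space M ==> 0 <= \<tau> x"
 shows "(%x. stop (\<tau> x) (W x)) \<in> M \<rightarrow>\<^sub>M path_space"
proof (rule measurable_nat_filtI)
 show "stop (\<tau> x) (W x) \<in> paths" if "x \<in> space M" for x
  using that assms(3) measurable_space[OF W] by (intro stop_paths) auto
 fix s :: real and B :: "real set" assume s: "0 <= s" "B \<in> sets borel"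
 have "{x \<in> space M. stop (\<tau> x) (W x) s \<in> Some ` B} =
   {x \<in> space M. 0 <= min s (\<tau> x) & W x (min s (\<tau> x)) \<in> Some ` B}"
  using s assms(3) by (auto simp: stop_def)
 also have "... \<in> sets M" using W \<tau> s by (intro measurable_eval) auto
 finally show "{x \<in> space M. stop (\<tau> x) (W x) s \<in> Some ` B} \<in> sets M" .
qed

lemma measurable_kill:
 assumes W: "W \<in> M \<rightarrow>\<^sub>M path_space" and \<tau>: "\<tau> \<in> bm M"
 shows "(%x. kill (\<tau> x) (W x)) \<in> M \<rightarrow>\<^sub>M path_space"
proof (rule measurable_nat_filtI)
 show "kill (\<tau> x) (W x) \<in> paths" if "x \<in> space M" for x
  using that measurable_space[OF W] by (intro kill_paths) auto
 fix s :: real and B :: "real set" assume s: "0 <= s" "B \<in> sets borel"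
 have "{x \<in> space M. kill (\<tau> x) (W x) s \<in> Some ` B} =
   {x \<in> space M. s < \<tau> x} Int {x \<in> space M. 0 <= s & W x s \<in> Some ` B}"
  using s by (auto simp: kill_def)
 also have "... \<in> sets M" using W \<tau> s by (intro sets.Int measurable_eval) auto
 finally show "{x \<in> space M. kill (\<tau> x) (W x) s \<in> Some ` B} \<in> sets M" .
qed

lemma measurable_stop_nat_filt: "0 <= t ==> stop t \<in> filt t \<rightarrow>\<^sub>M path_space"
proof (rule measurable_nat_filtI)
 assume t: "0 <= t"
 show "stop t x \<in> paths" if "x \<in> space (filt t)" for x
  using that t by (simp add: stop_paths)
 fix s :: real and B :: "real set" assume s: "0 <= s" "B \<in> sets borel"
 have "{x \<in> space (filt t). stop t x s \<in> Some ` B} = {x \<in> paths. x (min s t) \<in> Some ` B}"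
  using s t by (auto simp: stop_def)
 also have "... \<in> sets (filt t)"
  using s t by (intro sets_nat_filtI) auto
 finally show "{x \<in> space (filt t). stop t x s \<in> Some ` B} \<in> sets (filt t)" .
qed

text \<open>Galmarino's test: a functional that does not change when the path is stopped at \<open>t\<close> is known at time \<open>t\<close>.\<close>

lemma ucompl_nat_filt_stop:
 assumes t: "0 <= t" and f: "f \<in> ucompl path_space \<rightarrow>\<^sub>M N"
  and inv: "!!w. w \<in> paths ==> f (stop t w) = f w"
 shows "f \<in> ucompl (filt t) \<rightarrow>\<^sub>M N"
proof -
 have "stop t \<in> ucompl (filt t) \<rightarrow>\<^sub>M ucompl path_space"
  by (intro measurable_ucompl_lift measurable_ucomplI measurable_stop_nat_filt t)
 from measurable_compose[OF this f] show ?thesis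
  by (rule measurable_cong[THEN iffD1, rotated]) (use inv in simp)
qed

lemma ucompl_nat_filt_mono: "s <= t ==> sets (ucompl (nat_filt s)) \<subseteq> sets (ucompl (nat_filt t))"
proof
 fix A assume st: "s <= t" and A: "A \<in> sets (ucompl (nat_filt s))"
 have "(%w. w) \<in> nat_filt t \<rightarrow>\<^sub>M nat_filt s"
  using sets_nat_filt_mono[OF st] by (auto simp: measurable_def Int_absorb2 dest: sets.sets_into_space)
 then have "(%w. w) \<in> ucompl (nat_filt t) \<rightarrow>\<^sub>M ucompl (nat_filt s)"
  by (intro measurable_ucompl_lift measurable_ucomplI)
 from measurable_sets[OF this A] show "A \<in> sets (ucompl (nat_filt t))"
  using sets.sets_into_space[OF A] by (simp add: Int_absorb2)
qed

section \<open>First and last zeros\<close>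

text \<open>Limits of zeros from the right are zeros by right-continuity, which includes that a path cannot jump out of the
cemetery.\<close>

lemma zeros_right_closed:
 assumes w: "w \<in> paths" and s: "0 <= s" and ex: "!!e. 0 < e ==> \<exists>r\<in>zeros w. s <= r & r < s + e"
 shows "s \<in> zeros w"
proof (rule ccontr)
 assume no: "s \<notin> zeros w"
 have al: "w s ~= None"
 proof
  assume "w s = None"
  obtain r where "r \<in> zeros w" "s <= r" using ex[of 1] by auto
  then show False using pathsD(2)[OF w s _ \<open>w s = None\<close>, of r] by (auto simp: zeros_def)
 qed
 then have "the (w s) ~= 0" using no s by (auto simp: zeros_def)
 then have "\<forall>\<^sub>F r in at_right s. the (w r) ~= 0"
  using tendsto_imp_eventually_ne[OF pathsD(4)[OF w s al]] by blast
 then obtain t where t: "s < t" "!!r. s < r ==> r < t ==> the (w r) ~= 0"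
  unfolding eventually_at_right_field by blast
 obtain r where "r \<in> zeros w" "s <= r" "r < s + (t - s)" using ex[of "t - s"] t by auto
 then show False using t(2)[of r] no by (cases "r = s") (auto simp: zeros_def)
qed

lemma hit0_attained:
 assumes w: "w \<in> paths" and fin: "hit0 w < top"
 shows "enn2real (hit0 w) \<in> zeros w"
proof (rule zeros_right_closed[OF w])
 fix e :: real assume e: "0 < e"
 have "hit0 w < ennreal (enn2real (hit0 w) + e)"
  using e fin by (cases "hit0 w") (auto intro: ennreal_lessI)
 then obtain r where r: "r \<in> zeros w" "ennreal r < ennreal (enn2real (hit0 w) + e)"
  unfolding hit0_def Inf_less_iff by auto
 have "hit0 w <= ennreal r" unfolding hit0_def using r by (auto intro: Inf_lower)
 then have "enn2real (hit0 w) <= r"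
  using r(1) by (intro enn2real_leI) (auto simp: zeros_def)
 moreover have "r < enn2real (hit0 w) + e"
  using r by (simp add: zeros_def ennreal_less_iff)
 ultimately show "\<exists>r\<in>zeros w. enn2real (hit0 w) <= r & r < enn2real (hit0 w) + e" using r(1) by blast
qed simp

lemma hit0_le_iff:
 assumes w: "w \<in> paths"
 shows "hit0 w <= t & hit0 w < top \<longleftrightarrow> (\<exists>s\<in>zeros w. ennreal s <= t)"
proof
 assume *: "hit0 w <= t & hit0 w < top"
 then show "\<exists>s\<in>zeros w. ennreal s <= t"
  using hit0_attained[OF w] by (intro bexI[of _ "enn2real (hit0 w)"]) auto
next
 assume "\<exists>s\<in>zeros w. ennreal s <= t"
 then obtain s where s: "s \<in> zeros w" "ennreal s <= t" by blast
 have "hit0 w <= ennreal s" unfolding hit0_def using s by (auto intro: Inf_lower)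
 then show "hit0 w <= t & hit0 w < top" using s(2) by (auto intro: le_less_trans[OF _ ennreal_less_top])
qed

lemma zeros_shift: "0 <= r ==> zeros (shift r w) = {s. 0 <= s & r + s \<in> zeros w}"
 by (auto simp: zeros_def shift_def)

lemma hit0_shift_le_iff:
 assumes w: "w \<in> paths" and r: "0 <= r"
 shows "ennreal r + hit0 (shift r w) <= t & hit0 (shift r w) < top \<longleftrightarrow> (\<exists>s\<in>zeros w. r <= s & ennreal s <= t)"
proof
 assume *: "ennreal r + hit0 (shift r w) <= t & hit0 (shift r w) < top"
 let ?s = "enn2real (hit0 (shift r w))"
 have "?s \<in> zeros (shift r w)" using * hit0_attained[OF shift_paths[OF r w]] by blast
 then have "r + ?s \<in> zeros w" using zeros_shift[OF r] by auto
 moreover have "ennreal (r + ?s) <= t" using * r by (simp add: ennreal_plus)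
 ultimately show "\<exists>s\<in>zeros w. r <= s & ennreal s <= t" by (intro bexI[of _ "r + ?s"]) auto
next
 assume "\<exists>s\<in>zeros w. r <= s & ennreal s <= t"
 then obtain s where s: "s \<in> zeros w" "r <= s" "ennreal s <= t" by blast
 then have "s - r \<in> zeros (shift r w)" using zeros_shift[OF r] by auto
 then have le: "hit0 (shift r w) <= ennreal (s - r)" unfolding hit0_def by (auto intro: Inf_lower)
 have "ennreal r + hit0 (shift r w) <= ennreal r + ennreal (s - r)" using le by (rule add_left_mono)
 also have "... = ennreal s" using s(2) r by (simp flip: ennreal_plus)
 finally show "ennreal r + hit0 (shift r w) <= t & hit0 (shift r w) < top"
  using s(3) le by (auto intro: le_less_trans[OF _ ennreal_less_top])
qed

text \<open>The set of paths is the projection of a measurable set of pairs of a path and a time in \<open>[0,t]\<close>.\<close>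

lemma zero_before_measurable:
 assumes t: "0 <= t"
 shows "{w \<in> paths. \<exists>s\<in>zeros w. s <= t} \<in> sets (ucompl path_space)"
proof -
 let ?B = "{z \<in> paths \<times> UNIV. 0 <= snd z & fst z (snd z) \<in> Some ` {0}} Int (paths \<times> {0..t})"
 have paths: "paths \<in> sets path_space"
  using sets.top[of path_space] by simp
 have "?B \<in> sets (path_space \<Otimes>\<^sub>M borel)"
  by (rule sets.Int[OF measurable_coordinate_pair pair_measureI[OF paths]]) simp_all
 then have "fst ` ?B \<in> sets (ucompl path_space)"
  by (rule measurable_projection[OF compact_Icc[of 0 t]]) auto
 moreover have "fst ` ?B = {w \<in> paths. \<exists>s\<in>zeros w. s <= t}"
  by (force simp: zeros_def image_iff)
 ultimately show ?thesis by simp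
qed

lemma measurable_hit0: "hit0 \<in> bm (ucompl path_space)"
proof (rule borel_measurableI_le)
 fix y :: ennreal
 show "{w \<in> space (ucompl path_space). hit0 w <= y} \<in> sets (ucompl path_space)"
 proof (cases y)
  case (real t)
  have "{w \<in> space (ucompl path_space). hit0 w <= y} = {w \<in> paths. \<exists>s\<in>zeros w. s <= t}"
   using hit0_le_iff[of _ y] real
   by (auto simp: ennreal_le_iff intro: le_less_trans[OF _ ennreal_less_top])
  then show ?thesis using zero_before_measurable[OF real(1)] by simp
 next
  case top
  then show ?thesis using sets.top[of "ucompl path_space"] by simp
 qed
qed

text \<open>The last zero up to \<open>t\<close> is at most \<open>r\<close> if there is a zero up to \<open>t\<close> but none in \<open>[r + 1/n, t]\<close>; both are statements on
first zeros, of the path and of its shifts.\<close>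

lemma last_zero_le_iff:
 assumes w: "w \<in> paths" and r: "0 <= r"
 shows "last_zero t w <= ennreal r \<longleftrightarrow> hit0 w <= t & hit0 w < top &
  ~ (\<exists>n. ennreal (r + 1 / Suc n) + hit0 (shift (r + 1 / Suc n) w) <= t & hit0 (shift (r + 1 / Suc n) w) < top)"
proof -
 have "(\<exists>n. ennreal (r + 1 / Suc n) + hit0 (shift (r + 1 / Suc n) w) <= t & hit0 (shift (r + 1 / Suc n) w) < top)
   \<longleftrightarrow> (\<exists>n. \<exists>s\<in>zeros w. r + 1 / Suc n <= s & ennreal s <= t)"
  using hit0_shift_le_iff[OF w, of "r + 1 / Suc n" t for n] r by simp
 also have "... \<longleftrightarrow> (\<exists>s\<in>zeros w. r < s & ennreal s <= t)"
 proof
  assume "\<exists>n. \<exists>s\<in>zeros w. r + 1 / Suc n <= s & ennreal s <= t"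
  then obtain n s where s: "s \<in> zeros w" "r + 1 / Suc n <= s" "ennreal s <= t" by blast
  have "0 < 1 / real (Suc n)" by simp
  then have "r < s" using s(2) by linarith
  then show "\<exists>s\<in>zeros w. r < s & ennreal s <= t" using s by blast
 next
  assume "\<exists>s\<in>zeros w. r < s & ennreal s <= t"
  then obtain s where s: "s \<in> zeros w" "r < s" "ennreal s <= t" by blast
  then obtain n where "1 / Suc n < s - r" by (meson diff_gt_0_iff_gt nat_approx_posE)
  then show "\<exists>n. \<exists>s\<in>zeros w. r + 1 / Suc n <= s & ennreal s <= t"
   using s by (intro exI[of _ n] bexI[of _ s]) auto
 qed
 finally have *: "(\<exists>n. ennreal (r + 1 / Suc n) + hit0 (shift (r + 1 / Suc n) w) <= t & hit0 (shift (r + 1 / Suc n) w) < top)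
   \<longleftrightarrow> (\<exists>s\<in>zeros w. r < s & ennreal s <= t)" .
 let ?Z = "{s \<in> zeros w. ennreal s <= t}"
 have ne: "?Z ~= {} \<longleftrightarrow> hit0 w <= t & hit0 w < top" using hit0_le_iff[OF w, of t] by blast
 have "Sup (ennreal ` ?Z) <= ennreal r \<longleftrightarrow> (\<forall>s\<in>?Z. s <= r)"
  using r by (simp add: Sup_le_iff ennreal_le_iff)
 also have "... \<longleftrightarrow> ~ (\<exists>s\<in>zeros w. r < s & ennreal s <= t)"
  by (auto simp: not_less[symmetric])
 finally have "Sup (ennreal ` ?Z) <= ennreal r \<longleftrightarrow> ~ (\<exists>s\<in>zeros w. r < s & ennreal s <= t)" .
 then show ?thesis unfolding * using ne
  by (auto simp: last_zero_def Let_def top_unique)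
qed

lemma measurable_hit0_shift:
 assumes "0 <= r" shows "(%w. hit0 (shift r w)) \<in> bm (ucompl path_space)"
proof -
 have "shift r \<in> path_space \<rightarrow>\<^sub>M path_space"
  using measurable_shift[of "%w. w" path_space "%_. r"] assms by simp
 then have "shift r \<in> ucompl path_space \<rightarrow>\<^sub>M ucompl path_space"
  by (intro measurable_ucompl_lift measurable_ucomplI)
 from measurable_compose[OF this measurable_hit0] show ?thesis .
qed

lemma measurable_last_zero:
 "(%z. last_zero (snd z) (fst z)) \<in> bm (ucompl path_space \<Otimes>\<^sub>M borel)"
proof (rule borel_measurableI_le)
 fix y :: ennreal
 let ?M = "ucompl path_space \<Otimes>\<^sub>M (borel :: ennreal measure)"
 show "{z \<in> space ?M. last_zero (snd z) (fst z) <= y} \<in> sets ?M"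
 proof (cases y)
  case (real r)
  have [measurable]: "(%z. hit0 (fst z)) \<in> bm ?M"
   by (rule measurable_compose[OF measurable_fst measurable_hit0])
  have [measurable]: "(%z. hit0 (shift (r + 1 / Suc n) (fst z))) \<in> bm ?M" for n
   using real by (intro measurable_compose[OF measurable_fst measurable_hit0_shift]) auto
  have "{z \<in> space ?M. last_zero (snd z) (fst z) <= y} = {z \<in> space ?M. hit0 (fst z) <= snd z & hit0 (fst z) < top &
   ~ (\<exists>n. ennreal (r + 1 / Suc n) + hit0 (shift (r + 1 / Suc n) (fst z)) <= snd z & hit0 (shift (r + 1 / Suc n) (fst z)) < top)}"
   using last_zero_le_iff[OF _ real(1)] unfolding real(2)
   by (intro Collect_cong conj_cong refl) (simp add: space_pair_measure mem_Times_iff)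
  also have "... \<in> sets ?M" by measurable
  finally show ?thesis .
 next
  case top
  then show ?thesis using sets.top[of ?M] by simp
 qed
qed

lemma measurable_last_zero_comp:
 assumes "W \<in> M \<rightarrow>\<^sub>M ucompl path_space" "\<tau> \<in> bm M"
 shows "(%x. last_zero (\<tau> x) (W x)) \<in> bm M"
 using measurable_compose[OF measurable_Pair[OF assms] measurable_last_zero] by simp

lemma zeros_stop:
 assumes "0 <= t" shows "{s \<in> zeros (stop t w). s <= t} = {s \<in> zeros w. s <= t}"
 using assms by (auto simp: zeros_def stop_def)

lemma last_zero_stop: "0 <= t ==> last_zero (ennreal t) (stop t w) = last_zero (ennreal t) w"
 using zeros_stop[of t w] by (simp add: last_zero_def)

lemma hit0_nat_filt:
 assumes t: "0 <= t" shows "{w \<in> paths. hit0 w <= ennreal t} \<in> sets (ucompl (filt t))"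
proof -
 have eq: "hit0 w <= ennreal t \<longleftrightarrow> (\<exists>s\<in>zeros w. s <= t)" if "w \<in> paths" for w
  using hit0_le_iff[OF that, of "ennreal t"] t
  by (auto intro: le_less_trans[OF _ ennreal_less_top] simp: ennreal_le_iff)
 have "Measurable.pred (ucompl path_space) (%w. hit0 w <= ennreal t)"
  using measurable_hit0 by measurable
 then have "Measurable.pred (ucompl (filt t)) (%w. hit0 w <= ennreal t)"
 proof (rule ucompl_nat_filt_stop[OF t])
  fix w assume "w \<in> paths"
  then show "(hit0 (stop t w) <= ennreal t) = (hit0 w <= ennreal t)"
   using zeros_stop[OF t, of w] by (subst (1 2) eq) (auto simp: stop_paths t)
 qed
 then show ?thesis by (simp add: pred_def)
qed

section \<open>Integration against kernels and exponential times\<close>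

lemma AE_kernel_of_bind:
 assumes K: "K \<in> R \<rightarrow>\<^sub>M subprob_algebra M" and ne: "space R ~= {}"
  and ae: "AE x in R \<bind> K. Q x"
 shows "AE y in R. AE x in K y. Q x"
proof -
 have sets: "sets (R \<bind> K) = sets M"
  using sets_bind[of R K M] ne sets_kernel[OF K] by auto
 obtain Z where Z: "Z \<in> sets M" "emeasure (R \<bind> K) Z = 0" "{x \<in> space M. ~ Q x} \<subseteq> Z"
  using ae sets sets_eq_imp_space_eq[OF sets] by (auto elim!: AE_E)
 have "(NN y. emeasure (K y) Z \<partial>R) = 0"
  using Z by (simp add: emeasure_bind[OF ne K])
 then have "AE y in R. emeasure (K y) Z = 0"
  using Z(1) K by (subst (asm) nn_integral_0_iff_AE) auto
 with AE_space show ?thesis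
 proof eventually_elim
  fix y assume y: "y \<in> space R" "emeasure (K y) Z = 0"
  have Ky: "sets (K y) = sets M" using sets_kernel[OF K y(1)] .
  show "AE x in K y. Q x"
  proof (rule AE_I')
   show "Z \<in> null_sets (K y)" using y(2) Z(1) Ky by (auto simp: null_sets_def)
   show "{x \<in> space (K y). ~ Q x} \<subseteq> Z"
    using Z(3) sets_eq_imp_space_eq[OF Ky] by simp
  qed
 qed
qed

lemma exp_law_eq: "exp_law q = density lborel (exponential_density q)"
 unfolding exp_law_def by simp

lemma sets_exp_law [simp, measurable_cong]: "sets (exp_law q) = sets borel"
 and space_exp_law [simp]: "space (exp_law q) = UNIV"
 unfolding exp_law_def by simp_all

lemma prob_space_exp_law: "0 < q ==> prob_space (exp_law q)"
 unfolding exp_law_eq by (rule prob_space_exponential_density)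

lemma measurable_exponential_density [measurable]: "exponential_density q \<in> bm borel"
 by simp

lemma nn_integral_exp_law:
 "f \<in> bm borel ==>
   (NN s. f s \<partial>exp_law q) = (NN s. ennreal (exponential_density q s) * f s \<partial>lborel)"
 unfolding exp_law_def by (rule nn_integral_density) measurable

lemma AE_exp_law_nonneg: "AE s in exp_law q. 0 <= s"
 unfolding exp_law_def
 by (subst AE_density) (auto simp: exponential_density_def)

lemma nn_integral_exp_law_shift:
 assumes f: "f \<in> bm borel" and r: "0 <= r" and q: "0 < q"
 shows "(NN s. ind {r..} s * f s \<partial>exp_law q) = ennreal (exp (- q * r)) * (NN s. f (r + s) \<partial>exp_law q)"
proof -
 have [measurable]: "f \<in> bm borel" by fact
 have "(NN s. ind {r..} s * f s \<partial>exp_law q)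
   = (NN s. ennreal (exponential_density q s) * (ind {r..} s * f s) \<partial>lborel)"
  by (rule nn_integral_exp_law) measurable
 also have "... = (NN s. ennreal (exponential_density q (r + s)) * (ind {r..} (r + s) * f (r + s)) \<partial>lborel)"
  using nn_integral_real_affine[of "%s. ennreal (exponential_density q s) * (ind {r..} s * f s)" 1 r]
  by (simp add: add.commute)
 also have "... = (NN s. ennreal (exp (- q * r)) * (ennreal (exponential_density q s) * f (r + s)) \<partial>lborel)"
 proof (rule nn_integral_cong)
  fix s :: real
  show "ennreal (exponential_density q (r + s)) * (ind {r..} (r + s) * f (r + s)) =
    ennreal (exp (- q * r)) * (ennreal (exponential_density q s) * f (r + s))"
  proof (cases "s < 0")
   case False
   have "exponential_density q (r + s) = exp (- q * r) * exponential_density q s"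
    using False r by (simp add: exponential_density_def exp_add[symmetric] algebra_simps)
   then show ?thesis using False q
    by (simp add: ennreal_mult mult.assoc exponential_density_def)
  qed (simp add: exponential_density_def)
 qed
 also have "... = ennreal (exp (- q * r)) * (NN s. ennreal (exponential_density q s) * f (r + s) \<partial>lborel)"
  by (rule nn_integral_cmult) measurable
 also have "... = ennreal (exp (- q * r)) * (NN s. f (r + s) \<partial>exp_law q)"
  by (subst nn_integral_exp_law) auto
 finally show ?thesis .
qed

definition exp_ennreal :: "real => ennreal => ennreal" where
 "exp_ennreal q t = (if t = top then 0 else ennreal (exp (- q * enn2real t)))"

lemma exp_law_tail:
 assumes q: "0 < q" shows "(NN s. ind {s. t <= ennreal s} s \<partial>exp_law q) = exp_ennreal q t"
proof (cases t)
 case (real r)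
 interpret prob_space "exp_law q" by (rule prob_space_exp_law[OF q])
 have "AE s in exp_law q. ind {s. t <= ennreal s} s = (ind {r..} s * 1 :: ennreal)"
  using AE_exp_law_nonneg
 proof eventually_elim
  case (elim s)
  then show ?case using real by (simp add: indicator_def ennreal_le_iff)
 qed
 then have "(NN s. ind {s. t <= ennreal s} s \<partial>exp_law q) = (NN s. ind {r..} s * 1 \<partial>exp_law q)"
  by (rule nn_integral_cong_AE)
 also have "... = ennreal (exp (- q * r)) * (NN s. 1 \<partial>exp_law q)"
  using real q by (intro nn_integral_exp_law_shift) auto
 also have "... = exp_ennreal q t" using real emeasure_space_1 by (simp add: exp_ennreal_def)
 finally show ?thesis .
qed (simp add: exp_ennreal_def top_unique)

lemma measurable_exp_ennreal [measurable]: "exp_ennreal q \<in> bm borel"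
 unfolding exp_ennreal_def by measurable

section \<open>Markov property for universally measurable functionals\<close>

context nice_markov_process
begin

abbreviation cP :: "real => path measure" where "cP x \<equiv> completion (P x)"

abbreviation hqq :: "real => real => real" where "hqq \<equiv> hq P \<beta> \<eta>"

abbreviation hl :: "real => real" where "hl \<equiv> hlim P \<beta> \<eta>"

lemma P_in: "P x \<in> space (prob_algebra path_space)"
 using measurable_space[OF kernel, of x] by simp

lemma prob_P: "prob_space (P x)" and sets_P [simp, measurable_cong]: "sets (P x) = sets path_space"
 using P_in[of x] by (simp_all add: space_prob_algebra)

lemma kernel': "P \<in> borel \<rightarrow>\<^sub>M subprob_algebra path_space"
 by (rule measurable_prob_algebraD[OF kernel])

lemma finite_P: "finite_measure (P x)"
 using prob_P[of x] by (simp add: prob_space_def)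

lemma prob_cP: "prob_space (cP x)"
proof (rule prob_spaceI)
 have "paths \<in> sets (P x)" using sets.top[of "P x"] by simp
 then show "emeasure (cP x) (space (cP x)) = 1"
  using prob_space.emeasure_space_1[OF prob_P[of x]] by simp
qed

lemma init_law_in: "\<mu> \<in> space (prob_algebra borel) ==> init_law P \<mu> \<in> space (prob_algebra path_space)"
 unfolding init_law_def using prob_space_bind'[OF _ kernel] sets_bind'[OF _ kernel]
 by (simp add: space_prob_algebra)

lemma sets_init_law: "\<mu> \<in> space (prob_algebra borel) ==> sets (init_law P \<mu>) = sets path_space"
 using init_law_in by (simp add: space_prob_algebra)

lemma ucompl_completion: "f \<in> ucompl path_space \<rightarrow>\<^sub>M N ==> f \<in> cP x \<rightarrow>\<^sub>M N"
 by (rule measurable_ucompl_completion) (simp_all add: finite_P)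

text \<open>The filtration of the process tests a set against the completion of each initial law, and universal measurability passes all tests.\<close>

lemma usual_filtI:
 assumes A: "A \<in> sets (ucompl (nat_filt t))" shows "A \<in> sets (usual_filt P t)"
 unfolding usual_filt_def sets_measure_of[OF usual_filt_generator]
proof (rule sigma_sets.Basic, intro CollectI ballI allI impI)
 fix \<mu> s assume \<mu>: "\<mu> \<in> space (prob_algebra (borel :: real measure))" and s: "t < s \<or> s = top"
 then have "t <= s" by auto
 then have A': "A \<in> sets (ucompl (nat_filt s))" using A ucompl_nat_filt_mono by blast
 have sub: "subalgebra (init_law P \<mu>) (nat_filt s)"
  using sets_init_law[OF \<mu>] sets_eq_imp_space_eq[OF sets_init_law[OF \<mu>]] sets_nat_filt_mono[of s top]
  by (simp add: subalgebra_def)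
 have "prob_space (init_law P \<mu>)" using init_law_in[OF \<mu>] by (simp add: space_prob_algebra)
 then have "finite_measure (restr_to_subalg (init_law P \<mu>) (nat_filt s))"
  using prob_space_restr_to_subalg[OF sub] by (simp add: prob_space_def)
 then show "A \<in> sets (completion (restr_to_subalg (init_law P \<mu>) (nat_filt s)))"
  using A' sets_restr_to_subalg[OF sub] unfolding sets_ucompl by blast
qed

lemma space_usual_filt: "space (usual_filt P t) = paths"
 using filtration.space_F[OF filtration_usual_filt] .

lemma stopping_time_hit0: "stopping_time (usual_filt P) hit0"
proof
 fix t
 show "Measurable.pred (usual_filt P t) (%w. hit0 w <= t)"
 proof (cases t)
  case (real r)
  then show ?thesis
   using usual_filtI[OF hit0_nat_filt[OF real(1)]] by (simp add: pred_def space_usual_filt)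
 qed simp
qed

lemma return_in: "return borel x \<in> space (prob_algebra (borel :: real measure))"
 by (simp add: space_prob_algebra prob_space_return)

lemma markov_sets:
 assumes r: "0 <= r" and A: "A \<in> sets (filt r)" and B: "B \<in> sets path_space"
 shows "emeasure (P x) {w \<in> A. shift r w \<in> B} = (NN w. ind A w * emeasure (P (pos r w)) B \<partial>P x)"
proof -
 let ?T = "%_::path. ennreal r"
 have st: "stopping_time (usual_filt P) ?T" by (rule stopping_time_const)
 have "A \<in> sets (filtration.pre_sigma paths (usual_filt P) ?T)"
 proof (rule filtration.sets_pre_sigmaI[OF filtration_usual_filt st])
  fix t
  show "{w \<in> A. ennreal r <= t} \<in> sets (usual_filt P t)"
  proof (cases "ennreal r <= t")
   case True
   then have "A \<in> sets (nat_filt t)" using A sets_nat_filt_mono by blast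
   then show ?thesis using True by (auto intro: usual_filtI)
  qed simp
 qed
 from strong_markov[OF return_in[of x] st this B] r
 have "emeasure (cP x) {w \<in> A. shift r w \<in> B} = (NN w. ind A w * emeasure (P (pos r w)) B \<partial>P x)"
  by simp
 moreover have "{w \<in> A. shift r w \<in> B} \<in> sets (P x)"
 proof -
  have "shift r \<in> path_space \<rightarrow>\<^sub>M path_space"
   using measurable_shift[of "%w. w" path_space "%_. r"] r by simp
  from measurable_sets[OF this B] have "shift r -` B Int paths \<in> sets path_space" by simp
  moreover have "A \<in> sets path_space" using A sets_nat_filt_mono[of "ennreal r" top] by auto
  moreover have "{w \<in> A. shift r w \<in> B} = A Int (shift r -` B Int paths)"
   using sets.sets_into_space[OF \<open>A \<in> sets path_space\<close>] by auto
  ultimately show ?thesis by simp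
 qed
 ultimately show ?thesis by simp
qed

lemma measurable_shift_const: "0 <= r ==> shift r \<in> path_space \<rightarrow>\<^sub>M path_space"
 using measurable_shift[of "%w. w" path_space "%_. r"] by simp

lemma measurable_pos_P: "0 <= r ==> pos r \<in> bm (P x)"
 using measurable_pos[of r top] by (simp cong: measurable_cong_sets)

text \<open>The law at time \<open>r\<close> serves as initial law of the shifted path, so that almost sure properties transfer to it.\<close>

definition law_at :: "real => real => real measure" where
 "law_at r x = distr (P x) borel (pos r)"

lemma law_at_in: "0 <= r ==> law_at r x \<in> space (prob_algebra borel)"
 unfolding law_at_def space_prob_algebra
 using prob_space.prob_space_distr[OF prob_P measurable_pos_P] by simp

lemma emeasure_init_law_at:
 assumes r: "0 <= r" and B: "B \<in> sets path_space"
 shows "emeasure (init_law P (law_at r x)) B = (NN w. emeasure (P (pos r w)) B \<partial>P x)"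
proof -
 have "emeasure (init_law P (law_at r x)) B = (NN y. emeasure (P y) B \<partial>law_at r x)"
  unfolding init_law_def by (rule emeasure_bind_prob_algebra[OF law_at_in[OF r] kernel B])
 also have "... = (NN w. emeasure (P (pos r w)) B \<partial>P x)"
  unfolding law_at_def
  by (rule nn_integral_distr[OF measurable_pos_P[OF r]])
    (use measurable_emeasure_kernel[OF kernel' B] in simp)
 finally show ?thesis .
qed

lemma distr_shift: "0 <= r ==> distr (P x) path_space (shift r) = init_law P (law_at r x)"
proof (rule measure_eqI)
 assume r: "0 <= r"
 show "sets (distr (P x) path_space (shift r)) = sets (init_law P (law_at r x))"
  using sets_init_law[OF law_at_in[OF r]] by simp
 fix B assume "B \<in> sets (distr (P x) path_space (shift r))"
 then have B: "B \<in> sets path_space" by simp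
 have "emeasure (distr (P x) path_space (shift r)) B = emeasure (P x) (shift r -` B Int space (P x))"
  using measurable_shift_const[OF r] B by (intro emeasure_distr) (simp_all cong: measurable_cong_sets)
 also have "shift r -` B Int space (P x) = {w \<in> paths. shift r w \<in> B}" by auto
 also have "emeasure (P x) ... = (NN w. ind paths w * emeasure (P (pos r w)) B \<partial>P x)"
  using sets.top[of "filt r"] by (intro markov_sets[OF r _ B]) simp
 also have "... = (NN w. emeasure (P (pos r w)) B \<partial>P x)"
  by (rule nn_integral_cong) simp
 finally show "emeasure (distr (P x) path_space (shift r)) B = emeasure (init_law P (law_at r x)) B"
  using emeasure_init_law_at[OF r B] by simp
qed

lemma markov_AE:
 assumes r: "0 <= r" and ae: "AE w in init_law P (law_at r x). Q w"
 shows "AE w in P x. Q (shift r w)" and "AE w in P x. AE w' in P (pos r w). Q w'"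
proof -
 have s: "shift r \<in> P x \<rightarrow>\<^sub>M path_space"
  using measurable_shift_const[OF r] by (simp cong: measurable_cong_sets)
 show "AE w in P x. Q (shift r w)"
  using ae unfolding distr_shift[OF r, symmetric] by (rule AE_distrD[OF s])
 have "AE y in law_at r x. AE w' in P y. Q w'"
  by (rule AE_kernel_of_bind[OF _ _ ae[unfolded init_law_def]])
    (use kernel' in "simp_all add: law_at_def cong: measurable_cong_sets")
 then show "AE w in P x. AE w' in P (pos r w). Q w'"
  unfolding law_at_def by (rule AE_distrD[OF measurable_pos_P[OF r]])
qed

lemma markov_integral_borel:
 assumes r: "0 <= r" and A: "A \<in> sets (filt r)" and Y: "Y \<in> bm path_space"
 shows "(NN w. ind A w * Y (shift r w) \<partial>P x)
      = (NN w. ind A w * (\<integral>\<^sup>+w'. Y w' \<partial>P (pos r w)) \<partial>P x)"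
proof -
 let ?D = "density (P x) (ind A)"
 have AM: "A \<in> sets path_space" using A sets_nat_filt_mono[of "ennreal r" top] by auto
 have s: "shift r \<in> P x \<rightarrow>\<^sub>M path_space"
  using measurable_shift_const[OF r] by (simp cong: measurable_cong_sets)
 have p: "pos r \<in> bm (P x)" by (rule measurable_pos_P[OF r])
 have indm: "ind A \<in> bm (P x)" using AM by simp
 have K: "P \<in> distr ?D borel (pos r) \<rightarrow>\<^sub>M subprob_algebra path_space"
  using kernel' by (simp cong: measurable_cong_sets)
 have eq: "distr ?D path_space (shift r) = distr ?D borel (pos r) \<bind> P"
 proof (rule measure_eqI)
  show "sets (distr ?D path_space (shift r)) = sets (distr ?D borel (pos r) \<bind> P)"
   by (subst sets_bind[where N = path_space]) auto
  fix B assume "B \<in> sets (distr ?D path_space (shift r))"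
  then have B: "B \<in> sets path_space" by simp
  have sB: "shift r -` B Int space (P x) \<in> sets (P x)" by (rule measurable_sets[OF s B])
  have "emeasure (distr ?D path_space (shift r)) B = emeasure ?D (shift r -` B Int space ?D)"
   using s B by (intro emeasure_distr) (simp_all cong: measurable_cong_sets)
  also have "... = (NN w. ind A w * ind (shift r -` B Int space (P x)) w \<partial>P x)"
   using emeasure_density[OF indm sB] by (simp only: space_density)
  also have "... = (NN w. ind {w \<in> A. shift r w \<in> B} w \<partial>P x)"
   by (rule nn_integral_cong) (auto simp: indicator_def)
  also have "... = emeasure (P x) {w \<in> A. shift r w \<in> B}"
  proof (rule nn_integral_indicator)
   have "{w \<in> A. shift r w \<in> B} = A Int (shift r -` B Int space (P x))"
    using sets.sets_into_space[OF AM] by auto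
   then show "{w \<in> A. shift r w \<in> B} \<in> sets (P x)" using AM sB by simp
  qed
  also have "... = (NN w. ind A w * emeasure (P (pos r w)) B \<partial>P x)"
   by (rule markov_sets[OF r A B])
  also have "... = (NN w. emeasure (P (pos r w)) B \<partial>?D)"
  proof (rule nn_integral_density[symmetric, OF indm])
   show "(%w. emeasure (P (pos r w)) B) \<in> bm (P x)"
    by (rule measurable_compose[OF p measurable_emeasure_kernel[OF kernel' B]])
  qed
  also have "... = (NN y. emeasure (P y) B \<partial>distr ?D borel (pos r))"
  proof (rule nn_integral_distr[symmetric])
   show "pos r \<in> bm ?D" using p by simp
   show "(%y. emeasure (P y) B) \<in> bm (distr ?D borel (pos r))"
    using measurable_emeasure_kernel[OF kernel' B] by simp
  qed
  also have "... = emeasure (distr ?D borel (pos r) \<bind> P) B"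
   by (rule emeasure_bind[symmetric, OF _ K B]) simp
  finally show "emeasure (distr ?D path_space (shift r)) B = emeasure (distr ?D borel (pos r) \<bind> P) B" .
 qed
 have Yk: "(%y. \<integral>\<^sup>+w'. Y w' \<partial>P y) \<in> bm borel"
  by (rule measurable_compose[OF kernel' nn_integral_measurable_subprob_algebra[OF Y]])
 have "(NN w. ind A w * Y (shift r w) \<partial>P x) = (NN w. Y (shift r w) \<partial>?D)"
  by (rule nn_integral_density[symmetric, OF indm]) (rule measurable_compose[OF s Y])
 also have "... = (NN w. Y w \<partial>distr ?D path_space (shift r))"
  using s Y by (intro nn_integral_distr[symmetric]) simp_all
 also have "... = (NN y. \<integral>\<^sup>+w'. Y w' \<partial>P y \<partial>distr ?D borel (pos r))"
  unfolding eq by (rule nn_integral_bind[OF Y K])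
 also have "... = (NN w. \<integral>\<^sup>+w'. Y w' \<partial>P (pos r w) \<partial>?D)"
  using p Yk by (intro nn_integral_distr) simp_all
 also have "... = (NN w. ind A w * (\<integral>\<^sup>+w'. Y w' \<partial>P (pos r w)) \<partial>P x)"
  by (rule nn_integral_density[OF indm]) (rule measurable_compose[OF p Yk])
 finally show ?thesis .
qed

lemma markov_integral:
 assumes r: "0 <= r" and A: "A \<in> sets (filt r)"
  and Y: "Y \<in> bm (completion (init_law P (law_at r x)))"
 shows "(NN w. ind A w * Y (shift r w) \<partial>P x)
      = (NN w. ind A w * (\<integral>\<^sup>+w'. Y w' \<partial>P (pos r w)) \<partial>P x)"
proof -
 from completion_ex_borel_measurable[OF Y]
 obtain Y' where Y': "Y' \<in> bm path_space" "AE w in init_law P (law_at r x). Y w = Y' w"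
  using measurable_cong_sets[OF sets_init_law[OF law_at_in[OF r, of x]] refl, of borel] by blast
 have "(NN w. ind A w * Y (shift r w) \<partial>P x) = (NN w. ind A w * Y' (shift r w) \<partial>P x)"
  using markov_AE(1)[OF r Y'(2)] by (intro nn_integral_cong_AE) auto
 also have "... = (NN w. ind A w * (\<integral>\<^sup>+w'. Y' w' \<partial>P (pos r w)) \<partial>P x)"
  by (rule markov_integral_borel[OF r A Y'(1)])
 also have "... = (NN w. ind A w * (\<integral>\<^sup>+w'. Y w' \<partial>P (pos r w)) \<partial>P x)"
 proof (rule nn_integral_cong_AE, use markov_AE(2)[OF r Y'(2)] in eventually_elim)
  fix w assume "AE w' in P (pos r w). Y w' = Y' w'"
  then have "(\<integral>\<^sup>+w'. Y' w' \<partial>P (pos r w)) = (\<integral>\<^sup>+w'. Y w' \<partial>P (pos r w))"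
   by (intro nn_integral_cong_AE) auto
  then show "ind A w * (\<integral>\<^sup>+w'. Y' w' \<partial>P (pos r w)) = ind A w * (\<integral>\<^sup>+w'. Y w' \<partial>P (pos r w))"
   by simp
 qed
 finally show ?thesis .
qed

definition post_hit :: "path => path" where
 "post_hit w = shift (enn2real (hit0 w)) w"

lemma measurable_post_hit: "post_hit \<in> ucompl path_space \<rightarrow>\<^sub>M path_space"
 unfolding post_hit_def
proof (rule measurable_shift)
 show "(%w. w) \<in> ucompl path_space \<rightarrow>\<^sub>M path_space"
  by (rule measurable_ucomplI) simp
 show "(%w. enn2real (hit0 w)) \<in> bm (ucompl path_space)"
  using measurable_hit0 by measurable
qed simp

text \<open>At its first zero the path restarts with law \<open>P 0\<close>, independently of the value of that time.\<close>

lemma strong_markov_sets: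
 assumes B: "B \<in> sets path_space"
 shows "emeasure (cP x) {w \<in> paths. hit0 w <= ennreal c & post_hit w \<in> B}
      = emeasure (cP x) {w \<in> paths. hit0 w <= ennreal c} * emeasure (P 0) B"
proof -
 let ?A = "{w \<in> paths. hit0 w <= ennreal c}"
 have pred: "{w \<in> ?A. hit0 w <= t} \<in> sets (usual_filt P t)" for t
 proof -
  have "{w \<in> ?A. hit0 w <= t} = {w \<in> space (usual_filt P (min t (ennreal c))). hit0 w <= min t (ennreal c)}"
   by (auto simp: space_usual_filt)
  also have "... \<in> sets (usual_filt P (min t (ennreal c)))"
   using stopping_timeD[OF stopping_time_hit0] unfolding pred_def by blast
  finally show ?thesis
   using filtration.sets_F_mono[OF filtration_usual_filt, of "min t (ennreal c)" t] by auto
 qed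
 have A: "?A \<in> sets (filtration.pre_sigma paths (usual_filt P) hit0)"
  by (rule filtration.sets_pre_sigmaI[OF filtration_usual_filt stopping_time_hit0 pred])
 have lt: "w \<in> ?A ==> hit0 w < top" for w by (auto intro: le_less_trans[OF _ ennreal_less_top])
 have A': "?A \<in> sets (cP x)"
 proof -
  have "Measurable.pred (cP x) (%w. hit0 w <= ennreal c)"
   using ucompl_completion[OF measurable_hit0] by measurable
  then show ?thesis by (simp add: pred_def)
 qed
 have "emeasure (cP x) {w \<in> paths. hit0 w <= ennreal c & post_hit w \<in> B} =
   emeasure (cP x) {w \<in> ?A. hit0 w < top & shift (enn2real (hit0 w)) w \<in> B}"
  using lt by (intro arg_cong2[where f = emeasure]) (auto simp: post_hit_def)
 also have "... = (NN w. ind {w \<in> ?A. hit0 w < top} w * emeasure (P (pos (enn2real (hit0 w)) w)) B \<partial>P x)"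
  using strong_markov[OF return_in[of x] stopping_time_hit0 A B] by simp
 also have "... = (NN w. ind ?A w * emeasure (P 0) B \<partial>P x)"
 proof (rule nn_integral_cong)
  fix w show "ind {w \<in> ?A. hit0 w < top} w * emeasure (P (pos (enn2real (hit0 w)) w)) B =
    ind ?A w * emeasure (P 0) B"
   using lt[of w] hit0_attained[of w] by (auto simp: indicator_def zeros_def)
 qed
 also have "... = (NN w. ind ?A w * emeasure (P 0) B \<partial>cP x)"
  by (rule nn_integral_completion[symmetric])
 also have "... = emeasure (cP x) ?A * emeasure (P 0) B"
  using A' by (simp add: nn_integral_multc)
 finally show ?thesis .
qed

lemma strong_markov_AE:
 assumes ae: "AE w in P 0. Q w"
 shows "AE w in P x. hit0 w < top --> Q (post_hit w)"
proof -
 obtain N where N: "N \<in> sets path_space" "emeasure (P 0) N = 0" "{w \<in> paths. ~ Q w} \<subseteq> N"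
  using ae by (auto elim!: AE_E)
 have th: "post_hit \<in> cP x \<rightarrow>\<^sub>M path_space"
  by (rule ucompl_completion[OF measurable_post_hit])
 have [measurable]: "hit0 \<in> bm (cP x)"
  by (rule ucompl_completion[OF measurable_hit0])
 have "{w \<in> paths. hit0 w <= ennreal (real n) & post_hit w \<in> N} \<in> null_sets (cP x)" for n
 proof -
  have "{w \<in> paths. hit0 w <= ennreal (real n) & post_hit w \<in> N} =
    {w \<in> space (cP x). hit0 w <= ennreal (real n)} Int (post_hit -` N Int space (cP x))"
   by auto
  also have "... \<in> sets (cP x)"
   by (rule sets.Int[OF _ measurable_sets[OF th N(1)]]) measurable
  finally show ?thesis using strong_markov_sets[OF N(1), of x "real n"] N(2) by (auto simp: null_sets_def)
 qed
 then have "(\<Union>n::nat. {w \<in> paths. hit0 w <= ennreal (real n) & post_hit w \<in> N}) \<in> null_sets (cP x)"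
  by (rule null_sets_UN)
 then have "AE w in cP x. hit0 w < top --> Q (post_hit w)"
 proof (rule AE_I', intro subsetI)
  fix w assume "w \<in> {w \<in> space (cP x). ~ (hit0 w < top --> Q (post_hit w))}"
  then have w: "w \<in> paths" "hit0 w < top" "~ Q (post_hit w)" by auto
  then have "post_hit w \<in> N" using N(3) measurable_space[OF th, of w] by auto
  moreover obtain n where "hit0 w <= ennreal (real n)"
   using w(2) by (metis ennreal_cases less_top ennreal_leI real_arch_simple)
  ultimately show "w \<in> (\<Union>n::nat. {w \<in> paths. hit0 w <= ennreal (real n) & post_hit w \<in> N})"
   using w by blast
 qed
 then show ?thesis by (simp add: AE_completion_iff)
qed

lemma strong_markov_integral_borel:
 assumes Y: "Y \<in> bm path_space" and q: "0 < q"
 shows "(NN w. exp_ennreal q (hit0 w) * Y (post_hit w) \<partial>P x)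
      = (NN w. exp_ennreal q (hit0 w) \<partial>P x) * (NN w. Y w \<partial>P 0)"
proof -
 let ?C = "cP x"
 interpret C: prob_space ?C by (rule prob_cP)
 interpret E: prob_space "exp_law q" by (rule prob_space_exp_law[OF q])
 interpret CE: pair_sigma_finite ?C "exp_law q" ..
 have th: "post_hit \<in> ?C \<rightarrow>\<^sub>M path_space" by (rule ucompl_completion[OF measurable_post_hit])
 have T[measurable]: "hit0 \<in> bm ?C" by (rule ucompl_completion[OF measurable_hit0])
 have Yth[measurable]: "(%w. Y (post_hit w)) \<in> bm ?C" by (rule measurable_compose[OF th Y])
 have A: "{w \<in> paths. hit0 w <= ennreal c} \<in> sets ?C" for c
 proof -
  have "Measurable.pred ?C (%w. hit0 w <= ennreal c)" by measurable
  then show ?thesis by (simp add: pred_def)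
 qed
 have step: "(NN w. ind {w \<in> paths. hit0 w <= ennreal c} w * Y (post_hit w) \<partial>?C)
   = emeasure ?C {w \<in> paths. hit0 w <= ennreal c} * (NN w. Y w \<partial>P 0)" for c
 proof -
  let ?A = "{w \<in> paths. hit0 w <= ennreal c}" and ?D = "density ?C (ind {w \<in> paths. hit0 w <= ennreal c})"
  have eq: "distr ?D path_space post_hit = scale_measure (emeasure ?C ?A) (P 0)"
  proof (rule measure_eqI)
   fix B assume "B \<in> sets (distr ?D path_space post_hit)"
   then have B: "B \<in> sets path_space" by simp
   have sB: "post_hit -` B Int space ?C \<in> sets ?C" by (rule measurable_sets[OF th B])
   have "emeasure (distr ?D path_space post_hit) B = emeasure ?D (post_hit -` B Int space ?D)"
    using th B by (intro emeasure_distr) simp_all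
   also have "... = (NN w. ind ?A w * ind (post_hit -` B Int space ?C) w \<partial>?C)"
    using A sB by (simp add: emeasure_density)
   also have "... = (NN w. ind {w \<in> paths. hit0 w <= ennreal c & post_hit w \<in> B} w \<partial>?C)"
    by (rule nn_integral_cong) (auto simp: indicator_def)
   also have "... = emeasure ?C {w \<in> paths. hit0 w <= ennreal c & post_hit w \<in> B}"
   proof (rule nn_integral_indicator)
    have "{w \<in> paths. hit0 w <= ennreal c & post_hit w \<in> B} = ?A Int (post_hit -` B Int space ?C)" by auto
    then show "{w \<in> paths. hit0 w <= ennreal c & post_hit w \<in> B} \<in> sets ?C"
     using A sB by simp
   qed
   finally show "emeasure (distr ?D path_space post_hit) B = emeasure (scale_measure (emeasure ?C ?A) (P 0)) B"
    using strong_markov_sets[OF B] by simp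
  qed simp
  have "(NN w. ind ?A w * Y (post_hit w) \<partial>?C) = (NN w. Y (post_hit w) \<partial>?D)"
   using A by (intro nn_integral_density[symmetric]) simp_all
  also have "... = (NN w. Y w \<partial>distr ?D path_space post_hit)"
   using th Y by (intro nn_integral_distr[symmetric]) simp_all
  also have "... = emeasure ?C ?A * (NN w. Y w \<partial>P 0)"
   unfolding eq using Y by (intro nn_integral_scale_measure) simp
  finally show ?thesis .
 qed
 have fub: "(NN w. exp_ennreal q (hit0 w) * Z w \<partial>?C)
   = (NN c. (NN w. ind {w \<in> paths. hit0 w <= ennreal c} w * Z w \<partial>?C) \<partial>exp_law q)"
  if Z[measurable]: "Z \<in> bm ?C" for Z
 proof -
  have "(NN w. exp_ennreal q (hit0 w) * Z w \<partial>?C)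
    = (NN w. (NN c. ind {c. hit0 w <= ennreal c} c * Z w \<partial>exp_law q) \<partial>?C)"
   using exp_law_tail[OF q] by (intro nn_integral_cong) (simp add: nn_integral_multc)
  also have "... = (NN w. (NN c. (if hit0 w <= ennreal c then 1 else 0) * Z w \<partial>exp_law q) \<partial>?C)"
   by (intro nn_integral_cong) (auto simp: indicator_def)
  also have "... = (NN c. (NN w. (if hit0 w <= ennreal c then 1 else 0) * Z w \<partial>?C) \<partial>exp_law q)"
   by (rule CE.Fubini'[symmetric]) measurable
  also have "... = (NN c. (NN w. ind {w \<in> paths. hit0 w <= ennreal c} w * Z w \<partial>?C) \<partial>exp_law q)"
   by (intro nn_integral_cong) (auto simp: indicator_def)
  finally show ?thesis .
 qed
 have meas: "(%c. emeasure ?C {w \<in> paths. hit0 w <= ennreal c}) \<in> bm (exp_law q)"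
 proof -
  have "(%c. NN w. (if hit0 w <= ennreal c then 1 else 0) \<partial>?C) \<in> bm (exp_law q)"
   by measurable
  moreover have "(NN w. (if hit0 w <= ennreal c then 1 else 0) \<partial>?C) = emeasure ?C {w \<in> paths. hit0 w <= ennreal c}" for c
  proof -
   have "(NN w. (if hit0 w <= ennreal c then 1 else 0) \<partial>?C) = (NN w. ind {w \<in> paths. hit0 w <= ennreal c} w \<partial>?C)"
    by (intro nn_integral_cong) (simp add: indicator_def)
   then show ?thesis using nn_integral_indicator[OF A[of c]] by (simp only:)
  qed
  ultimately show ?thesis by simp
 qed
 have "(NN w. exp_ennreal q (hit0 w) * Y (post_hit w) \<partial>?C)
   = (NN c. emeasure ?C {w \<in> paths. hit0 w <= ennreal c} * (NN w. Y w \<partial>P 0) \<partial>exp_law q)"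
  using fub[OF Yth] step by simp
 also have "... = (NN c. emeasure ?C {w \<in> paths. hit0 w <= ennreal c} \<partial>exp_law q) * (NN w. Y w \<partial>P 0)"
  by (rule nn_integral_multc[OF meas])
 also have "(NN c. emeasure ?C {w \<in> paths. hit0 w <= ennreal c} \<partial>exp_law q) = (NN w. exp_ennreal q (hit0 w) \<partial>?C)"
  using fub[of "%_. 1"] A by simp
 finally show ?thesis by (simp add: nn_integral_completion)
qed

lemma strong_markov_integral:
 assumes Y: "Y \<in> bm (cP 0)" and q: "0 < q"
 shows "(NN w. exp_ennreal q (hit0 w) * Y (post_hit w) \<partial>P x)
      = (NN w. exp_ennreal q (hit0 w) \<partial>P x) * (NN w. Y w \<partial>P 0)"
proof -
 from completion_ex_borel_measurable[OF Y]
 obtain Y' where Y': "Y' \<in> bm path_space" "AE w in P 0. Y w = Y' w"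
  using measurable_cong_sets[OF sets_P[of 0] refl, of borel] by blast
 have "(NN w. exp_ennreal q (hit0 w) * Y (post_hit w) \<partial>P x) = (NN w. exp_ennreal q (hit0 w) * Y' (post_hit w) \<partial>P x)"
 proof (rule nn_integral_cong_AE, use strong_markov_AE[OF Y'(2), of x] in eventually_elim)
  fix w assume "hit0 w < top --> Y (post_hit w) = Y' (post_hit w)"
  then show "exp_ennreal q (hit0 w) * Y (post_hit w) = exp_ennreal q (hit0 w) * Y' (post_hit w)"
   by (cases "hit0 w = top") (simp_all add: exp_ennreal_def less_top[symmetric])
 qed
 also have "... = (NN w. exp_ennreal q (hit0 w) \<partial>P x) * (NN w. Y' w \<partial>P 0)"
  by (rule strong_markov_integral_borel[OF Y'(1) q])
 also have "(NN w. Y' w \<partial>P 0) = (NN w. Y w \<partial>P 0)"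
  using Y'(2) by (intro nn_integral_cong_AE) auto
 finally show ?thesis .
qed


text \<open>A limit of zeros that is no zero is isolated from the right, hence the left end of an excursion interval; but excursions
of the process start at \<open>0\<close> almost surely.\<close>

lemma zeros_closed_0: "AE w in P 0. closed (zeros w)"
 using excursions_of_process AE_space
proof eventually_elim
 case (elim w)
 have w: "w \<in> paths" using elim(2) by simp
 have "z \<in> zeros w" if z: "z \<in> closure (zeros w)" for z
 proof (rule ccontr)
  assume nz: "z \<notin> zeros w"
  have "closure (zeros w) \<subseteq> {0..}" by (rule closure_minimal) (auto simp: zeros_def)
  then have z0: "0 <= z" using z by auto
  have "~ (\<forall>e>0. \<exists>r\<in>zeros w. z <= r & r < z + e)"
   using zeros_right_closed[OF w z0] nz by blast
  then obtain e where e: "0 < e" "!!r. r \<in> zeros w ==> z <= r ==> ~ r < z + e" by blast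
  have "z \<in> left_ends w"
   unfolding left_ends_def
   using z z0 e by (auto intro!: exI[of _ "z + e"] simp: zeros_def)
  then have "excursion_at z w \<in> excursions" using elim(1) by blast
  then have "excursion_at z w 0 = Some 0" by (auto simp: excursions_def)
  then show False using nz z0 by (simp add: excursion_at_def zeros_def)
 qed
 then have "closure (zeros w) \<subseteq> zeros w" by blast
 then show ?case by (simp add: closure_subset_eq)
qed

lemma hit0_eq_top_iff: "w \<in> paths ==> hit0 w = top \<longleftrightarrow> zeros w = {}"
 using hit0_le_iff[of w top] by (auto simp: less_top)

lemma zeros_post_hit:
 assumes w: "w \<in> paths" and fin: "hit0 w < top"
 shows "zeros w = (%s. enn2real (hit0 w) + s) ` zeros (post_hit w)"
proof (intro equalityI subsetI)
 fix s assume s: "s \<in> zeros w"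
 have "hit0 w <= ennreal s" unfolding hit0_def using s by (auto intro: Inf_lower)
 then have "enn2real (hit0 w) <= s"
  using s by (intro enn2real_leI) (auto simp: zeros_def)
 then show "s \<in> (%s. enn2real (hit0 w) + s) ` zeros (post_hit w)"
  using s unfolding post_hit_def by (intro image_eqI[of _ _ "s - enn2real (hit0 w)"]) (auto simp: zeros_shift)
qed (auto simp: post_hit_def zeros_shift)

text \<open>The zero set is that of the path after its first zero, translated.\<close>

lemma zeros_closed: "AE w in P x. closed (zeros w)"
 using strong_markov_AE[OF zeros_closed_0, of x] AE_space
proof eventually_elim
 case (elim w)
 then have w: "w \<in> paths" by simp
 show ?case
 proof (cases "hit0 w < top")
  case True
  then have "closed (zeros (post_hit w))" using elim(1) by blast
  then show ?thesis using zeros_post_hit[OF w True] closed_translation by metis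
 next
  case False
  then have "zeros w = {}" using hit0_eq_top_iff[OF w] by (auto simp: less_top[symmetric])
  then show ?thesis by simp
 qed
qed

end

section \<open>Additive functionals as measures\<close>

text \<open>Additive, monotone continuous functionals are measures.  The last exit formula becomes an identity between two
measures on a \<open>\<sigma>\<close>-algebra with a convenient \<open>\<inter>\<close>-stable generator.\<close>

lemma functional_measure:
 fixes I :: "('a => ennreal) => ennreal"
 assumes cong: "!!f g. (!!x. x \<in> space M ==> f x = g x) ==> I f = I g"
  and add: "!!f g. f \<in> bm M ==> g \<in> bm M ==> I (%x. f x + g x) = I f + I g"
  and cmult: "!!c f. f \<in> bm M ==> I (%x. c * f x) = c * I f"
  and sup: "!!f. (!!n::nat. f n \<in> bm M) ==> incseq f ==> I (%x. SUP n. f n x) = (SUP n. I (f n))"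
 shows "\<exists>N. sets N = sets M & (\<forall>f\<in>bm M. I f = (NN x. f x \<partial>N))"
proof -
 define N where "N = measure_of (space M) (sets M) (%A. I (ind A))"
 have zero: "I (%_. 0) = 0" using cmult[of "%_. 0" 0] by simp
 have ca: "countably_additive (sets M) (%A. I (ind A))"
  unfolding countably_additive_def
 proof (intro allI impI)
  fix A :: "nat => _" assume A: "range A \<subseteq> sets M" "disjoint_family A" "(\<Union>i. A i) \<in> sets M"
  have [measurable]: "A i \<in> sets M" for i using A by auto
  have fin: "I (%x. \<Sum>i<n. ind (A i) x) = (\<Sum>i<n. I (ind (A i)))" for n
  proof (induction n)
   case (Suc n)
   have "I (%x. (\<Sum>i<n. ind (A i) x) + ind (A n) x) = I (%x. \<Sum>i<n. ind (A i) x) + I (ind (A n))"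
    by (rule add) measurable
   then show ?case using Suc by simp
  qed (simp add: zero)
  have "(\<Sum>i. I (ind (A i))) = (SUP n. I (%x. \<Sum>i<n. ind (A i) x))"
   unfolding fin by (rule suminf_eq_SUP)
  also have "... = I (%x. SUP n. \<Sum>i<n. ind (A i) x)"
   by (rule sup[symmetric]) (auto simp: incseq_def le_fun_def intro!: sum_mono2)
  also have "(%x. SUP n. \<Sum>i<n. ind (A i) x) = (ind (\<Union>i. A i) :: _ => ennreal)"
   using A(2) by (intro ext) (simp flip: suminf_eq_SUP add: suminf_indicator)
  finally show "(\<Sum>i. I (ind (A i))) = I (ind (\<Union>i. A i))" .
 qed
 have pos: "positive (sets M) (%A. I (ind A))"
  using zero by (simp add: positive_def indicator_def[abs_def])
 have setsN: "sets N = sets M" unfolding N_def by simp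
 have em: "emeasure N A = I (ind A)" if "A \<in> sets M" for A
  using emeasure_measure_of[OF N_def sets.space_closed, unfolded setsN, OF pos ca that] .
 have "I f = (NN x. f x \<partial>N)" if "f \<in> bm M" for f
  using that
 proof (induction rule: borel_measurable_induct)
  case (cong f g)
  then show ?case
   using assms(1)[of f g] nn_integral_cong[of N f g] sets_eq_imp_space_eq[OF setsN] by simp
 next
  case (set A)
  then show ?case using em setsN by simp
 next
  case (mult u c)
  then show ?case using cmult[of u c] setsN by (simp add: nn_integral_cmult cong: measurable_cong_sets)
 next
  case (add u v)
  then show ?case using assms(2)[of v u] setsN by (simp add: nn_integral_add cong: measurable_cong_sets)
 next
  case (seq U)
  have "I (%x. SUP n. U n x) = (SUP n. I (U n))" using seq by (intro sup) auto
  also have "... = (SUP n. NN x. U n x \<partial>N)" using seq by simp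
  also have "... = (NN x. (SUP n. U n x) \<partial>N)"
   using seq setsN by (intro nn_integral_monotone_convergence_SUP[symmetric]) (auto cong: measurable_cong_sets)
  finally show ?case by (simp add: image_comp)
 qed
 with setsN show ?thesis by blast
qed

lemma borel_measure_eqI_Ioc:
 fixes M N :: "real measure"
 assumes "sets M = sets borel" "sets N = sets borel"
  and eq: "!!a b. a <= b ==> emeasure M {a<..b} = emeasure N {a<..b}"
  and fin: "!!a b. a <= b ==> emeasure M {a<..b} ~= \<infinity>"
 shows "M = N"
proof (rule measure_eqI_generator_eq[where E = "range (%(a, b). {a<..b::real})" and \<Omega> = UNIV and A = "%i::nat. {- real i<..real i}"])
 show "Int_stable (range (%(a, b). {a<..b::real}))"
 proof (rule Int_stableI)
  fix X Y :: "real set" assume "X \<in> range (%(a, b). {a<..b})" "Y \<in> range (%(a, b). {a<..b})"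
  then obtain a b c d where "X = {a<..b}" "Y = {c<..d}" by auto
  then have "X Int Y = {max a c<..min b d}" by auto
  then show "X Int Y \<in> range (%(a, b). {a<..b})"
   by (intro range_eqI[of _ _ "(max a c, min b d)"]) simp
 qed
 show "emeasure M X = emeasure N X" if E: "X \<in> range (%(a, b). {a<..b::real})" for X
 proof -
  obtain a b where X: "X = {a<..b}" using E by auto
  show ?thesis using eq[of a b] X by (cases "a <= b") auto
 qed
 show "(\<Union>i::nat. {- real i<..real i}) = UNIV"
 proof (intro equalityI subsetI)
  fix x :: real
  obtain n :: nat where "\<bar>x\<bar> < real n" using reals_Archimedean2 by blast
  then have "x \<in> {- real n<..real n}" by auto
  then show "x \<in> (\<Union>i::nat. {- real i<..real i})" by blast
 qed simp
 show "range (%i::nat. {- real i<..real i}) \<subseteq> range (%(a, b). {a<..b::real})"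
 proof (rule image_subsetI)
  fix i :: nat
  show "{- real i<..real i} \<in> range (%(a, b). {a<..b::real})"
   by (rule range_eqI[of _ _ "(- real i, real i)"]) simp
 qed
 have "sets (borel :: real measure) = sigma_sets UNIV (range (%(a, b). {a<..b::real}))"
  by (subst borel_sigma_sets_Ioc) (simp add: sets_measure_of)
 with assms(1,2) show "sets M = sigma_sets UNIV (range (%(a, b). {a<..b}))"
   "sets N = sigma_sets UNIV (range (%(a, b). {a<..b}))"
  by simp_all
 show "emeasure M {- real i<..real i} ~= \<infinity>" for i :: nat
  by (rule fin) simp
qed simp

section \<open>Last zeros on closed zero sets\<close>

definition gz :: "real => path => real" where
 "gz s w = enn2real (last_zero (ennreal s) w)"

lemma hit0_le_real:
 assumes "w \<in> paths" "0 <= s" shows "hit0 w <= ennreal s \<longleftrightarrow> (\<exists>z\<in>zeros w. z <= s)"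
 using hit0_le_iff[OF assms(1), of "ennreal s"] assms(2)
 by (auto intro: le_less_trans[OF _ ennreal_less_top] simp: ennreal_le_iff)

lemma gz_eqI:
 assumes "z \<in> zeros w" "z <= s" "!!y. y \<in> zeros w ==> y <= s ==> y <= z"
 shows "last_zero (ennreal s) w = ennreal z" and "gz s w = z"
proof -
 have z: "0 <= z" using assms(1) by (auto simp: zeros_def)
 then have s: "0 <= s" using assms(2) by simp
 have "Sup (ennreal ` {y \<in> zeros w. ennreal y <= ennreal s}) = ennreal z"
 proof (rule antisym)
  show "Sup (ennreal ` {y \<in> zeros w. ennreal y <= ennreal s}) <= ennreal z"
   using assms(3) s by (auto intro!: Sup_least ennreal_leI simp: ennreal_le_iff)
  show "ennreal z <= Sup (ennreal ` {y \<in> zeros w. ennreal y <= ennreal s})"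
   using assms(1,2) s by (intro Sup_upper) (auto simp: ennreal_le_iff)
 qed
 then show "last_zero (ennreal s) w = ennreal z"
  using assms(1,2) s by (auto simp: last_zero_def Let_def ennreal_le_iff)
 then show "gz s w = z" using z by (simp add: gz_def)
qed

text \<open>The supremum that defines the last zero is attained as the zero set is closed.\<close>

lemma gz_attained:
 assumes w: "w \<in> paths" and cl: "closed (zeros w)" and s: "0 <= s" and hit: "hit0 w <= ennreal s"
 shows "gz s w \<in> zeros w" "gz s w <= s" "!!y. y \<in> zeros w ==> y <= s ==> y <= gz s w"
  "last_zero (ennreal s) w = ennreal (gz s w)"
proof -
 let ?Z = "zeros w Int {..s}"
 have ne: "?Z ~= {}" using hit hit0_le_real[OF w s] by auto
 have bdd: "bdd_above ?Z" by (auto intro: bdd_aboveI[of _ s])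
 have "closed ?Z" using cl by (intro closed_Int) auto
 then have mem: "Sup ?Z \<in> ?Z" by (rule closed_contains_Sup[OF ne bdd])
 have up: "y <= Sup ?Z" if "y \<in> zeros w" "y <= s" for y
  using that bdd by (intro cSup_upper) auto
 note * = gz_eqI[of "Sup ?Z" w s]
 have eq: "gz s w = Sup ?Z" "last_zero (ennreal s) w = ennreal (Sup ?Z)"
  using * mem up by auto
 show "gz s w \<in> zeros w" "gz s w <= s" "!!y. y \<in> zeros w ==> y <= s ==> y <= gz s w"
  "last_zero (ennreal s) w = ennreal (gz s w)"
  using mem up eq by auto
qed

lemma gz_nonneg: "0 <= gz s w"
 by (simp add: gz_def)

lemma shift_shift: "0 <= r ==> 0 <= t ==> shift t (shift r w) = shift (r + t) w"
 by (auto simp: shift_def add.assoc intro!: restrict_ext)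

lemma gz_shift:
 assumes w: "w \<in> paths" and cl: "closed (zeros w)" and r: "0 <= r" and s: "0 <= s"
 shows "hit0 w <= ennreal s & r <= gz s w \<longleftrightarrow> r <= s & hit0 (shift r w) <= ennreal (s - r)"
  and "r <= s ==> hit0 (shift r w) <= ennreal (s - r) ==> gz s w = r + gz (s - r) (shift r w)"
proof -
 have w': "shift r w \<in> paths" by (rule shift_paths[OF r w])
 have cl': "closed (zeros (shift r w))"
 proof -
  have "zeros (shift r w) = {0..} Int (%s. r + s) -` zeros w"
   using zeros_shift[OF r] by auto
  then show ?thesis using cl by (auto intro!: closed_Int continuous_closed_vimage continuous_intros)
 qed
 show 1: "gz s w = r + gz (s - r) (shift r w)"
  if "r <= s" "hit0 (shift r w) <= ennreal (s - r)"
 proof (rule gz_eqI(2))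
  have sr: "0 <= s - r" using that by simp
  note g = gz_attained[OF w' cl' sr that(2)]
  show "r + gz (s - r) (shift r w) \<in> zeros w" using g(1) zeros_shift[OF r] by auto
  show "r + gz (s - r) (shift r w) <= s" using g(2) by simp
  fix y assume y: "y \<in> zeros w" "y <= s"
  show "y <= r + gz (s - r) (shift r w)"
  proof (cases "r <= y")
   case True
   then have "y - r \<in> zeros (shift r w)" using y zeros_shift[OF r] by auto
   then show ?thesis using g(3)[of "y - r"] y by simp
  next
   case False then show ?thesis using gz_nonneg[of "s - r" "shift r w"] by simp
  qed
 qed
 show "hit0 w <= ennreal s & r <= gz s w \<longleftrightarrow> r <= s & hit0 (shift r w) <= ennreal (s - r)"
 proof
  assume *: "hit0 w <= ennreal s & r <= gz s w"
  note g = gz_attained[OF w cl s conjunct1[OF *]]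
  have "gz s w - r \<in> zeros (shift r w)" using g(1) * zeros_shift[OF r] by auto
  then show "r <= s & hit0 (shift r w) <= ennreal (s - r)"
   using hit0_le_real[OF w', of "s - r"] g(2) * by force
 next
  assume *: "r <= s & hit0 (shift r w) <= ennreal (s - r)"
  then have eq: "gz s w = r + gz (s - r) (shift r w)" using 1 by blast
  obtain z where "z \<in> zeros (shift r w)" "z <= s - r"
   using hit0_le_real[OF w', of "s - r"] * by auto
  then have "r + z \<in> zeros w" "r + z <= s" using zeros_shift[OF r] by auto
  then show "hit0 w <= ennreal s & r <= gz s w"
   using hit0_le_real[OF w s] eq gz_nonneg[of "s - r" "shift r w"] by auto
 qed
qed

lemma measurable_gz:
 "(%z. gz (snd z) (fst z)) \<in> bm prod_space"
proof -
 have "(%z. last_zero (ennreal (snd z)) (fst z)) \<in> bm prod_space"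
  by (rule measurable_last_zero_comp) measurable
 then show ?thesis unfolding gz_def by measurable
qed

lemma measurable_hit0_fst: "(%z. hit0 (fst z)) \<in> bm prod_space"
 by (rule measurable_compose[OF measurable_fst measurable_hit0])

text \<open>The generators use deterministic times, for which the Markov property at a fixed time suffices.  The functionals of
\<open>(X\<^sub>s, s < v)\<close> and of \<open>v\<close> are measurable for this \<open>\<sigma>\<close>-algebra.\<close>

definition optional :: "(path \<times> real) measure" where
 "optional = sigma (paths \<times> {0..}) {A \<times> {r..} | A r. 0 <= r & A \<in> sets (filt r)}"

lemma optional_generator:
 "{A \<times> {r..} | A r. 0 <= r & A \<in> sets (filt r)} \<subseteq> Pow (paths \<times> {0..})"
 using sets.sets_into_space by fastforce

lemma space_optional [simp]: "space optional = paths \<times> {0..}"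
 unfolding optional_def by (rule space_measure_of[OF optional_generator])

lemma sets_optional:
 "sets optional = sigma_sets (paths \<times> {0..}) {A \<times> {r..} | A r. 0 <= r & A \<in> sets (filt r)}"
 unfolding optional_def by (rule sets_measure_of[OF optional_generator])

lemma rectangle_optional:
 "0 <= r ==> A \<in> sets (filt r) ==> A \<times> {r..} \<in> sets optional"
 unfolding sets_optional by (rule sigma_sets.Basic) blast

lemma Int_stable_optional:
 "Int_stable {A \<times> {r..} | A r. 0 <= r & A \<in> sets (nat_filt (ennreal (r::real)))}"
proof (rule Int_stableI, safe)
 fix A B and r s :: real assume *: "0 <= r" "A \<in> sets (filt r)" "0 <= s" "B \<in> sets (filt s)"
 have "A \<in> sets (nat_filt (ennreal (max r s)))" "B \<in> sets (nat_filt (ennreal (max r s)))"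
  using * sets_nat_filt_mono[of "ennreal r" "ennreal (max r s)"] sets_nat_filt_mono[of "ennreal s" "ennreal (max r s)"]
  by (auto intro: ennreal_leI)
 moreover have "A \<times> {r..} Int B \<times> {s..} = (A Int B) \<times> {max r s..}" by auto
 ultimately show "\<exists>C t. A \<times> {r..} Int B \<times> {s..} = C \<times> {t..} & 0 <= t & C \<in> sets (filt t)"
  using * by (intro exI[of _ "A Int B"] exI[of _ "max r s"]) auto
qed

lemma measurable_optionalI:
 assumes W: "W \<in> M \<rightarrow>\<^sub>M path_space" and \<tau>: "\<tau> \<in> bm M" and pos: "!!x. x \<in> space M ==> 0 <= \<tau> x"
 shows "(%x. (W x, \<tau> x)) \<in> M \<rightarrow>\<^sub>M optional"
 unfolding optional_def
proof (rule measurable_measure_of[OF optional_generator])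
 show "(%x. (W x, \<tau> x)) \<in> space M \<rightarrow> paths \<times> {0..}" using measurable_space[OF W] pos by auto
 fix C assume "C \<in> {A \<times> {r..} | A r. 0 <= r & A \<in> sets (nat_filt (ennreal (r::real)))}"
 then obtain A r where C: "C = A \<times> {r..}" "0 <= r" "A \<in> sets (filt r)" by auto
 have "A \<in> sets path_space" using C(3) sets_nat_filt_mono[of "ennreal r" top] by auto
 then have "(W -` A Int space M) Int (\<tau> -` {r..} Int space M) \<in> sets M"
  by (rule sets.Int[OF measurable_sets[OF W] measurable_sets[OF \<tau>]]) simp_all
 also have "(W -` A Int space M) Int (\<tau> -` {r..} Int space M) = (%x. (W x, \<tau> x)) -` C Int space M"
  using C by auto
 finally show "(%x. (W x, \<tau> x)) -` C Int space M \<in> sets M" .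
qed

lemma measurable_optional_section:
 assumes \<phi>: "\<phi> \<in> bm optional" and w: "w \<in> paths"
 shows "(%v. ind {0..} v * \<phi> (w, v) :: ennreal) \<in> bm borel"
proof -
 have "(%v. (w, v)) \<in> restrict_space borel {0..} \<rightarrow>\<^sub>M optional"
  by (rule measurable_optionalI) (use w in "auto simp: space_restrict_space intro: measurable_restrict_space1")
 from measurable_compose[OF this \<phi>]
 have "(%v. \<phi> (w, v)) \<in> bm (restrict_space borel {0..})" .
 then have "(%v. \<phi> (w, v) * ind {0..} v) \<in> bm borel"
  by (subst (asm) borel_measurable_restrict_space_iff_ennreal) auto
 then show ?thesis by (simp add: mult.commute)
qed

text \<open>A path killed at \<open>v\<close> is alive at \<open>s\<close> only if \<open>v \<ge> s + 1/n\<close> for some \<open>n\<close>, which produces countably many generators.\<close>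

lemma measurable_optional_kill:
 "(%z. kill (snd z) (fst z)) \<in> optional \<rightarrow>\<^sub>M path_space"
proof (rule measurable_nat_filtI)
 show "kill (snd z) (fst z) \<in> paths" if "z \<in> space optional" for z
  using that by (auto intro: kill_paths)
 fix s :: real and B :: "real set" assume s: "0 <= s" and B: "B \<in> sets borel"
 have "{z \<in> space optional. kill (snd z) (fst z) s \<in> Some ` B}
   = (\<Union>n. {w \<in> paths. w s \<in> Some ` B} \<times> {s + 1 / Suc n..})"
 proof (intro set_eqI iffI)
  fix z assume z: "z \<in> {z \<in> space optional. kill (snd z) (fst z) s \<in> Some ` B}"
  then have "s < snd z" "fst z s \<in> Some ` B" "fst z \<in> paths"
   using s by (auto simp: kill_def split: if_splits)
  moreover obtain n where "1 / Suc n < snd z - s" using \<open>s < snd z\<close> by (meson diff_gt_0_iff_gt nat_approx_posE)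
  ultimately have "z \<in> {w \<in> paths. w s \<in> Some ` B} \<times> {s + 1 / Suc n..}" by (cases z) auto
  then show "z \<in> (\<Union>n. {w \<in> paths. w s \<in> Some ` B} \<times> {s + 1 / Suc n..})" by blast
 next
  fix z assume "z \<in> (\<Union>n. {w \<in> paths. w s \<in> Some ` B} \<times> {s + 1 / Suc n..})"
  then obtain n where n: "fst z \<in> paths" "fst z s \<in> Some ` B" "s + 1 / Suc n <= snd z" by auto
  have "0 < 1 / real (Suc n)" by simp
  then have "s < snd z" using n(3) by linarith
  then show "z \<in> {z \<in> space optional. kill (snd z) (fst z) s \<in> Some ` B}"
   using n s by (cases z) (auto simp: kill_def)
 qed
 also have "... \<in> sets optional"
 proof (intro sets.countable_UN image_subsetI)
  fix n :: nat
  have le: "s <= s + 1 / Suc n" by simp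
  have "{w \<in> paths. w s \<in> Some ` B} \<in> sets (nat_filt (ennreal (s + 1 / Suc n)))"
   by (rule sets_nat_filtI[OF s ennreal_leI[OF le] B])
  moreover have "0 <= s + 1 / Suc n" using s le by linarith
  ultimately show "{w \<in> paths. w s \<in> Some ` B} \<times> {s + 1 / Suc n..} \<in> sets optional"
   by (rule rectangle_optional[rotated])
 qed
 finally show "{z \<in> space optional. kill (snd z) (fst z) s \<in> Some ` B} \<in> sets optional" .
qed

lemma measurable_optional_snd: "snd \<in> bm optional"
proof (rule borel_measurableI_ge)
 fix r :: real
 have "{z \<in> space optional. r <= snd z} = paths \<times> {max 0 r..}" by auto
 also have "... \<in> sets optional"
  using sets.top[of "nat_filt (ennreal (max 0 r))"] by (intro rectangle_optional) auto
 finally show "{z \<in> space optional. r <= snd z} \<in> sets optional" .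
qed

context nice_markov_process
begin

section \<open>The local time as a random measure\<close>

abbreviation lt :: "path => real measure" where
 "lt w \<equiv> local_time_measure L w"

definition regular :: "path => bool" where
 "regular w \<longleftrightarrow> L 0 w = 0 & continuous_on {0..} (%t. L t w) & mono_on {0..} (%t. L t w)"

lemma sets_lt [simp, measurable_cong]: "sets (lt w) = sets borel"
 and space_lt [simp]: "space (lt w) = UNIV"
 unfolding local_time_measure_def by simp_all

lemma regular_mono: "regular w ==> 0 <= s ==> s <= t ==> L s w <= L t w"
 unfolding regular_def mono_on_def by auto

lemma regular_nonneg: "regular w ==> 0 <= t ==> 0 <= L t w"
 using regular_mono[of w 0 t] by (auto simp: regular_def)

lemma regular_continuous: "regular w ==> continuous_on UNIV (%t. L (max 0 t) w)"
 unfolding regular_def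
 by (intro continuous_on_compose2[of "{0..}" "%t. L t w" UNIV "%t. max 0 t"]) (auto intro!: continuous_intros)

lemma lt_Ioc: "regular w ==> a <= b ==> emeasure (lt w) {a<..b} = ennreal (L (max 0 b) w - L (max 0 a) w)"
 unfolding local_time_measure_def
 by (rule emeasure_interval_measure_Ioc)
   (use regular_continuous in "auto intro!: regular_mono simp: continuous_on_eq_continuous_within intro: continuous_within_subset")

lemma lt_Icc: "regular w ==> a <= b ==> emeasure (lt w) {a..b} = ennreal (L (max 0 b) w - L (max 0 a) w)"
 unfolding local_time_measure_def
 by (rule emeasure_interval_measure_Icc) (use regular_continuous in "auto intro!: regular_mono")

lemma lt_AE_ne: "regular w ==> AE v in lt w. v ~= a"
 using lt_Icc[of w a a] by (intro AE_I'[of "{a}"]) (auto simp: null_sets_def)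

lemma lt_AE_pos: "regular w ==> AE v in lt w. 0 < v"
proof -
 assume reg: "regular w"
 have "{- real n<..0} \<in> null_sets (lt w)" for n
  using lt_Ioc[OF reg, of "- real n" 0] by (auto simp: null_sets_def)
 then have "(\<Union>n. {- real n<..0}) \<in> null_sets (lt w)" by (rule null_sets_UN)
 then show ?thesis
 proof (rule AE_I')
  show "{v \<in> space (lt w). ~ 0 < v} \<subseteq> (\<Union>n. {- real n<..0})"
  proof
   fix v assume "v \<in> {v \<in> space (lt w). ~ 0 < v}"
   then have v: "v <= 0" by simp
   obtain n :: nat where "- v < real n" using reals_Archimedean2 by blast
   then have "v \<in> {- real n<..0}" using v by simp
   then show "v \<in> (\<Union>n. {- real n<..0})" by blast
  qed
 qed
qed

text \<open>Additivity of the local time says that its random measure after \<open>r\<close> is the translate of that of the shifted path.\<close>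

lemma lt_shift:
 assumes w: "regular w" and w': "regular w'" and r: "0 <= r"
  and eq: "!!t. 0 <= t ==> L (r + t) w = L r w + L t w'"
  and \<phi>: "\<phi> \<in> bm borel"
 shows "(NN v. ind {r..} v * \<phi> v \<partial>lt w) = (NN v. \<phi> (r + v) \<partial>lt w')"
proof -
 let ?M = "distr (lt w') borel (%v. r + v)" and ?N = "density (lt w) (ind {r<..})"
 have M: "emeasure ?M {a<..b} = ennreal (L (max r b) w - L (max r a) w)" if "a <= b" for a b
 proof -
  have "emeasure ?M {a<..b} = emeasure (lt w') {a - r<..b - r}"
   by (subst emeasure_distr) (auto intro!: arg_cong2[where f = emeasure])
  also have "... = ennreal (L (max 0 (b - r)) w' - L (max 0 (a - r)) w')"
   using that by (intro lt_Ioc[OF w']) simp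
  also have "L (max 0 (b - r)) w' - L (max 0 (a - r)) w' = L (r + max 0 (b - r)) w - L (r + max 0 (a - r)) w"
   by (subst (1 2) eq) auto
  also have "r + max 0 (b - r) = max r b" by auto
  also have "r + max 0 (a - r) = max r a" by auto
  finally show ?thesis .
 qed
 have N: "emeasure ?N {a<..b} = ennreal (L (max r b) w - L (max r a) w)" if ab: "a <= b" for a b
 proof -
  have "emeasure ?N {a<..b} = (NN v. ind {r<..} v * ind {a<..b} v \<partial>lt w)"
   by (rule emeasure_density) auto
  also have "... = (NN v. ind ({r<..} Int {a<..b}) v \<partial>lt w)"
   by (rule nn_integral_cong) (auto simp: indicator_def)
  also have "... = emeasure (lt w) ({r<..} Int {a<..b})" by simp
  also have "{r<..} Int {a<..b} = {max r a<..b}" by auto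
  also have "emeasure (lt w) ... = ennreal (L (max r b) w - L (max r a) w)"
  proof (cases "max r a <= b")
   case True
   then have "max 0 b = max r b" "max 0 (max r a) = max r a" using r by auto
   then show ?thesis using lt_Ioc[OF w True] by simp
  next
   case False
   then have "max r b = max r a" using ab by auto
   then show ?thesis using False by simp
  qed
  finally show ?thesis .
 qed
 have MN: "?M = ?N"
  using M N by (intro borel_measure_eqI_Ioc) auto
 have "(NN v. ind {r..} v * \<phi> v \<partial>lt w) = (NN v. ind {r<..} v * \<phi> v \<partial>lt w)"
  using lt_AE_ne[OF w, of r] by (intro nn_integral_cong_AE) (auto simp: indicator_def)
 also have "... = (NN v. \<phi> v \<partial>?N)" using \<phi> by (intro nn_integral_density[symmetric]) auto
 also have "... = (NN v. \<phi> (r + v) \<partial>lt w')"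
  unfolding MN[symmetric] using \<phi> by (intro nn_integral_distr) auto
 finally show ?thesis .
qed

lemma regular_init: "\<mu> \<in> space (prob_algebra borel) ==> AE w in init_law P \<mu>. regular w"
 unfolding regular_def by (rule local_time_paths)

lemma regular_P: "AE w in P x. regular w"
 using regular_init[OF return_in[of x]] unfolding init_law_return .

lemma regular_post_hit: "AE w in P x. hit0 w < top --> regular (post_hit w)"
 by (rule strong_markov_AE[OF regular_P])

text \<open>The support of the random measure is the closure of the zero set, which contains no point before the first zero.\<close>

lemma local_time_zero_before_hit:
 "AE w in P x. \<forall>t\<ge>0. ennreal t <= hit0 w --> L t w = 0"
 using regular_P[of x] local_time_support[OF return_in[of x], unfolded init_law_return] AE_space
proof eventually_elim
 case (elim w)
 have w: "w \<in> paths" using elim(3) by simp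
 note reg = elim(1) note supp = elim(2)
 show ?case
 proof (intro allI impI, rule ccontr)
  fix t :: real assume t: "0 <= t" "ennreal t <= hit0 w" and "L t w ~= 0"
  then have pos: "0 < L t w" using regular_nonneg[OF reg t(1)] by simp
  define S where "S = {s \<in> {0..t}. L s w = 0}"
  have "closed S"
  proof -
   have "closed ({0..t} Int (%s. L s w) -` {0})"
    using reg by (intro continuous_closed_preimage) (auto simp: regular_def intro: continuous_on_subset)
   moreover have "{0..t} Int (%s. L s w) -` {0} = S" by (auto simp: S_def)
   ultimately show ?thesis by simp
  qed
  moreover have ne: "S ~= {}" using reg t by (auto simp: S_def regular_def intro!: exI[of _ 0])
  moreover have bdd: "bdd_above S" by (auto simp: S_def intro: bdd_aboveI[of _ t])
  ultimately have "Sup S \<in> S" by (intro closed_contains_Sup)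
  define t0 where "t0 = Sup S"
  have t0: "0 <= t0" "t0 <= t" "L t0 w = 0" using \<open>Sup S \<in> S\<close> by (auto simp: S_def t0_def)
  have lt: "t0 < t" using t0 pos by (cases "t0 = t") auto
  have after: "0 < L s w" if "t0 < s" for s
  proof (cases "s <= t")
   case True
   have "s \<notin> S" using that cSup_upper[OF _ bdd, of s] by (auto simp: t0_def)
   then show ?thesis using True that t0 regular_nonneg[OF reg, of s] by (auto simp: S_def less_le)
  next
   case False
   then show ?thesis using pos regular_mono[OF reg t(1), of s] by simp
  qed
  have "L (max 0 (t0 - e)) w < L (t0 + e) w" if "0 < e" for e
  proof -
   have "L (max 0 (t0 - e)) w <= L t0 w" using that t0 by (intro regular_mono[OF reg]) auto
   then show ?thesis using after[of "t0 + e"] that t0 by simp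
  qed
  then have cl: "t0 \<in> closure (zeros w)" using supp t0 by blast
  have "zeros w \<subseteq> {t..}"
  proof
   fix z assume z: "z \<in> zeros w"
   have "ennreal t <= ennreal z"
    using t(2) z by (auto simp: hit0_def intro: order_trans Inf_lower)
   then show "z \<in> {t..}" using z by (auto simp: zeros_def ennreal_le_iff)
  qed
  then have "closure (zeros w) \<subseteq> {t..}" by (rule closure_minimal) simp
  then show False using cl lt by auto
 qed
qed

lemma usual_filt_completion:
 assumes \<mu>: "\<mu> \<in> space (prob_algebra borel)" and f: "f \<in> bm (usual_filt P t)"
 shows "f \<in> bm (completion (init_law P \<mu>))"
proof -
 let ?I = "init_law P \<mu>"
 have sp: "space ?I = paths" using sets_eq_imp_space_eq[OF sets_init_law[OF \<mu>]] by simp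
 have sub: "subalgebra ?I path_space" using sets_init_law[OF \<mu>] sp by (simp add: subalgebra_def)
 have restr: "restr_to_subalg ?I path_space = ?I"
  using sets_restr_to_subalg[OF sub] sets_init_law[OF \<mu>] emeasure_restr_to_subalg[OF sub]
  by (intro measure_eqI) auto
 have "sigma_sets (space (completion ?I)) {A. \<forall>\<mu>\<in>space (prob_algebra borel). \<forall>s. t < s \<or> s = top -->
   A \<in> sets (completion (restr_to_subalg (init_law P \<mu>) (nat_filt s)))} \<subseteq> sets (completion ?I)"
 proof (rule sets.sigma_sets_subset, intro subsetI)
  fix A assume "A \<in> {A. \<forall>\<mu>\<in>space (prob_algebra borel). \<forall>s. t < s \<or> s = top -->
   A \<in> sets (completion (restr_to_subalg (init_law P \<mu>) (nat_filt s)))}"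
  then have "A \<in> sets (completion (restr_to_subalg ?I path_space))" using \<mu> by simp
  then show "A \<in> sets (completion ?I)" unfolding restr .
 qed
 then have "sets (usual_filt P t) \<subseteq> sets (completion ?I)"
  unfolding usual_filt_def sets_measure_of[OF usual_filt_generator] by (simp add: sp)
 then show ?thesis using f sp space_usual_filt[of t] by (auto simp: measurable_def)
qed

lemma measurable_L:
 "\<mu> \<in> space (prob_algebra borel) ==> 0 <= t ==> L t \<in> bm (completion (init_law P \<mu>))"
 by (rule usual_filt_completion[OF _ local_time_adapted])

text \<open>Restriction to \<open>[0,n]\<close>, and the value \<open>0\<close> at the paths where the local time misbehaves, make all these measures finite.\<close>

definition cut_lt :: "real => path => real measure" where
 "cut_lt n w = (if regular w then density (lt w) (ind {0..n}) else null_measure borel)"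

lemma sets_cut_lt [simp, measurable_cong]: "sets (cut_lt n w) = sets borel"
 and space_cut_lt [simp]: "space (cut_lt n w) = UNIV"
 by (simp_all add: cut_lt_def)

lemma emeasure_cut_lt:
 assumes n: "0 <= n" and r: "0 <= r"
 shows "emeasure (cut_lt n w) {r..} = (if regular w & r <= n then ennreal (L n w - L r w) else 0)"
proof (cases "regular w")
 case True
 have "emeasure (cut_lt n w) {r..} = (NN v. ind {0..n} v * ind {r..} v \<partial>lt w)"
  using True by (simp add: cut_lt_def emeasure_density)
 also have "... = (NN v. ind {r..n} v \<partial>lt w)"
  using r by (intro nn_integral_cong) (auto simp: indicator_def)
 also have "... = emeasure (lt w) {r..n}" by simp
 finally show ?thesis using True n r lt_Icc[OF True, of r n] by (cases "r <= n") (auto simp: max_def)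
qed (simp add: cut_lt_def)

text \<open>For a rectangle \<open>A \<times> [r,\<infinity>)\<close> the measure is an increment of the adapted process \<open>L\<close>; finiteness lets the property pass to
complements, and so to all optional sets.\<close>

lemma measurable_cut_lt:
 assumes \<mu>: "\<mu> \<in> space (prob_algebra borel)" and n: "0 <= n" and \<phi>: "\<phi> \<in> bm optional"
 shows "(%w. NN v. ind {0..} v * \<phi> (w, v) \<partial>cut_lt n w) \<in> bm (completion (init_law P \<mu>))"
proof -
 let ?C = "completion (init_law P \<mu>)"
 have sp: "space ?C = paths" using sets_eq_imp_space_eq[OF sets_init_law[OF \<mu>]] by simp
 have reg: "Measurable.pred ?C regular"
 proof -
  have "Measurable.pred ?C (%w. ~ regular w)"
   by (rule sets_completion_AE) (use regular_init[OF \<mu>] in simp)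
  then have "Measurable.pred ?C (%w. ~ ~ regular w)" by (rule pred_intros_logic(2))
  then show ?thesis by simp
 qed
 have L: "L t \<in> bm ?C" if "0 <= t" for t by (rule measurable_L[OF \<mu> that])
 have sec: "{v. 0 <= v & (w, v) \<in> E} \<in> sets borel" if "E \<in> sets optional" "w \<in> paths" for E w
 proof -
  have "(%v. ind {0..} v * ind E (w, v) :: ennreal) \<in> bm borel"
   using that by (intro measurable_optional_section) auto
  then have "(%v. ind {0..} v * ind E (w, v) :: ennreal) -` {1} Int space borel \<in> sets borel"
   by (rule measurable_sets) simp
  moreover have "(%v. ind {0..} v * ind E (w, v) :: ennreal) -` {1} Int space borel = {v. 0 <= v & (w, v) \<in> E}"
   by (auto simp: indicator_def of_bool_def split: if_splits)
  ultimately show ?thesis by simp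
 qed
 have set: "(%w. emeasure (cut_lt n w) {v. 0 <= v & (w, v) \<in> E}) \<in> bm ?C" if E: "E \<in> sets optional" for E
  using Int_stable_optional optional_generator E[unfolded sets_optional]
 proof (induction rule: sigma_sets_induct_disjoint)
  case (basic E)
  then obtain A r where E: "E = A \<times> {r..}" "0 <= r" "A \<in> sets (filt r)" by auto
  have [measurable]: "A \<in> sets ?C"
   using E(3) sets_nat_filt_mono[of "ennreal r" top] sets_init_law[OF \<mu>] by auto
  have [measurable]: "Measurable.pred ?C regular" "L n \<in> bm ?C" "L r \<in> bm ?C"
   using reg L n E(2) by auto
  have "emeasure (cut_lt n w) {v. 0 <= v & (w, v) \<in> E}
    = (if w \<in> A & regular w & r <= n then ennreal (L n w - L r w) else 0)" for w
  proof -
   have "{v. 0 <= v & (w, v) \<in> E} = (if w \<in> A then {r..} else {})" using E by auto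
   then show ?thesis using emeasure_cut_lt[OF n E(2), of w] by simp
  qed
  then show ?case by simp
 next
  case empty then show ?case by simp
 next
  case (compl E)
  have E: "E \<in> sets optional" using compl(1) by (simp add: sets_optional)
  have tot: "(%w. emeasure (cut_lt n w) {0..}) \<in> bm ?C"
   unfolding emeasure_cut_lt[OF n order_refl] using reg L n by measurable
  have "(%w. emeasure (cut_lt n w) {0..} - emeasure (cut_lt n w) {v. 0 <= v & (w, v) \<in> E}) \<in> bm ?C"
   using tot compl(2) by (rule borel_measurable_minus_ennreal)
  then show ?case
  proof (rule measurable_cong[THEN iffD1, rotated])
   fix w assume "w \<in> space ?C"
   then have w: "w \<in> paths" using sp by simp
   have "{v. 0 <= v & (w, v) \<in> paths \<times> {0..} - E} = {0..} - {v. 0 <= v & (w, v) \<in> E}"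
    using w by auto
   moreover have "emeasure (cut_lt n w) {v. 0 <= v & (w, v) \<in> E} ~= \<infinity>"
   proof -
    have "emeasure (cut_lt n w) {v. 0 <= v & (w, v) \<in> E} <= emeasure (cut_lt n w) {0..}"
     by (intro emeasure_mono) auto
    also have "... < \<infinity>" unfolding emeasure_cut_lt[OF n order_refl] by simp
    finally show ?thesis by simp
   qed
   ultimately show "emeasure (cut_lt n w) {0..} - emeasure (cut_lt n w) {v. 0 <= v & (w, v) \<in> E}
     = emeasure (cut_lt n w) {v. 0 <= v & (w, v) \<in> paths \<times> {0..} - E}"
    using sec[OF E w] by (simp, intro emeasure_Diff[symmetric]) auto
  qed
 next
  case (union E)
  then have E: "E i \<in> sets optional" for i by (auto simp: sets_optional)
  have "(%w. \<Sum>i. emeasure (cut_lt n w) {v. 0 <= v & (w, v) \<in> E i}) \<in> bm ?C"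
   using union(3) by measurable
  then show ?case
  proof (rule measurable_cong[THEN iffD1, rotated])
   fix w assume "w \<in> space ?C"
   then have w: "w \<in> paths" using sp by simp
   have "{v. 0 <= v & (w, v) \<in> (\<Union>i. E i)} = (\<Union>i. {v. 0 <= v & (w, v) \<in> E i})" by auto
   moreover have "disjoint_family (%i. {v. 0 <= v & (w, v) \<in> E i})"
    using union(1) by (auto simp: disjoint_family_on_def)
   ultimately show "(\<Sum>i. emeasure (cut_lt n w) {v. 0 <= v & (w, v) \<in> E i})
     = emeasure (cut_lt n w) {v. 0 <= v & (w, v) \<in> (\<Union>i. E i)}"
    using sec[OF E w] by (simp add: suminf_emeasure image_subset_iff)
  qed
 qed
 show ?thesis
  using \<phi>
 proof (induction rule: borel_measurable_induct)
  case (cong f g)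
  show ?case
  proof (rule measurable_cong[THEN iffD2, OF _ cong(4)])
   fix w assume "w \<in> space ?C"
   then show "(NN v. ind {0..} v * f (w, v) \<partial>cut_lt n w) = (NN v. ind {0..} v * g (w, v) \<partial>cut_lt n w)"
    using cong(3) sp by (intro nn_integral_cong) (auto simp: indicator_def)
  qed
 next
  case (set E)
  show ?case
  proof (rule measurable_cong[THEN iffD1, OF _ \<open>E \<in> sets optional ==> (%w. emeasure (cut_lt n w) {v. 0 <= v & (w, v) \<in> E}) \<in> bm ?C\<close>])
   fix w assume "w \<in> space ?C"
   then have "{v. 0 <= v & (w, v) \<in> E} \<in> sets (cut_lt n w)" using sec[OF set] sp by simp
   then have "emeasure (cut_lt n w) {v. 0 <= v & (w, v) \<in> E} = (NN v. ind {v. 0 <= v & (w, v) \<in> E} v \<partial>cut_lt n w)"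
    by simp
   also have "... = (NN v. ind {0..} v * ind E (w, v) \<partial>cut_lt n w)"
    by (intro nn_integral_cong) (auto simp: indicator_def)
   finally show "emeasure (cut_lt n w) {v. 0 <= v & (w, v) \<in> E} = (NN v. ind {0..} v * ind E (w, v) \<partial>cut_lt n w)" .
  qed (use set \<open>!!E. E \<in> sets optional ==> (%w. emeasure (cut_lt n w) {v. 0 <= v & (w, v) \<in> E}) \<in> bm ?C\<close> in auto)
 next
  case (mult u c)
  have "(%w. c * (NN v. ind {0..} v * u (w, v) \<partial>cut_lt n w)) \<in> bm ?C"
   using mult(4) by measurable
  then show ?case
  proof (rule measurable_cong[THEN iffD1, rotated])
   fix w assume "w \<in> space ?C"
   then have "(%v. ind {0..} v * u (w, v)) \<in> bm (cut_lt n w)"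
    using measurable_optional_section[OF mult(2)] sp by simp
   then show "c * (NN v. ind {0..} v * u (w, v) \<partial>cut_lt n w) = (NN v. ind {0..} v * (c * u (w, v)) \<partial>cut_lt n w)"
    by (simp flip: nn_integral_cmult add: mult.left_commute)
  qed
 next
  case (add u v)
  have "(%w. (NN t. ind {0..} t * v (w, t) \<partial>cut_lt n w) + (NN t. ind {0..} t * u (w, t) \<partial>cut_lt n w)) \<in> bm ?C"
   using add(6,7) by measurable
  then show ?case
  proof (rule measurable_cong[THEN iffD1, rotated])
   fix w assume "w \<in> space ?C"
   then have "(%t. ind {0..} t * u (w, t)) \<in> bm (cut_lt n w)"
     "(%t. ind {0..} t * v (w, t)) \<in> bm (cut_lt n w)"
    using measurable_optional_section add(1,3) sp by auto
   then show "(NN t. ind {0..} t * v (w, t) \<partial>cut_lt n w) + (NN t. ind {0..} t * u (w, t) \<partial>cut_lt n w)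
     = (NN t. ind {0..} t * (v (w, t) + u (w, t)) \<partial>cut_lt n w)"
    by (simp flip: nn_integral_add add: distrib_left)
  qed
 next
  case (seq U)
  have "(%w. SUP i. (NN t. ind {0..} t * U i (w, t) \<partial>cut_lt n w)) \<in> bm ?C"
   using seq(5) by measurable
  then show ?case
  proof (rule measurable_cong[THEN iffD1, rotated])
   fix w assume "w \<in> space ?C"
   then have m: "(%t. ind {0..} t * U i (w, t)) \<in> bm (cut_lt n w)" for i
    using measurable_optional_section seq(1) sp by auto
   have "(SUP i. (NN t. ind {0..} t * U i (w, t) \<partial>cut_lt n w)) = (NN t. (SUP i. ind {0..} t * U i (w, t)) \<partial>cut_lt n w)"
    using m seq(3) by (intro nn_integral_monotone_convergence_SUP[symmetric])
     (auto simp: incseq_def le_fun_def intro!: mult_left_mono)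
   also have "... = (NN t. ind {0..} t * (SUP i. U i) (w, t) \<partial>cut_lt n w)"
    by (intro nn_integral_cong) (simp add: SUP_mult_left_ennreal image_comp)
   finally show "(SUP i. (NN t. ind {0..} t * U i (w, t) \<partial>cut_lt n w)) = (NN t. ind {0..} t * (SUP i. U i) (w, t) \<partial>cut_lt n w)" .
  qed
 qed
qed

lemma measurable_lt_integral:
 assumes \<mu>: "\<mu> \<in> space (prob_algebra borel)" and \<phi>: "\<phi> \<in> bm optional"
 shows "(%w. NN v. ind {0..} v * \<phi> (w, v) \<partial>lt w) \<in> bm (completion (init_law P \<mu>))"
proof -
 let ?I = "init_law P \<mu>"
 have "(%w. SUP n::nat. NN v. ind {0..} v * \<phi> (w, v) \<partial>cut_lt n w) \<in> bm (completion ?I)"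
  using measurable_cut_lt[OF \<mu> _ \<phi>] by measurable
 then show ?thesis
 proof (rule completion_measurable_AE)
  show "AE w in ?I. (NN v. ind {0..} v * \<phi> (w, v) \<partial>lt w) = (SUP n::nat. NN v. ind {0..} v * \<phi> (w, v) \<partial>cut_lt n w)"
   using regular_init[OF \<mu>] AE_space
  proof eventually_elim
   case (elim w)
   then have w: "w \<in> paths" using sets_eq_imp_space_eq[OF sets_init_law[OF \<mu>]] by simp
   note m = measurable_optional_section[OF \<phi> w]
   have "(SUP n::nat. NN v. ind {0..} v * \<phi> (w, v) \<partial>cut_lt n w)
     = (SUP n::nat. NN v. ind {0..real n} v * (ind {0..} v * \<phi> (w, v)) \<partial>lt w)"
    using elim(1) m by (simp add: cut_lt_def nn_integral_density)
   also have "... = (NN v. (SUP n::nat. ind {0..real n} v * (ind {0..} v * \<phi> (w, v))) \<partial>lt w)"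
    using m by (intro nn_integral_monotone_convergence_SUP[symmetric])
     (auto simp: incseq_def le_fun_def indicator_def)
   also have "... = (NN v. ind {0..} v * \<phi> (w, v) \<partial>lt w)"
   proof (rule nn_integral_cong)
    fix v :: real
    obtain n :: nat where n: "v <= real n" using real_arch_simple by blast
    show "(SUP n::nat. ind {0..real n} v * (ind {0..} v * \<phi> (w, v))) = ind {0..} v * \<phi> (w, v)"
    proof (rule antisym)
     show "(SUP n::nat. ind {0..real n} v * (ind {0..} v * \<phi> (w, v))) <= ind {0..} v * \<phi> (w, v)"
      by (rule SUP_least) (auto simp: indicator_def)
     show "ind {0..} v * \<phi> (w, v) <= (SUP n::nat. ind {0..real n} v * (ind {0..} v * \<phi> (w, v)))"
      by (rule SUP_upper2[of n]) (use n in "auto simp: indicator_def")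
    qed
   qed
   finally show ?case by simp
  qed
 qed simp
qed

end

lemma exp_law_head:
 assumes q: "0 < q"
 shows "(NN s. ind {s. ennreal s < t} s \<partial>exp_law q) = ennreal (one_minus_exp q t)"
proof -
 interpret prob_space "exp_law q" by (rule prob_space_exp_law[OF q])
 have "(NN s. ind {s. ennreal s < t} s \<partial>exp_law q) + (NN s. ind {s. t <= ennreal s} s \<partial>exp_law q)
   = (NN s. ind {s. ennreal s < t} s + ind {s. t <= ennreal s} s \<partial>exp_law q)"
  by (rule nn_integral_add[symmetric]) measurable
 also have "... = (NN s. 1 \<partial>exp_law q)" by (intro nn_integral_cong) (auto simp: indicator_def)
 also have "... = 1" using emeasure_space_1 by simp
 finally have "(NN s. ind {s. ennreal s < t} s \<partial>exp_law q) + exp_ennreal q t = 1"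
  by (simp only: exp_law_tail[OF q])
 moreover have "ennreal (one_minus_exp q t) + exp_ennreal q t = 1"
  using q by (cases t) (auto simp: one_minus_exp_def exp_ennreal_def simp flip: ennreal_plus)
 ultimately have "exp_ennreal q t + (NN s. ind {s. ennreal s < t} s \<partial>exp_law q)
   = exp_ennreal q t + ennreal (one_minus_exp q t)"
  by (simp only: add.commute)
 then show ?thesis
  unfolding ennreal_add_left_cancel by (auto simp: exp_ennreal_def split: if_splits)
qed

text \<open>The probability that \<open>e\<^sub>q\<close> falls between \<open>u\<close> and the end of the excursion.\<close>

definition exc_tail :: "real => real => path => ennreal" where
 "exc_tail q u ex = (NN s. ind {s. u < s & ennreal s < exc_length ex} s \<partial>exp_law q)"

lemma exc_tail_le_1: assumes "0 < q" shows "exc_tail q u ex <= 1"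
proof -
 interpret prob_space "exp_law q" by (rule prob_space_exp_law[OF assms])
 have "exc_tail q u ex <= (NN s. 1 \<partial>exp_law q)"
  unfolding exc_tail_def by (intro nn_integral_mono) (auto simp: indicator_def)
 then show ?thesis using emeasure_space_1 by simp
qed

lemma exc_tail_0: assumes "0 < q" shows "exc_tail q 0 ex = ennreal (one_minus_exp q (exc_length ex))"
proof -
 have ne: "AE s in exp_law q. 0 < s"
  unfolding exp_law_def by (subst AE_density) (auto simp: exponential_density_def intro: AE_mp[OF AE_lborel_singleton[of 0]])
 have "exc_tail q 0 ex = (NN s. ind {s. ennreal s < exc_length ex} s \<partial>exp_law q)"
  unfolding exc_tail_def
  by (rule nn_integral_cong_AE) (use ne in "eventually_elim, auto simp: indicator_def")
 then show ?thesis using exp_law_head[OF assms] by simp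
qed

lemma excursion_iff:
 "ex \<in> excursions ==> 0 < t ==> ennreal t < exc_length ex \<longleftrightarrow> ex t ~= Some 0"
 unfolding excursions_def by (metis (mono_tags, lifting) less_imp_le mem_Collect_eq)

lemma measurable_exc_path: "(%ex. ex) \<in> exc_space \<rightarrow>\<^sub>M path_space"
 by (rule measurable_restrict_space1) simp

lemma measurable_exc_length_pair:
 assumes u: "0 <= u"
 shows "{z \<in> space (exc_space \<Otimes>\<^sub>M borel). u < snd z & ennreal (snd z) < exc_length (fst z)} \<in> sets (exc_space \<Otimes>\<^sub>M borel)"
proof -
 let ?M = "exc_space \<Otimes>\<^sub>M (borel :: real measure)"
 have Z: "{z \<in> space ?M. 0 <= snd z & fst z (snd z) \<in> Some ` {0}} \<in> sets ?M"
  by (intro measurable_eval measurable_compose[OF measurable_fst measurable_exc_path]) simp_all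
 have "{z \<in> space ?M. u < snd z & ennreal (snd z) < exc_length (fst z)}
   = {z \<in> space ?M. u < snd z} - {z \<in> space ?M. 0 <= snd z & fst z (snd z) \<in> Some ` {0}}"
 proof (rule set_eqI)
  fix z :: "path \<times> real"
  have "u < snd z ==> fst z \<in> excursions ==> ennreal (snd z) < exc_length (fst z) \<longleftrightarrow> fst z (snd z) ~= Some 0"
   using u by (intro excursion_iff) auto
  moreover have "z \<in> space ?M ==> fst z \<in> excursions"
   by (simp add: space_pair_measure space_restrict_space mem_Times_iff)
  moreover have "fst z (snd z) \<in> Some ` {0} \<longleftrightarrow> fst z (snd z) = Some 0" by simp
  moreover have "u < snd z ==> 0 <= snd z" using u by simp
  ultimately show "z \<in> {z \<in> space ?M. u < snd z & ennreal (snd z) < exc_length (fst z)} \<longleftrightarrow>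
    z \<in> {z \<in> space ?M. u < snd z} - {z \<in> space ?M. 0 <= snd z & fst z (snd z) \<in> Some ` {0}}"
   unfolding mem_Collect_eq Diff_iff by blast
 qed
 also have "... \<in> sets ?M" by (rule sets.Diff[OF _ Z]) measurable
 finally show ?thesis .
qed

lemma measurable_exc_tail:
 assumes q: "0 < q" and u: "0 <= u" shows "exc_tail q u \<in> bm exc_space"
proof -
 interpret prob_space "exp_law q" by (rule prob_space_exp_law[OF q])
 have "(%(ex, s). ind {z \<in> space (exc_space \<Otimes>\<^sub>M borel). u < snd z & ennreal (snd z) < exc_length (fst z)} (ex, s) :: ennreal)
   \<in> bm (exc_space \<Otimes>\<^sub>M exp_law q)"
  using measurable_exc_length_pair[OF u] by (simp cong: measurable_cong_sets)
 then have "(%ex. NN s. ind {z \<in> space (exc_space \<Otimes>\<^sub>M borel). u < snd z & ennreal (snd z) < exc_length (fst z)} (ex, s) \<partial>exp_law q)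
   \<in> bm exc_space"
  by (rule borel_measurable_nn_integral)
 then show ?thesis
  unfolding exc_tail_def
 proof (rule measurable_cong[THEN iffD1, rotated])
  fix ex assume "ex \<in> space exc_space"
  then show "(NN s. ind {z \<in> space (exc_space \<Otimes>\<^sub>M borel). u < snd z & ennreal (snd z) < exc_length (fst z)} (ex, s) \<partial>exp_law q)
    = (NN s. ind {s. u < s & ennreal s < exc_length ex} s \<partial>exp_law q)"
   by (intro nn_integral_cong) (simp add: space_pair_measure indicator_def)
 qed
qed

context nice_markov_process
begin

section \<open>The last exit formula\<close>

text \<open>The value of \<open>\<phi>\<close> at the last zero before \<open>s\<close> times \<open>\<Gamma>\<close> of the path after it and of its age; averaged over the
exponential time it gives the left side of the last exit formula.\<close>

definition exit_fun :: "(path \<times> real => ennreal) => (path \<times> real => ennreal) => path \<times> real => ennreal" where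
 "exit_fun \<Gamma> \<phi> z = (if hit0 (fst z) <= ennreal (snd z)
   then \<phi> (fst z, gz (snd z) (fst z)) * \<Gamma> (shift (gz (snd z) (fst z)) (fst z), snd z - gz (snd z) (fst z)) else 0)"

definition exit_int :: "real => (path \<times> real => ennreal) => (path \<times> real => ennreal) => path => ennreal" where
 "exit_int q \<Gamma> \<phi> w = (NN s. exit_fun \<Gamma> \<phi> (w, s) \<partial>exp_law q)"

definition lt_int :: "real => (path \<times> real => ennreal) => path => ennreal" where
 "lt_int q \<phi> w = (NN v. ind {0..} v * (ennreal (exp (- q * v)) * \<phi> (w, v)) \<partial>lt w)"

lemma measurable_fst_path: "fst \<in> prod_space \<rightarrow>\<^sub>M path_space"
 by (rule measurable_compose[OF measurable_fst measurable_ucomplI]) simp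

lemma measurable_exit_fun:
 assumes \<Gamma>: "\<Gamma> \<in> bm (path_space \<Otimes>\<^sub>M borel)" and \<phi>: "\<phi> \<in> bm optional"
 shows "exit_fun \<Gamma> \<phi> \<in> bm prod_space"
proof -
 let ?M = "prod_space"
 note [measurable] = measurable_gz measurable_hit0_fst measurable_fst_path
 have [measurable]: "(%z. \<phi> (fst z, gz (snd z) (fst z))) \<in> bm ?M"
  by (rule measurable_compose[OF measurable_optionalI \<phi>]) (auto simp: gz_nonneg measurable_gz measurable_fst_path)
 have sh: "(%z. shift (gz (snd z) (fst z)) (fst z)) \<in> ?M \<rightarrow>\<^sub>M path_space"
  by (intro measurable_shift measurable_gz measurable_fst_path gz_nonneg)
 have [measurable]: "(%z. \<Gamma> (shift (gz (snd z) (fst z)) (fst z), snd z - gz (snd z) (fst z))) \<in> bm ?M"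
  by (rule measurable_compose[OF measurable_Pair[OF sh] \<Gamma>]) measurable
 show ?thesis unfolding exit_fun_def[abs_def] by measurable
qed

lemma measurable_section:
 assumes f: "f \<in> bm prod_space" and w: "w \<in> paths"
 shows "(%s::real. f (w, s) :: ennreal) \<in> bm borel"
 by (rule measurable_compose[OF measurable_Pair1' f]) (simp add: w)

lemma measurable_exit_int:
 assumes q: "0 < q" and "\<Gamma> \<in> bm (path_space \<Otimes>\<^sub>M borel)" "\<phi> \<in> bm optional"
 shows "exit_int q \<Gamma> \<phi> \<in> bm (ucompl path_space)"
proof -
 interpret prob_space "exp_law q" by (rule prob_space_exp_law[OF q])
 have "(%(w, s). exit_fun \<Gamma> \<phi> (w, s)) \<in> bm (ucompl path_space \<Otimes>\<^sub>M exp_law q)"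
  using measurable_exit_fun[OF assms(2,3)] by (simp cong: measurable_cong_sets)
 from borel_measurable_nn_integral[OF this] show ?thesis
  unfolding exit_int_def[abs_def] .
qed

text \<open>For \<open>\<phi> = 1\<^sub>A 1\<^sub>[\<^sub>r\<^sub>,\<^sub>\<infinity>\<^sub>)\<close> a contribution requires the last zero not to lie before \<open>r\<close>; it is then the last zero of the shifted
path.  Lack of memory of the exponential time produces the factor.\<close>

lemma exit_int_shift:
 assumes q: "0 < q" and \<Gamma>: "\<Gamma> \<in> bm (path_space \<Otimes>\<^sub>M borel)"
  and w: "w \<in> paths" "closed (zeros w)" and r: "0 <= r"
 shows "exit_int q \<Gamma> (ind (A \<times> {r..})) w
      = ind A w * (ennreal (exp (- q * r)) * exit_int q \<Gamma> (%_. 1) (shift r w))"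
proof -
 let ?f = "%s. exit_fun \<Gamma> (%_. 1) (shift r w, s - r)"
 have w': "shift r w \<in> paths" by (rule shift_paths[OF r w(1)])
 have m: "exit_fun \<Gamma> (%_. 1) \<in> bm prod_space"
  by (rule measurable_exit_fun[OF \<Gamma>]) simp
 have f: "?f \<in> bm borel"
  using measurable_section[OF m w'] by (rule measurable_compose[rotated]) simp
 have "AE s in exp_law q. exit_fun \<Gamma> (ind (A \<times> {r..})) (w, s)
   = ind A w * (ind {r..} s * ?f s)"
  using AE_exp_law_nonneg
 proof eventually_elim
  case (elim s)
  note g = gz_shift[OF w r elim]
  show ?case
  proof (cases "r <= s & hit0 (shift r w) <= ennreal (s - r)")
   case True
   then have eq: "gz s w = r + gz (s - r) (shift r w)" and h: "hit0 w <= ennreal s" "r <= gz s w"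
    using g by auto
   have "shift (gz s w) w = shift (gz (s - r) (shift r w)) (shift r w)"
    unfolding eq using shift_shift[OF r gz_nonneg] by simp
   then show ?thesis using True h eq
    by (simp add: exit_fun_def indicator_def algebra_simps)
  next
   case False
   then have "~ (hit0 w <= ennreal s & r <= gz s w)" using g(1) by blast
   then show ?thesis using False by (auto simp: exit_fun_def indicator_def)
  qed
 qed
 then have "exit_int q \<Gamma> (ind (A \<times> {r..})) w = (NN s. ind A w * (ind {r..} s * ?f s) \<partial>exp_law q)"
  unfolding exit_int_def by (rule nn_integral_cong_AE)
 also have "... = ind A w * (NN s. ind {r..} s * ?f s \<partial>exp_law q)"
  using f by (intro nn_integral_cmult) simp
 also have "(NN s. ind {r..} s * ?f s \<partial>exp_law q) = ennreal (exp (- q * r)) * (NN s. ?f (r + s) \<partial>exp_law q)"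
  by (rule nn_integral_exp_law_shift[OF f r q])
 finally show ?thesis by (simp add: exit_int_def)
qed

lemma exit_int_post_hit:
 assumes q: "0 < q" and \<Gamma>: "\<Gamma> \<in> bm (path_space \<Otimes>\<^sub>M borel)"
  and w: "w \<in> paths" "closed (zeros w)"
 shows "exit_int q \<Gamma> (%_. 1) w = exp_ennreal q (hit0 w) * exit_int q \<Gamma> (%_. 1) (post_hit w)"
proof (cases "hit0 w = top")
 case True
 then show ?thesis
  by (simp add: exit_int_def exit_fun_def exp_ennreal_def top_unique)
next
 case False
 then obtain T where T: "0 <= T" "hit0 w = ennreal T" by (cases "hit0 w") auto
 have "exit_int q \<Gamma> (%_. 1) w = exit_int q \<Gamma> (ind (paths \<times> {T..})) w"
  unfolding exit_int_def
 proof (rule nn_integral_cong_AE, use AE_exp_law_nonneg[of q] in eventually_elim)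
  case (elim s)
  show ?case
  proof (cases "hit0 w <= ennreal s")
   case hit: True
   note g = gz_attained[OF w elim hit]
   have "hit0 w <= ennreal (gz s w)" unfolding hit0_def using g(1) by (auto intro: Inf_lower)
   then have "T <= gz s w" using T gz_nonneg[of s w] by (simp add: ennreal_le_iff)
   then show ?thesis using w by (simp add: exit_fun_def)
  qed (simp add: exit_fun_def)
 qed
 also have "... = ind paths w * (ennreal (exp (- q * T)) * exit_int q \<Gamma> (%_. 1) (shift T w))"
  by (rule exit_int_shift[OF q \<Gamma> w T(1)])
 finally show ?thesis using w T by (simp add: exp_ennreal_def post_hit_def)
qed

lemma local_time_additive_const:
 assumes "0 <= r"
 shows "AE w in P x. \<forall>t\<ge>0. L (r + t) w = L r w + L t (shift r w)"
 using local_time_additive[OF return_in[of x] stopping_time_const[of "usual_filt P" "ennreal r"], unfolded init_law_return] assms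
 by simp

lemma measurable_exp_phi:
 "\<phi> \<in> bm optional ==> (%z. ennreal (exp (- q * snd z)) * \<phi> z) \<in> bm optional"
 using measurable_optional_snd by measurable

lemma measurable_lt_int_init:
 "\<mu> \<in> space (prob_algebra borel) ==> \<phi> \<in> bm optional ==>
   lt_int q \<phi> \<in> bm (completion (init_law P \<mu>))"
 using measurable_lt_integral[OF _ measurable_exp_phi, of \<mu> \<phi> q]
 unfolding lt_int_def[abs_def] by simp

lemma measurable_lt_int:
 "\<phi> \<in> bm optional ==> lt_int q \<phi> \<in> bm (cP x)"
 using measurable_lt_int_init[OF return_in[of x]] by simp

lemma lt_int_shift:
 assumes w: "regular w" "regular (shift r w)" and r: "0 <= r"
  and add: "!!t. 0 <= t ==> L (r + t) w = L r w + L t (shift r w)"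
 shows "lt_int q (ind (A \<times> {r..})) w
      = ind A w * (ennreal (exp (- q * r)) * lt_int q (%_. 1) (shift r w))"
proof -
 have "lt_int q (ind (A \<times> {r..})) w
   = (NN v. ind A w * (ind {r..} v * ennreal (exp (- q * v))) \<partial>lt w)"
  unfolding lt_int_def using r
  by (intro nn_integral_cong) (auto simp: indicator_def)
 also have "... = ind A w * (NN v. ind {r..} v * ennreal (exp (- q * v)) \<partial>lt w)"
  by (rule nn_integral_cmult) simp
 also have "(NN v. ind {r..} v * ennreal (exp (- q * v)) \<partial>lt w) = (NN v. ennreal (exp (- q * (r + v))) \<partial>lt (shift r w))"
  by (rule lt_shift[OF w r add]) auto
 also have "... = (NN v. ennreal (exp (- q * r)) * (ind {0..} v * ennreal (exp (- q * v))) \<partial>lt (shift r w))"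
 proof (rule nn_integral_cong_AE, use lt_AE_pos[OF w(2)] in eventually_elim)
  case (elim v)
  have "exp (- q * (r + v)) = exp (- q * r) * exp (- q * v)"
   by (simp add: exp_add[symmetric] algebra_simps)
  then show ?case using elim by (simp add: ennreal_mult)
 qed
 also have "... = ennreal (exp (- q * r)) * lt_int q (%_. 1) (shift r w)"
  unfolding lt_int_def by (subst nn_integral_cmult[symmetric]) simp_all
 finally show ?thesis .
qed

lemma lt_int_post_hit:
 "AE w in P x. lt_int q (%_. 1) w = exp_ennreal q (hit0 w) * lt_int q (%_. 1) (post_hit w)"
 using regular_P[of x] regular_post_hit[of x] local_time_zero_before_hit[of x] AE_space
  local_time_additive[OF return_in[of x] stopping_time_hit0, unfolded init_law_return]
proof eventually_elim
 case (elim w)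
 note reg = elim(1)
 show ?case
 proof (cases "hit0 w = top")
  case True
  have "AE v in lt w. False"
  proof -
   have "{0<..real n} \<in> null_sets (lt w)" for n
    using lt_Ioc[OF reg, of 0 "real n"] elim(3) reg True by (auto simp: null_sets_def regular_def)
   then have "(\<Union>n. {0<..real n}) \<in> null_sets (lt w)" by (rule null_sets_UN)
   moreover have "(\<Union>n. {0<..real n}) = {0<..}" using real_arch_simple by auto
   ultimately have "AE v in lt w. v \<notin> {0<..}" by (metis AE_not_in)
   with lt_AE_pos[OF reg] show ?thesis by eventually_elim simp
  qed
  then have "AE v in lt w. ind {0..} v * (ennreal (exp (- q * v)) * 1) = 0"
   by eventually_elim simp
  then have "lt_int q (%_. 1) w = (NN v. 0 \<partial>lt w)"
   unfolding lt_int_def by (rule nn_integral_cong_AE)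
  then show ?thesis using True by (simp add: exp_ennreal_def)
 next
  case False
  then obtain T where T: "0 <= T" "hit0 w = ennreal T" by (cases "hit0 w") auto
  have ph: "post_hit w = shift T w" using T by (simp add: post_hit_def)
  have reg': "regular (shift T w)" using elim(2) T ph by simp
  have "L T w = 0" using elim(3) T by simp
  then have "{0<..T} \<in> null_sets (lt w)"
   using lt_Ioc[OF reg T(1)] T reg by (auto simp: null_sets_def regular_def)
  then have "AE v in lt w. v \<notin> {0<..T}" by (rule AE_not_in)
  with lt_AE_pos[OF reg] have "AE v in lt w. T <= v" by eventually_elim auto
  then have "AE v in lt w. ind {0..} v * (ennreal (exp (- q * v)) * 1)
    = ind {0..} v * (ennreal (exp (- q * v)) * ind (UNIV \<times> {T..}) (w, v))"
   by eventually_elim simp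
  then have "lt_int q (%_. 1) w = lt_int q (ind (UNIV \<times> {T..})) w"
   unfolding lt_int_def by (rule nn_integral_cong_AE)
  also have "... = ind UNIV w * (ennreal (exp (- q * T)) * lt_int q (%_. 1) (shift T w))"
   using elim(5) T by (intro lt_int_shift[OF reg reg' T(1)]) (simp add: post_hit_def)
  finally show ?thesis using T ph by (simp add: exp_ennreal_def)
 qed
qed

definition hit_laplace :: "real => real => ennreal" where
 "hit_laplace q x = (NN w. exp_ennreal q (hit0 w) \<partial>P x)"

definition total_potential :: "real => ennreal" where
 "total_potential q = (NN w. lt_int q (%_. 1) w \<partial>P 0)"

definition exit_weight :: "real => (path \<times> real => ennreal) => ennreal" where
 "exit_weight q \<Gamma> = (NN w. exit_int q \<Gamma> (%_. 1) w \<partial>P 0)"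

lemma one_optional: "(%_. 1 :: ennreal) \<in> bm optional"
 by simp

lemma exit_int_at:
 assumes q: "0 < q" and \<Gamma>: "\<Gamma> \<in> bm (path_space \<Otimes>\<^sub>M borel)"
 shows "(NN w. exit_int q \<Gamma> (%_. 1) w \<partial>P x) = hit_laplace q x * exit_weight q \<Gamma>"
proof -
 have "(NN w. exit_int q \<Gamma> (%_. 1) w \<partial>P x)
   = (NN w. exp_ennreal q (hit0 w) * exit_int q \<Gamma> (%_. 1) (post_hit w) \<partial>P x)"
 proof (rule nn_integral_cong_AE, use zeros_closed[of x] AE_space in eventually_elim)
  case (elim w)
  then show ?case by (intro exit_int_post_hit[OF q \<Gamma>]) auto
 qed
 also have "... = hit_laplace q x * exit_weight q \<Gamma>"
  unfolding hit_laplace_def exit_weight_def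
  by (rule strong_markov_integral[OF ucompl_completion[OF measurable_exit_int[OF q \<Gamma> one_optional]] q])
 finally show ?thesis .
qed

lemma lt_int_at:
 assumes q: "0 < q"
 shows "(NN w. lt_int q (%_. 1) w \<partial>P x) = hit_laplace q x * total_potential q"
proof -
 have "(NN w. lt_int q (%_. 1) w \<partial>P x)
   = (NN w. exp_ennreal q (hit0 w) * lt_int q (%_. 1) (post_hit w) \<partial>P x)"
  by (rule nn_integral_cong_AE[OF lt_int_post_hit])
 also have "... = hit_laplace q x * total_potential q"
  unfolding hit_laplace_def total_potential_def
  by (rule strong_markov_integral[OF measurable_lt_int[OF one_optional] q])
 finally show ?thesis .
qed

text \<open>Both sides are functionals of the path shifted by \<open>r\<close>, and then of the path after its first zero.  Hence each is the same
factor, made of \<open>A\<close>, \<open>r\<close> and the Laplace transform of the hitting time, times a constant under \<open>P 0\<close>.\<close>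

lemma last_exit_base:
 assumes q: "0 < q" and \<Gamma>: "\<Gamma> \<in> bm (path_space \<Otimes>\<^sub>M borel)"
  and r: "0 <= r" and A: "A \<in> sets (filt r)"
 shows "total_potential q * (NN w. exit_int q \<Gamma> (ind (A \<times> {r..})) w \<partial>P x)
      = exit_weight q \<Gamma> * (NN w. lt_int q (ind (A \<times> {r..})) w \<partial>P x)"
proof -
 let ?e = "ennreal (exp (- q * r))" and ?C = "cP x"
 have fin: "finite_measure (init_law P (law_at r x))"
  using init_law_in[OF law_at_in[OF r, of x]] by (simp add: space_prob_algebra prob_space_def)
 have AM: "A \<in> sets ?C" using A sets_nat_filt_mono[of "ennreal r" top] by auto
 have sh: "shift r \<in> P x \<rightarrow>\<^sub>M path_space"
  using measurable_shift_const[OF r] by (simp cong: measurable_cong_sets)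
 have step: "(NN w. ind A w * (?e * Y (shift r w)) \<partial>P x)
   = ?e * (NN w. ind A w * hit_laplace q (pos r w) \<partial>P x) * c"
  if Y: "Y \<in> bm (completion (init_law P (law_at r x)))"
   and Yy: "!!y. (NN w. Y w \<partial>P y) = hit_laplace q y * c" for Y c
 proof -
  have Ysh: "(%w. Y (shift r w)) \<in> bm ?C"
  proof -
   from completion_ex_borel_measurable[OF Y]
   obtain Y' where Y': "Y' \<in> bm path_space" "AE w in init_law P (law_at r x). Y w = Y' w"
    using measurable_cong_sets[OF sets_init_law[OF law_at_in[OF r, of x]] refl, of borel] by blast
   have "(%w. Y' (shift r w)) \<in> bm ?C"
    by (rule measurable_completion[OF measurable_compose[OF sh Y'(1)]])
   then show ?thesis
    by (rule completion_measurable_AE[OF _ markov_AE(1)[OF r Y'(2)]]) simp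
  qed
  have H: "(%y. hit_laplace q y) \<in> bm (ucompl borel)"
   unfolding hit_laplace_def
   by (rule nn_integral_kernel_ucompl[OF kernel measurable_compose[OF measurable_hit0 measurable_exp_ennreal]])
  have "pos r \<in> ucompl path_space \<rightarrow>\<^sub>M ucompl borel"
   using measurable_pos[of r top] r by (intro measurable_ucompl_lift measurable_ucomplI) simp
  from measurable_compose[OF this H]
  have Hp: "(%w. hit_laplace q (pos r w)) \<in> bm ?C" by (rule ucompl_completion)
  have "(NN w. ind A w * (?e * Y (shift r w)) \<partial>P x) = (NN w. ?e * (ind A w * Y (shift r w)) \<partial>?C)"
   by (simp add: nn_integral_completion mult.left_commute)
  also have "... = ?e * (NN w. ind A w * Y (shift r w) \<partial>?C)"
   using AM Ysh by (intro nn_integral_cmult) simp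
  also have "(NN w. ind A w * Y (shift r w) \<partial>?C) = (NN w. ind A w * (hit_laplace q (pos r w) * c) \<partial>?C)"
   unfolding nn_integral_completion using markov_integral[OF r A Y] Yy by simp
  also have "... = (NN w. ind A w * hit_laplace q (pos r w) \<partial>?C) * c"
   using AM Hp by (subst nn_integral_multc[symmetric]) (simp_all add: mult.assoc)
  finally show ?thesis by (simp add: nn_integral_completion mult.assoc)
 qed
 have "(NN w. exit_int q \<Gamma> (ind (A \<times> {r..})) w \<partial>P x)
   = (NN w. ind A w * (?e * exit_int q \<Gamma> (%_. 1) (shift r w)) \<partial>P x)"
 proof (rule nn_integral_cong_AE, use zeros_closed[of x] AE_space in eventually_elim)
  case (elim w)
  then show ?case by (intro exit_int_shift[OF q \<Gamma> _ _ r]) auto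
 qed
 also have "... = ?e * (NN w. ind A w * hit_laplace q (pos r w) \<partial>P x) * exit_weight q \<Gamma>"
 proof (rule step)
  show "exit_int q \<Gamma> (%_. 1) \<in> bm (completion (init_law P (law_at r x)))"
   by (rule measurable_ucompl_completion[OF measurable_exit_int[OF q \<Gamma> one_optional] fin sets_init_law[OF law_at_in[OF r]]])
 qed (rule exit_int_at[OF q \<Gamma>])
 finally have 1: "(NN w. exit_int q \<Gamma> (ind (A \<times> {r..})) w \<partial>P x)
   = ?e * (NN w. ind A w * hit_laplace q (pos r w) \<partial>P x) * exit_weight q \<Gamma>" .
 have "(NN w. lt_int q (ind (A \<times> {r..})) w \<partial>P x)
   = (NN w. ind A w * (?e * lt_int q (%_. 1) (shift r w)) \<partial>P x)"
 proof (rule nn_integral_cong_AE,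
   use regular_P[of x] markov_AE(1)[OF r regular_init[OF law_at_in[OF r, of x]]] local_time_additive_const[OF r, of x] in eventually_elim)
  case (elim w)
  then show ?case by (intro lt_int_shift[OF _ _ r]) auto
 qed
 also have "... = ?e * (NN w. ind A w * hit_laplace q (pos r w) \<partial>P x) * total_potential q"
  by (rule step[OF measurable_lt_int_init[OF law_at_in[OF r] one_optional] lt_int_at[OF q]])
 finally show ?thesis unfolding 1 by (simp add: ac_simps)
qed

lemma last_exit_value:
 assumes q: "0 < q" and \<Gamma>: "\<Gamma> \<in> bm (path_space \<Otimes>\<^sub>M borel)"
 shows "\<exists>N. sets N = sets optional & (\<forall>\<phi>\<in>bm optional.
  c * (NN w. exit_int q \<Gamma> \<phi> w \<partial>cP x) = (NN z. \<phi> z \<partial>N))"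
proof (rule functional_measure)
 let ?C = "cP x"
 have m: "(%s. exit_fun \<Gamma> \<phi> (w, s)) \<in> bm (exp_law q)"
  if "\<phi> \<in> bm optional" "w \<in> space ?C" for \<phi> w
  using measurable_section[OF measurable_exit_fun[OF \<Gamma> that(1)], of w] that(2) by simp
 have M: "exit_int q \<Gamma> \<phi> \<in> bm ?C" if "\<phi> \<in> bm optional" for \<phi>
  by (rule ucompl_completion[OF measurable_exit_int[OF q \<Gamma> that]])
 show "c * (NN w. exit_int q \<Gamma> f w \<partial>?C) = c * (NN w. exit_int q \<Gamma> g w \<partial>?C)"
  if "!!z. z \<in> space optional ==> f z = g z" for f g
  using that unfolding exit_int_def exit_fun_def
  by (intro arg_cong2[where f = "(*)"] nn_integral_cong refl) (simp add: gz_nonneg)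
 show "c * (NN w. exit_int q \<Gamma> (%z. f z + g z) w \<partial>?C)
   = c * (NN w. exit_int q \<Gamma> f w \<partial>?C) + c * (NN w. exit_int q \<Gamma> g w \<partial>?C)"
  if f: "f \<in> bm optional" and g: "g \<in> bm optional" for f g
 proof -
  have "exit_int q \<Gamma> (%z. f z + g z) w = exit_int q \<Gamma> f w + exit_int q \<Gamma> g w"
   if "w \<in> space ?C" for w
   unfolding exit_int_def
   by (subst nn_integral_add[OF m[OF f that] m[OF g that], symmetric])
     (auto intro!: nn_integral_cong simp: exit_fun_def distrib_right)
  then have "(NN w. exit_int q \<Gamma> (%z. f z + g z) w \<partial>?C)
    = (NN w. exit_int q \<Gamma> f w + exit_int q \<Gamma> g w \<partial>?C)"
   by (rule nn_integral_cong)
  then show ?thesis using M[OF f] M[OF g] by (simp add: nn_integral_add distrib_left)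
 qed
 show "c * (NN w. exit_int q \<Gamma> (%z. d * f z) w \<partial>?C) = d * (c * (NN w. exit_int q \<Gamma> f w \<partial>?C))"
  if f: "f \<in> bm optional" for d f
 proof -
  have "exit_int q \<Gamma> (%z. d * f z) w = d * exit_int q \<Gamma> f w" if "w \<in> space ?C" for w
   unfolding exit_int_def
   by (subst nn_integral_cmult[OF m[OF f that], symmetric])
     (auto intro!: nn_integral_cong simp: exit_fun_def mult.assoc)
  then have "(NN w. exit_int q \<Gamma> (%z. d * f z) w \<partial>?C) = (NN w. d * exit_int q \<Gamma> f w \<partial>?C)"
   by (rule nn_integral_cong)
  then show ?thesis using M[OF f] by (simp add: nn_integral_cmult mult.left_commute)
 qed
 show "c * (NN w. exit_int q \<Gamma> (%z. SUP n. f n z) w \<partial>?C) = (SUP n. c * (NN w. exit_int q \<Gamma> (f n) w \<partial>?C))"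
  if f: "!!n::nat. f n \<in> bm optional" and inc: "incseq f" for f
 proof -
  have inc': "incseq (%n. exit_fun \<Gamma> (f n))"
   using inc by (auto simp: incseq_def le_fun_def exit_fun_def intro!: mult_right_mono)
  have "exit_int q \<Gamma> (%z. SUP n. f n z) w = (SUP n. exit_int q \<Gamma> (f n) w)" if "w \<in> space ?C" for w
  proof -
   have "(SUP n. exit_int q \<Gamma> (f n) w) = (NN s. (SUP n. exit_fun \<Gamma> (f n) (w, s)) \<partial>exp_law q)"
    unfolding exit_int_def
    using inc' m[OF f that] by (intro nn_integral_monotone_convergence_SUP[symmetric]) (auto simp: incseq_def le_fun_def)
   also have "... = exit_int q \<Gamma> (%z. SUP n. f n z) w"
    unfolding exit_int_def exit_fun_def
    by (intro nn_integral_cong) (simp add: SUP_mult_right_ennreal)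
   finally show ?thesis by simp
  qed
  then have "(NN w. exit_int q \<Gamma> (%z. SUP n. f n z) w \<partial>?C) = (NN w. (SUP n. exit_int q \<Gamma> (f n) w) \<partial>?C)"
   by (rule nn_integral_cong)
  also have "... = (SUP n. NN w. exit_int q \<Gamma> (f n) w \<partial>?C)"
  proof (rule nn_integral_monotone_convergence_SUP)
   show "incseq (%n. exit_int q \<Gamma> (f n))"
    using inc' by (auto simp: incseq_def le_fun_def exit_int_def intro!: nn_integral_mono)
  qed (rule M[OF f])
  finally show ?thesis by (simp add: SUP_mult_left_ennreal)
 qed
qed

lemma local_time_functional:
 "\<exists>N. sets N = sets optional & (\<forall>\<phi>\<in>bm optional.
  c * (NN w. lt_int q \<phi> w \<partial>cP x) = (NN z. \<phi> z \<partial>N))"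
proof (rule functional_measure)
 let ?C = "cP x"
 have m: "(%v. ind {0..} v * (ennreal (exp (- q * v)) * \<phi> (w, v))) \<in> bm (lt w)"
  if "\<phi> \<in> bm optional" "w \<in> space ?C" for \<phi> w
  using measurable_optional_section[OF measurable_exp_phi[OF that(1)], of w q] that(2) by simp
 note M = measurable_lt_int
 show "c * (NN w. lt_int q f w \<partial>?C) = c * (NN w. lt_int q g w \<partial>?C)"
  if "!!z. z \<in> space optional ==> f z = g z" for f g
 proof -
  have "lt_int q f w = lt_int q g w" if "w \<in> space ?C" for w
   unfolding lt_int_def
  proof (rule nn_integral_cong)
   fix v :: real
   show "ind {0..} v * (ennreal (exp (- q * v)) * f (w, v)) = ind {0..} v * (ennreal (exp (- q * v)) * g (w, v))"
    using \<open>!!z. z \<in> space optional ==> f z = g z\<close>[of "(w, v)"] that by (cases "0 <= v") simp_all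
  qed
  then have "(NN w. lt_int q f w \<partial>?C) = (NN w. lt_int q g w \<partial>?C)"
   by (rule nn_integral_cong)
  then show ?thesis by simp
 qed
 show "c * (NN w. lt_int q (%z. f z + g z) w \<partial>?C)
   = c * (NN w. lt_int q f w \<partial>?C) + c * (NN w. lt_int q g w \<partial>?C)"
  if f: "f \<in> bm optional" and g: "g \<in> bm optional" for f g
 proof -
  have "lt_int q (%z. f z + g z) w = lt_int q f w + lt_int q g w"
   if "w \<in> space ?C" for w
   unfolding lt_int_def
   by (subst nn_integral_add[OF m[OF f that] m[OF g that], symmetric]) (simp add: distrib_left)
  then have "(NN w. lt_int q (%z. f z + g z) w \<partial>?C)
    = (NN w. lt_int q f w + lt_int q g w \<partial>?C)"
   by (rule nn_integral_cong)
  then show ?thesis using M[OF f] M[OF g] by (simp add: nn_integral_add distrib_left)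
 qed
 show "c * (NN w. lt_int q (%z. d * f z) w \<partial>?C) = d * (c * (NN w. lt_int q f w \<partial>?C))"
  if f: "f \<in> bm optional" for d f
 proof -
  have "lt_int q (%z. d * f z) w = d * lt_int q f w" if "w \<in> space ?C" for w
   unfolding lt_int_def
   by (subst nn_integral_cmult[OF m[OF f that], symmetric]) (simp add: mult.left_commute)
  then have "(NN w. lt_int q (%z. d * f z) w \<partial>?C) = (NN w. d * lt_int q f w \<partial>?C)"
   by (rule nn_integral_cong)
  then show ?thesis using M[OF f] by (simp add: nn_integral_cmult mult.left_commute)
 qed
 show "c * (NN w. lt_int q (%z. SUP n. f n z) w \<partial>?C) = (SUP n. c * (NN w. lt_int q (f n) w \<partial>?C))"
  if f: "!!n::nat. f n \<in> bm optional" and inc: "incseq f" for f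
 proof -
  have inc': "incseq (%n v. ind {0..} v * (ennreal (exp (- q * v)) * f n (w, v)))" for w
   using inc by (auto simp: incseq_def le_fun_def intro!: mult_left_mono)
  have "lt_int q (%z. SUP n. f n z) w = (SUP n. lt_int q (f n) w)" if "w \<in> space ?C" for w
  proof -
   have "(SUP n. lt_int q (f n) w)
     = (NN v. (SUP n. ind {0..} v * (ennreal (exp (- q * v)) * f n (w, v))) \<partial>lt w)"
    unfolding lt_int_def
    using inc' m[OF f that] by (intro nn_integral_monotone_convergence_SUP[symmetric])
   also have "... = lt_int q (%z. SUP n. f n z) w"
    unfolding lt_int_def
    by (intro nn_integral_cong) (simp add: SUP_mult_left_ennreal)
   finally show ?thesis by simp
  qed
  then have "(NN w. lt_int q (%z. SUP n. f n z) w \<partial>?C) = (NN w. (SUP n. lt_int q (f n) w) \<partial>?C)"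
   by (rule nn_integral_cong)
  also have "... = (SUP n. NN w. lt_int q (f n) w \<partial>?C)"
  proof (rule nn_integral_monotone_convergence_SUP)
   show "incseq (%n. lt_int q (f n))"
    using inc' by (auto simp: incseq_def le_fun_def lt_int_def intro!: nn_integral_mono)
  qed (rule M[OF f])
  finally show ?thesis by (simp add: SUP_mult_left_ennreal)
 qed
qed

text \<open>Both sides are measures in \<open>\<phi>\<close> that agree on the \<open>\<inter>\<close>-stable generator.\<close>

theorem last_exit_formula:
 assumes q: "0 < q" and \<Gamma>: "\<Gamma> \<in> bm (path_space \<Otimes>\<^sub>M borel)" and le1: "!!z. \<Gamma> z <= 1"
  and fin: "total_potential q < top" and \<phi>: "\<phi> \<in> bm optional"
 shows "total_potential q * (NN w. exit_int q \<Gamma> \<phi> w \<partial>P x)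
      = exit_weight q \<Gamma> * (NN w. lt_int q \<phi> w \<partial>P x)"
proof -
 obtain N1 where N1: "sets N1 = sets optional & (\<forall>\<phi>\<in>bm optional.
   total_potential q * (NN w. exit_int q \<Gamma> \<phi> w \<partial>cP x) = (NN z. \<phi> z \<partial>N1))"
  using last_exit_value[OF q \<Gamma>, of "total_potential q" x] by (elim exE) (rule that)
 obtain N2 where N2: "sets N2 = sets optional & (\<forall>\<phi>\<in>bm optional.
   exit_weight q \<Gamma> * (NN w. lt_int q \<phi> w \<partial>cP x) = (NN z. \<phi> z \<partial>N2))"
  using local_time_functional[where c = "exit_weight q \<Gamma>" and q = q and x = x] by (elim exE) (rule that)
 note N1 = conjunct1[OF N1] bspec[OF conjunct2[OF N1], unfolded nn_integral_completion]
 note N2 = conjunct1[OF N2] bspec[OF conjunct2[OF N2], unfolded nn_integral_completion]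
 let ?E = "{A \<times> {r..} | A r. 0 <= r & A \<in> sets (nat_filt (ennreal (r::real)))}"
 have pE: "X \<in> sets optional" if "X \<in> ?E" for X
  using that rectangle_optional by auto
 have "N1 = N2"
 proof (rule measure_eqI_generator_eq[where E = ?E and \<Omega> = "paths \<times> {0..}" and A = "%_. paths \<times> {0..}"])
  show "Int_stable ?E" by (rule Int_stable_optional)
  show "?E \<subseteq> Pow (paths \<times> {0..})" by (rule optional_generator)
  show "emeasure N1 X = emeasure N2 X" if X: "X \<in> ?E" for X
  proof -
   obtain A r where A: "X = A \<times> {r..}" "0 <= r" "A \<in> sets (filt r)" using X by auto
   have "emeasure N1 X = (NN z. ind X z \<partial>N1)" using pE[OF X] N1(1) by simp
   also have "... = (NN z. ind X z \<partial>N2)"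
    using last_exit_base[OF q \<Gamma> A(2,3), of x] N1(2)[of "ind X"] N2(2)[of "ind X"] pE[OF X] A(1) by simp
   also have "... = emeasure N2 X" using pE[OF X] N2(1) by simp
   finally show ?thesis .
  qed
  show "sets N1 = sigma_sets (paths \<times> {0..}) ?E" "sets N2 = sigma_sets (paths \<times> {0..}) ?E"
   using N1(1) N2(1) by (simp_all add: sets_optional)
  have "paths \<times> {0..} \<in> ?E"
   using sets.top[of "nat_filt (ennreal 0)"] by (intro CollectI exI[of _ paths] exI[of _ "0 :: real"]) simp
  then show "range (%_::nat. paths \<times> {0..}) \<subseteq> ?E" by simp
  show "(\<Union>i::nat. paths \<times> {0::real..}) = paths \<times> {0..}" by simp
  have top: "paths \<times> {0..} \<in> sets optional" using sets.top[of optional] by simp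
  have "emeasure N1 (paths \<times> {0..}) = (NN z. ind (paths \<times> {0..}) z \<partial>N1)" using top N1(1) by simp
  also have "... = total_potential q * (NN w. exit_int q \<Gamma> (ind (paths \<times> {0..})) w \<partial>P x)"
   using N1(2)[of "ind (paths \<times> {0..})"] top by simp
  also have "... <= total_potential q * (NN w. (NN s. 1 \<partial>exp_law q) \<partial>P x)"
   unfolding exit_int_def exit_fun_def
   by (intro mult_left_mono nn_integral_mono) (auto simp: indicator_def le1)
  also have "... = total_potential q"
   using prob_space.emeasure_space_1[OF prob_P[of x]] prob_space.emeasure_space_1[OF prob_space_exp_law[OF q]] by simp
  finally show "emeasure N1 (paths \<times> {0..}) ~= \<infinity>" using fin by (auto simp: top_unique)
 qed
 then show ?thesis using N1(2)[OF \<phi>] N2(2)[OF \<phi>] by simp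
qed

end

lemma finite_completion:
 assumes "finite_measure K" shows "finite_measure (completion K)"
 using finite_measure.emeasure_finite[OF assms] by (intro finite_measureI) simp

section \<open>Excursions and the normalising constant\<close>

lemma excursion_at_nonzero:
 assumes "0 < t" shows "excursion_at l w t ~= Some 0 \<longleftrightarrow> (\<forall>s\<in>{l<..l + t}. w s ~= Some 0)"
 using assms by (auto simp: excursion_at_def)

lemma exc_length_excursion_at:
 assumes "excursion_at l w \<in> excursions" "0 < t"
 shows "ennreal t < exc_length (excursion_at l w) \<longleftrightarrow> (\<forall>s\<in>{l<..l + t}. w s ~= Some 0)"
 using excursion_iff[OF assms] excursion_at_nonzero[OF assms(2)] by simp

lemma left_end_zero: "closed (zeros w) ==> l \<in> left_ends w ==> l \<in> zeros w"
 by (simp add: left_ends_def closure_closed)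

lemma countable_left_ends:
 assumes cl: "closed (zeros w)" shows "countable (left_ends w)"
proof -
 have "\<forall>l\<in>left_ends w. \<exists>q. q \<in> \<rat> & l < q & (\<forall>s\<in>{l<..<q}. w s ~= Some 0)"
 proof
  fix l assume "l \<in> left_ends w"
  then obtain r where r: "l < r" "\<forall>s\<in>{l<..<r}. w s ~= Some 0" by (auto simp: left_ends_def)
  obtain q where "q \<in> \<rat>" "l < q" "q < r" using Rats_dense_in_real[OF r(1)] by blast
  then show "\<exists>q. q \<in> \<rat> & l < q & (\<forall>s\<in>{l<..<q}. w s ~= Some 0)" using r by (intro exI[of _ q]) auto
 qed
 from bchoice[OF this] obtain f where f: "\<forall>l\<in>left_ends w. f l \<in> \<rat> & l < f l & (\<forall>s\<in>{l<..<f l}. w s ~= Some 0)" ..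
 have "inj_on f (left_ends w)"
 proof (rule linorder_inj_onI)
  fix l l' assume "l < l'" "l \<in> left_ends w" "l' \<in> left_ends w"
  moreover have "w l' = Some 0" using left_end_zero[OF cl \<open>l' \<in> left_ends w\<close>] by (simp add: zeros_def)
  ultimately show "f l ~= f l'" using f by (metis greaterThanLessThan_iff)
 qed auto
 moreover have "countable (f ` left_ends w)"
  by (rule countable_subset[OF _ countable_rat]) (use f in auto)
 ultimately show ?thesis using countable_image_inj_on by blast
qed

definition post_exit :: "real => (path => ennreal) => path \<times> real => ennreal" where
 "post_exit u \<gamma> z = ind {u<..} (snd z) * \<gamma> (stop u (fst z))"

lemma measurable_stop_const: "0 <= u ==> stop u \<in> path_space \<rightarrow>\<^sub>M path_space"
 using measurable_stop[of "%w. w" path_space "%_. u"] by simp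

lemma measurable_post_exit:
 assumes u: "0 <= u" and \<gamma>: "\<gamma> \<in> bm path_space"
 shows "post_exit u \<gamma> \<in> bm (path_space \<Otimes>\<^sub>M borel)"
proof -
 have [measurable]: "(%z. \<gamma> (stop u (fst z))) \<in> bm (path_space \<Otimes>\<^sub>M (borel :: real measure))"
  by (rule measurable_compose[OF measurable_compose[OF measurable_fst measurable_stop_const[OF u]] \<gamma>])
 show ?thesis unfolding post_exit_def[abs_def] by measurable
qed

context nice_markov_process
begin

text \<open>At a time at which the last zero has age above \<open>u\<close>, the last zero is the left end of the excursion interval that
straddles this time, and distinct excursions straddle disjoint sets of times.\<close>

lemma excursion_decomposition:
 assumes q: "0 < q" and u: "0 <= u"
  and w: "w \<in> paths" "closed (zeros w)" "0 \<in> zeros w"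
  and exc: "\<forall>l\<in>left_ends w. excursion_at l w \<in> excursions"
 shows "exit_int q (post_exit u \<gamma>) (%_. 1) w
  = (NN l. ennreal (exp (- q * l)) * (\<gamma> (stop u (excursion_at l w)) * exc_tail q u (excursion_at l w))
     \<partial>count_space (left_ends w))"
proof -
 interpret E: prob_space "exp_law q" by (rule prob_space_exp_law[OF q])
 have cnt: "countable (left_ends w)" by (rule countable_left_ends[OF w(2)])
 interpret C: sigma_finite_measure "count_space (left_ends w)"
  using cnt by (rule sigma_finite_measure_count_space_countable)
 interpret CE: pair_sigma_finite "count_space (left_ends w)" "exp_law q" ..
 let ?c = "%l. \<gamma> (stop u (excursion_at l w))"
 define Ex where "Ex l = {s. u < s - l & ennreal (s - l) < exc_length (excursion_at l w)}" for l
 have Ex_iff: "s \<in> Ex l \<longleftrightarrow> u < s - l & (\<forall>r\<in>{l<..s}. w r ~= Some 0)" if "l \<in> left_ends w" for s l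
  using exc_length_excursion_at[of l w "s - l"] exc that u by (auto simp: Ex_def)
 have gz_Ex: "gz s w = l" if l: "l \<in> left_ends w" and s: "s \<in> Ex l" for s l
 proof (rule gz_eqI(2))
  show "l \<in> zeros w" by (rule left_end_zero[OF w(2) l])
  show "l <= s" using Ex_iff[OF l] s u by auto
  show "y <= l" if "y \<in> zeros w" "y <= s" for y
   using Ex_iff[OF l] s that by (force simp: zeros_def)
 qed
 have hit: "hit0 w <= ennreal s" if "0 <= s" for s
  using hit0_le_real[OF w(1) that] w(3) that by auto
 have ptw: "exit_fun (post_exit u \<gamma>) (%_. 1) (w, s) = (NN l. ind (Ex l) s * ?c l \<partial>count_space (left_ends w))"
  if s: "0 <= s" for s
 proof (cases "u < s - gz s w")
  case True
  let ?l = "gz s w"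
  note g = gz_attained[OF w(1,2) s hit[OF s]]
  have noz: "\<forall>r\<in>{?l<..s}. w r ~= Some 0"
  proof (intro ballI notI)
   fix r assume r: "r \<in> {?l<..s}" "w r = Some 0"
   then have "r \<in> zeros w" using gz_nonneg[of s w] by (simp add: zeros_def)
   from g(3)[OF this] r show False by simp
  qed
  have l: "?l \<in> left_ends w"
   unfolding left_ends_def using g(1) True u noz closure_subset by (auto intro!: exI[of _ s])
  have sE: "s \<in> Ex ?l" using Ex_iff[OF l] True noz by simp
  have "(NN l. ind (Ex l) s * ?c l \<partial>count_space (left_ends w))
    = (NN l. ?c ?l * ind {?l} l \<partial>count_space (left_ends w))"
  proof (rule nn_integral_cong)
   fix l assume "l \<in> space (count_space (left_ends w))"
   then have l': "l \<in> left_ends w" by simp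
   show "ind (Ex l) s * ?c l = ?c ?l * ind {?l} l"
   proof (cases "l = ?l")
    case True
    have "s \<in> Ex l" unfolding True by (rule sE)
    then have "ind (Ex l) s * ?c l = ?c l" by (simp only: indicator_simps mult_1)
    also have "... = ?c ?l * ind {?l} l" unfolding True[symmetric] by simp
    finally show ?thesis .
   next
    case False
    then have "s \<notin> Ex l" using gz_Ex[OF l'] by blast
    then show ?thesis using False by simp
   qed
  qed
  also have "... = ?c ?l"
   using l by (subst nn_integral_indicator_singleton) (simp_all add: emeasure_count_space_finite)
  also have "stop u (excursion_at ?l w) = stop u (shift ?l w)"
   using noz True u by (auto simp: stop_def excursion_at_def shift_def intro!: restrict_ext)
  finally show ?thesis using True hit[OF s]
   by (simp add: exit_fun_def post_exit_def)
 next
  case False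
  have "(NN l. ind (Ex l) s * ?c l \<partial>count_space (left_ends w)) = (NN l. 0 \<partial>count_space (left_ends w))"
  proof (rule nn_integral_cong)
   fix l assume "l \<in> space (count_space (left_ends w))"
   then have l: "l \<in> left_ends w" by simp
   have "s \<notin> Ex l" using gz_Ex[OF l, of s] False by (auto simp: Ex_def)
   then show "ind (Ex l) s * ?c l = 0" by simp
  qed
  then show ?thesis using False by (simp add: exit_fun_def post_exit_def)
 qed
 have Exm [measurable]: "Ex l \<in> sets borel" for l
  unfolding Ex_def by measurable
 have "exit_int q (post_exit u \<gamma>) (%_. 1) w
   = (NN s. NN l. ind (Ex l) s * ?c l \<partial>count_space (left_ends w) \<partial>exp_law q)"
  unfolding exit_int_def
  by (rule nn_integral_cong_AE, use AE_exp_law_nonneg[of q] in eventually_elim) (rule ptw)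
 also have "... = (NN l. NN s. ind (Ex l) s * ?c l \<partial>exp_law q \<partial>count_space (left_ends w))"
 proof (rule CE.Fubini')
  show "(%(l, s). ind (Ex l) s * ?c l) \<in> bm (count_space (left_ends w) \<Otimes>\<^sub>M exp_law q)"
   by (rule measurable_pair_measure_countable1[OF cnt]) (simp, measurable)
 qed
 also have "... = (NN l. ennreal (exp (- q * l)) * (?c l * exc_tail q u (excursion_at l w)) \<partial>count_space (left_ends w))"
 proof (rule nn_integral_cong)
  fix l assume "l \<in> space (count_space (left_ends w))"
  then have l: "l \<in> left_ends w" by simp
  then have l0: "0 <= l" using left_end_zero[OF w(2)] by (auto simp: zeros_def)
  let ?f = "%s. ind {s. u < s - l & ennreal (s - l) < exc_length (excursion_at l w)} s :: ennreal"
  have "(NN s. ind (Ex l) s * ?c l \<partial>exp_law q) = (NN s. ind (Ex l) s \<partial>exp_law q) * ?c l"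
   by (rule nn_integral_multc) simp
  also have "(NN s. ind (Ex l) s \<partial>exp_law q) = (NN s. ind {l..} s * ?f s \<partial>exp_law q)"
   unfolding Ex_def using u by (intro nn_integral_cong) (auto simp: indicator_def)
  also have "... = ennreal (exp (- q * l)) * (NN s. ?f (l + s) \<partial>exp_law q)"
   by (rule nn_integral_exp_law_shift[OF _ l0 q]) measurable
  also have "(NN s. ?f (l + s) \<partial>exp_law q) = exc_tail q u (excursion_at l w)"
   unfolding exc_tail_def by (intro nn_integral_cong) (simp add: indicator_def)
  finally show "(NN s. ind (Ex l) s * ?c l \<partial>exp_law q)
    = ennreal (exp (- q * l)) * (?c l * exc_tail q u (excursion_at l w))" by (simp add: ac_simps)
 qed
 finally show ?thesis .
qed

lemma space_\<eta>: "space \<eta> = paths Int excursions"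
 using sets_eq_imp_space_eq[OF sets_exc] by (simp add: space_restrict_space Int_commute)

lemma measurable_\<eta>I: "f \<in> bm exc_space ==> f \<in> bm \<eta>"
 using sets_exc by (simp cong: measurable_cong_sets)

lemma measurable_exc_stop:
 "0 <= u ==> \<gamma> \<in> bm path_space ==> (%ex. \<gamma> (stop u ex)) \<in> bm exc_space"
 by (rule measurable_compose[OF measurable_exc_path measurable_compose[OF measurable_stop_const]])

lemma start_0: "AE w in P 0. 0 \<in> zeros w"
 using start[of 0] by eventually_elim (simp add: zeros_def)

text \<open>The compensation formula, applied to a functional that depends on the past through the discount \<open>e\<^sup>-\<^sup>q\<^sup>l\<close> alone and is
therefore adapted and left-continuous.\<close>

lemma exit_weight_excursion:
 fixes \<gamma> :: "path => real"
 assumes q: "0 < q" and u: "0 <= u" and \<gamma>: "\<gamma> \<in> bm path_space" "!!w. 0 <= \<gamma> w"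
 shows "exit_weight q (post_exit u (%w. ennreal (\<gamma> w)))
  = total_potential q * (NN ex. ennreal (\<gamma> (stop u ex)) * exc_tail q u ex \<partial>\<eta>)"
proof -
 define K where "K = (NN ex. ennreal (\<gamma> (stop u ex)) * exc_tail q u ex \<partial>\<eta>)"
 define F where "F l w ex = exp (- q * l) * (\<gamma> (stop u ex) * enn2real (exc_tail q u ex))" for l :: real and w ex :: path
 have tail_fin: "exc_tail q u ex < top" for ex
  using exc_tail_le_1[OF q, of u ex] by (rule le_less_trans) simp
 have F_eq: "ennreal (F l w ex) = ennreal (exp (- q * l)) * (ennreal (\<gamma> (stop u ex)) * exc_tail q u ex)" for l w ex
  using tail_fin \<gamma>(2) by (simp add: F_def ennreal_mult)
 have G: "(%ex. ennreal (\<gamma> (stop u ex)) * exc_tail q u ex) \<in> bm exc_space"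
  using measurable_exc_stop[OF u \<gamma>(1)] measurable_exc_tail[OF q u] by measurable
 have comp: "(NN w. (NN l. ennreal (F l w (excursion_at l w)) \<partial>count_space (left_ends w)) \<partial>P 0)
   = (NN w. (\<integral>\<^sup>+l\<in>{0..}. (NN ex. ennreal (F l w ex) \<partial>\<eta>) \<partial>lt w) \<partial>P 0)"
 proof (rule compensation)
  show "0 <= F l w ex" for l w ex using \<gamma>(2) by (simp add: F_def)
  show "(%(w, ex). F l w ex) \<in> bm (filt l \<Otimes>\<^sub>M exc_space)" for l
  proof -
   have "(%ex. exp (- q * l) * (\<gamma> (stop u ex) * enn2real (exc_tail q u ex))) \<in> bm exc_space"
    using measurable_exc_stop[OF u \<gamma>(1)] measurable_exc_tail[OF q u] by measurable
   from measurable_compose[OF measurable_snd this, of "filt l"] show ?thesis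
    unfolding F_def by (simp add: case_prod_unfold)
  qed
  show "((%v. F v w ex) \<longlongrightarrow> F l w ex) (at_left l)" for l w ex
   unfolding F_def by (intro tendsto_intros)
 qed
 have "exit_weight q (post_exit u (%w. ennreal (\<gamma> w)))
   = (NN w. (NN l. ennreal (F l w (excursion_at l w)) \<partial>count_space (left_ends w)) \<partial>P 0)"
  unfolding exit_weight_def
 proof (rule nn_integral_cong_AE, use zeros_closed_0 start_0 excursions_of_process AE_space in eventually_elim)
  case (elim w)
  then have "w \<in> paths" by simp
  from excursion_decomposition[OF q u this elim(1,2,3), of "%w. ennreal (\<gamma> w)"] show ?case by (simp add: F_eq)
 qed
 also have "... = (NN w. lt_int q (%_. 1) w * K \<partial>P 0)"
  unfolding comp
 proof (rule nn_integral_cong)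
  fix w
  have "(NN ex. ennreal (F l w ex) \<partial>\<eta>) = ennreal (exp (- q * l)) * K" for l
   unfolding F_eq K_def by (rule nn_integral_cmult[OF measurable_\<eta>I[OF G]])
  then have "(\<integral>\<^sup>+l\<in>{0..}. (NN ex. ennreal (F l w ex) \<partial>\<eta>) \<partial>lt w)
    = (NN l. ind {0..} l * (ennreal (exp (- q * l)) * 1) * K \<partial>lt w)"
   by (intro nn_integral_cong) (simp add: ac_simps)
  also have "... = lt_int q (%_. 1) w * K"
   unfolding lt_int_def by (rule nn_integral_multc) measurable
  finally show "(\<integral>\<^sup>+l\<in>{0..}. (NN ex. ennreal (F l w ex) \<partial>\<eta>) \<partial>lt w) = lt_int q (%_. 1) w * K" .
 qed
 also have "... = (NN w. lt_int q (%_. 1) w * K \<partial>cP 0)"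
  by (simp add: nn_integral_completion)
 also have "... = (NN w. lt_int q (%_. 1) w \<partial>cP 0) * K"
  by (rule nn_integral_multc[OF measurable_lt_int[OF one_optional]])
 also have "... = total_potential q * K"
  by (simp only: total_potential_def nn_integral_completion)
 finally show ?thesis by (simp add: K_def)
qed

text \<open>The drift coefficient \<open>\<beta>\<close> compares the local time with Lebesgue measure on the zero set, first on intervals.\<close>

lemma zero_set_local_time:
 "AE w in P 0. (NN s. ind (zeros w) s \<partial>exp_law q) = ennreal (q * \<beta>) * lt_int q (%_. 1) w"
 if q: "0 < q"
 using regular_P[of 0] zeros_closed_0 beta_local_time[OF return_in[of 0], unfolded init_law_return]
proof eventually_elim
 case (elim w)
 note reg = elim(1)
 have Z: "zeros w \<in> sets borel" using elim(2) by (rule borel_closed)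
 have m: "emeasure lborel (zeros w Int {0..t}) = ennreal (\<beta> * L t w)" if "0 <= t" for t
 proof -
  have "emeasure lborel (zeros w Int {0..t}) <= emeasure lborel {0..t}" by (rule emeasure_mono) auto
  then have "emeasure lborel (zeros w Int {0..t}) ~= \<infinity>" using that by (auto simp: top_unique)
  then show ?thesis using elim(3) that by (simp add: emeasure_eq_ennreal_measure)
 qed
 let ?M = "density lborel (ind (zeros w))" and ?N = "scale_measure (ennreal \<beta>) (lt w)"
 have M: "emeasure ?M {a<..b} = ennreal (\<beta> * L (max 0 b) w - \<beta> * L (max 0 a) w)" if ab: "a <= b" for a b
 proof -
  have "emeasure ?M {a<..b} = (NN s. ind (zeros w) s * ind {a<..b} s \<partial>lborel)"
   using Z by (simp add: emeasure_density)
  also have "... = (NN s. ind (zeros w Int {0..max 0 b} - zeros w Int {0..max 0 a}) s \<partial>lborel)"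
  proof (rule nn_integral_cong_AE, use AE_lborel_singleton[of "0::real"] in eventually_elim)
   case (elim s)
   then show ?case by (auto simp: indicator_def zeros_def)
  qed
  also have "... = emeasure lborel (zeros w Int {0..max 0 b} - zeros w Int {0..max 0 a})"
   using Z by (intro nn_integral_indicator) auto
  also have "... = emeasure lborel (zeros w Int {0..max 0 b}) - emeasure lborel (zeros w Int {0..max 0 a})"
   using Z m[of "max 0 a"] ab by (intro emeasure_Diff) auto
  also have "... = ennreal (\<beta> * L (max 0 b) w - \<beta> * L (max 0 a) w)"
   using m[of "max 0 a"] m[of "max 0 b"] beta_nonneg regular_nonneg[OF reg, of "max 0 a"]
   by (simp add: ennreal_minus)
  finally show ?thesis .
 qed
 have N: "emeasure ?N {a<..b} = ennreal (\<beta> * L (max 0 b) w - \<beta> * L (max 0 a) w)" if ab: "a <= b" for a b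
  using lt_Ioc[OF reg ab] beta_nonneg regular_mono[OF reg, of "max 0 a" "max 0 b"] ab
  by (simp add: ennreal_mult[symmetric] right_diff_distrib)
 have MN: "?M = ?N" using M N by (intro borel_measure_eqI_Ioc) auto
 have "(NN s. ind (zeros w) s \<partial>exp_law q)
   = (NN s. ennreal (exponential_density q s) * ind (zeros w) s \<partial>lborel)"
  using Z by (intro nn_integral_exp_law) simp
 also have "... = (NN s. ind (zeros w) s * ennreal (exponential_density q s) \<partial>lborel)"
  by (simp only: mult.commute)
 also have "... = (NN s. ennreal (exponential_density q s) \<partial>?M)"
  using Z by (intro nn_integral_density[symmetric]) auto
 also have "... = ennreal \<beta> * (NN s. ennreal (exponential_density q s) \<partial>lt w)"
  unfolding MN by (rule nn_integral_scale_measure) simp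
 also have "(NN s. ennreal (exponential_density q s) \<partial>lt w)
   = (NN v. ennreal q * (ind {0..} v * (ennreal (exp (- q * v)) * 1)) \<partial>lt w)"
  using q by (intro nn_integral_cong) (auto simp: indicator_def exponential_density_def ennreal_mult' mult.commute)
 also have "... = ennreal q * lt_int q (%_. 1) w"
  unfolding lt_int_def by (rule nn_integral_cmult) measurable
 finally show ?case using q beta_nonneg by (simp add: ennreal_mult mult.assoc[symmetric] mult.commute)
qed

definition kappa :: "real => ennreal" where
 "kappa q = ennreal (q * \<beta>) + (NN ex. ennreal (one_minus_exp q (exc_length ex)) \<partial>\<eta>)"

text \<open>Under \<open>P 0\<close> the time \<open>e\<^sub>q\<close> falls either into the zero set or into an excursion.  The first probability is \<open>q \<beta>\<close> times the
potential by the drift of the local time, the second \<open>\<eta>(1 - e\<^sup>-\<^sup>q\<^sup>\<zeta>)\<close> times it by the compensation formula.\<close>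

lemma total_potential_kappa: assumes q: "0 < q" shows "total_potential q * kappa q = 1"
proof -
 let ?Z = "%w. NN s. ind (zeros w) s \<partial>exp_law q"
 let ?E = "exit_int q (post_exit 0 (%_. 1)) (%_. 1)"
 let ?C = "cP 0"
 have ZM: "?Z \<in> bm ?C"
  by (rule completion_measurable_AE[OF _ zero_set_local_time[OF q]])
    (use measurable_lt_int[OF one_optional, of q 0] in auto)
 have EM: "?E \<in> bm ?C"
  by (rule ucompl_completion[OF measurable_exit_int[OF q measurable_post_exit one_optional]]) auto
 have "AE w in P 0. ?Z w + ?E w = 1"
  using zeros_closed_0 start_0 AE_space
 proof eventually_elim
  case (elim w)
  then have w: "w \<in> paths" by simp
  have hit: "hit0 w <= ennreal s" if "0 <= s" for s
   using hit0_le_real[OF w that] elim(2) that by auto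
  have "?Z w + ?E w = (NN s. ind (zeros w) s + exit_fun (post_exit 0 (%_. 1)) (%_. 1) (w, s) \<partial>exp_law q)"
   unfolding exit_int_def
   using borel_closed[OF elim(1)]
    measurable_section[OF measurable_exit_fun[OF measurable_post_exit one_optional] w, of 0 "%_. 1"]
   by (intro nn_integral_add[symmetric]) auto
  also have "... = (NN s. 1 \<partial>exp_law q)"
  proof (rule nn_integral_cong_AE, use AE_exp_law_nonneg[of q] in eventually_elim)
   case (elim s)
   note g = gz_attained[OF w \<open>closed (zeros w)\<close> elim hit[OF elim]]
   have "s \<in> zeros w \<longleftrightarrow> gz s w = s" using g(1) g(3)[of s] g(2) by auto
   then show ?case using hit[OF elim] g(2) by (auto simp: exit_fun_def post_exit_def indicator_def)
  qed
  also have "... = 1" using prob_space.emeasure_space_1[OF prob_space_exp_law[OF q]] by simp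
  finally show ?case .
 qed
 then have "(NN w. ?Z w + ?E w \<partial>?C) = (NN w. 1 \<partial>?C)"
  by (intro nn_integral_cong_AE AE_completion)
 then have "(NN w. ?Z w \<partial>?C) + (NN w. ?E w \<partial>?C) = 1"
  using ZM EM prob_space.emeasure_space_1[OF prob_cP[of 0]] by (simp add: nn_integral_add)
 moreover have "(NN w. ?Z w \<partial>?C) = ennreal (q * \<beta>) * total_potential q"
 proof -
  have "(NN w. ?Z w \<partial>?C) = (NN w. ennreal (q * \<beta>) * lt_int q (%_. 1) w \<partial>?C)"
   by (rule nn_integral_cong_AE[OF AE_completion[OF zero_set_local_time[OF q]]])
  also have "... = ennreal (q * \<beta>) * (NN w. lt_int q (%_. 1) w \<partial>?C)"
   by (rule nn_integral_cmult[OF measurable_lt_int[OF one_optional]])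
  finally show ?thesis by (simp only: total_potential_def nn_integral_completion)
 qed
 moreover have "(NN w. ?E w \<partial>?C) = total_potential q * (NN ex. ennreal (one_minus_exp q (exc_length ex)) \<partial>\<eta>)"
  using exit_weight_excursion[OF q order_refl, of "%_. 1"] exc_tail_0[OF q]
  by (simp add: exit_weight_def nn_integral_completion)
 ultimately show ?thesis by (simp add: kappa_def distrib_left mult.commute)
qed

lemma total_potential_finite: "0 < q ==> total_potential q < top"
 using total_potential_kappa[of q] by (cases "total_potential q = top") (auto simp: ennreal_top_mult less_top split: if_splits)

lemma kappa_bounds: assumes q: "0 < q" shows "0 < kappa q" "kappa q < top"
proof -
 note K = total_potential_kappa[OF q]
 show "0 < kappa q" using K by (auto simp: zero_less_iff_neq_zero)
 show "kappa q < top"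
 proof (rule ccontr)
  assume "~ kappa q < top"
  then have "kappa q = top" by (simp add: less_top[symmetric])
  then show False using K by (cases "total_potential q = 0") (auto simp: ennreal_mult_top)
 qed
qed

text \<open>Chebyshev: \<open>\<eta>(1 - e\<^sup>-\<^sup>\<zeta>)\<close> is finite as the potential is positive.\<close>

lemma exc_length_finite_measure:
 assumes u: "0 < u" shows "emeasure \<eta> {ex \<in> space \<eta>. ennreal u < exc_length ex} < top"
  and "{ex \<in> space \<eta>. ennreal u < exc_length ex} \<in> sets \<eta>"
proof -
 let ?A = "{ex \<in> space \<eta>. ennreal u < exc_length ex}"
 have B: "{ex \<in> space exc_space. 0 <= u & ex u \<in> Some ` {0}} \<in> sets exc_space"
  by (rule measurable_eval[OF measurable_exc_path, of "%_. u"]) simp_all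
 have "space exc_space - {ex \<in> space exc_space. 0 <= u & ex u \<in> Some ` {0}} \<in> sets exc_space"
  by (rule sets.compl_sets[OF B])
 also have "space exc_space - {ex \<in> space exc_space. 0 <= u & ex u \<in> Some ` {0}} = ?A"
  using excursion_iff[OF _ u] u by (auto simp: space_\<eta> space_restrict_space)
 finally show A: "?A \<in> sets \<eta>" using sets_exc by simp
 have "ennreal (1 - exp (- u)) * emeasure \<eta> ?A = (NN ex. ennreal (1 - exp (- u)) * ind ?A ex \<partial>\<eta>)"
  using A by (simp add: nn_integral_cmult)
 also have "... <= (NN ex. ennreal (one_minus_exp 1 (exc_length ex)) \<partial>\<eta>)"
 proof (rule nn_integral_mono)
  fix ex
  show "ennreal (1 - exp (- u)) * ind ?A ex <= ennreal (one_minus_exp 1 (exc_length ex))"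
  proof (cases "exc_length ex")
   case (real r)
   then show ?thesis using u by (auto simp: indicator_def one_minus_exp_def ennreal_less_iff intro!: ennreal_leI)
  next
   case top
   then show ?thesis using u by (auto simp: indicator_def one_minus_exp_def intro!: ennreal_leI)
  qed
 qed
 also have "... <= kappa 1" by (simp add: kappa_def)
 also have "... < top" by (rule kappa_bounds) simp
 finally show "emeasure \<eta> ?A < top"
  using u by (auto simp: ennreal_mult_less_top)
qed

definition no_hit :: "real => real => ennreal" where
 "no_hit t y = emeasure (cP y) {w \<in> paths. ennreal t < hit0 w}"

definition escape :: "real => real => ennreal" where
 "escape q y = (NN w. ennreal (one_minus_exp q (hit0 w)) \<partial>P y)"

lemma no_hit_sets: "{w \<in> paths. ennreal t < hit0 w} \<in> sets (ucompl path_space)"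
proof -
 have "Measurable.pred (ucompl path_space) (%w. ennreal t < hit0 w)"
  using measurable_hit0 by measurable
 then show ?thesis by (simp add: pred_def)
qed

lemma no_hit_integral: "no_hit t y = (NN w. ind {w \<in> paths. ennreal t < hit0 w} w \<partial>P y)"
proof -
 have "{w \<in> paths. ennreal t < hit0 w} \<in> sets (cP y)"
  using no_hit_sets finite_P sets_P unfolding sets_ucompl by blast
 then show ?thesis
  unfolding no_hit_def by (subst nn_integral_completion[symmetric]) simp
qed

lemma measurable_no_hit: "no_hit t \<in> bm (ucompl borel)"
 unfolding no_hit_integral[abs_def]
 by (rule nn_integral_kernel_ucompl[OF kernel]) (use no_hit_sets in simp)

lemma measurable_escape: "escape q \<in> bm (ucompl borel)"
proof -
 have "(%w. ennreal (one_minus_exp q (hit0 w))) \<in> bm (ucompl path_space)"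
  unfolding one_minus_exp_def using measurable_hit0 by measurable
 then show ?thesis unfolding escape_def[abs_def] by (rule nn_integral_kernel_ucompl[OF kernel])
qed

text \<open>Right-continuity in \<open>t\<close>, which reduces joint measurability in time and position to countably many times.\<close>

lemma no_hit_SUP: "no_hit t y = (SUP r\<in>\<rat>. if t < r then no_hit r y else 0)"
proof (rule antisym)
 have S: "{w \<in> paths. ennreal t < hit0 w} \<in> sets (cP y)" for t
  using no_hit_sets finite_P sets_P unfolding sets_ucompl by blast
 have mono: "no_hit s y <= no_hit r y" if "r <= s" for r s
  unfolding no_hit_def using that S
  by (intro emeasure_mono) (auto intro: le_less_trans[OF ennreal_leI])
 show "(SUP r\<in>\<rat>. if t < r then no_hit r y else 0) <= no_hit t y"
  by (rule SUP_least) (auto intro: mono)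
 have inc: "incseq (%n. {w \<in> paths. ennreal (t + 1 / Suc n) < hit0 w})"
 proof (rule incseq_SucI, safe)
  fix n w assume "ennreal (t + 1 / Suc n) < hit0 w"
  moreover have "ennreal (t + 1 / Suc (Suc n)) <= ennreal (t + 1 / Suc n)"
   by (intro ennreal_leI add_left_mono divide_left_mono) auto
  ultimately show "ennreal (t + 1 / Suc (Suc n)) < hit0 w" by (rule le_less_trans[rotated])
 qed
 have "{w \<in> paths. ennreal t < hit0 w} = (\<Union>n. {w \<in> paths. ennreal (t + 1 / Suc n) < hit0 w})"
 proof (intro equalityI subsetI)
  fix w assume "w \<in> {w \<in> paths. ennreal t < hit0 w}"
  then have wt: "w \<in> paths" "ennreal t < hit0 w" by auto
  have "(%n. ennreal (t + 1 / Suc n)) \<longlonglongrightarrow> ennreal (t + 0)"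
   by (intro tendsto_ennrealI tendsto_intros LIMSEQ_Suc[OF lim_1_over_n])
  then have "\<forall>\<^sub>F n in sequentially. ennreal (t + 1 / Suc n) < hit0 w"
   using wt(2) by (intro order_tendstoD(2)) auto
  then obtain n where "ennreal (t + 1 / Suc n) < hit0 w"
   by (auto simp: eventually_sequentially)
  then show "w \<in> (\<Union>n. {w \<in> paths. ennreal (t + 1 / Suc n) < hit0 w})" using wt(1) by blast
 next
  fix w assume "w \<in> (\<Union>n. {w \<in> paths. ennreal (t + 1 / Suc n) < hit0 w})"
  then obtain n where n: "w \<in> paths" "ennreal (t + 1 / Suc n) < hit0 w" by blast
  have "ennreal t <= ennreal (t + 1 / Suc n)" by (intro ennreal_leI) simp
  then show "w \<in> {w \<in> paths. ennreal t < hit0 w}" using n by (auto intro: le_less_trans)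
 qed
 moreover have "range (%n. {w \<in> paths. ennreal (t + 1 / Suc n) < hit0 w}) \<subseteq> sets (cP y)"
  by (rule image_subsetI) (rule S)
 ultimately have "no_hit t y = (SUP n. no_hit (t + 1 / Suc n) y)"
  unfolding no_hit_def using SUP_emeasure_incseq[OF _ inc, of "cP y"] by (simp only:)
 also have "... <= (SUP r\<in>\<rat>. if t < r then no_hit r y else 0)"
 proof (rule SUP_least)
  fix n
  have "t < t + 1 / Suc n" by simp
  from Rats_dense_in_real[OF this] obtain r where r: "r \<in> \<rat>" "t < r" "r < t + 1 / Suc n" by blast
  show "no_hit (t + 1 / Suc n) y <= (SUP r\<in>\<rat>. if t < r then no_hit r y else 0)"
   by (rule SUP_upper2[OF r(1)]) (use r mono in auto)
 qed
 finally show "no_hit t y <= (SUP r\<in>\<rat>. if t < r then no_hit r y else 0)" .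
qed

lemma escape_no_hit: assumes q: "0 < q" shows "escape q y = (NN t. no_hit t y \<partial>exp_law q)"
proof -
 let ?C = "cP y"
 interpret C: prob_space ?C by (rule prob_cP)
 interpret E: prob_space "exp_law q" by (rule prob_space_exp_law[OF q])
 interpret CE: pair_sigma_finite ?C "exp_law q" ..
 have [measurable]: "hit0 \<in> bm ?C" by (rule ucompl_completion[OF measurable_hit0])
 have "escape q y = (NN w. NN t. (if ennreal t < hit0 w then 1 else 0) \<partial>exp_law q \<partial>?C)"
  unfolding escape_def nn_integral_completion exp_law_head[OF q, symmetric]
  by (intro nn_integral_cong) (auto simp: indicator_def)
 also have "... = (NN t. NN w. (if ennreal t < hit0 w then 1 else 0) \<partial>?C \<partial>exp_law q)"
  by (rule CE.Fubini'[symmetric]) measurable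
 also have "... = (NN t. no_hit t y \<partial>exp_law q)"
  unfolding no_hit_integral nn_integral_completion by (intro nn_integral_cong) (simp add: indicator_def)
 finally show ?thesis .
qed

lemma AE_exp_law_pos: "AE s in exp_law q. 0 < s"
 unfolding exp_law_def
 by (subst AE_density) (auto simp: exponential_density_def intro: AE_mp[OF AE_lborel_singleton[of 0]])

text \<open>The excursions longer than \<open>u\<close>, as a finite measure on all paths: universally measurable functionals of excursions
can be integrated against it.\<close>

definition long_exc :: "real => path measure" where
 "long_exc u = distr (density \<eta> (ind (longer u))) path_space (%ex. ex)"

lemma measurable_long_ind:
 assumes "0 < u" shows "ind (longer u) \<in> bm \<eta>"
proof -
 have "ind {ex \<in> space \<eta>. ennreal u < exc_length ex} \<in> bm \<eta>"
  using exc_length_finite_measure(2)[OF assms] by simp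
 then show ?thesis by (rule measurable_cong[THEN iffD1, rotated]) (simp add: indicator_def)
qed

lemma exc_path_\<eta>: "(%ex. ex) \<in> \<eta> \<rightarrow>\<^sub>M path_space"
 using measurable_exc_path sets_exc by (simp cong: measurable_cong_sets)

lemma sets_long_exc [simp, measurable_cong]: "sets (long_exc u) = sets path_space"
 by (simp add: long_exc_def)

lemma nn_integral_long_exc:
 assumes u: "0 < u" and f: "f \<in> bm path_space"
 shows "(NN w. f w \<partial>long_exc u) = (NN ex. f ex * ind (longer u) ex \<partial>\<eta>)"
proof -
 have "(NN w. f w \<partial>long_exc u) = (NN ex. f ex \<partial>density \<eta> (ind (longer u)))"
  unfolding long_exc_def using exc_path_\<eta> f by (intro nn_integral_distr) simp_all
 also have "... = (NN ex. ind (longer u) ex * f ex \<partial>\<eta>)"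
  by (rule nn_integral_density[OF measurable_long_ind[OF u] measurable_compose[OF exc_path_\<eta> f]])
 finally show ?thesis by (simp add: mult.commute)
qed

lemma finite_long_exc: assumes u: "0 < u" shows "finite_measure (long_exc u)"
proof (rule finite_measureI)
 have "emeasure (long_exc u) (space (long_exc u)) = (NN w. 1 \<partial>long_exc u)" by simp
 also have "... = (NN ex. ind {ex \<in> space \<eta>. ennreal u < exc_length ex} ex \<partial>\<eta>)"
  by (subst nn_integral_long_exc[OF u]) (auto intro!: nn_integral_cong simp: indicator_def)
 also have "... = emeasure \<eta> {ex \<in> space \<eta>. ennreal u < exc_length ex}"
  by (rule nn_integral_indicator[OF exc_length_finite_measure(2)[OF u]])
 also have "... < top" by (rule exc_length_finite_measure(1)[OF u])
 finally show "emeasure (long_exc u) (space (long_exc u)) ~= \<infinity>" by simp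
qed

lemma long_exc_ucompl:
 assumes u: "0 < u" and f: "f \<in> bm (ucompl path_space)"
 shows "(NN w. f w \<partial>long_exc u) = (NN ex. f ex * ind (longer u) ex \<partial>\<eta>)"
  and "(%ex. f ex * ind (longer u) ex) \<in> bm (completion \<eta>)"
proof -
 obtain g where g: "g \<in> bm path_space" "AE w in long_exc u. f w = g w"
  using ucompl_AE_borel[OF f finite_long_exc[OF u]] by auto
 have "AE ex in density \<eta> (ind (longer u)). f ex = g ex"
  using AE_distrD[OF _ g(2)[unfolded long_exc_def]] exc_path_\<eta> by simp
 then have "AE ex in \<eta>. ennreal u < exc_length ex --> f ex = g ex"
  by (subst (asm) AE_density[OF measurable_long_ind[OF u]]) (auto simp: indicator_def)
 then have ae: "AE ex in \<eta>. f ex * ind (longer u) ex = g ex * ind (longer u) ex"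
  by eventually_elim (auto simp: indicator_def)
 have "(NN w. f w \<partial>long_exc u) = (NN w. g w \<partial>long_exc u)"
  using g(2) by (rule nn_integral_cong_AE)
 also have "... = (NN ex. g ex * ind (longer u) ex \<partial>\<eta>)"
  by (rule nn_integral_long_exc[OF u g(1)])
 also have "... = (NN ex. f ex * ind (longer u) ex \<partial>\<eta>)"
  using ae by (intro nn_integral_cong_AE) auto
 finally show "(NN w. f w \<partial>long_exc u) = (NN ex. f ex * ind (longer u) ex \<partial>\<eta>)" .
 have "(%ex. g ex * ind (longer u) ex) \<in> bm \<eta>"
  using measurable_compose[OF exc_path_\<eta> g(1)] measurable_long_ind[OF u] by measurable
 from completion_measurable_AE[OF measurable_completion[OF this] ae]
 show "(%ex. f ex * ind (longer u) ex) \<in> bm (completion \<eta>)" by simp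
qed

lemma measurable_no_hit_at:
 assumes u: "0 <= u" shows "(%z. no_hit (snd z) (pos u (fst z))) \<in> bm prod_space"
proof -
 have "pos u \<in> ucompl path_space \<rightarrow>\<^sub>M ucompl borel"
  using measurable_pos[of u top] u by (intro measurable_ucompl_lift measurable_ucomplI) simp
 then have [measurable]: "(%z. no_hit r (pos u (fst z))) \<in> bm prod_space" for r
  by (intro measurable_compose[OF measurable_fst measurable_compose[OF _ measurable_no_hit]])
 have "(%z. SUP r\<in>\<rat>. if snd z < r then no_hit r (pos u (fst z)) else 0) \<in> bm prod_space"
  by (rule borel_measurable_SUP[OF countable_rat]) measurable
 then show ?thesis by (subst no_hit_SUP)
qed

text \<open>The Markov property of the excursion measure identifies two finite measures on the \<open>\<sigma>\<close>-algebra at time \<open>u\<close>; the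
survival probability, which is only universally measurable, is first replaced by a measurable version.\<close>

lemma exc_markov_fixed:
 assumes u: "0 < u" and t: "0 <= t" and Y: "Y \<in> bm (filt u)"
 shows "(NN w. Y w \<partial>long_exc (u + t)) = (NN w. Y w * no_hit t (pos u w) \<partial>long_exc u)"
proof -
 let ?N = "filt u"
 have ut: "0 < u + t" using u t by simp
 have sub: "sets ?N \<subseteq> sets path_space" by (rule sets_nat_filt_mono) simp
 have id: "(%w. w) \<in> path_space \<rightarrow>\<^sub>M ?N"
  using sub by (auto simp: measurable_def Int_absorb2 dest: sets.sets_into_space)
 have Hm: "(%w. no_hit t (pos u w)) \<in> bm (ucompl path_space)"
  using measurable_compose[OF measurable_Pair2'[of t borel "ucompl path_space"] measurable_no_hit_at[of u]] u by simp
 obtain p where p: "p \<in> bm path_space" "AE w in long_exc u. no_hit t (pos u w) = p w"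
  using ucompl_AE_borel[OF Hm finite_long_exc[OF u]] by auto
 have pl: "p \<in> bm (long_exc u)" using p(1) by simp
 have eq: "distr (long_exc (u + t)) ?N (%w. w) = distr (density (long_exc u) p) ?N (%w. w)"
 proof (rule measure_eqI)
  fix A assume "A \<in> sets (distr (long_exc (u + t)) ?N (%w. w))"
  then have A: "A \<in> sets ?N" by simp
  then have A': "A \<in> sets path_space" "A \<subseteq> paths" using sub sets.sets_into_space[OF A] by auto
  have "emeasure (distr (long_exc (u + t)) ?N (%w. w)) A = emeasure (long_exc (u + t)) A"
   using A A' id sets_eq_imp_space_eq[OF sets_long_exc[of "u + t"]]
   by (subst emeasure_distr) (auto simp: Int_absorb2 cong: measurable_cong_sets)
  also have "... = (NN w. ind A w \<partial>long_exc (u + t))" using A' by simp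
  also have "... = (NN ex. ind A ex * ind {ex. ennreal (u + t) < exc_length ex} ex \<partial>\<eta>)"
   using A' by (intro nn_integral_long_exc[OF ut]) simp
  also have "... = (NN ex. ind {ex \<in> excursions. ex \<in> A & ennreal (u + t) < exc_length ex & pos (u + t) ex \<in> UNIV} ex \<partial>\<eta>)"
   by (intro nn_integral_cong) (auto simp: indicator_def space_\<eta>)
  also have "... = emeasure \<eta> {ex \<in> excursions. ex \<in> A & ennreal (u + t) < exc_length ex & pos (u + t) ex \<in> UNIV}"
  proof (rule nn_integral_indicator)
   have "{ex \<in> excursions. ex \<in> A & ennreal (u + t) < exc_length ex & pos (u + t) ex \<in> UNIV}
     = ((%ex. ex) -` A Int space \<eta>) Int {ex \<in> space \<eta>. ennreal (u + t) < exc_length ex}"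
    using A' by (auto simp: space_\<eta>)
   also have "... \<in> sets \<eta>"
    by (rule sets.Int[OF measurable_sets[OF exc_path_\<eta> A'(1)] exc_length_finite_measure(2)[OF ut]])
   finally show "{ex \<in> excursions. ex \<in> A & ennreal (u + t) < exc_length ex & pos (u + t) ex \<in> UNIV} \<in> sets \<eta>" .
  qed
  also have "... = (NN ex. ind {ex \<in> A. ennreal u < exc_length ex} ex
    * emeasure (completion (P (pos u ex))) {w \<in> paths. w t \<in> Some ` UNIV & ennreal t < hit0 w} \<partial>\<eta>)"
   by (rule exc_markov[OF u t A]) simp
  also have "... = (NN ex. (ind A ex * no_hit t (pos u ex)) * ind (longer u) ex \<partial>\<eta>)"
  proof (rule nn_integral_cong)
   fix ex
   let ?y = "pos u ex"
   have S: "{w \<in> paths. ennreal t < hit0 w} \<in> sets (cP ?y)"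
    using no_hit_sets finite_P sets_P unfolding sets_ucompl by blast
   have al: "{w \<in> paths. w t ~= None} \<in> sets (cP ?y)"
    using measurable_alive[OF t, of top] by simp
   have "{w \<in> paths. w t \<in> Some ` UNIV & ennreal t < hit0 w} = {w \<in> paths. ennreal t < hit0 w} Int {w \<in> paths. w t ~= None}"
    by (auto simp: image_iff)
   then have "emeasure (cP ?y) {w \<in> paths. w t \<in> Some ` UNIV & ennreal t < hit0 w}
     = emeasure (cP ?y) ({w \<in> paths. ennreal t < hit0 w} Int {w \<in> paths. w t ~= None})"
    by (rule arg_cong)
   also have "emeasure (cP ?y) ({w \<in> paths. ennreal t < hit0 w} Int {w \<in> paths. w t ~= None}) = no_hit t ?y"
    unfolding no_hit_def
   proof (rule emeasure_eq_AE)
    show "AE w in cP ?y. (w \<in> {w \<in> paths. ennreal t < hit0 w} Int {w \<in> paths. w t ~= None}) = (w \<in> {w \<in> paths. ennreal t < hit0 w})"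
     using AE_completion[OF conservative[of ?y]] by eventually_elim (use t in auto)
   qed (use S al in auto)
   finally have eq: "emeasure (cP ?y) {w \<in> paths. w t \<in> Some ` UNIV & ennreal t < hit0 w} = no_hit t ?y" .
   show "ind {ex \<in> A. ennreal u < exc_length ex} ex * emeasure (cP ?y) {w \<in> paths. w t \<in> Some ` UNIV & ennreal t < hit0 w}
     = ind A ex * no_hit t ?y * ind (longer u) ex"
    unfolding eq by (simp add: indicator_def)
  qed
  also have "... = (NN w. ind A w * no_hit t (pos u w) \<partial>long_exc u)"
  proof (rule long_exc_ucompl(1)[OF u, symmetric])
   have "ind A \<in> bm (ucompl path_space)" using A' by (intro borel_measurable_indicator) auto
   then show "(%w. ind A w * no_hit t (pos u w)) \<in> bm (ucompl path_space)"
    using Hm by (rule borel_measurable_times_ennreal)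
  qed
  also have "... = (NN w. p w * ind A w \<partial>long_exc u)"
   by (rule nn_integral_cong_AE, use p(2) in eventually_elim) (simp add: mult.commute)
  also have "... = emeasure (density (long_exc u) p) A" using A' pl by (simp add: emeasure_density)
  also have "... = emeasure (distr (density (long_exc u) p) ?N (%w. w)) A"
   using A A' id sets_eq_imp_space_eq[OF sets_long_exc[of u]]
   by (subst emeasure_distr) (auto simp: Int_absorb2 cong: measurable_cong_sets)
  finally show "emeasure (distr (long_exc (u + t)) ?N (%w. w)) A = emeasure (distr (density (long_exc u) p) ?N (%w. w)) A" .
 qed simp
 have "(NN w. Y w \<partial>long_exc (u + t)) = (NN w. Y w \<partial>distr (long_exc (u + t)) ?N (%w. w))"
  using id Y by (intro nn_integral_distr[symmetric]) (simp_all cong: measurable_cong_sets)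
 also have "... = (NN w. Y w \<partial>density (long_exc u) p)"
  unfolding eq using id Y by (intro nn_integral_distr) (simp_all cong: measurable_cong_sets)
 also have "... = (NN w. p w * Y w \<partial>long_exc u)"
  using measurable_compose[OF id Y] pl by (intro nn_integral_density) simp_all
 also have "... = (NN w. Y w * no_hit t (pos u w) \<partial>long_exc u)"
  by (rule nn_integral_cong_AE, use p(2) in eventually_elim) (simp add: mult.commute)
 finally show ?thesis .
qed

text \<open>Lack of memory at \<open>u\<close> turns the tail into the event that the remaining excursion outlives a fresh exponential time,
and the Markov property of the excursion measure replaces it by the escape probability from \<open>\<epsilon>\<^sub>u\<close>.\<close>

lemma exc_tail_markov:
 fixes \<gamma> :: "path => ennreal"
 assumes q: "0 < q" and u: "0 < u" and \<gamma>: "\<gamma> \<in> bm path_space"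
 shows "(NN ex. \<gamma> (stop u ex) * exc_tail q u ex \<partial>\<eta>)
  = ennreal (exp (- q * u)) * (NN w. \<gamma> (stop u w) * escape q (pos u w) \<partial>long_exc u)"
proof -
 interpret E: prob_space "exp_law q" by (rule prob_space_exp_law[OF q])
 interpret eta: sigma_finite_measure \<eta> by (rule sigma_finite_exc)
 interpret EE: pair_sigma_finite \<eta> "exp_law q" ..
 let ?C = "completion (long_exc u)"
 have finC: "finite_measure ?C" by (rule finite_completion[OF finite_long_exc[OF u]])
 interpret LC: finite_measure ?C by fact
 interpret LE: pair_sigma_finite ?C "exp_law q" ..
 have Yn: "(%w. \<gamma> (stop u w)) \<in> bm (filt u)"
  using u by (intro measurable_compose[OF measurable_stop_nat_filt \<gamma>]) simp
 have Yp: "(%w. \<gamma> (stop u w)) \<in> bm path_space"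
  using u by (intro measurable_compose[OF measurable_stop_const \<gamma>]) simp
 have tail: "exc_tail q u ex = ennreal (exp (- q * u)) * (NN t. ind {t. 0 < t & ennreal (u + t) < exc_length ex} t \<partial>exp_law q)" for ex
 proof -
  have "exc_tail q u ex = (NN s. ind {u..} s * ind {s. u < s & ennreal s < exc_length ex} s \<partial>exp_law q)"
   unfolding exc_tail_def by (intro nn_integral_cong) (auto simp: indicator_def)
  also have "... = ennreal (exp (- q * u)) * (NN t. ind {s. u < s & ennreal s < exc_length ex} (u + t) \<partial>exp_law q)"
   using u by (intro nn_integral_exp_law_shift[OF _ _ q]) (simp_all, measurable)
  finally show ?thesis by (simp add: indicator_def)
 qed
 have Im: "(%z. ind {t. 0 < t & ennreal (u + t) < exc_length (fst z)} (snd z) :: ennreal) \<in> bm (\<eta> \<Otimes>\<^sub>M exp_law q)"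
 proof -
  let ?A = "{z \<in> space (exc_space \<Otimes>\<^sub>M borel). u < snd z & ennreal (snd z) < exc_length (fst z)}"
  have "(%z. (fst z, u + snd z)) \<in> exc_space \<Otimes>\<^sub>M (borel :: real measure) \<rightarrow>\<^sub>M exc_space \<Otimes>\<^sub>M borel" by measurable
  moreover have "ind ?A \<in> bm (exc_space \<Otimes>\<^sub>M borel)"
   using measurable_exc_length_pair[of u] u by simp
  ultimately have "(%z. ind ?A (fst z, u + snd z) :: ennreal) \<in> bm (exc_space \<Otimes>\<^sub>M (borel :: real measure))"
   by (rule measurable_compose)
  then have "(%z. ind {t. 0 < t & ennreal (u + t) < exc_length (fst z)} (snd z) :: ennreal) \<in> bm (exc_space \<Otimes>\<^sub>M (borel :: real measure))"
   by (rule measurable_cong[THEN iffD1, rotated]) (auto simp: indicator_def space_pair_measure)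
  moreover have "sets (\<eta> \<Otimes>\<^sub>M exp_law q) = sets (exc_space \<Otimes>\<^sub>M (borel :: real measure))"
   by (rule sets_pair_measure_cong[OF sets_exc]) simp
  ultimately show ?thesis by (simp cong: measurable_cong_sets)
 qed
 have Yeta: "(%ex. \<gamma> (stop u ex)) \<in> bm \<eta>" by (rule measurable_compose[OF exc_path_\<eta> Yp])
 have I1: "(%ex. NN t. ind {t. 0 < t & ennreal (u + t) < exc_length ex} t \<partial>exp_law q) \<in> bm \<eta>"
  using Im by (intro E.borel_measurable_nn_integral) (simp add: case_prod_unfold)
 have "(NN ex. \<gamma> (stop u ex) * exc_tail q u ex \<partial>\<eta>)
   = ennreal (exp (- q * u)) * (NN ex. \<gamma> (stop u ex) * (NN t. ind {t. 0 < t & ennreal (u + t) < exc_length ex} t \<partial>exp_law q) \<partial>\<eta>)"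
  unfolding tail using Yeta I1 by (subst nn_integral_cmult[symmetric]) (auto intro!: nn_integral_cong simp: ac_simps)
 also have "(NN ex. \<gamma> (stop u ex) * (NN t. ind {t. 0 < t & ennreal (u + t) < exc_length ex} t \<partial>exp_law q) \<partial>\<eta>)
   = (NN ex. NN t. \<gamma> (stop u ex) * ind {t. 0 < t & ennreal (u + t) < exc_length ex} t \<partial>exp_law q \<partial>\<eta>)"
  by (intro nn_integral_cong nn_integral_cmult[symmetric]) (auto intro!: borel_measurable_indicator)
 also have "... = (NN t. NN ex. \<gamma> (stop u ex) * ind {t. 0 < t & ennreal (u + t) < exc_length ex} t \<partial>\<eta> \<partial>exp_law q)"
 proof (rule EE.Fubini'[symmetric])
  have "(%z. \<gamma> (stop u (fst z)) * ind {t. 0 < t & ennreal (u + t) < exc_length (fst z)} (snd z)) \<in> bm (\<eta> \<Otimes>\<^sub>M exp_law q)"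
   using measurable_compose[OF measurable_fst Yeta] Im by (rule borel_measurable_times_ennreal)
  then show "(%(ex, t). \<gamma> (stop u ex) * ind {t. 0 < t & ennreal (u + t) < exc_length ex} t) \<in> bm (\<eta> \<Otimes>\<^sub>M exp_law q)"
   by (simp add: case_prod_unfold)
 qed
 also have "... = (NN t. NN w. \<gamma> (stop u w) * no_hit t (pos u w) \<partial>?C \<partial>exp_law q)"
 proof (rule nn_integral_cong_AE, use AE_exp_law_pos[of q] in eventually_elim)
  case (elim t)
  have "(NN ex. \<gamma> (stop u ex) * ind {t. 0 < t & ennreal (u + t) < exc_length ex} t \<partial>\<eta>)
    = (NN ex. \<gamma> (stop u ex) * ind {ex. ennreal (u + t) < exc_length ex} ex \<partial>\<eta>)"
   using elim by (intro nn_integral_cong) (simp add: indicator_def)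
  also have "... = (NN w. \<gamma> (stop u w) \<partial>long_exc (u + t))"
   using u elim by (intro nn_integral_long_exc[OF _ Yp, symmetric]) simp
  also have "... = (NN w. \<gamma> (stop u w) * no_hit t (pos u w) \<partial>long_exc u)"
   using elim by (intro exc_markov_fixed[OF u _ Yn]) simp
  finally show ?case by (simp add: nn_integral_completion)
 qed
 also have "... = (NN w. NN t. \<gamma> (stop u w) * no_hit t (pos u w) \<partial>exp_law q \<partial>?C)"
 proof (rule LE.Fubini')
  have fst: "fst \<in> ?C \<Otimes>\<^sub>M exp_law q \<rightarrow>\<^sub>M ucompl path_space"
  proof -
   have "(%w. w) \<in> ucompl path_space \<rightarrow>\<^sub>M ucompl path_space" by simp
   then have "(%w. w) \<in> ?C \<rightarrow>\<^sub>M ucompl path_space"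
    by (rule measurable_ucompl_completion) (simp_all add: finite_long_exc u)
   then show ?thesis by (rule measurable_compose[OF measurable_fst])
  qed
  have "(%z. no_hit (snd z) (pos u (fst z))) \<in> bm (?C \<Otimes>\<^sub>M exp_law q)"
   using measurable_compose[OF measurable_Pair[OF fst] measurable_no_hit_at[of u]] u by simp
  moreover have "(%z. \<gamma> (stop u (fst z))) \<in> bm (?C \<Otimes>\<^sub>M exp_law q)"
   by (rule measurable_compose[OF fst measurable_ucomplI[OF Yp]])
  ultimately show "(%(w, t). \<gamma> (stop u w) * no_hit t (pos u w)) \<in> bm (?C \<Otimes>\<^sub>M exp_law q)"
   by (simp add: case_prod_unfold)
 qed
 also have "... = (NN w. \<gamma> (stop u w) * escape q (pos u w) \<partial>?C)"
 proof (rule nn_integral_cong)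
  fix w
  have "(%t. no_hit t (pos u w)) \<in> bm borel"
   by (subst no_hit_SUP, rule borel_measurable_SUP[OF countable_rat]) measurable
  then show "(NN t. \<gamma> (stop u w) * no_hit t (pos u w) \<partial>exp_law q) = \<gamma> (stop u w) * escape q (pos u w)"
   unfolding escape_no_hit[OF q] by (intro nn_integral_cmult) simp
 qed
 finally show ?thesis by (simp add: nn_integral_completion)
qed

end

section \<open>Setwise limits of measures\<close>

lemma nn_integral_layer_cake:
 assumes M: "sigma_finite_measure M" and f: "f \<in> bm M"
 shows "(NN x. ennreal (f x) \<partial>M) = (NN y. ind {0..} y * emeasure M {x \<in> space M. y < f x} \<partial>lborel)"
proof -
 interpret sigma_finite_measure M by fact
 interpret pair_sigma_finite M "lborel :: real measure" ..
 have [measurable]: "f \<in> bm M" by fact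
 have "(NN x. ennreal (f x) \<partial>M) = (NN x. (NN y. (if 0 <= y & y < f x then 1 else 0) \<partial>lborel) \<partial>M)"
 proof (rule nn_integral_cong)
  fix x
  have "(NN y. (if 0 <= y & y < f x then 1 else 0) \<partial>lborel) = (NN y. ind {0..<f x} y \<partial>lborel)"
   by (intro nn_integral_cong) (simp add: indicator_def)
  also have "... = ennreal (f x)" by (cases "0 <= f x") (auto simp: ennreal_neg)
  finally show "ennreal (f x) = (NN y. (if 0 <= y & y < f x then 1 else 0) \<partial>lborel)" by simp
 qed
 also have "... = (NN y. (NN x. (if 0 <= y & y < f x then 1 else 0) \<partial>M) \<partial>lborel)"
  by (rule Fubini'[symmetric]) measurable
 also have "... = (NN y. ind {0..} y * emeasure M {x \<in> space M. y < f x} \<partial>lborel)"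
 proof (rule nn_integral_cong)
  fix y :: real
  have "(NN x. (if 0 <= y & y < f x then 1 else 0) \<partial>M) = (NN x. ind {0..} y * ind {x \<in> space M. y < f x} x \<partial>M)"
   by (intro nn_integral_cong) (simp add: indicator_def)
  also have "... = ind {0..} y * (NN x. ind {x \<in> space M. y < f x} x \<partial>M)"
   using f by (intro nn_integral_cmult) measurable
  finally show "(NN x. (if 0 <= y & y < f x then 1 else 0) \<partial>M) = ind {0..} y * emeasure M {x \<in> space M. y < f x}"
   using f by simp
 qed
 finally show ?thesis .
qed

text \<open>The layer cake formula reduces the integral to the measures of superlevel sets, which converge boundedly.\<close>

lemma setwise_limit_nn_integral:
 fixes f :: "'a => real"
 assumes fin: "!!n. finite_measure (\<nu> n)" "finite_measure \<nu>0"
  and sets: "!!n. sets (\<nu> n) = sets M" "sets \<nu>0 = sets M"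
  and lim: "!!A. A \<in> sets M ==> (%n. emeasure (\<nu> n) A) \<longlonglongrightarrow> emeasure \<nu>0 A"
  and bnd: "!!n. emeasure (\<nu> n) (space M) <= ennreal B"
  and f: "f \<in> bm M" "!!x. x \<in> space M ==> f x <= K"
 shows "(%n. NN x. ennreal (f x) \<partial>\<nu> n) \<longlonglongrightarrow> (NN x. ennreal (f x) \<partial>\<nu>0)"
proof -
 have sp: "space (\<nu> n) = space M" "space \<nu>0 = space M" for n
  by (rule sets_eq_imp_space_eq[OF sets(1)]) (rule sets_eq_imp_space_eq[OF sets(2)])
 have fm: "f \<in> bm (\<nu> n)" "f \<in> bm \<nu>0" for n
  using f(1) sets by (simp_all cong: measurable_cong_sets)
 have lc: "(NN x. ennreal (f x) \<partial>\<nu> n) = (NN y. ind {0..} y * emeasure (\<nu> n) {x \<in> space M. y < f x} \<partial>lborel)" for n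
  using nn_integral_layer_cake[OF _ fm(1)] fin(1)[of n] sp by (simp add: finite_measure_def)
 have lc0: "(NN x. ennreal (f x) \<partial>\<nu>0) = (NN y. ind {0..} y * emeasure \<nu>0 {x \<in> space M. y < f x} \<partial>lborel)"
  using nn_integral_layer_cake[OF _ fm(2)] fin(2) sp by (simp add: finite_measure_def)
 have S: "{x \<in> space M. y < f x} \<in> sets M" for y using f(1) by measurable
 have anti: "(%y. ind {0..} y * emeasure N {x \<in> space M. y < f x}) \<in> bm lborel"
  if N: "sets N = sets M" "finite_measure N" for N
 proof -
  interpret finite_measure N by fact
  have "(%y. NN x. (if y < f x then 1 else 0) \<partial>N) \<in> bm lborel"
   using f(1) N(1) by (intro borel_measurable_nn_integral) (measurable, simp cong: measurable_cong_sets)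
  moreover have "(NN x. (if y < f x then 1 else 0) \<partial>N) = emeasure N {x \<in> space M. y < f x}" for y
  proof -
   have "(NN x. (if y < f x then 1 else 0) \<partial>N) = (NN x. ind {x \<in> space M. y < f x} x \<partial>N)"
    using sets_eq_imp_space_eq[OF N(1)] by (intro nn_integral_cong) (simp add: indicator_def)
   then show ?thesis using S[of y] N(1) by simp
  qed
  ultimately have "(%y. emeasure N {x \<in> space M. y < f x}) \<in> bm lborel" by simp
  then show ?thesis by (intro borel_measurable_times_ennreal) auto
 qed
 show ?thesis
  unfolding lc lc0
 proof (rule nn_integral_dominated_convergence[where w = "%y. ennreal B * ind {0..K} y"])
  show "(%y. ind {0..} y * emeasure (\<nu> n) {x \<in> space M. y < f x}) \<in> bm lborel" for n
   by (rule anti) (use sets fin in auto)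
  show "(%y. ind {0..} y * emeasure \<nu>0 {x \<in> space M. y < f x}) \<in> bm lborel"
   by (rule anti) (use sets fin in auto)
  show "AE y in lborel. ind {0..} y * emeasure (\<nu> n) {x \<in> space M. y < f x} <= ennreal B * ind {0..K} y" for n
  proof (rule AE_I2)
   fix y :: real
   show "ind {0..} y * emeasure (\<nu> n) {x \<in> space M. y < f x} <= ennreal B * ind {0..K} y"
   proof (cases "0 <= y & y <= K")
    case True
    have "emeasure (\<nu> n) {x \<in> space M. y < f x} <= emeasure (\<nu> n) (space M)"
     using sets.top[of "\<nu> n"] sp by (intro emeasure_mono) auto
    then show ?thesis using True bnd[of n] by (auto intro: order_trans)
   next
    case False
    have z: "ind {0..} y * emeasure (\<nu> n) {x \<in> space M. y < f x} = 0"
    proof (cases "0 <= y")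
     case True
     then have e: "{x \<in> space M. y < f x} = {}" using f(2) False by force
     show ?thesis unfolding e by simp
    qed simp
    show ?thesis unfolding z by simp
   qed
  qed
  show "(NN y. ennreal B * ind {0..K} y \<partial>lborel) < \<infinity>"
   by (subst nn_integral_cmult_indicator) (auto simp: ennreal_mult_less_top emeasure_lborel_Icc_eq)
  show "AE y in lborel. (%n. ind {0..} y * emeasure (\<nu> n) {x \<in> space M. y < f x})
    \<longlonglongrightarrow> ind {0..} y * emeasure \<nu>0 {x \<in> space M. y < f x}"
   using lim[OF S] by (intro AE_I2) (auto simp: indicator_def)
 qed auto
qed


section \<open>Functionals of the path at its last zero\<close>

lemma nat_filt_agree:
 assumes A: "A \<in> sets (filt t)" and t: "0 <= t"
  and w: "w \<in> paths" "w' \<in> paths" and eq: "!!s. 0 <= s ==> s <= t ==> w s = w' s"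
 shows "w \<in> A \<longleftrightarrow> w' \<in> A"
proof -
 have "A \<in> sigma_sets paths {{w \<in> paths. w s \<in> Some ` B} | s B. 0 <= s & ennreal s <= ennreal t & B \<in> sets (borel :: real measure)}"
  using A unfolding nat_filt_def sets_measure_of[OF nat_filt_generator_sub] .
 then show ?thesis
 proof (induction rule: sigma_sets.induct)
  case (Basic A)
  then obtain s B where "A = {w \<in> paths. w s \<in> Some ` B}" "0 <= s" "ennreal s <= ennreal t" by blast
  then show ?case using w eq[of s] t by (simp add: ennreal_le_iff)
 qed (use w in auto)
qed

text \<open>Right-continuity with isolated cemetery: a path alive at \<open>t\<close> survives a little longer.\<close>

lemma lifetime_gt_iff:
 assumes w: "w \<in> paths" and t: "0 <= t"
 shows "ennreal t < lifetime w \<longleftrightarrow> w t ~= None"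
proof
 assume lt: "ennreal t < lifetime w"
 show "w t ~= None"
 proof
  assume "w t = None"
  then have "lifetime w <= ennreal t" unfolding lifetime_def using t by (auto intro!: Inf_lower)
  then show False using lt by simp
 qed
next
 assume "w t ~= None"
 then obtain q where q: "t < q" "w q ~= None" using alive_iff[OF w t] by blast
 have "ennreal q <= lifetime w"
  unfolding lifetime_def
 proof (rule Inf_greatest)
  fix y assume "y \<in> ennreal ` {t. 0 <= t & w t = None}"
  then obtain r where r: "y = ennreal r" "0 <= r" "w r = None" by auto
  have "q <= r" using pathsD(2)[OF w, of r q] r q by (cases "r <= q") auto
  then show "ennreal q <= y" using r(1) by (simp add: ennreal_leI)
 qed
 moreover have "ennreal t < ennreal q" using q(1) t by (simp add: ennreal_less_iff)
 ultimately show "ennreal t < lifetime w" by (rule less_le_trans[rotated])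
qed

lemma measurable_lifetime: "lifetime \<in> bm path_space"
proof (rule borel_measurableI_greater)
 fix y :: ennreal
 show "{w \<in> space path_space. y < lifetime w} \<in> sets path_space"
 proof (cases y)
  case (real t)
  have "{w \<in> space path_space. y < lifetime w} = {w \<in> paths. w t ~= None}"
   using lifetime_gt_iff[OF _ real(1)] real(2) by auto
  then show ?thesis using measurable_alive[OF real(1), of top] by simp
 qed simp
qed

lemma last_zero_less_top_iff: "w \<in> paths ==> last_zero (ennreal s) w < top \<longleftrightarrow> (\<exists>z\<in>zeros w. ennreal z <= ennreal s)"
proof -
 let ?Z = "{z \<in> zeros w. ennreal z <= ennreal s}"
 have "Sup (ennreal ` ?Z) <= ennreal s" by (rule Sup_least) auto
 then have "Sup (ennreal ` ?Z) < top" by (rule le_less_trans) simp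
 then show ?thesis by (auto simp: last_zero_def Let_def)
qed

lemma last_zero_ge:
 assumes "z \<in> zeros w" "ennreal z <= t" shows "ennreal z <= last_zero t w"
proof -
 have "ennreal z <= Sup (ennreal ` {z \<in> zeros w. ennreal z <= t})" using assms by (intro Sup_upper) auto
 then show ?thesis using assms by (auto simp: last_zero_def Let_def)
qed

lemma last_zero_cong:
 "{z \<in> zeros w. ennreal z <= s} = {z \<in> zeros w'. ennreal z <= t} ==> last_zero s w = last_zero t w'"
 by (simp add: last_zero_def)

text \<open>The two versions of the functional: \<open>exit_value\<close> refers to the last zero before an independent time \<open>s\<close> of the
process, \<open>final_value\<close> to the last zero of a mortal path.\<close>

definition exit_value ::
 "(path => real) => (real => real) => (path => real) => real => path => real => real" where
 "exit_value F f G u w s = (if last_zero (ennreal s) w + ennreal u < ennreal s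
   then F (kill (gz s w) w) * f (gz s w) * G (stop u (shift (gz s w) w)) else 0)"

definition final_value ::
 "(path => real) => (real => real) => (path => real) => real => path => real" where
 "final_value F f G u w = F (kill (enn2real (last_zero top w)) w) * f (enn2real (last_zero top w))
   * G (stop u (shift (enn2real (last_zero top w)) w))
   * ind {w. last_zero top w + ennreal u < lifetime w} w"

lemma measurable_exit_parts:
 fixes F G :: "path => real" and f :: "real => real"
 assumes F: "F \<in> bm path_space" and G: "G \<in> bm path_space"
  and f: "f \<in> bm (restrict_space borel {0..})" and u: "0 <= u"
  and W: "W \<in> M \<rightarrow>\<^sub>M path_space" and \<tau>: "\<tau> \<in> bm M" and pos: "!!x. x \<in> space M ==> 0 <= \<tau> x"
 shows "(%x. F (kill (\<tau> x) (W x)) * f (\<tau> x) * G (stop u (shift (\<tau> x) (W x)))) \<in> bm M"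
proof (intro borel_measurable_times)
 show "(%x. F (kill (\<tau> x) (W x))) \<in> bm M"
  by (rule measurable_compose[OF measurable_kill[OF W \<tau>] F])
 show "(%x. f (\<tau> x)) \<in> bm M"
  by (rule measurable_compose[OF measurable_restrict_space2[OF _ \<tau>] f]) (use pos in auto)
 show "(%x. G (stop u (shift (\<tau> x) (W x)))) \<in> bm M"
  by (rule measurable_compose[OF measurable_compose[OF measurable_shift[OF W \<tau> pos] measurable_stop_const[OF u]] G])
qed

lemma measurable_exit_value:
 assumes "F \<in> bm path_space" "G \<in> bm path_space"
  "f \<in> bm (restrict_space borel {0..})" "0 <= u"
 shows "(%z. exit_value F f G u (fst z) (snd z)) \<in> bm prod_space"
proof -
 let ?M = "prod_space"
 have fst: "fst \<in> ?M \<rightarrow>\<^sub>M path_space"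
  by (rule measurable_compose[OF measurable_fst measurable_ucomplI]) simp
 have [measurable]: "(%z. F (kill (gz (snd z) (fst z)) (fst z)) * f (gz (snd z) (fst z)) * G (stop u (shift (gz (snd z) (fst z)) (fst z))))
   \<in> bm ?M"
  by (rule measurable_exit_parts[OF assms fst measurable_gz gz_nonneg])
 have [measurable]: "(%z. last_zero (ennreal (snd z)) (fst z)) \<in> bm ?M"
  by (rule measurable_last_zero_comp) measurable
 show ?thesis unfolding exit_value_def by measurable
qed

lemma measurable_last_zero_top: "last_zero top \<in> bm (ucompl path_space)"
 using measurable_last_zero_comp[of "%w. w" "ucompl path_space" "%_. top"] by simp

lemma measurable_final_value:
 assumes "F \<in> bm path_space" "G \<in> bm path_space"
  "f \<in> bm (restrict_space borel {0..})" "0 <= u"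
 shows "final_value F f G u \<in> bm (ucompl path_space)"
proof -
 let ?M = "ucompl path_space"
 have id: "(%w. w) \<in> ?M \<rightarrow>\<^sub>M path_space" by (rule measurable_ucomplI) simp
 note [measurable] = measurable_last_zero_top measurable_compose[OF id measurable_lifetime]
 have m: "(%w. F (kill (enn2real (last_zero top w)) w) * f (enn2real (last_zero top w)) * G (stop u (shift (enn2real (last_zero top w)) w)))
   \<in> bm ?M"
  by (rule measurable_exit_parts[OF assms id]) measurable
 have "(%w. if last_zero top w + ennreal u < lifetime w then 1 else 0 :: real) \<in> bm ?M"
  by measurable
 then have "(%w. ind {w. last_zero top w + ennreal u < lifetime w} w :: real) \<in> bm ?M"
  by (simp add: indicator_def of_bool_def)
 then show ?thesis
  unfolding final_value_def[abs_def] by (rule borel_measurable_times[OF m])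
qed

lemma kill_zeros: "zeros (kill s w) = {z \<in> zeros w. z < s}"
 by (auto simp: zeros_def kill_def)

lemma lifetime_kill:
 assumes w: "w \<in> paths" and al: "\<forall>t\<ge>0. w t ~= None" and s: "0 <= s"
 shows "lifetime (kill s w) = ennreal s"
proof -
 have "{t. 0 <= t & kill s w t = None} = {t. s <= t}" using al s by (auto simp: kill_def)
 then have "lifetime (kill s w) = Inf (ennreal ` {t. s <= t})" by (simp add: lifetime_def)
 also have "... = ennreal s"
  by (rule antisym) (auto intro!: Inf_lower Inf_greatest ennreal_leI)
 finally show ?thesis .
qed

lemma final_kill_generic:
 assumes w: "w \<in> paths" "closed (zeros w)" and al: "\<forall>t\<ge>0. w t ~= None" and u: "0 <= u" and s: "0 < s" and nz: "s \<notin> zeros w"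
 shows "final_value F f G u (kill s w) = exit_value F f G u w s"
proof -
 have lz: "last_zero top (kill s w) = last_zero (ennreal s) w"
 proof (rule last_zero_cong)
  show "{z \<in> zeros (kill s w). ennreal z <= top} = {z \<in> zeros w. ennreal z <= ennreal s}"
   using nz s by (auto simp: kill_zeros ennreal_le_iff less_le)
 qed
 have life: "lifetime (kill s w) = ennreal s" using s by (intro lifetime_kill[OF w(1) al]) simp
 show ?thesis
 proof (cases "last_zero (ennreal s) w + ennreal u < ennreal s")
  case False
  then show ?thesis by (simp add: final_value_def exit_value_def lz life)
 next
  case True
  let ?g = "gz s w"
  have "last_zero (ennreal s) w < top" using True by (auto simp: less_top[symmetric])
  then have "last_zero (ennreal s) w = ennreal ?g" by (simp add: gz_def)
  then have gu: "?g + u < s" using True u s gz_nonneg[of s w] by (simp add: ennreal_less_iff flip: ennreal_plus)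
  have k: "kill ?g (kill s w) = kill ?g w" using gu u by (auto simp: kill_def intro!: restrict_ext)
  have st: "stop u (shift ?g (kill s w)) = stop u (shift ?g w)"
   using gu u gz_nonneg[of s w] by (auto simp: stop_def shift_def kill_def intro!: restrict_ext)
  show ?thesis using True k st
   by (simp add: final_value_def exit_value_def lz life flip: gz_def)
 qed
qed

lemma final_kill_zero:
 assumes w: "w \<in> paths" and al: "\<forall>t\<ge>0. w t ~= None" and u: "0 < u" and s: "0 < s" and z: "s \<in> zeros w"
  and near: "\<exists>r\<in>zeros w. s - u < r & r < s"
 shows "final_value F f G u (kill s w) = exit_value F f G u w s"
proof -
 have life: "lifetime (kill s w) = ennreal s" using s by (intro lifetime_kill[OF w al]) simp
 obtain r where r: "r \<in> zeros w" "s - u < r" "r < s" using near by blast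
 have "ennreal r <= last_zero top (kill s w)" using r by (intro last_zero_ge) (auto simp: kill_zeros)
 then have "ennreal r + ennreal u <= last_zero top (kill s w) + ennreal u" by (rule add_right_mono)
 moreover have "ennreal s <= ennreal r + ennreal u" using r u by (auto simp: zeros_def simp flip: ennreal_plus intro!: ennreal_leI)
 ultimately have 1: "~ last_zero top (kill s w) + ennreal u < ennreal s" by (meson not_less order_trans)
 have "ennreal s <= last_zero (ennreal s) w" using z by (intro last_zero_ge) auto
 then have "ennreal s <= last_zero (ennreal s) w + ennreal u" by (rule order_trans) simp
 then have 2: "~ last_zero (ennreal s) w + ennreal u < ennreal s" by (simp add: not_less)
 show ?thesis using 1 2 by (simp add: final_value_def exit_value_def life)
qed

text \<open>Each such zero owns the interval of length \<open>u\<close> before it, and a rational number in it.\<close>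

lemma countable_isolated_zeros:
 assumes "0 < (u::real)" shows "countable {s \<in> zeros w. ~ (\<exists>r\<in>zeros w. s - u < r & r < s)}"
proof -
 let ?D = "{s \<in> zeros w. ~ (\<exists>r\<in>zeros w. s - u < r & r < s)}"
 have "\<forall>s\<in>?D. \<exists>q. q \<in> \<rat> & s - u < q & q < s"
  using assms Rats_dense_in_real by (metis diff_less_eq less_add_same_cancel1 add.commute)
 from bchoice[OF this] obtain f where f: "\<forall>s\<in>?D. f s \<in> \<rat> & s - u < f s & f s < s" ..
 have "inj_on f ?D"
 proof (rule linorder_inj_onI)
  fix s t assume st: "s < t" "s \<in> ?D" "t \<in> ?D"
  then have "s <= t - u" by (auto simp: not_less)
  moreover have "f s < s" "t - u < f t" using bspec[OF f st(2)] bspec[OF f st(3)] by auto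
  ultimately show "f s ~= f t" by linarith
 qed auto
 moreover have "countable (f ` ?D)" by (rule countable_subset[OF _ countable_rat]) (use f in auto)
 ultimately show ?thesis using countable_image_inj_on by blast
qed

text \<open>Killing at \<open>s\<close> turns \<open>s\<close> into the lifetime and the last zero before \<open>s\<close> into the last zero.  If \<open>s\<close> is itself a zero, then
killing removes it; the two functionals still vanish unless the previous zero is at distance \<open>u\<close> or more, which
happens for countably many \<open>s\<close>.\<close>

lemma AE_final_kill:
 assumes w: "w \<in> paths" "closed (zeros w)" and al: "\<forall>t\<ge>0. w t ~= None" and u: "0 < u"
 shows "AE s in lborel. 0 < s --> final_value F f G u (kill s w) = exit_value F f G u w s"
proof -
 let ?D = "{s \<in> zeros w. ~ (\<exists>r\<in>zeros w. s - u < r & r < s)}"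
 have "?D \<in> null_sets lborel"
  by (rule countable_imp_null_set_lborel[OF countable_isolated_zeros[OF u]])
 then have "AE s in lborel. s \<notin> ?D" by (rule AE_not_in)
 then show ?thesis
 proof eventually_elim
  case (elim s)
  show ?case
  proof
   assume s: "0 < s"
   show "final_value F f G u (kill s w) = exit_value F f G u w s"
   proof (cases "s \<in> zeros w")
    case True
    then show ?thesis using elim by (intro final_kill_zero[OF w(1) al u s]) auto
   next
    case False
    then show ?thesis using u by (intro final_kill_generic[OF w al _ s]) auto
   qed
  qed
 qed
qed

lemma exit_value_stop:
 assumes b: "0 <= b" and u: "0 <= u"
 shows "exit_value F f G u (stop b w) b = exit_value F f G u w b"
proof -
 note lz = last_zero_stop[OF b, of w]
 then have g: "gz b (stop b w) = gz b w" by (simp add: gz_def)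
 show ?thesis
 proof (cases "last_zero (ennreal b) w + ennreal u < ennreal b")
  case True
  let ?g = "gz b w"
  have "last_zero (ennreal b) w < top" using True by (auto simp: less_top[symmetric])
  then have "last_zero (ennreal b) w = ennreal ?g" by (simp add: gz_def)
  then have gu: "?g + u < b" using True u b gz_nonneg[of b w] by (simp add: ennreal_less_iff flip: ennreal_plus)
  have k: "kill ?g (stop b w) = kill ?g w" using gu u by (auto simp: kill_def stop_def intro!: restrict_ext)
  have st: "stop u (shift ?g (stop b w)) = stop u (shift ?g w)"
   using gu u gz_nonneg[of b w] by (auto simp: stop_def shift_def intro!: restrict_ext)
  show ?thesis using k st g lz by (simp add: exit_value_def)
 qed (simp add: exit_value_def lz)
qed

context nice_markov_process
begin

section \<open>The law conditioned on an early last zero\<close>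

definition joint :: "real => real => (path \<times> real => ennreal) => ennreal" where
 "joint x q Y = (NN w. (NN s. Y (w, s) \<partial>exp_law q) \<partial>P x)"

lemma completion_pair_measurable:
 "f \<in> bm prod_space ==> f \<in> bm (cP x \<Otimes>\<^sub>M (borel :: real measure))"
proof -
 assume f: "f \<in> bm prod_space"
 have "(%w. w) \<in> cP x \<rightarrow>\<^sub>M ucompl path_space"
  by (rule ucompl_completion) simp
 then have "(%z. (fst z, snd z)) \<in> cP x \<Otimes>\<^sub>M (borel :: real measure) \<rightarrow>\<^sub>M prod_space"
  by (rule measurable_Pair[OF measurable_compose[OF measurable_fst] measurable_snd])
 from measurable_compose[OF this f] show ?thesis by simp
qed

lemma joint_with_exp_time:
 assumes q: "0 < q" and E: "E \<in> sets prod_space"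
 shows "emeasure (with_exp_time P x q) E = joint x q (ind E)"
proof -
 interpret E: prob_space "exp_law q" by (rule prob_space_exp_law[OF q])
 have "(ind E :: _ => ennreal) \<in> bm (cP x \<Otimes>\<^sub>M (borel :: real measure))"
  using E by (intro completion_pair_measurable) simp
 then have E1: "E \<in> sets (cP x \<Otimes>\<^sub>M (borel :: real measure))"
 proof -
  assume m: "(ind E :: _ => ennreal) \<in> bm (cP x \<Otimes>\<^sub>M (borel :: real measure))"
  have "(ind E :: _ => ennreal) -` {1} Int space (cP x \<Otimes>\<^sub>M (borel :: real measure)) \<in> sets (cP x \<Otimes>\<^sub>M (borel :: real measure))"
   by (rule measurable_sets[OF m]) simp
  also have "(ind E :: _ => ennreal) -` {1} Int space (cP x \<Otimes>\<^sub>M (borel :: real measure)) = E"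
   using sets.sets_into_space[OF E] by (auto simp: indicator_def space_pair_measure of_bool_def split: if_splits)
  finally show ?thesis .
 qed
 have "sets (cP x \<Otimes>\<^sub>M exp_law q) = sets (cP x \<Otimes>\<^sub>M (borel :: real measure))"
  by (rule sets_pair_measure_cong) simp_all
 then have E2: "E \<in> sets (cP x \<Otimes>\<^sub>M exp_law q)" using E1 by simp
 have "emeasure (with_exp_time P x q) E = emeasure (cP x \<Otimes>\<^sub>M exp_law q) E"
  unfolding with_exp_time_def by (rule completion_pair_sets(2)[OF prob_P prob_space_exp_law[OF q] E2])
 also have "... = (NN w. (NN s. ind E (w, s) \<partial>exp_law q) \<partial>cP x)"
  by (rule E.emeasure_pair_measure[OF E2])
 finally show ?thesis by (simp add: joint_def nn_integral_completion)
qed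

lemma measure_with_exp_time:
 assumes q: "0 < q" and R: "{z \<in> paths \<times> UNIV. R z} \<in> sets prod_space"
 shows "\<P>(z in with_exp_time P x q. R z) = enn2real (joint x q (ind {z \<in> paths \<times> UNIV. R z}))"
proof -
 have "{z \<in> space (with_exp_time P x q). R z} = {z \<in> paths \<times> UNIV. R z}"
  by (simp add: with_exp_time_def space_pair_measure)
 then show ?thesis using joint_with_exp_time[OF q R, of x] by (simp add: measure_def)
qed

lemma joint_section:
 assumes "f \<in> bm prod_space"
 shows "0 < q ==> (%w. NN s. f (w, s) \<partial>exp_law q) \<in> bm (cP x)"
proof -
 assume q: "0 < q"
 interpret E: prob_space "exp_law q" by (rule prob_space_exp_law[OF q])
 have "sets (cP x \<Otimes>\<^sub>M exp_law q) = sets (cP x \<Otimes>\<^sub>M (borel :: real measure))"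
  by (rule sets_pair_measure_cong) simp_all
 from measurable_cong_sets[OF this refl, of borel] completion_pair_measurable[OF assms, of x]
 have "f \<in> bm (cP x \<Otimes>\<^sub>M exp_law q)" by blast
 then have "(%(w, s). f (w, s)) \<in> bm (cP x \<Otimes>\<^sub>M exp_law q)" by simp
 then show ?thesis by (rule E.borel_measurable_nn_integral)
qed

lemma joint_add:
 assumes q: "0 < q" and f: "f \<in> bm prod_space" and g: "g \<in> bm prod_space"
 shows "joint x q (%z. f z + g z) = joint x q f + joint x q g"
proof -
 have "joint x q (%z. f z + g z) = (NN w. (NN s. f (w, s) \<partial>exp_law q) + (NN s. g (w, s) \<partial>exp_law q) \<partial>P x)"
  unfolding joint_def
 proof (rule nn_integral_cong)
  fix w assume "w \<in> space (P x)"
  then show "(NN s. f (w, s) + g (w, s) \<partial>exp_law q) = (NN s. f (w, s) \<partial>exp_law q) + (NN s. g (w, s) \<partial>exp_law q)"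
   using measurable_section[OF f, of w] measurable_section[OF g, of w] by (intro nn_integral_add) auto
 qed
 also have "... = joint x q f + joint x q g"
  unfolding joint_def
  using nn_integral_add[OF joint_section[OF f q, of x] joint_section[OF g q, of x]]
  by (simp only: nn_integral_completion)
 finally show ?thesis .
qed

lemma joint_mono: "(!!w s. w \<in> paths ==> f (w, s) <= g (w, s)) ==> joint x q f <= joint x q g"
 unfolding joint_def by (intro nn_integral_mono) simp

lemma joint_cong: "(!!w s. w \<in> paths ==> 0 <= s ==> f (w, s) = g (w, s)) ==> joint x q f = joint x q g"
 unfolding joint_def
proof (rule nn_integral_cong)
 fix w assume *: "!!w s. w \<in> paths ==> 0 <= s ==> f (w, s) = g (w, s)" "w \<in> space (P x)"
 show "(NN s. f (w, s) \<partial>exp_law q) = (NN s. g (w, s) \<partial>exp_law q)"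
  by (rule nn_integral_cong_AE, use AE_exp_law_nonneg[of q] in eventually_elim) (use * in simp)
qed

lemma joint_const: assumes "0 < q" shows "joint x q (%_. c) = c"
 using prob_space.emeasure_space_1[OF prob_P[of x]] prob_space.emeasure_space_1[OF prob_space_exp_law[OF assms]]
 by (simp add: joint_def)

lemma exit_weight_one: assumes q: "0 < q" shows "exit_weight q (%_. 1) = 1"
proof -
 have "exit_weight q (%_. 1) = (NN w. 1 \<partial>P 0)"
  unfolding exit_weight_def
 proof (rule nn_integral_cong_AE, use start_0 AE_space in eventually_elim)
  case (elim w)
  have "exit_int q (%_. 1) (%_. 1) w = (NN s. 1 \<partial>exp_law q)"
   unfolding exit_int_def
  proof (rule nn_integral_cong_AE, use AE_exp_law_nonneg[of q] in eventually_elim)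
   case (elim s)
   then have "hit0 w <= ennreal s"
    using hit0_le_real[of w s] \<open>0 \<in> zeros w\<close> \<open>w \<in> space (P 0)\<close> by auto
   then show ?case by (simp add: exit_fun_def)
  qed
  then show ?case using prob_space.emeasure_space_1[OF prob_space_exp_law[OF q]] by simp
 qed
 then show ?thesis using prob_space.emeasure_space_1[OF prob_P[of 0]] by simp
qed

text \<open>The last exit formula after division by the potential at \<open>0\<close>, which is the inverse of \<open>kappa q\<close>.\<close>

lemma last_exit_formula_kappa:
 assumes q: "0 < q" and \<Gamma>: "\<Gamma> \<in> bm (path_space \<Otimes>\<^sub>M borel)" and le1: "!!z. \<Gamma> z <= 1"
  and \<phi>: "\<phi> \<in> bm optional"
 shows "(NN w. exit_int q \<Gamma> \<phi> w \<partial>P x) = kappa q * exit_weight q \<Gamma> * (NN w. lt_int q \<phi> w \<partial>P x)"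
proof -
 note W = total_potential_kappa[OF q]
 have "kappa q * (total_potential q * (NN w. exit_int q \<Gamma> \<phi> w \<partial>P x))
   = kappa q * (exit_weight q \<Gamma> * (NN w. lt_int q \<phi> w \<partial>P x))"
  using last_exit_formula[OF q \<Gamma> le1 total_potential_finite[OF q] \<phi>, of x] by simp
 moreover have "kappa q * (total_potential q * z) = z" for z
 proof -
  have "kappa q * (total_potential q * z) = total_potential q * kappa q * z" by (simp only: ac_simps)
  then show ?thesis unfolding W by simp
 qed
 ultimately show ?thesis by (simp add: mult.assoc)
qed

end

text \<open>The potential \<open>V\<close> may vanish here; the conditioning event is then null and the limit law dies at time \<open>0\<close>.\<close>

locale last_zero_law = nice_markov_process +
 fixes a x :: real and Pa :: "path measure"
 assumes a_pos: "0 < a" and Pa_law: "is_last_zero_law P a x Pa"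
begin

definition qs :: "nat => real" where "qs n = 1 / Suc n"

lemma qs_pos: "0 < qs n" and qs_le_1: "qs n <= 1" by (simp_all add: qs_def)

lemma qs_tendsto: "qs \<longlonglongrightarrow> 0"
 unfolding qs_def[abs_def] by (rule LIMSEQ_Suc[OF lim_1_over_n])

lemma qs_at_right: "filterlim qs (at_right 0) sequentially"
 unfolding filterlim_at using qs_tendsto qs_pos by (auto simp: less_imp_neq[symmetric])

lemma exp_qs_tendsto: "(%n. ennreal (exp (qs n * r))) \<longlonglongrightarrow> 1"
proof -
 have "(%n. ennreal (exp (qs n * r))) \<longlonglongrightarrow> ennreal (exp (0 * r))"
  by (intro tendsto_ennrealI tendsto_intros qs_tendsto)
 then show ?thesis by simp
qed

definition early :: "(path \<times> real) set" where
 "early = {z \<in> paths \<times> UNIV. last_zero (ennreal (snd z)) (fst z) < ennreal a}"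

lemma early_sets [measurable]: "early \<in> sets prod_space"
proof -
 have [measurable]: "(%z. last_zero (ennreal (snd z)) (fst z)) \<in> bm prod_space"
  by (rule measurable_last_zero_comp) measurable
 have "early = {z \<in> space prod_space. last_zero (ennreal (snd z)) (fst z) < ennreal a}"
  by (auto simp: early_def space_pair_measure)
 also have "... \<in> sets prod_space" by measurable
 finally show ?thesis .
qed

lemma early_iff: "w \<in> paths ==> (w, s) \<in> early \<longleftrightarrow> last_zero (ennreal s) w < ennreal a"
 by (simp add: early_def)

definition pn :: "nat => ennreal" where "pn n = joint x (qs n) (ind early)"

definition pot :: "real => (path \<times> real => ennreal) => ennreal" where
 "pot q \<phi> = (NN w. lt_int q \<phi> w \<partial>P x)"

abbreviation cutoff :: "path \<times> real => ennreal" where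
 "cutoff \<equiv> %z. ind {..<a} (snd z)"

lemma cutoff_measurable: "cutoff \<in> bm optional"
 using measurable_optional_snd by measurable

text \<open>Before time \<open>a\<close> the discount stays between \<open>e\<^sup>-\<^sup>q\<^sup>a\<close> and \<open>1\<close>.\<close>

lemma pot_exp_bounds:
 assumes q: "0 <= q" and \<phi>: "\<phi> \<in> bm optional" "!!w v. a <= v ==> \<phi> (w, v) = 0"
 shows "pot q \<phi> <= pot 0 \<phi>" "ennreal (exp (- q * a)) * pot 0 \<phi> <= pot q \<phi>"
proof -
 show "pot q \<phi> <= pot 0 \<phi>"
  unfolding pot_def lt_int_def
 proof (intro nn_integral_mono)
  fix w v
  show "ind {0..} v * (ennreal (exp (- q * v)) * \<phi> (w, v)) <= ind {0..} v * (ennreal (exp (- 0 * v)) * \<phi> (w, v))"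
  proof (cases "0 <= v")
   case True
   then have "ennreal (exp (- q * v)) <= 1" using q by simp
   from mult_right_mono[OF this, of "\<phi> (w, v)"] show ?thesis using True by simp
  qed simp
 qed
 have "ennreal (exp (- q * a)) * pot 0 \<phi> = (NN w. ennreal (exp (- q * a)) * lt_int 0 \<phi> w \<partial>cP x)"
  unfolding pot_def using nn_integral_cmult[OF measurable_lt_int[OF \<phi>(1), of 0 x], of "ennreal (exp (- q * a))"]
  by (simp add: nn_integral_completion)
 also have "... <= (NN w. lt_int q \<phi> w \<partial>cP x)"
 proof (rule nn_integral_mono)
  fix w assume "w \<in> space (cP x)"
  then have "w \<in> paths" by simp
  from measurable_optional_section[OF measurable_exp_phi[OF \<phi>(1)] this, of 0]
  have "ennreal (exp (- q * a)) * lt_int 0 \<phi> w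
    = (NN v. ennreal (exp (- q * a)) * (ind {0..} v * (ennreal (exp (- 0 * v)) * \<phi> (w, v))) \<partial>lt w)"
   unfolding lt_int_def by (intro nn_integral_cmult[symmetric]) simp
  also have "... <= lt_int q \<phi> w"
   unfolding lt_int_def
  proof (rule nn_integral_mono)
   fix v
   show "ennreal (exp (- q * a)) * (ind {0..} v * (ennreal (exp (- 0 * v)) * \<phi> (w, v)))
     <= ind {0..} v * (ennreal (exp (- q * v)) * \<phi> (w, v))"
   proof (cases "0 <= v & v < a")
    case True
    then have "exp (- q * a) <= exp (- q * v)" using q by (auto intro: mult_left_mono)
    then show ?thesis using True by (auto intro!: mult_right_mono ennreal_leI)
   qed (use \<phi>(2) in \<open>auto simp: not_less indicator_def\<close>)
  qed
  finally show "ennreal (exp (- q * a)) * lt_int 0 \<phi> w <= lt_int q \<phi> w" .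
 qed
 finally show "ennreal (exp (- q * a)) * pot 0 \<phi> <= pot q \<phi>" by (simp add: pot_def nn_integral_completion)
qed

lemma pot_tendsto:
 assumes \<phi>: "\<phi> \<in> bm optional" "!!w v. a <= v ==> \<phi> (w, v) = 0"
 shows "(%n. pot (qs n) \<phi>) \<longlonglongrightarrow> pot 0 \<phi>"
proof (rule tendsto_sandwich[of "%n. ennreal (exp (- qs n * a)) * pot 0 \<phi>" _ _ "%_. pot 0 \<phi>"])
 show "\<forall>\<^sub>F n in sequentially. ennreal (exp (- qs n * a)) * pot 0 \<phi> <= pot (qs n) \<phi>"
  "\<forall>\<^sub>F n in sequentially. pot (qs n) \<phi> <= pot 0 \<phi>"
  using pot_exp_bounds[OF less_imp_le[OF qs_pos] \<phi>] by auto
 have "(%n. ennreal (exp (- qs n * a)) * pot 0 \<phi>) \<longlonglongrightarrow> 1 * pot 0 \<phi>"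
  using exp_qs_tendsto[of "- a"] by (intro tendsto_mult_ennreal) auto
 then show "(%n. ennreal (exp (- qs n * a)) * pot 0 \<phi>) \<longlonglongrightarrow> pot 0 \<phi>" by simp
qed simp

lemma last_exit_early:
 assumes q: "0 < q" and \<Gamma>: "\<Gamma> \<in> bm (path_space \<Otimes>\<^sub>M borel)" and le1: "!!z. \<Gamma> z <= 1"
  and \<phi>: "\<phi> \<in> bm optional"
 shows "joint x q (%z. ind early z * exit_fun \<Gamma> \<phi> z) = kappa q * exit_weight q \<Gamma> * pot q (%z. cutoff z * \<phi> z)"
proof -
 have \<phi>': "(%z. cutoff z * \<phi> z) \<in> bm optional"
  using cutoff_measurable \<phi> by (rule borel_measurable_times_ennreal)
 have "joint x q (%z. ind early z * exit_fun \<Gamma> \<phi> z) = (NN w. exit_int q \<Gamma> (%z. cutoff z * \<phi> z) w \<partial>P x)"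
  unfolding joint_def exit_int_def
 proof (rule nn_integral_cong_AE, use zeros_closed[of x] AE_space in eventually_elim)
  case (elim w)
  then have w: "w \<in> paths" by simp
  show ?case
  proof (rule nn_integral_cong_AE, use AE_exp_law_nonneg[of q] in eventually_elim)
   case (elim s)
   show ?case
   proof (cases "hit0 w <= ennreal s")
    case True
    note g = gz_attained(4)[OF w \<open>closed (zeros w)\<close> elim True]
    have "(w, s) \<in> early \<longleftrightarrow> gz s w < a"
     unfolding early_iff[OF w] g using gz_nonneg[of s w] by (simp add: ennreal_less_iff)
    then show ?thesis by (auto simp: exit_fun_def indicator_def)
   qed (simp add: exit_fun_def)
  qed
 qed
 also have "... = kappa q * exit_weight q \<Gamma> * pot q (%z. cutoff z * \<phi> z)"
  unfolding pot_def by (rule last_exit_formula_kappa[OF q \<Gamma> le1 \<phi>'])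
 finally show ?thesis .
qed

text \<open>On the conditioning event there is a zero before the exponential time, so the last exit formula applies with \<open>\<Gamma> = \<phi> = 1\<close>.\<close>

lemma joint_early: assumes q: "0 < q" shows "joint x q (ind early) = kappa q * pot q cutoff"
proof -
 have "joint x q (ind early) = joint x q (%z. ind early z * exit_fun (%_. 1) (%_. 1) z)"
 proof (rule joint_cong)
  fix w s assume w: "w \<in> paths" and s: "(0::real) <= s"
  have "hit0 w <= ennreal s" if "(w, s) \<in> early"
  proof -
   have "last_zero (ennreal s) w < top" using that early_iff[OF w] by (auto simp: less_top[symmetric])
   then show ?thesis
    using last_zero_less_top_iff[OF w, of s] hit0_le_iff[OF w, of "ennreal s"] by blast
  qed
  then show "ind early (w, s) = ind early (w, s) * exit_fun (%_. 1) (%_. 1) (w, s)"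
   by (auto simp: exit_fun_def indicator_def)
 qed
 also have "... = kappa q * exit_weight q (%_. 1) * pot q (%z. cutoff z * 1)"
  by (rule last_exit_early[OF q]) auto
 finally show ?thesis by (simp add: exit_weight_one[OF q])
qed

lemma V_pot: "V P L 0 a x = pot 0 cutoff"
 unfolding V_def pot_def lt_int_def
proof (rule nn_integral_cong_AE, use regular_P[of x] in eventually_elim)
 case (elim w)
 have "emeasure (lt w) {0..a} = (NN v. ind {0..a} v \<partial>lt w)" by simp
 also have "... = (NN v. ind {0..} v * (ennreal (exp (- 0 * v)) * cutoff (w, v)) \<partial>lt w)"
  by (rule nn_integral_cong_AE, use lt_AE_ne[OF elim, of a] in eventually_elim) (auto simp: indicator_def)
 finally show ?case .
qed

text \<open>A probability bounds the discounted potential, and the discount is bounded below on \<open>[0,a)\<close>.\<close>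

lemma pot_finite: "pot 0 cutoff < top"
proof -
 have "kappa 1 * pot 1 cutoff = joint x 1 (ind early)" by (rule joint_early[symmetric]) simp
 also have "... <= joint x 1 (%_. 1)" by (rule joint_mono) (simp add: indicator_def)
 also have "... < top" by (subst joint_const) simp_all
 finally have "pot 1 cutoff ~= top" using kappa_bounds(1)[of 1] by (auto simp: ennreal_mult_top split: if_splits)
 moreover have "ennreal (exp (- 1 * a)) * pot 0 cutoff <= pot 1 cutoff"
  by (rule pot_exp_bounds(2)[OF _ cutoff_measurable]) auto
 ultimately show ?thesis by (cases "pot 0 cutoff = top") (auto simp: ennreal_mult_top less_top top_unique)
qed

lemma Pa_prob: "prob_space Pa" and sets_Pa [simp, measurable_cong]: "sets Pa = sets path_space"
 using Pa_law by (auto simp: is_last_zero_law_def)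

lemma space_Pa [simp]: "space Pa = paths"
 using sets_eq_imp_space_eq[OF sets_Pa] by simp

lemma alive_sets: "0 <= t ==> {w \<in> paths. w t ~= None} \<in> sets Pa"
 using measurable_alive[of t top] by simp

lemma indicator_alive_measurable:
 assumes "0 <= t" shows "(ind {w. w t ~= None} :: path => ennreal) \<in> bm path_space"
proof -
 have "(ind {w \<in> paths. w t ~= None} :: path => ennreal) \<in> bm path_space"
  using measurable_alive[of t top] assms by simp
 then show ?thesis by (rule measurable_cong[THEN iffD1, rotated]) (simp add: indicator_def)
qed

end

locale last_zero_conditioned = last_zero_law +
 assumes V_pos: "0 < V P L 0 a x"
begin

lemma pot_cutoff_pos: "0 < pot (qs n) cutoff"
proof -
 have "0 < ennreal (exp (- qs n * a)) * pot 0 cutoff"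
  using V_pos V_pot by (simp add: ennreal_zero_less_mult_iff)
 also have "... <= pot (qs n) cutoff"
  by (rule pot_exp_bounds(2)[OF less_imp_le[OF qs_pos] cutoff_measurable]) auto
 finally show ?thesis .
qed

lemma pn_eq: "pn n = kappa (qs n) * pot (qs n) cutoff"
 unfolding pn_def by (rule joint_early[OF qs_pos])

lemma pn_pos: "0 < pn n"
 unfolding pn_eq using pot_cutoff_pos kappa_bounds(1)[OF qs_pos] by (simp add: ennreal_zero_less_mult_iff)

lemma pn_le_1: "pn n <= 1"
proof -
 have "pn n <= joint x (qs n) (%_. 1)" unfolding pn_def by (rule joint_mono) (simp add: indicator_def)
 then show ?thesis by (simp add: joint_const[OF qs_pos])
qed

lemma pn_finite: "pn n < top" using pn_le_1[of n] by (rule le_less_trans) simp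

lemma inverse_pn: "inverse (pn n) < top" "inverse (pn n) * pn n = 1"
proof -
 show "inverse (pn n) < top" using pn_pos[of n] by (auto simp: less_top[symmetric])
 show "inverse (pn n) * pn n = 1"
  using ennreal_divide_self[of "pn n"] pn_pos[of n] pn_finite[of n] by (auto simp: divide_ennreal_def mult.commute)
qed

text \<open>The conditional expectation of \<open>Y\<close> given that the last zero before the exponential time is below \<open>a\<close>, for
\<open>q = 1, 1/2, 1/3, ...\<close>.  A sequence is enough since all limits exist, and it allows dominated convergence.\<close>

definition cond_int :: "nat => (path \<times> real => ennreal) => ennreal" where
 "cond_int n Y = inverse (pn n) * joint x (qs n) (%z. ind early z * Y z)"

lemma cond_int_add:
 assumes "Y \<in> bm prod_space" "Z \<in> bm prod_space"
 shows "cond_int n (%z. Y z + Z z) = cond_int n Y + cond_int n Z"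
 unfolding cond_int_def distrib_left
 by (subst joint_add[OF qs_pos]) (use assms in "auto simp: distrib_left")

lemma cond_int_le_const:
 assumes "!!w s. w \<in> paths ==> Y (w, s) <= K" shows "cond_int n Y <= K"
proof -
 have "joint x (qs n) (%z. ind early z * Y z) <= joint x (qs n) (%z. K * ind early z)"
  using assms by (intro joint_mono) (auto simp: indicator_def)
 also have "... = K * pn n"
 proof -
  have m: "(%w. NN s. ind early (w, s) \<partial>exp_law (qs n)) \<in> bm (cP x)"
   by (rule joint_section[OF _ qs_pos]) measurable
  have "joint x (qs n) (%z. K * ind early z) = (NN w. K * (NN s. ind early (w, s) \<partial>exp_law (qs n)) \<partial>P x)"
   unfolding joint_def
  proof (rule nn_integral_cong)
   fix w assume "w \<in> space (P x)"
   then show "(NN s. K * ind early (w, s) \<partial>exp_law (qs n)) = K * (NN s. ind early (w, s) \<partial>exp_law (qs n))"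
    using measurable_section[of "ind early" w] by (intro nn_integral_cmult) simp
  qed
  also have "... = K * pn n"
   unfolding pn_def joint_def using nn_integral_cmult[OF m, of K] by (simp add: nn_integral_completion)
  finally show ?thesis .
 qed
 finally have "cond_int n Y <= inverse (pn n) * (K * pn n)"
  unfolding cond_int_def by (rule mult_left_mono) simp
 also have "... = K" using inverse_pn(2)[of n] by (simp add: mult.left_commute)
 finally show ?thesis .
qed

lemma rect_prod_space: "A \<in> sets (ucompl path_space) ==> B \<in> sets borel ==> A \<times> B \<in> sets prod_space"
 by (rule pair_measureI)

text \<open>The defining property of the limit law for constant stopping times.\<close>

lemma law_limit:
 assumes t: "0 <= t" and A: "A \<in> sets (filt t)"
 shows "(%n. cond_int n (ind (A \<times> {t<..}))) \<longlonglongrightarrow> emeasure Pa (A Int {w. w t ~= None})"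
proof -
 interpret Pa: prob_space Pa by (rule Pa_prob)
 have AM: "A \<in> sets path_space" "A \<subseteq> paths"
  using A sets_nat_filt_mono[of "ennreal t" top] sets.sets_into_space[OF A] by auto
 let ?T = "%_::path. ennreal t"
 have st: "stopping_time nat_filt ?T" by (rule stopping_time_const)
 have pre: "A \<in> sets (filtration.pre_sigma paths nat_filt ?T)"
 proof (rule filtration.sets_pre_sigmaI[OF filtration_nat_filt st])
  fix r show "{w \<in> A. ennreal t <= r} \<in> sets (nat_filt r)"
   using A sets_nat_filt_mono[of "ennreal t" r] by (cases "ennreal t <= r") auto
 qed
 let ?p = "%q. \<P>(z in with_exp_time P x q. (fst z \<in> A & ennreal t < ennreal (snd z)) \<bar> last_zero (ennreal (snd z)) (fst z) < ennreal a)"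
 have "(?p \<longlongrightarrow> measure Pa {w \<in> A. ennreal t < lifetime w}) (at_right 0)"
  using Pa_law st pre unfolding is_last_zero_law_def by blast
 then have lim: "(%n. ?p (qs n)) \<longlonglongrightarrow> measure Pa {w \<in> A. ennreal t < lifetime w}"
  by (rule filterlim_compose[OF _ qs_at_right])
 have "{w \<in> A. ennreal t < lifetime w} = A Int {w. w t ~= None}"
  using lifetime_gt_iff[OF _ t] AM by auto
 with tendsto_ennrealI[OF lim]
 have lim': "(%n. ennreal (?p (qs n))) \<longlonglongrightarrow> emeasure Pa (A Int {w. w t ~= None})"
  by (simp add: Pa.emeasure_eq_measure)
 have "ennreal (?p (qs n)) = cond_int n (ind (A \<times> {t<..}))" for n
 proof -
  have S: "{z \<in> paths \<times> UNIV. (fst z \<in> A & ennreal t < ennreal (snd z)) & last_zero (ennreal (snd z)) (fst z) < ennreal a}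
    = early Int (A \<times> {t<..})"
   using t AM by (auto simp: early_def ennreal_less_iff)
  have Sm: "early Int (A \<times> {t<..}) \<in> sets prod_space"
   using AM by (intro sets.Int early_sets rect_prod_space) auto
  have E: "{z \<in> paths \<times> UNIV. last_zero (ennreal (snd z)) (fst z) < ennreal a} = early"
   by (simp add: early_def)
  let ?j = "joint x (qs n) (ind (early Int (A \<times> {t<..})))"
  have "?p (qs n) = enn2real ?j / enn2real (pn n)"
   unfolding cond_prob_def
   using measure_with_exp_time[OF qs_pos, of "%z. (fst z \<in> A & ennreal t < ennreal (snd z)) & last_zero (ennreal (snd z)) (fst z) < ennreal a" x n]
    measure_with_exp_time[OF qs_pos, of "%z. last_zero (ennreal (snd z)) (fst z) < ennreal a" x n]
   unfolding S E pn_def using Sm early_sets by simp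
  moreover have "?j <= 1"
  proof -
   have "?j <= joint x (qs n) (%_. 1)" by (rule joint_mono) (simp add: indicator_def)
   then show ?thesis by (simp add: joint_const[OF qs_pos])
  qed
  then have "?j < top" by (rule le_less_trans) simp
  moreover have "0 < enn2real (pn n)" using pn_pos pn_finite by (simp add: enn2real_positive_iff)
  ultimately have "ennreal (?p (qs n)) = ?j / pn n"
   using pn_finite[of n] by (simp add: divide_ennreal[symmetric])
  also have "... = inverse (pn n) * ?j" by (simp add: divide_ennreal_def mult.commute)
  also have "ind (early Int (A \<times> {t<..})) = (%z. ind early z * ind (A \<times> {t<..}) z :: ennreal)"
   by (auto simp: indicator_def)
  finally show ?thesis by (simp add: cond_int_def)
 qed
 then show ?thesis using lim' by simp
qed

lemma late_limit_borel:
 fixes Y :: "path => real"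
 assumes b: "0 <= b" and Y: "Y \<in> bm (filt b)" "!!w. w \<in> paths ==> Y w <= K"
 shows "(%n. cond_int n (%z. ind {b<..} (snd z) * ennreal (Y (fst z))))
  \<longlonglongrightarrow> (NN w. ind {w. w b ~= None} w * ennreal (Y w) \<partial>Pa)"
proof -
 let ?N = "filt b" and ?C = "cP x"
 define wt where "wt n z = inverse (pn n) * (ind early z * ind {b<..} (snd z))" for n and z :: "path \<times> real"
 define J where "J n = ?C \<Otimes>\<^sub>M exp_law (qs n)" for n
 have setsJ: "sets (J n) = sets (?C \<Otimes>\<^sub>M (borel :: real measure))" for n
  unfolding J_def by (rule sets_pair_measure_cong) simp_all
 have spN: "(%w. w) \<in> path_space \<rightarrow>\<^sub>M ?N"
  using sets_nat_filt_mono[of "ennreal b" top] by (auto simp: measurable_def Int_absorb2 dest: sets.sets_into_space)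
 have wm: "wt n \<in> bm prod_space" for n unfolding wt_def by measurable
 have pm: "f \<in> bm (J n)" if "f \<in> bm prod_space" for f :: "path \<times> real => ennreal" and n
  using completion_pair_measurable[OF that, of x] measurable_cong_sets[OF setsJ[of n] refl, of borel] by blast
 have fstN: "fst \<in> J n \<rightarrow>\<^sub>M ?N" for n
 proof -
  have "(%w. w) \<in> ?C \<rightarrow>\<^sub>M ?N" by (rule ucompl_completion[OF measurable_ucomplI[OF spN]])
  then show ?thesis unfolding J_def by (rule measurable_compose[OF measurable_fst])
 qed
 define \<nu> where "\<nu> n = distr (density (J n) (wt n)) ?N fst" for n
 define \<nu>0 where "\<nu>0 = distr (density Pa (ind {w. w b ~= None})) ?N (%w. w)"
 have idPa: "(%w. w) \<in> Pa \<rightarrow>\<^sub>M ?N" using spN by (simp cong: measurable_cong_sets)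
 have indPa: "(ind {w. w b ~= None} :: path => ennreal) \<in> bm Pa"
  using indicator_alive_measurable[OF b] by simp
 have int: "(NN w. f w \<partial>\<nu> n) = cond_int n (%z. ind {b<..} (snd z) * f (fst z))"
  if f: "f \<in> bm ?N" for f n
 proof -
  interpret E: prob_space "exp_law (qs n)" by (rule prob_space_exp_law[OF qs_pos])
  have fp: "(%z. f (fst z)) \<in> bm prod_space"
   by (rule measurable_compose[OF measurable_fst measurable_ucomplI[OF measurable_compose[OF spN f]]])
  have "(NN w. f w \<partial>\<nu> n) = (NN z. f (fst z) \<partial>density (J n) (wt n))"
   unfolding \<nu>_def using fstN[of n] f by (intro nn_integral_distr) simp_all
  also have "... = (NN z. wt n z * f (fst z) \<partial>J n)"
   by (rule nn_integral_density[OF pm[OF wm] pm[OF fp]])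
  also have "... = (NN z. inverse (pn n) * (ind early z * (ind {b<..} (snd z) * f (fst z))) \<partial>J n)"
   by (intro nn_integral_cong) (simp add: wt_def mult.assoc)
  also have "... = inverse (pn n) * (NN z. ind early z * (ind {b<..} (snd z) * f (fst z)) \<partial>J n)"
   using fp by (intro nn_integral_cmult pm) measurable
  also have "(NN z. ind early z * (ind {b<..} (snd z) * f (fst z)) \<partial>J n)
    = (NN w. NN s. ind early (w, s) * (ind {b<..} (snd (w, s)) * f (fst (w, s))) \<partial>exp_law (qs n) \<partial>?C)"
  proof -
   have "(%z. ind early z * (ind {b<..} (snd z) * f (fst z))) \<in> bm (?C \<Otimes>\<^sub>M exp_law (qs n))"
    using fp unfolding J_def[symmetric] by (intro pm) measurable
   from E.nn_integral_fst[OF this] show ?thesis by (simp add: J_def)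
  qed
  finally show ?thesis by (simp add: cond_int_def joint_def nn_integral_completion)
 qed
 have int0: "(NN w. f w \<partial>\<nu>0) = (NN w. ind {w. w b ~= None} w * f w \<partial>Pa)"
  if f: "f \<in> bm ?N" for f
 proof -
  have "(NN w. f w \<partial>\<nu>0) = (NN w. f w \<partial>density Pa (ind {w. w b ~= None}))"
   unfolding \<nu>0_def using idPa f by (intro nn_integral_distr) simp_all
  also have "... = (NN w. ind {w. w b ~= None} w * f w \<partial>Pa)"
   by (rule nn_integral_density[OF indPa measurable_compose[OF idPa f]])
  finally show ?thesis .
 qed
 have em: "emeasure (\<nu> n) A = cond_int n (ind (A \<times> {b<..}))" if "A \<in> sets ?N" for A n
 proof -
  have "emeasure (\<nu> n) A = (NN w. ind A w \<partial>\<nu> n)" using that by (simp add: \<nu>_def)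
  also have "... = cond_int n (%z. ind {b<..} (snd z) * ind A (fst z))" using that by (intro int) simp
  also have "(%z. ind {b<..} (snd z) * ind A (fst z) :: ennreal) = ind (A \<times> {b<..})"
   by (auto simp: indicator_def)
  finally show ?thesis .
 qed
 have em0: "emeasure \<nu>0 A = emeasure Pa (A Int {w. w b ~= None})" if A: "A \<in> sets ?N" for A
 proof -
  have AM: "A \<in> sets path_space" "A \<subseteq> paths"
   using A sets_nat_filt_mono[of "ennreal b" top] sets.sets_into_space[OF A] by auto
  have "emeasure \<nu>0 A = (NN w. ind A w \<partial>\<nu>0)" using that by (simp add: \<nu>0_def)
  also have "... = (NN w. ind {w. w b ~= None} w * ind A w \<partial>Pa)" using that by (intro int0) simp
  also have "... = (NN w. ind (A Int {w \<in> paths. w b ~= None}) w \<partial>Pa)"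
   using AM by (intro nn_integral_cong) (auto simp: indicator_def)
  also have "... = emeasure Pa (A Int {w \<in> paths. w b ~= None})"
   using AM alive_sets[OF b] by (intro nn_integral_indicator sets.Int) simp_all
  also have "A Int {w \<in> paths. w b ~= None} = A Int {w. w b ~= None}" using AM by auto
  finally show ?thesis .
 qed
 have top: "paths \<in> sets ?N" using sets.top[of ?N] by simp
 have b1: "emeasure (\<nu> n) (space ?N) <= ennreal 1" for n
  using em[OF top, of n] cond_int_le_const[of "ind (paths \<times> {b<..})" 1 n] by (simp add: indicator_def)
 have "(%n. NN w. ennreal (Y w) \<partial>\<nu> n) \<longlonglongrightarrow> (NN w. ennreal (Y w) \<partial>\<nu>0)"
 proof (rule setwise_limit_nn_integral[where M = ?N and B = 1 and K = K])
  show "finite_measure (\<nu> n)" for n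
  proof (rule finite_measureI)
   have "space (\<nu> n) = space ?N" by (simp add: \<nu>_def)
   then show "emeasure (\<nu> n) (space (\<nu> n)) ~= \<infinity>" using b1[of n] by (auto simp: top_unique)
  qed
  show "finite_measure \<nu>0"
  proof (rule finite_measureI)
   have "space \<nu>0 = space ?N" by (simp add: \<nu>0_def)
   then show "emeasure \<nu>0 (space \<nu>0) ~= \<infinity>"
    using em0[OF top] finite_measure.emeasure_finite[of Pa] Pa_prob by (simp add: prob_space_def)
  qed
  show "(%n. emeasure (\<nu> n) A) \<longlonglongrightarrow> emeasure \<nu>0 A" if "A \<in> sets ?N" for A
   using law_limit[OF b that] unfolding em[OF that] em0[OF that] .
 qed (use Y b1 in \<open>auto simp: \<nu>_def \<nu>0_def\<close>)
 moreover have Ye: "(%w. ennreal (Y w)) \<in> bm ?N" using Y(1) by measurable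
 ultimately show ?thesis unfolding int[OF Ye] int0[OF Ye] by simp
qed

text \<open>The conditional probabilities whose limit the law is vanish on every null event of the process.\<close>

lemma late_null:
 assumes b: "0 <= b" and A: "A \<in> sets (filt b)" "emeasure (P x) A = 0"
 shows "AE w in Pa. w b ~= None --> w \<notin> A"
proof -
 have AM: "A \<in> sets path_space" "A \<subseteq> paths"
  using A sets_nat_filt_mono[of "ennreal b" top] sets.sets_into_space[OF A(1)] by auto
 have "cond_int n (ind (A \<times> {b<..})) = 0" for n
 proof -
  have "joint x (qs n) (%z. ind early z * ind (A \<times> {b<..}) z) <= (NN w. ind A w \<partial>P x)"
   unfolding joint_def
  proof (rule nn_integral_mono)
   fix w
   have "(NN s. ind early (w, s) * ind (A \<times> {b<..}) (w, s) \<partial>exp_law (qs n)) <= (NN s. ind A w \<partial>exp_law (qs n))"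
    by (intro nn_integral_mono) (auto simp: indicator_def)
   also have "... = ind A w" using prob_space.emeasure_space_1[OF prob_space_exp_law[OF qs_pos]] by simp
   finally show "(NN s. ind early (w, s) * ind (A \<times> {b<..}) (w, s) \<partial>exp_law (qs n)) <= ind A w" .
  qed
  also have "... = 0" using AM A(2) by simp
  finally show ?thesis by (simp add: cond_int_def)
 qed
 then have "emeasure Pa (A Int {w. w b ~= None}) = 0"
  using LIMSEQ_unique[OF law_limit[OF b A(1)], of 0] by simp
 moreover have "A Int {w. w b ~= None} = A Int {w \<in> paths. w b ~= None}" using AM by auto
 ultimately have "A Int {w \<in> paths. w b ~= None} \<in> null_sets Pa"
  using AM alive_sets[OF b] by (intro null_setsI sets.Int) simp_all
 from AE_not_in[OF this] AE_space show ?thesis by eventually_elim auto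
qed

text \<open>Universally measurable functionals may be replaced by measurable versions, because null events of the
process are null for the limit law.\<close>

lemma late_limit:
 fixes Y :: "path => real"
 assumes b: "0 <= b" and Y: "Y \<in> bm (ucompl (filt b))"
  "!!w. w \<in> paths ==> 0 <= Y w" "!!w. w \<in> paths ==> Y w <= K"
 shows "(%n. cond_int n (%z. ind {b<..} (snd z) * ennreal (Y (fst z))))
  \<longlonglongrightarrow> (NN w. ind {w. w b ~= None} w * ennreal (Y w) \<partial>Pa)"
proof -
 let ?N = "filt b"
 have sub: "subalgebra (P x) ?N"
  using sets_nat_filt_mono[of "ennreal b" top] by (simp add: subalgebra_def)
 let ?R = "restr_to_subalg (P x) ?N"
 have "finite_measure ?R" using prob_space_restr_to_subalg[OF sub prob_P] by (simp add: prob_space_def)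
 moreover have "(%w. ennreal (Y w)) \<in> bm (ucompl ?N)" using Y(1) by measurable
 ultimately obtain g where g: "g \<in> bm ?N" "AE w in ?R. ennreal (Y w) = g w"
  using ucompl_AE_borel[OF _ _ sets_restr_to_subalg[OF sub]] by blast
 define Y' where "Y' w = min K (enn2real (g w))" for w
 have Y'm: "Y' \<in> bm ?N" unfolding Y'_def using g(1) by measurable
 have eq: "Y w = Y' w" if "ennreal (Y w) = g w" "w \<in> paths" for w
  using that Y(2,3)[of w] by (simp add: Y'_def flip: that(1))
 obtain Z where Z: "Z \<in> sets ?N" "emeasure (P x) Z = 0" "{w \<in> paths. ennreal (Y w) ~= g w} \<subseteq> Z"
 proof -
  obtain Z where "{w \<in> space ?R. ~ ennreal (Y w) = g w} \<subseteq> Z" "emeasure ?R Z = 0" "Z \<in> sets ?R"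
   using g(2) by (rule AE_E)
  then show ?thesis using that[of Z] sets_restr_to_subalg[OF sub] emeasure_restr_to_subalg[OF sub]
   by (simp add: space_restr_to_subalg)
 qed
 have "AE w in P x. w \<notin> Z"
  using Z(1,2) sets_nat_filt_mono[of "ennreal b" top] by (intro AE_not_in null_setsI) auto
 then have aeP: "AE w in P x. Y w = Y' w"
  using AE_space by eventually_elim (use Z(3) eq in auto)
 have aePa: "AE w in Pa. w b ~= None --> Y w = Y' w"
  using late_null[OF b Z(1,2)] AE_space by eventually_elim (use Z(3) eq in auto)
 have "cond_int n (%z. ind {b<..} (snd z) * ennreal (Y (fst z)))
   = cond_int n (%z. ind {b<..} (snd z) * ennreal (Y' (fst z)))" for n
  unfolding cond_int_def joint_def
  by (rule arg_cong2[where f = "(*)", OF refl], rule nn_integral_cong_AE, use aeP in eventually_elim) simp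
 moreover have "(NN w. ind {w. w b ~= None} w * ennreal (Y w) \<partial>Pa)
   = (NN w. ind {w. w b ~= None} w * ennreal (Y' w) \<partial>Pa)"
  by (rule nn_integral_cong_AE, use aePa in eventually_elim) (auto simp: indicator_def)
 moreover have "(%n. cond_int n (%z. ind {b<..} (snd z) * ennreal (Y' (fst z))))
  \<longlonglongrightarrow> (NN w. ind {w. w b ~= None} w * ennreal (Y' w) \<partial>Pa)"
  by (rule late_limit_borel[OF b Y'm, of K]) (simp add: Y'_def)
 ultimately show ?thesis by simp
qed

text \<open>Without a zero between \<open>a\<close> and \<open>s\<close>, the last zero is the same for all times between them.\<close>

lemma early_mono: "w \<in> paths ==> (w, s) \<in> early ==> a <= t ==> t <= s ==> (w, t) \<in> early & gz t w = gz s w & last_zero (ennreal t) w = last_zero (ennreal s) w"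
proof -
 assume w: "w \<in> paths" and e: "(w, s) \<in> early" and t: "a <= t" "t <= s"
 have lz: "last_zero (ennreal s) w < ennreal a" using e early_iff[OF w] by blast
 have "last_zero (ennreal t) w = last_zero (ennreal s) w"
 proof (rule last_zero_cong, intro equalityI subsetI)
  fix z assume z: "z \<in> {z \<in> zeros w. ennreal z <= ennreal s}"
  then have "ennreal z < ennreal a" using last_zero_ge[of z w "ennreal s"] lz by (auto intro: le_less_trans)
  then show "z \<in> {z \<in> zeros w. ennreal z <= ennreal t}"
   using z t(1) ennreal_leI[OF t(1)] by auto
 qed (use ennreal_leI[OF t(2)] in \<open>auto intro: order_trans\<close>)
 then show ?thesis using lz early_iff[OF w] by (simp add: gz_def)
qed

text \<open>The complementary event is incompatible with the conditioning as soon as the exponential time exceeds \<open>t\<close>.\<close>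

lemma late_zero_free:
 assumes t: "a <= t" shows "AE w in Pa. w t ~= None --> last_zero (ennreal t) w < ennreal a"
proof -
 have t0: "0 <= t" using t a_pos by simp
 let ?B = "{w \<in> paths. ~ last_zero (ennreal t) w < ennreal a}"
 define Y where "Y w = (if last_zero (ennreal t) w < ennreal a then 0 else 1 :: real)" for w
 have lzm: "last_zero (ennreal t) \<in> bm (ucompl path_space)"
  by (rule measurable_last_zero_comp[of "%w. w" "ucompl path_space" "%_. ennreal t"]) simp_all
 have Yu: "Y \<in> bm (ucompl path_space)" unfolding Y_def using lzm by measurable
 have Ym: "Y \<in> bm (ucompl (filt t))"
  by (rule ucompl_nat_filt_stop[OF t0 Yu]) (simp add: Y_def last_zero_stop[OF t0])
 have "cond_int n (%z. ind {t<..} (snd z) * ennreal (Y (fst z))) = 0" for n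
 proof -
  have "joint x (qs n) (%z. ind early z * (ind {t<..} (snd z) * ennreal (Y (fst z)))) = joint x (qs n) (%_. 0)"
  proof (rule joint_cong)
   fix w s assume w: "w \<in> paths"
   show "ind early (w, s) * (ind {t<..} (snd (w, s)) * ennreal (Y (fst (w, s)))) = 0"
    using early_mono[OF w _ t, of s] early_iff[OF w, of t] by (auto simp: Y_def indicator_def)
  qed
  then show ?thesis by (simp add: cond_int_def joint_const[OF qs_pos])
 qed
 then have "(NN w. ind {w. w t ~= None} w * ennreal (Y w) \<partial>Pa) = 0"
  using LIMSEQ_unique[OF late_limit[OF t0 Ym, of 1], of 0] by (simp add: Y_def)
 then have "(NN w. ind {w. w t ~= None} w * ennreal (Y w) \<partial>completion Pa) = 0"
  by (simp add: nn_integral_completion)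
 moreover have "(%w. ind {w. w t ~= None} w * ennreal (Y w)) \<in> bm (completion Pa)"
 proof (rule borel_measurable_times_ennreal)
  show "(ind {w. w t ~= None} :: path => ennreal) \<in> bm (completion Pa)"
   by (rule measurable_completion) (use indicator_alive_measurable[OF t0] in "simp cong: measurable_cong_sets")
  have "finite_measure Pa" using Pa_prob by (simp add: prob_space_def)
  then have "Y \<in> bm (completion Pa)"
   using measurable_ucompl_completion[OF Yu] by simp
  then show "(%w. ennreal (Y w)) \<in> bm (completion Pa)" by measurable
 qed
 ultimately have "AE w in completion Pa. ind {w. w t ~= None} w * ennreal (Y w) = 0"
  by (subst (asm) nn_integral_0_iff_AE) auto
 then have "AE w in Pa. ind {w. w t ~= None} w * ennreal (Y w) = 0"
  by (simp add: AE_completion_iff)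
 then show ?thesis by eventually_elim (auto simp: Y_def indicator_def split: if_splits)
qed

text \<open>If a path alive at \<open>b\<close> had a zero after \<open>b\<close>, it would still be alive at some later rational time, where the last zero would not be below \<open>a\<close>.\<close>

lemma late_last_zero:
 assumes b: "a <= b"
 shows "AE w in Pa. w b ~= None --> last_zero top w = last_zero (ennreal b) w & last_zero (ennreal b) w < ennreal a"
proof -
 have "AE w in Pa. \<forall>t\<in>insert b (\<rat> Int {b<..}). w t ~= None --> last_zero (ennreal t) w < ennreal a"
  using late_zero_free b by (intro AE_ball_countable') (auto intro: countable_rat)
 then show ?thesis
  using AE_space
 proof eventually_elim
  case (elim w)
  then have w: "w \<in> paths" by simp
  show ?case
  proof
   assume al: "w b ~= None"
   then have lz: "last_zero (ennreal b) w < ennreal a" using elim(1) by blast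
   have "z <= b" if z: "z \<in> zeros w" for z
   proof (rule ccontr)
    assume "~ z <= b"
    then have zb: "b < z" by simp
    have "0 <= z" "w z ~= None" using z by (auto simp: zeros_def)
    then obtain t where t: "t \<in> \<rat>" "z < t" "w t ~= None" using alive_iff[OF w, of z] by blast
    then have "last_zero (ennreal t) w < ennreal a" using elim(1) zb by auto
    moreover have "ennreal z <= last_zero (ennreal t) w" using z t by (intro last_zero_ge ennreal_leI) auto
    ultimately have "ennreal z < ennreal a" by (rule le_less_trans[rotated])
    then show False using zb b \<open>0 <= z\<close> by (simp add: ennreal_less_iff)
   qed
   then have "{z \<in> zeros w. ennreal z <= top} = {z \<in> zeros w. ennreal z <= ennreal b}"
    by (auto intro: ennreal_leI)
   then show "last_zero top w = last_zero (ennreal b) w & last_zero (ennreal b) w < ennreal a"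
    using lz last_zero_cong by blast
  qed
 qed
qed

end

section \<open>Paths that die before a fixed time\<close>

context last_zero_conditioned
begin

text \<open>The weight that the product of the law of the process and Lebesgue measure on \<open>(0,b]\<close> gives to the conditioning event.\<close>

definition window_int :: "real => (path \<times> real => ennreal) => ennreal" where
 "window_int b Y = (NN w. (NN s. ind early (w, s) * (ind {0<..b} s * Y (w, s)) \<partial>lborel) \<partial>P x)"

lemma prod_space_pair:
 assumes f: "f \<in> prod_space \<rightarrow>\<^sub>M N" shows "f \<in> cP x \<Otimes>\<^sub>M lborel \<rightarrow>\<^sub>M N"
proof -
 have "(%w. w) \<in> cP x \<rightarrow>\<^sub>M ucompl path_space" by (rule ucompl_completion) simp
 then have "(%z. (fst z, snd z)) \<in> cP x \<Otimes>\<^sub>M lborel \<rightarrow>\<^sub>M prod_space"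
  by (intro measurable_Pair measurable_compose[OF measurable_fst]) simp_all
 from measurable_compose[OF this f] show ?thesis by simp
qed

lemma lborel_section_measurable:
 "f \<in> bm prod_space ==> (%w. NN s. f (w, s) \<partial>lborel :: ennreal) \<in> bm (cP x)"
proof -
 assume "f \<in> bm prod_space"
 then have "(%(w, s). f (w, s)) \<in> bm (cP x \<Otimes>\<^sub>M lborel)"
  unfolding case_prod_eta by (rule prod_space_pair)
 then show "(%w. NN s. f (w, s) \<partial>lborel :: ennreal) \<in> bm (cP x)"
  by (rule lborel.borel_measurable_nn_integral)
qed

lemma window_measurable:
 "Y \<in> bm prod_space ==> (%z. ind early z * (ind {0<..b} (snd z) * Y z) :: ennreal) \<in> bm prod_space"
 by measurable

lemma window_int_cmult:
 assumes Y: "Y \<in> bm prod_space"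
 shows "(NN w. (NN s. k * (ind early (w, s) * (ind {0<..b} s * Y (w, s))) \<partial>lborel) \<partial>P x) = k * window_int b Y"
proof -
 note W = window_measurable[OF Y, of b]
 have "(NN w. (NN s. k * (ind early (w, s) * (ind {0<..b} s * Y (w, s))) \<partial>lborel) \<partial>P x)
   = (NN w. k * (NN s. ind early (w, s) * (ind {0<..b} s * Y (w, s)) \<partial>lborel) \<partial>P x)"
 proof (rule nn_integral_cong)
  fix w assume "w \<in> space (P x)"
  then show "(NN s. k * (ind early (w, s) * (ind {0<..b} s * Y (w, s))) \<partial>lborel)
    = k * (NN s. ind early (w, s) * (ind {0<..b} s * Y (w, s)) \<partial>lborel)"
   using measurable_section[OF W, of w] by (intro nn_integral_cmult) simp
 qed
 also have "... = k * window_int b Y"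
  unfolding window_int_def using nn_integral_cmult[OF lborel_section_measurable[OF W], of k]
  by (simp add: nn_integral_completion)
 finally show ?thesis .
qed

text \<open>On \<open>(0,b]\<close> the exponential density lies between \<open>q e\<^sup>-\<^sup>q\<^sup>b\<close> and \<open>q\<close>.\<close>

lemma window_bounds:
 assumes q: "0 < q" and Y: "Y \<in> bm prod_space"
 shows "joint x q (%z. ind early z * (ind {0<..b} (snd z) * Y z)) <= ennreal q * window_int b Y"
  and "ennreal (exp (- q * b)) * (ennreal q * window_int b Y) <= joint x q (%z. ind early z * (ind {0<..b} (snd z) * Y z))"
proof -
 let ?wt = "%w s. ind early (w, s) * (ind {0<..b} s * Y (w, s))"
 have J: "joint x q (%z. ind early z * (ind {0<..b} (snd z) * Y z))
   = (NN w. (NN s. ennreal (exponential_density q s) * ?wt w s \<partial>lborel) \<partial>P x)"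
  unfolding joint_def
 proof (rule nn_integral_cong)
  fix w assume "w \<in> space (P x)"
  then have "?wt w \<in> bm borel" using measurable_section[OF window_measurable[OF Y, of b], of w] by simp
  then show "(NN s. ind early (w, s) * (ind {0<..b} (snd (w, s)) * Y (w, s)) \<partial>exp_law q)
    = (NN s. ennreal (exponential_density q s) * ?wt w s \<partial>lborel)"
   by (simp add: nn_integral_exp_law)
 qed
 have "ennreal (exponential_density q s) * ?wt w s <= ennreal q * ?wt w s" for w s
 proof (cases "0 < s & s <= b")
  case True
  then have "exponential_density q s <= q" using q by (simp add: exponential_density_def)
  then show ?thesis by (intro mult_right_mono ennreal_leI) auto
 qed simp
 then show "joint x q (%z. ind early z * (ind {0<..b} (snd z) * Y z)) <= ennreal q * window_int b Y"
  unfolding J window_int_cmult[OF Y, symmetric] by (intro nn_integral_mono) simp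
 have "ennreal (exp (- q * b) * q) * ?wt w s <= ennreal (exponential_density q s) * ?wt w s" for w s
 proof (cases "0 < s & s <= b")
  case True
  then have "exp (- q * b) * q <= exponential_density q s" using q by (simp add: exponential_density_def)
  then show ?thesis by (intro mult_right_mono ennreal_leI) auto
 qed simp
 then have "ennreal (exp (- q * b) * q) * window_int b Y <= joint x q (%z. ind early z * (ind {0<..b} (snd z) * Y z))"
  unfolding J window_int_cmult[OF Y, symmetric] by (intro nn_integral_mono) simp
 then show "ennreal (exp (- q * b)) * (ennreal q * window_int b Y) <= joint x q (%z. ind early z * (ind {0<..b} (snd z) * Y z))"
  using q by (simp add: ennreal_mult mult.assoc)
qed

lemma window_int_le:
 assumes "!!w s. w \<in> paths ==> Y (w, s) <= K" shows "window_int b Y <= K * window_int b (%_. 1)"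
proof -
 have "window_int b Y <= (NN w. (NN s. K * (ind early (w, s) * (ind {0<..b} s * 1)) \<partial>lborel) \<partial>P x)"
  unfolding window_int_def using assms by (intro nn_integral_mono) (auto simp: indicator_def)
 also have "... = K * window_int b (%_. 1)" by (rule window_int_cmult) simp
 finally show ?thesis .
qed

lemma window_int_1: assumes "0 < b" shows "window_int b (%_. 1) < top"
proof -
 have "window_int b (%_. 1) <= (NN w. (NN s. ind {0<..b} s \<partial>lborel) \<partial>P x)"
  unfolding window_int_def by (intro nn_integral_mono) (auto simp: indicator_def)
 also have "... = ennreal b"
  using assms prob_space.emeasure_space_1[OF prob_P[of x]] by (simp add: emeasure_lborel_Ioc)
 finally show ?thesis by (rule le_less_trans) simp
qed

definition window_const :: "real => ennreal => bool" where
 "window_const b c \<longleftrightarrow> c < top & (\<forall>Y K. Y \<in> bm prod_space --> K < top --> (\<forall>w\<in>paths. \<forall>s. Y (w, s) <= K) -->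
   (%n. cond_int n (%z. ind {0<..b} (snd z) * Y z)) \<longlonglongrightarrow> c * window_int b Y)"

text \<open>Up to factors that tend to \<open>1\<close> the conditional integral over \<open>(0,b]\<close> is a multiple of \<open>window_int b Y\<close> that does not depend on
\<open>Y\<close>.  For \<open>Y = 1\<close> it converges by the defining property of the limit law, at the times \<open>0\<close> and \<open>b\<close>; this gives convergence of
the multiple, unless \<open>window_int b Y\<close> vanishes for all \<open>Y\<close>.\<close>

lemma window_const_exists:
 assumes b: "0 < b" shows "\<exists>c. window_const b c"
proof -
 interpret Pa: prob_space Pa by (rule Pa_prob)
 define \<alpha> where "\<alpha> n = inverse (pn n) * ennreal (qs n)" for n
 let ?c = "%n Y. cond_int n (%z. ind {0<..b} (snd z) * Y z)"
 let ?e = "%n. ennreal (exp (qs n * - b))"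
 let ?W = "window_int b (%_. 1)"
 have up: "?c n Y <= \<alpha> n * window_int b Y" and lo: "?e n * (\<alpha> n * window_int b Y) <= ?c n Y"
  if "Y \<in> bm prod_space" for n Y
  using mult_left_mono[OF window_bounds(1)[OF qs_pos[of n] that, of b], of "inverse (pn n)"]
   mult_left_mono[OF window_bounds(2)[OF qs_pos[of n] that, of b], of "inverse (pn n)"]
  unfolding cond_int_def \<alpha>_def by (simp_all add: ac_simps)
 define l where "l = emeasure Pa (paths Int {w. w 0 ~= None}) - emeasure Pa (paths Int {w. w b ~= None})"
 have xl: "(%n. ?c n (%_. 1)) \<longlonglongrightarrow> l"
 proof -
  have top: "paths \<in> sets (nat_filt t)" for t using sets.top[of "nat_filt t"] by simp
  have rect: "(%z. ind (paths \<times> {b<..}) z :: ennreal) \<in> bm prod_space"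
   using rect_prod_space[of paths "{b<..}"] top[of top] by (intro borel_measurable_indicator) auto
  have "?c n (%_. 1) = cond_int n (ind (paths \<times> {0<..})) - cond_int n (ind (paths \<times> {b<..}))" for n
  proof -
   have "cond_int n (ind (paths \<times> {0<..})) = cond_int n (%z. ind {0<..b} (snd z) * 1 + ind (paths \<times> {b<..}) z)"
    unfolding cond_int_def
    by (rule arg_cong[where f = "(*) _"], rule joint_cong) (use b in "auto simp: indicator_def")
   also have "... = ?c n (%_. 1) + cond_int n (ind (paths \<times> {b<..}))"
    by (rule cond_int_add[OF _ rect]) measurable
   finally have e: "cond_int n (ind (paths \<times> {0<..})) = ?c n (%_. 1) + cond_int n (ind (paths \<times> {b<..}))" .
   have "cond_int n (ind (paths \<times> {b<..})) <= 1" by (rule cond_int_le_const) (simp add: indicator_def)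
   then have "cond_int n (ind (paths \<times> {b<..})) ~= top" by (auto simp: top_unique)
   then show ?thesis unfolding e by simp
  qed
  moreover have "(%n. cond_int n (ind (paths \<times> {0<..})) - cond_int n (ind (paths \<times> {b<..}))) \<longlonglongrightarrow> l"
   unfolding l_def using b
   by (intro tendsto_diff_ennreal law_limit top) (simp_all add: Pa.emeasure_finite less_top[symmetric])
  ultimately show ?thesis by simp
 qed
 have lfin: "l < top" unfolding l_def
  by (rule le_less_trans[OF diff_le_self_ennreal]) (simp add: less_top[symmetric])
 show ?thesis
 proof (cases "?W = 0")
  case True
  have "?c n Y = 0" "window_int b Y = 0"
   if "Y \<in> bm prod_space" "K < top" "\<forall>w\<in>paths. \<forall>s. Y (w, s) <= K" for Y K n
  proof -
   show z: "window_int b Y = 0" using window_int_le[of Y K b] that(3) True by simp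
   show "?c n Y = 0" using up[OF that(1), of n] unfolding z by simp
  qed
  then have "window_const b 0" unfolding window_const_def by simp
  then show ?thesis ..
 next
  case False
  then have W: "inverse ?W < top" "?W * inverse ?W = 1"
   using window_int_1[OF b] ennreal_divide_self[of ?W] by (auto simp: less_top[symmetric] divide_ennreal_def)
  have "(%n. \<alpha> n * ?W) \<longlonglongrightarrow> l"
  proof (rule tendsto_sandwich[OF _ _ xl])
   show "\<forall>\<^sub>F n in sequentially. ?c n (%_. 1) <= \<alpha> n * ?W" using up[of "%_. 1"] by simp
   have "\<alpha> n * ?W <= ennreal (exp (qs n * b)) * ?c n (%_. 1)" for n
   proof -
    have "ennreal (exp (qs n * b)) * (?e n * (\<alpha> n * ?W)) <= ennreal (exp (qs n * b)) * ?c n (%_. 1)"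
     using lo[of "%_. 1" n] by (intro mult_left_mono) simp_all
    moreover have "ennreal (exp (qs n * b)) * ?e n = 1"
     by (simp flip: ennreal_mult exp_add)
    ultimately show ?thesis by (simp flip: mult.assoc)
   qed
   then show "\<forall>\<^sub>F n in sequentially. \<alpha> n * ?W <= ennreal (exp (qs n * b)) * ?c n (%_. 1)" by simp
   have "(%n. ennreal (exp (qs n * b)) * ?c n (%_. 1)) \<longlonglongrightarrow> 1 * l"
    using lfin by (intro tendsto_mult_ennreal exp_qs_tendsto xl) auto
   then show "(%n. ennreal (exp (qs n * b)) * ?c n (%_. 1)) \<longlonglongrightarrow> l" by simp
  qed
  then have "(%n. \<alpha> n * ?W * inverse ?W) \<longlonglongrightarrow> l * inverse ?W"
   using lfin W by (intro tendsto_mult_ennreal tendsto_const) auto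
  then have al: "\<alpha> \<longlonglongrightarrow> l * inverse ?W" using W(2) by (simp add: mult.assoc)
  have cfin: "l * inverse ?W < top" using lfin W(1) by (simp add: ennreal_mult_less_top)
  have "(%n. ?c n Y) \<longlonglongrightarrow> l * inverse ?W * window_int b Y"
   if Y: "Y \<in> bm prod_space" "K < top" "\<forall>w\<in>paths. \<forall>s. Y (w, s) <= K" for Y K
  proof -
   have "window_int b Y <= K * ?W" using Y(3) by (intro window_int_le) auto
   also have "... < top" using Y(2) window_int_1[OF b] by (simp add: ennreal_mult_less_top)
   finally have wf: "window_int b Y < top" .
   have u: "(%n. \<alpha> n * window_int b Y) \<longlonglongrightarrow> l * inverse ?W * window_int b Y"
    using wf cfin al by (intro tendsto_mult_ennreal tendsto_const) auto
   have mf: "l * inverse ?W * window_int b Y ~= top" using ennreal_mult_less_top[of "l * inverse ?W" "window_int b Y"] wf cfin unfolding less_top by blast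
   have "(%n. ?e n * (\<alpha> n * window_int b Y)) \<longlonglongrightarrow> 1 * (l * inverse ?W * window_int b Y)"
    by (rule tendsto_mult_ennreal[OF exp_qs_tendsto u]) (simp add: mf)
   then have lim: "(%n. ?e n * (\<alpha> n * window_int b Y)) \<longlonglongrightarrow> l * inverse ?W * window_int b Y" by (simp only: mult_1)
   show ?thesis
    by (rule tendsto_sandwich[OF always_eventually always_eventually lim u]) (intro allI lo[OF Y(1)] up[OF Y(1)])+
  qed
  then have "window_const b (l * inverse ?W)" unfolding window_const_def using cfin by blast
  then show ?thesis ..
 qed
qed

text \<open>The limit law on paths that die in \<open>(0,b]\<close> and the image, under killing, of a multiple of the product law on the
conditioning event are finite measures on the path space.  They agree on the events \<open>A\<close> known at time \<open>t\<close> on which the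
path is alive at \<open>t\<close>: there the path killed at \<open>s\<close> belongs to \<open>A\<close> if and only if the path itself does and \<open>t < s\<close>, so that both
measures are given by the limit at \<open>t\<close> minus the limit at \<open>b\<close>.  These events form a generator.  A universally measurable \<open>Y\<close> is
replaced by a measurable version, because its composition with killing need not be measurable on the product.\<close>

lemma kill_law:
 assumes b: "0 < b" and c: "window_const b c"
  and Y: "Y \<in> bm (ucompl path_space)" and Z: "Z \<in> bm prod_space"
  and eq: "AE w in P x. AE s in lborel. 0 < s --> Y (kill s w) = Z (w, s)"
 shows "(NN w. ind {w. w 0 ~= None & w b = None} w * Y w \<partial>Pa) = c * window_int b Z"
proof -
 interpret Pa: prob_space Pa by (rule Pa_prob)
 interpret C: prob_space "cP x" by (rule prob_cP)
 let ?D = "{w \<in> paths. w 0 ~= None & w b = None}" and ?kill = "%z. kill (snd z) (fst z)"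
 let ?wt = "%z. c * (ind early z * (ind {0<..b} (snd z) * 1))"
 have cfin: "c < top" using c by (simp add: window_const_def)
 define M1 where "M1 = density Pa (ind ?D)"
 define N where "N = density (cP x \<Otimes>\<^sub>M lborel) ?wt"
 define M2 where "M2 = distr N path_space ?kill"
 have D: "?D \<in> sets Pa"
 proof -
  have "?D = {w \<in> paths. w 0 ~= None} - {w \<in> paths. w b ~= None}" by auto
  then show ?thesis using alive_sets[of 0] alive_sets[of b] b by simp
 qed
 have wm: "?wt \<in> bm (cP x \<Otimes>\<^sub>M lborel)"
  by (rule prod_space_pair, rule borel_measurable_times_ennreal[OF _ window_measurable]) simp_all
 have kp: "?kill \<in> prod_space \<rightarrow>\<^sub>M path_space"
  by (rule measurable_kill[OF measurable_fst_path]) simp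
 have kN: "?kill \<in> N \<rightarrow>\<^sub>M path_space" using prod_space_pair[OF kp] by (simp add: N_def)
 have int2: "(NN z. f z \<partial>N) = c * window_int b f" if f: "f \<in> bm prod_space" for f
 proof -
  have g: "(%z. c * (ind early z * (ind {0<..b} (snd z) * f z))) \<in> bm prod_space"
   by (rule borel_measurable_times_ennreal[OF _ window_measurable[OF f]]) simp
  have "(NN z. f z \<partial>N) = (NN z. ?wt z * f z \<partial>(cP x \<Otimes>\<^sub>M lborel))"
   unfolding N_def by (rule nn_integral_density[OF wm prod_space_pair[OF f]])
  also have "... = (NN z. c * (ind early z * (ind {0<..b} (snd z) * f z)) \<partial>(cP x \<Otimes>\<^sub>M lborel))"
   by (intro nn_integral_cong) (simp add: mult.assoc)
  also have "... = (NN w. NN s. c * (ind early (w, s) * (ind {0<..b} (snd (w, s)) * f (w, s))) \<partial>lborel \<partial>cP x)"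
   by (rule lborel.nn_integral_fst[OF prod_space_pair[OF g], symmetric])
  also have "... = c * window_int b f"
   using window_int_cmult[OF f, of c b] by (simp add: nn_integral_completion)
  finally show ?thesis .
 qed
 have em1: "emeasure M1 B = emeasure Pa (?D Int B)" if B: "B \<in> sets path_space" for B
  unfolding M1_def by (subst emeasure_density) (use D B in "auto simp flip: indicator_inter_arith intro!: nn_integral_indicator")
 have em2: "emeasure M2 B = c * window_int b (%z. ind B (?kill z))" if B: "B \<in> sets path_space" for B
 proof -
  have "emeasure M2 B = (NN w. ind B w \<partial>M2)" using B by (simp add: M2_def)
  also have "... = (NN z. ind B (?kill z) \<partial>N)"
   unfolding M2_def using B by (intro nn_integral_distr kN) simp_all
  also have "... = c * window_int b (%z. ind B (?kill z))"
   by (rule int2[OF measurable_compose[OF kp]]) (use B in simp)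
  finally show ?thesis .
 qed
 have Nfin: "finite_measure N"
 proof (rule finite_measureI)
  have "emeasure N (space N) = (NN z. 1 \<partial>N)" by simp
  also have "... = c * window_int b (%_. 1)" by (rule int2) simp
  also have "... < top" using cfin window_int_1[OF b] by (simp add: ennreal_mult_less_top)
  finally show "emeasure N (space N) ~= \<infinity>" by simp
 qed
 have key: "emeasure M1 (A Int {w \<in> paths. w t ~= None}) = emeasure M2 (A Int {w \<in> paths. w t ~= None})"
  if t: "0 <= t" and A: "A \<in> sets (filt t)" for A t
 proof -
  let ?B = "A Int {w \<in> paths. w t ~= None}"
  have AM: "A \<in> sets path_space" "A \<subseteq> paths"
   using A sets_nat_filt_mono[of "ennreal t" top] sets.sets_into_space[OF A] by auto
  have B: "?B \<in> sets path_space" using AM alive_sets[OF t] by simp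
  have "window_int b (%z. ind ?B (?kill z)) = window_int b (ind (A \<times> {t<..}))"
   unfolding window_int_def
  proof (rule nn_integral_cong_AE, use conservative[of x] AE_space in eventually_elim)
   case (elim w)
   then have w: "w \<in> paths" by simp
   have "ind {0<..b} s * ind ?B (?kill (w, s)) = (ind {0<..b} s * ind (A \<times> {t<..}) (w, s) :: ennreal)" for s
   proof (cases "0 < s & t < s")
    case True
    have "kill s w \<in> A \<longleftrightarrow> w \<in> A"
     by (rule nat_filt_agree[OF A t kill_paths[OF w] w]) (use True in "auto simp: kill_def")
    moreover have "kill s w t = w t" using True t by (simp add: kill_def)
    ultimately show ?thesis using True elim(1) t kill_paths[OF w, of s] by (auto simp: indicator_def)
   next
    case False
    then have "kill s w t = None" if "0 < s" using that t by (simp add: kill_def)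
    then show ?thesis using False by (auto simp: indicator_def)
   qed
   then show ?case by simp
  qed
  then have e2: "emeasure M2 ?B = c * window_int b (ind (A \<times> {t<..}))" using em2[OF B] by simp
  show ?thesis
  proof (cases "t <= b")
   case True
   have Ab: "A \<in> sets (filt b)" using A sets_nat_filt_mono[of "ennreal t" "ennreal b"] True by (auto intro: ennreal_leI)
   have rm: "ind (A \<times> {r<..}) \<in> bm prod_space" for r :: real
    using rect_prod_space[of A "{r<..}"] AM by (intro borel_measurable_indicator) auto
   have "(%n. cond_int n (ind (A \<times> {t<..}))) \<longlonglongrightarrow> c * window_int b (ind (A \<times> {t<..})) + emeasure Pa (A Int {w. w b ~= None})"
   proof -
    have "cond_int n (ind (A \<times> {t<..})) = cond_int n (%z. ind {0<..b} (snd z) * ind (A \<times> {t<..}) z) + cond_int n (ind (A \<times> {b<..}))" for n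
    proof -
     have "ind (A \<times> {t<..}) = (%z. ind {0<..b} (snd z) * ind (A \<times> {t<..}) z + ind (A \<times> {b<..}) z :: ennreal)"
      using True t by (auto simp: indicator_def fun_eq_iff)
     then have "cond_int n (ind (A \<times> {t<..})) = cond_int n (%z. ind {0<..b} (snd z) * ind (A \<times> {t<..}) z + ind (A \<times> {b<..}) z)"
      by (rule arg_cong)
     also have "... = cond_int n (%z. ind {0<..b} (snd z) * ind (A \<times> {t<..}) z) + cond_int n (ind (A \<times> {b<..}))"
      by (rule cond_int_add[OF borel_measurable_times_ennreal[OF _ rm] rm]) measurable
     finally show ?thesis .
    qed
    moreover have "(%n. cond_int n (%z. ind {0<..b} (snd z) * ind (A \<times> {t<..}) z)) \<longlonglongrightarrow> c * window_int b (ind (A \<times> {t<..}))"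
     using c rm[of t] unfolding window_const_def
     by (elim conjE allE[of _ "ind (A \<times> {t<..})"] allE[of _ 1]) (auto simp: indicator_def)
    ultimately show ?thesis using tendsto_add[OF _ law_limit[OF less_imp_le[OF b] Ab]] by simp
   qed
   from LIMSEQ_unique[OF law_limit[OF t A] this]
   have e: "emeasure Pa (A Int {w. w t ~= None}) = emeasure M2 ?B + emeasure Pa (A Int {w. w b ~= None})"
    unfolding e2 .
   have i: "A Int {w. w r ~= None} = A Int {w \<in> paths. w r ~= None}" for r using AM by auto
   have z: "w 0 ~= None & w t ~= None & (w t ~= None \<or> w b = None)" if "w \<in> A" "w t ~= None" for w
    using pathsD(2)[of w 0 t] that AM(2) t by blast
   have z': "w t ~= None" if "w \<in> A" "w b ~= None" for w
    using pathsD(2)[of w t b] that AM(2) t True by blast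
   have "A Int {w. w t ~= None} = (?D Int ?B) \<union> (A Int {w. w b ~= None})"
    unfolding set_eq_iff Int_iff Un_iff mem_Collect_eq using AM(2) z z' by (metis subsetD)
   moreover have "emeasure Pa ((?D Int ?B) \<union> (A Int {w. w b ~= None})) = emeasure Pa (?D Int ?B) + emeasure Pa (A Int {w. w b ~= None})"
   proof (rule plus_emeasure[symmetric])
    show "?D Int ?B \<in> sets Pa" using D B by simp
    show "A Int {w. w b ~= None} \<in> sets Pa" unfolding i by (rule sets.Int) (use AM(1) alive_sets[OF less_imp_le[OF b]] in \<open>simp_all only: sets_Pa\<close>)
   qed auto
   ultimately have "emeasure Pa (?D Int ?B) + emeasure Pa (A Int {w. w b ~= None}) = emeasure M2 ?B + emeasure Pa (A Int {w. w b ~= None})"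
    using e by simp
   moreover have "y = y'" if "y + r = y' + r" "r ~= top" for y y' r :: ennreal
    using arg_cong[OF that(1), of "%wt. wt - r"] that(2) by simp
   ultimately have "emeasure Pa (?D Int ?B) = emeasure M2 ?B"
    using Pa.emeasure_finite[of "A Int {w. w b ~= None}"] unfolding infinity_ennreal_def by blast
   then show ?thesis using em1[OF B] by simp
  next
   case False
   have "?D Int ?B = {}" using False b pathsD(2)[of _ b t] by fastforce
   moreover have "window_int b (ind (A \<times> {t<..})) = 0"
   proof -
    have z: "ind early (w, s) * (ind {0<..b} s * ind (A \<times> {t<..}) (w, s)) = (0 :: ennreal)" for w s
     using False by (auto simp: indicator_def)
    show ?thesis unfolding window_int_def z by simp
   qed
   ultimately show ?thesis using em1[OF B] e2 by simp
  qed
 qed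
 let ?E = "insert paths {A Int {w \<in> paths. w t ~= None} | A t. 0 <= t & A \<in> sets (filt t)}"
 have Esub: "?E \<subseteq> Pow paths" by auto
 have Esets: "sets path_space = sigma_sets paths ?E"
 proof (rule antisym)
  show "sigma_sets paths ?E \<subseteq> sets path_space"
  proof -
   have "A Int {w \<in> paths. w t ~= None} \<in> sets path_space" if "0 <= t" "A \<in> sets (filt t)" for A t
    using that alive_sets[of t] sets_nat_filt_mono[of "ennreal t" top] by auto
   then show ?thesis using sets.sigma_sets_subset[of ?E path_space] sets.top[of path_space] by auto
  qed
  show "sets path_space \<subseteq> sigma_sets paths ?E"
  proof -
   have "{w \<in> paths. w s \<in> Some ` B} \<in> ?E" if s: "0 <= s" "B \<in> sets (borel :: real measure)" for s B
   proof (rule insertI2, intro CollectI exI conjI)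
    show "{w \<in> paths. w s \<in> Some ` B} = {w \<in> paths. w s \<in> Some ` B} Int {w \<in> paths. w s ~= None}" by auto
    show "{w \<in> paths. w s \<in> Some ` B} \<in> sets (filt s)" using s by (intro sets_nat_filtI) auto
   qed (use s in simp)
   then show ?thesis
    unfolding nat_filt_def sets_measure_of[OF nat_filt_generator_sub] by (intro sigma_sets_mono) blast
  qed
 qed
 have M12: "M1 = M2"
 proof (rule measure_eqI_generator_eq[where E = ?E and \<Omega> = paths and A = "%_. paths"])
  show "Int_stable ?E"
  proof (rule Int_stableI)
   fix X X' assume X: "X \<in> ?E" "X' \<in> ?E"
   show "X Int X' \<in> ?E"
   proof (cases "X = paths \<or> X' = paths")
    case True
    moreover have "X \<subseteq> paths" "X' \<subseteq> paths" using X Esub by (auto simp only: Pow_iff subset_iff)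
    ultimately have "X Int X' = X \<or> X Int X' = X'" by blast
    then show ?thesis using X by (elim disjE) (simp_all only:)
   next
    case False
    then obtain A t A' t' where A: "X = A Int {w \<in> paths. w t ~= None}" "0 <= t" "A \<in> sets (filt t)"
     and A': "X' = A' Int {w \<in> paths. w t' ~= None}" "0 <= t'" "A' \<in> sets (nat_filt (ennreal t'))"
     using X by blast
    let ?m = "max t t'"
    have "A \<in> sets (nat_filt (ennreal ?m))" "A' \<in> sets (nat_filt (ennreal ?m))"
     using A(3) A'(3) sets_nat_filt_mono[of "ennreal t" "ennreal ?m"] sets_nat_filt_mono[of "ennreal t'" "ennreal ?m"]
     by (auto simp: ennreal_leI)
    then have "A Int A' \<in> sets (nat_filt (ennreal ?m))" by (rule sets.Int)
    moreover have "X Int X' = (A Int A') Int {w \<in> paths. w ?m ~= None}"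
    proof -
     have "(w t ~= None & w t' ~= None) = (w ?m ~= None)" if "w \<in> paths" for w
     proof (cases "t <= t'")
      case True
      then show ?thesis using pathsD(2)[OF that A(2) True] by (cases "w t") (simp_all add: max_def)
     next
      case False
      then show ?thesis using pathsD(2)[OF that A'(2), of t] by (cases "w t'") (simp_all add: max_def)
     qed
     then show ?thesis unfolding A(1) A'(1) by blast
    qed
    ultimately show ?thesis using A(2) by (intro insertI2 CollectI exI[of _ "A Int A'"] exI[of _ ?m]) simp
   qed
  qed
  show "sets M1 = sigma_sets paths ?E" "sets M2 = sigma_sets paths ?E"
   unfolding Esets[symmetric] by (simp_all add: M1_def M2_def)
  fix X assume "X \<in> ?E"
  then consider "X = paths" | A t where "X = A Int {w \<in> paths. w t ~= None}" "0 <= t" "A \<in> sets (filt t)" by blast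
  then show "emeasure M1 X = emeasure M2 X"
  proof cases
   case 1
   have top: "paths \<in> sets (nat_filt t)" for t using sets.top[of "nat_filt t"] by simp
   let ?A = "paths Int {w \<in> paths. w 0 ~= None}"
   have A: "?A \<in> sets path_space" using alive_sets[of 0] by (simp add: Int_absorb1)
   have "emeasure M1 paths = emeasure M1 ?A" unfolding em1[OF top] em1[OF A] by (rule arg_cong[where f = "emeasure Pa"]) auto
   also have "... = emeasure M2 ?A" by (rule key[OF order_refl]) (use top[of 0] in simp)
   also have "... = emeasure M2 paths"
   proof -
    have "window_int b (%z. ind ?A (?kill z)) = window_int b (%z. ind paths (?kill z))"
     unfolding window_int_def
    proof (rule nn_integral_cong_AE, use conservative[of x] AE_space in eventually_elim)
     case (elim w)
     then have w: "w \<in> paths" by simp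
     have "ind {0<..b} s * ind ?A (?kill (w, s)) = (ind {0<..b} s * ind paths (?kill (w, s)) :: ennreal)" for s
      using kill_paths[OF w, of s] elim(1) by (auto simp: indicator_def kill_def)
     then show ?case by simp
    qed
    then show ?thesis unfolding em2[OF top] em2[OF A] by simp
   qed
   finally show ?thesis using 1 by simp
  next
   case 2
   then show ?thesis using key by simp
  qed
 next
  show "emeasure M1 paths ~= \<infinity>" for i :: nat
   using em1[of paths] sets.top[of path_space] Pa.emeasure_finite by simp
 qed (use Esub in auto)
 have M1fin: "finite_measure M1"
 proof (rule finite_measureI)
  have "space M1 = paths" by (simp add: M1_def)
  then show "emeasure M1 (space M1) ~= \<infinity>" using em1[of paths] sets.top[of path_space] Pa.emeasure_finite by simp
 qed
 obtain Y' where Y': "Y' \<in> bm path_space" "AE w in M1. Y w = Y' w"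
  using ucompl_AE_borel[OF Y M1fin] by (auto simp: M1_def)
 obtain U where U: "U \<in> sets path_space" "emeasure M1 U = 0" "{w \<in> paths. Y w ~= Y' w} \<subseteq> U"
 proof -
  obtain U where "{w \<in> space M1. ~ Y w = Y' w} \<subseteq> U" "emeasure M1 U = 0" "U \<in> sets M1"
   using Y'(2) by (rule AE_E)
  then show ?thesis using that[of U] by (simp add: M1_def)
 qed
 have "c * window_int b (%z. ind U (?kill z)) = 0" using em2[OF U(1)] U(2) M12 by simp
 then have "(NN w. (NN s. c * (ind early (w, s) * (ind {0<..b} s * ind U (kill s w))) \<partial>lborel) \<partial>P x) = 0"
  using window_int_cmult[OF measurable_compose[OF kp borel_measurable_indicator[OF U(1)]], of c b] by simp
 moreover have cm: "(%z. c * (ind early z * (ind {0<..b} (snd z) * ind U (?kill z)))) \<in> bm prod_space"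
  by (rule borel_measurable_times_ennreal[OF _ window_measurable[OF measurable_compose[OF kp]]]) (use U(1) in simp_all)
 ultimately have "AE w in cP x. (NN s. c * (ind early (w, s) * (ind {0<..b} s * ind U (kill s w))) \<partial>lborel) = 0"
  using nn_integral_0_iff_AE[OF lborel_section_measurable[OF cm]] by (simp add: nn_integral_completion)
 then have nullU: "AE w in P x. (NN s. c * (ind early (w, s) * (ind {0<..b} s * ind U (kill s w))) \<partial>lborel) = 0"
  by (simp add: AE_completion_iff)
 have Dind: "ind {w. w 0 ~= None & w b = None} w = (ind ?D w :: ennreal)" if "w \<in> paths" for w
  using that by (simp add: indicator_def)
 have "(NN w. ind {w. w 0 ~= None & w b = None} w * Y w \<partial>Pa) = (NN w. ind ?D w * Y' w \<partial>Pa)"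
 proof (rule nn_integral_cong_AE)
  have "AE w in Pa. 0 < (ind ?D w :: ennreal) --> Y w = Y' w"
   using Y'(2) unfolding M1_def by (subst (asm) AE_density) (use D in auto)
  then show "AE w in Pa. ind {w. w 0 ~= None & w b = None} w * Y w = ind ?D w * Y' w"
   using AE_space by eventually_elim (auto simp: indicator_def)
 qed
 also have "... = (NN w. Y' w \<partial>M1)"
  unfolding M1_def using D Y'(1) by (intro nn_integral_density[symmetric]) (simp_all cong: measurable_cong_sets)
 also have "... = (NN z. Y' (?kill z) \<partial>N)"
  unfolding M12 M2_def using Y'(1) by (intro nn_integral_distr kN) simp_all
 also have "... = c * window_int b (%z. Y' (?kill z))" by (rule int2[OF measurable_compose[OF kp Y'(1)]])
 also have "... = (NN w. (NN s. c * (ind early (w, s) * (ind {0<..b} s * Y' (?kill (w, s)))) \<partial>lborel) \<partial>P x)"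
  by (rule window_int_cmult[OF measurable_compose[OF kp Y'(1)], symmetric])
 also have "... = (NN w. (NN s. c * (ind early (w, s) * (ind {0<..b} s * Z (w, s))) \<partial>lborel) \<partial>P x)"
 proof (rule nn_integral_cong_AE, use nullU eq AE_space in eventually_elim)
  case (elim w)
  then have w: "w \<in> paths" by simp
  have "(%s. c * (ind early (w, s) * (ind {0<..b} s * ind U (kill s w)))) \<in> bm lborel"
   using measurable_section[OF cm w] by simp
  from nn_integral_0_iff_AE[OF this] elim(1)
  have ae: "AE s in lborel. c * (ind early (w, s) * (ind {0<..b} s * ind U (kill s w))) = 0" by blast
  show ?case
  proof (rule nn_integral_cong_AE, use ae elim(2) in eventually_elim)
   case (elim s)
   show ?case
   proof (cases "0 < s & c ~= 0 & (w, s) \<in> early & s <= b")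
    case True
    then have "kill s w \<notin> U" using elim(1) by (auto simp: indicator_def split: if_splits)
    then have "Y (kill s w) = Y' (kill s w)" using U(3) kill_paths[OF w, of s] by auto
    then show ?thesis using elim(2) True by simp
   qed (auto simp: indicator_def)
  qed
 qed
 also have "... = c * window_int b Z" by (rule window_int_cmult[OF Z])
 finally show ?thesis .
qed

section \<open>The last zero under the limit law\<close>

context
 fixes F G :: "path => real" and f :: "real => real" and u K :: real
 assumes F: "F \<in> bm path_space" "!!w. w \<in> paths ==> 0 <= F w"
  and G: "G \<in> bm path_space" "!!w. w \<in> paths ==> 0 <= G w" "!!w. w \<in> paths ==> G w <= 1"
  and f: "f \<in> bm (restrict_space borel {0..})" "!!t. 0 <= t ==> 0 <= f t"
  and Ff: "!!w t. w \<in> paths ==> 0 <= t ==> F w * f t <= K"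
  and u: "0 < u"
begin

lemma exit_value_bounds:
 assumes "w \<in> paths" shows "0 <= exit_value F f G u w s" "exit_value F f G u w s <= K"
proof -
 let ?g = "gz s w"
 note p = kill_paths[OF assms, of ?g] stop_paths[OF less_imp_le[OF u] shift_paths[OF gz_nonneg[of s w] assms]]
 have K: "0 <= K" using Ff[OF assms order_refl] F(2)[OF assms] f(2)[of 0] by (meson mult_nonneg_nonneg order_refl order_trans)
 have Fg: "0 <= F (kill ?g w) * f ?g" using F(2)[OF p(1)] f(2)[OF gz_nonneg[of s w]] by (rule mult_nonneg_nonneg)
 show "0 <= exit_value F f G u w s" using Fg G(2)[OF p(2)] by (simp add: exit_value_def)
 have "F (kill ?g w) * f ?g * G (stop u (shift ?g w)) <= F (kill ?g w) * f ?g"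
  using Fg G(2,3)[OF p(2)] by (rule mult_right_le_one_le)
 then show "exit_value F f G u w s <= K" using Ff[OF p(1) gz_nonneg[of s w]] K by (simp add: exit_value_def)
qed

text \<open>With \<open>b = a + u\<close> the functional splits into a part with \<open>s \<le> b\<close>, which corresponds to paths dying in \<open>(0,b]\<close>, and a part with
\<open>s > b\<close>.  In the latter the last zero before \<open>s\<close> is the last zero before \<open>b\<close>, it lies below \<open>a\<close>, and the \<open>u\<close> units of time after it
are over at \<open>b\<close>: the functional is known at time \<open>b\<close>.\<close>

lemma final_limit:
 "(%n. cond_int n (%z. ennreal (exit_value F f G u (fst z) (snd z))))
   \<longlonglongrightarrow> (NN w. ennreal (final_value F f G u w) \<partial>Pa)"
proof -
 let ?E = "%z. ennreal (exit_value F f G u (fst z) (snd z))"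
 let ?\<Phi> = "%w. ennreal (final_value F f G u w)"
 have u0: "0 <= u" using u by simp
 define b where "b = a + u"
 have b: "0 < b" "a <= b" "0 <= b" using a_pos u by (auto simp: b_def)
 obtain c where c: "window_const b c" using window_const_exists[OF b(1)] by blast
 have E: "?E \<in> bm prod_space"
  using measurable_exit_value[OF F(1) G(1) f(1) u0] by measurable
 have \<Phi>: "?\<Phi> \<in> bm (ucompl path_space)"
  using measurable_final_value[OF F(1) G(1) f(1) u0] by measurable
 have 1: "(NN w. ind {w. w 0 ~= None & w b = None} w * ?\<Phi> w \<partial>Pa) = c * window_int b ?E"
 proof (rule kill_law[OF b(1) c \<Phi> E])
  show "AE w in P x. AE s in lborel. 0 < s --> ?\<Phi> (kill s w) = ?E (w, s)"
   using zeros_closed[of x] conservative[of x] AE_space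
  proof eventually_elim
   case (elim w)
   show ?case using AE_final_kill[of w u F f G] elim u by auto
  qed
 qed
 define Y where "Y w = exit_value F f G u w b" for w
 have Ym: "Y \<in> bm (ucompl (filt b))"
 proof (rule ucompl_nat_filt_stop[OF b(3)])
  have "(%w. (w, b)) \<in> ucompl path_space \<rightarrow>\<^sub>M prod_space" by measurable
  from measurable_compose[OF this measurable_exit_value[OF F(1) G(1) f(1) u0]]
  show "Y \<in> bm (ucompl path_space)" by (simp add: Y_def[abs_def])
  show "Y (stop b w) = Y w" for w unfolding Y_def by (rule exit_value_stop[OF b(3) u0])
 qed
 have L2: "(%n. cond_int n (%z. ind {b<..} (snd z) * ennreal (Y (fst z))))
   \<longlonglongrightarrow> (NN w. ind {w. w b ~= None} w * ennreal (Y w) \<partial>Pa)"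
  by (rule late_limit[OF b(3) Ym, of K]) (simp_all add: Y_def exit_value_bounds)
 have L1: "(%n. cond_int n (%z. ind {0<..b} (snd z) * ?E z)) \<longlonglongrightarrow> c * window_int b ?E"
  using c E unfolding window_const_def
  by (elim conjE allE[of _ ?E] allE[of _ "ennreal K"]) (auto simp: exit_value_bounds ennreal_leI)
 have late: "last_zero (ennreal b) w + ennreal u < ennreal b" if lt: "last_zero (ennreal b) w < ennreal a" for w
 proof -
  obtain r where r: "0 <= r" "last_zero (ennreal b) w = ennreal r"
   using less_imp_neq[OF less_le_trans[OF lt top_greatest]] by (cases "last_zero (ennreal b) w") auto
  then have "r < a" using lt by (simp add: ennreal_less_iff)
  then show ?thesis using r u b by (simp add: b_def ennreal_less_iff flip: ennreal_plus)
 qed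
 have split: "cond_int n ?E = cond_int n (%z. ind {0<..b} (snd z) * ?E z) + cond_int n (%z. ind {b<..} (snd z) * ennreal (Y (fst z)))" for n
 proof -
  have "cond_int n ?E = cond_int n (%z. ind {0<..b} (snd z) * ?E z + ind {b<..} (snd z) * ennreal (Y (fst z)))"
   unfolding cond_int_def
  proof (rule arg_cong[where f = "(*) _"], rule joint_cong)
   fix w and s :: real assume w: "w \<in> paths" and s: "0 <= s"
   have "?E (w, s) = ind {0<..b} s * ?E (w, s) + ind {b<..} s * ennreal (Y w)" if e: "(w, s) \<in> early"
   proof -
    consider "s = 0" | "0 < s" "s <= b" | "b < s" using s by linarith
    then show ?thesis
    proof cases
     case 1
     then have "exit_value F f G u w s = 0" by (simp add: exit_value_def)
     then show ?thesis using 1 b by simp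
    next
     case 2
     then show ?thesis by (simp add: indicator_def)
    next
     case 3
     note m = early_mono[OF w e b(2) less_imp_le[OF 3]]
     have lt: "last_zero (ennreal b) w < ennreal a" using m early_iff[OF w] by blast
     have "last_zero (ennreal s) w + ennreal u < ennreal s"
      using less_le_trans[OF late[OF lt] ennreal_leI[OF less_imp_le[OF 3]]] m by simp
     then have "exit_value F f G u w s = Y w" using m late[OF lt] by (simp add: exit_value_def Y_def)
     then show ?thesis using 3 b by (simp add: indicator_def)
    qed
   qed
   then show "ind early (w, s) * ?E (w, s) = ind early (w, s) *
     (ind {0<..b} (snd (w, s)) * ?E (w, s) + ind {b<..} (snd (w, s)) * ennreal (Y (fst (w, s))))"
    by (cases "(w, s) \<in> early") simp_all
  qed
  also have "... = cond_int n (%z. ind {0<..b} (snd z) * ?E z) + cond_int n (%z. ind {b<..} (snd z) * ennreal (Y (fst z)))"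
  proof (rule cond_int_add)
   show "(%z. ind {0<..b} (snd z) * ?E z) \<in> bm prod_space" using E by measurable
   have "Y \<in> bm (ucompl path_space)"
    using Ym ucompl_nat_filt_mono[of "ennreal b" top] by (auto simp: measurable_def)
   then show "(%z. ind {b<..} (snd z) * ennreal (Y (fst z))) \<in> bm prod_space" by measurable
  qed
  finally show ?thesis .
 qed
 (* on paths alive at b, the last zero before b is the last zero of the path, and the lifetime exceeds it by more than u *)
 have 2: "(NN w. ind {w. w b ~= None} w * ennreal (Y w) \<partial>Pa) = (NN w. ind {w. w b ~= None} w * ?\<Phi> w \<partial>Pa)"
 proof (rule nn_integral_cong_AE, use late_last_zero[OF b(2)] AE_space in eventually_elim)
  case (elim w)
  then have w: "w \<in> paths" by simp
  show ?case
  proof (cases "w b = None")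
   case False
   then have lz: "last_zero top w = last_zero (ennreal b) w" "last_zero (ennreal b) w < ennreal a" using elim by auto
   have "ennreal b < lifetime w" using lifetime_gt_iff[OF w b(3)] False by simp
   with late[OF lz(2)] have "last_zero (ennreal b) w + ennreal u < lifetime w" by (rule less_trans)
   then have "final_value F f G u w = Y w"
    using late[OF lz(2)] by (simp add: final_value_def Y_def exit_value_def lz(1) gz_def)
   then show ?thesis by simp
  qed simp
 qed
 have "(NN w. ?\<Phi> w \<partial>Pa) = (NN w. ind {w. w 0 ~= None & w b = None} w * ?\<Phi> w + ind {w. w b ~= None} w * ?\<Phi> w \<partial>completion Pa)"
  unfolding nn_integral_completion
 proof (rule nn_integral_cong)
  fix w assume "w \<in> space Pa"
  then have w: "w \<in> paths" by simp
  show "?\<Phi> w = ind {w. w 0 ~= None & w b = None} w * ?\<Phi> w + ind {w. w b ~= None} w * ?\<Phi> w"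
  proof (cases "w 0 = None")
   case True
   then have "~ ennreal 0 < lifetime w" using lifetime_gt_iff[OF w order_refl] by simp
   then have "final_value F f G u w = 0" by (auto simp: final_value_def not_less)
   then show ?thesis by simp
  qed (auto simp: indicator_def)
 qed
 also have "... = c * window_int b ?E + (NN w. ind {w. w b ~= None} w * ?\<Phi> w \<partial>Pa)"
 proof (subst nn_integral_add)
  have \<Phi>c: "?\<Phi> \<in> bm (completion Pa)"
   by (rule measurable_ucompl_completion[OF \<Phi>]) (use Pa_prob in "simp_all add: prob_space_def")
  have al: "(ind {w. w t ~= None} :: path => ennreal) \<in> bm (completion Pa)" if "0 <= t" for t
   by (rule measurable_completion) (use indicator_alive_measurable[OF that] in "simp cong: measurable_cong_sets")
  show "(%w. ind {w. w b ~= None} w * ?\<Phi> w) \<in> bm (completion Pa)"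
   by (rule borel_measurable_times_ennreal[OF al[OF b(3)] \<Phi>c])
  have "(%w. ind {w. w 0 ~= None} w * (1 - ind {w. w b ~= None} w) * ?\<Phi> w) \<in> bm (completion Pa)"
   using al[OF order_refl] al[OF b(3)] \<Phi>c by (intro borel_measurable_times_ennreal borel_measurable_minus_ennreal) simp_all
  then show "(%w. ind {w. w 0 ~= None & w b = None} w * ?\<Phi> w) \<in> bm (completion Pa)"
   by (rule measurable_cong[THEN iffD1, rotated]) (auto simp: indicator_def)
 qed (simp only: nn_integral_completion 1)
 finally have fin: "(NN w. ?\<Phi> w \<partial>Pa) = c * window_int b ?E + (NN w. ind {w. w b ~= None} w * ?\<Phi> w \<partial>Pa)" .
 show ?thesis unfolding split fin 2[symmetric] by (rule tendsto_add[OF L1 L2])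
qed

end

end

context nice_markov_process
begin

section \<open>The limit of the normalised escape probabilities\<close>

lemma escape_le_1: "escape q y <= 1"
proof -
 have "escape q y <= (NN w. 1 \<partial>P y)"
  unfolding escape_def by (intro nn_integral_mono) (simp add: one_minus_exp_def)
 then show ?thesis using prob_space.emeasure_space_1[OF prob_P[of y]] by simp
qed

lemma hq_escape: assumes q: "0 < q" shows "hqq q y = enn2real (escape q y) / enn2real (kappa q)"
proof -
 let ?I = "NN ex. ennreal (one_minus_exp q (exc_length ex)) \<partial>\<eta>"
 have S: "{z \<in> paths \<times> UNIV. ennreal (snd z) < hit0 (fst z)} \<in> sets prod_space"
 proof -
  have "{z \<in> space prod_space. ennreal (snd z) < hit0 (fst z)} \<in> sets prod_space"
   using measurable_hit0_fst by measurable
  then show ?thesis by (simp add: space_pair_measure)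
 qed
 have "joint y q (ind {z \<in> paths \<times> UNIV. ennreal (snd z) < hit0 (fst z)}) = escape q y"
  unfolding joint_def escape_def
 proof (rule nn_integral_cong)
  fix w assume "w \<in> space (P y)"
  then have "(NN s. ind {z \<in> paths \<times> UNIV. ennreal (snd z) < hit0 (fst z)} (w, s) \<partial>exp_law q)
    = (NN s. ind {s. ennreal s < hit0 w} s \<partial>exp_law q)"
   by (intro nn_integral_cong) (simp add: indicator_def)
  then show "(NN s. ind {z \<in> paths \<times> UNIV. ennreal (snd z) < hit0 (fst z)} (w, s) \<partial>exp_law q)
    = ennreal (one_minus_exp q (hit0 w))"
   by (simp add: exp_law_head[OF q])
 qed
 then have n: "\<P>(z in with_exp_time P y q. ennreal (snd z) < hit0 (fst z)) = enn2real (escape q y)"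
  using measure_with_exp_time[OF q S, of y] by simp
 have "?I < top" using kappa_bounds(2)[OF q] unfolding kappa_def by simp
 then have "enn2real (kappa q) = q * \<beta> + enn2real ?I"
  unfolding kappa_def using q beta_nonneg by (simp add: enn2real_plus)
 then show ?thesis unfolding hq_def n by simp
qed

lemma hq_nonneg: "0 < q ==> 0 <= hqq q y" by (simp add: hq_escape)

lemma ennreal_hq: assumes q: "0 < q" shows "ennreal (hqq q y) = inverse (kappa q) * escape q y"
proof -
 have fin: "escape q y < top" using escape_le_1 by (rule le_less_trans) simp
 have "0 < enn2real (kappa q)" using kappa_bounds[OF q] by (simp add: enn2real_positive_iff)
 then have "ennreal (hqq q y) = escape q y / kappa q"
  unfolding hq_escape[OF q] using fin kappa_bounds(2)[OF q] by (simp add: divide_ennreal[symmetric])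
 then show ?thesis by (simp add: divide_ennreal_def mult.commute)
qed

lemma measurable_hq_pos:
 assumes q: "0 < q" and u: "0 <= u" shows "(%w. hqq q (pos u w)) \<in> bm (ucompl path_space)"
proof -
 have p: "pos u \<in> ucompl path_space \<rightarrow>\<^sub>M ucompl borel"
  using measurable_pos[of u top] u by (intro measurable_ucompl_lift measurable_ucomplI) simp
 show ?thesis
  unfolding hq_escape[OF q] using measurable_compose[OF p measurable_escape[of q]] by measurable
qed

lemma completion_long_exc:
 "0 < u ==> f \<in> bm (ucompl path_space) ==> f \<in> bm (completion (long_exc u))"
 by (rule measurable_ucompl_completion) (simp_all add: finite_long_exc)

text \<open>Up to the discount at \<open>u\<close>, the escape probability from \<open>\<epsilon>\<^sub>u\<close> integrates to a part of \<open>\<eta>(1 - e\<^sup>-\<^sup>q\<^sup>\<zeta>)\<close>.\<close>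

lemma hq_long_exc_le:
 assumes q: "0 < q" and u: "0 < u"
 shows "(NN w. ennreal (hqq q (pos u w)) \<partial>long_exc u) <= ennreal (exp (q * u))"
proof -
 have em: "(%w. escape q (pos u w)) \<in> bm (completion (long_exc u))"
 proof (rule completion_long_exc[OF u])
  have "pos u \<in> ucompl path_space \<rightarrow>\<^sub>M ucompl borel"
   using measurable_pos[of u top] u by (intro measurable_ucompl_lift measurable_ucomplI) simp
  from measurable_compose[OF this measurable_escape[of q]]
  show "(%w. escape q (pos u w)) \<in> bm (ucompl path_space)" .
 qed
 let ?J = "NN w. escape q (pos u w) \<partial>long_exc u"
 have "ennreal (exp (- q * u)) * ?J = (NN ex. exc_tail q u ex \<partial>\<eta>)"
  using exc_tail_markov[OF q u, of "%_. 1"] by simp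
 also have "... <= (NN ex. ennreal (one_minus_exp q (exc_length ex)) \<partial>\<eta>)"
 proof (rule nn_integral_mono)
  fix ex
  have "exc_tail q u ex <= exc_tail q 0 ex"
   unfolding exc_tail_def using u by (intro nn_integral_mono) (auto simp: indicator_def)
  then show "exc_tail q u ex <= ennreal (one_minus_exp q (exc_length ex))" unfolding exc_tail_0[OF q] .
 qed
 also have "... <= kappa q" unfolding kappa_def by simp
 finally have le: "ennreal (exp (- q * u)) * ?J <= kappa q" .
 have "?J = ennreal (exp (q * u)) * (ennreal (exp (- q * u)) * ?J)"
  by (simp flip: mult.assoc ennreal_mult exp_add)
 also have "... <= ennreal (exp (q * u)) * kappa q" using le by (rule mult_left_mono) simp
 finally have J: "?J <= ennreal (exp (q * u)) * kappa q" .
 have "(NN w. ennreal (hqq q (pos u w)) \<partial>long_exc u) = inverse (kappa q) * ?J"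
  unfolding ennreal_hq[OF q] using nn_integral_cmult[OF em, of "inverse (kappa q)"] by (simp add: nn_integral_completion)
 also have "... <= inverse (kappa q) * (ennreal (exp (q * u)) * kappa q)" using J by (rule mult_left_mono) simp
 also have "... = ennreal (exp (q * u)) * (kappa q / kappa q)" by (simp add: divide_ennreal_def ac_simps)
 also have "... = ennreal (exp (q * u))" using kappa_bounds[OF q] by simp
 finally show ?thesis .
qed

abbreviation hq_controlled :: bool where
 "hq_controlled \<equiv> (\<exists>H \<in> bm borel.
        (\<forall>q>0. \<forall>y. \<bar>hqq q y\<bar> <= H y) &
        (SUP t\<in>{0..}. NN ex. ennreal (H (pos t ex))
          * ind {ex. ennreal t < exc_length ex} ex \<partial>\<eta>) < top)
      \<or> (\<forall>y. mono_on {0<..} (%q. hqq q y) \<or> antimono_on {0<..} (%q. hqq q y))"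

context
 assumes A: "!!y. \<exists>l. ((%q. hqq q y) \<longlongrightarrow> l) (at_right 0)"
begin

lemma hlim_tendsto: "((%q. hqq q y) \<longlongrightarrow> hl y) (at_right 0)"
proof -
 obtain l where l: "((%q. hqq q y) \<longlongrightarrow> l) (at_right 0)" using A by blast
 then have "hl y = l" unfolding hlim_def by (intro tendsto_Lim) auto
 then show ?thesis using l by simp
qed

lemma hlim_nonneg: "0 <= hl y"
 by (rule tendsto_lowerbound[OF hlim_tendsto]) (auto simp: eventually_at_filter hq_nonneg)

lemma hlim_sequence:
 assumes "!!n. 0 < q n" "filterlim q (at_right 0) sequentially"
 shows "(%n. hqq (q n) y) \<longlonglongrightarrow> hl y"
 by (rule filterlim_compose[OF hlim_tendsto assms(2)])

lemma measurable_hlim_pos: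
 assumes u: "0 <= u" shows "(%w. hl (pos u w)) \<in> bm (ucompl path_space)"
proof (rule borel_measurable_LIMSEQ_real)
 let ?q = "%n. 1 / real (Suc n)"
 have l: "filterlim ?q (at_right 0) sequentially"
  unfolding filterlim_at using LIMSEQ_Suc[OF lim_1_over_n] by simp
 show "(%n. hqq (?q n) (pos u w)) \<longlonglongrightarrow> hl (pos u w)" for w
  by (rule hlim_sequence[OF _ l]) simp
 show "(%w. hqq (?q n) (pos u w)) \<in> bm (ucompl path_space)" for n
  by (rule measurable_hq_pos[OF _ u]) simp
qed

text \<open>Fatou's lemma turns the uniform bound on the approximations into one on the limit.\<close>

lemma hlim_long_exc_finite:
 assumes u: "0 < u" shows "(NN w. ennreal (hl (pos u w)) \<partial>long_exc u) < top"
proof -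
 let ?q = "%n. 1 / real (Suc n)"
 have l: "filterlim ?q (at_right 0) sequentially"
  unfolding filterlim_at using LIMSEQ_Suc[OF lim_1_over_n] by simp
 let ?f = "%n w. ennreal (hqq (?q n) (pos u w))"
 have lim: "(%n. ?f n w) \<longlonglongrightarrow> ennreal (hl (pos u w))" for w
  by (intro tendsto_ennrealI hlim_sequence[OF _ l]) simp
 have "(NN w. ennreal (hl (pos u w)) \<partial>long_exc u) = (NN w. liminf (%n. ?f n w) \<partial>completion (long_exc u))"
  unfolding nn_integral_completion using lim_imp_Liminf[OF sequentially_bot lim] by simp
 also have "... <= liminf (%n. NN w. ?f n w \<partial>completion (long_exc u))"
 proof (rule nn_integral_liminf)
  fix n
  have "(%w. hqq (?q n) (pos u w)) \<in> bm (completion (long_exc u))"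
   using u by (intro completion_long_exc measurable_hq_pos) simp_all
  then show "?f n \<in> bm (completion (long_exc u))" by measurable
 qed
 also have "... <= ennreal (exp u)"
 proof (rule Liminf_le[OF sequentially_bot always_eventually], rule)
  fix n
  have "(NN w. ?f n w \<partial>long_exc u) <= ennreal (exp (?q n * u))" by (rule hq_long_exc_le[OF _ u]) simp
  also have "... <= ennreal (exp u)" using u by (intro ennreal_leI) (simp add: field_simps)
  finally show "(NN w. ?f n w \<partial>completion (long_exc u)) <= ennreal (exp u)" by (simp only: nn_integral_completion)
 qed
 finally show ?thesis by (rule le_less_trans) simp
qed

text \<open>Dominated convergence.  If \<open>q \<mapsto> h\<^sub>q(y)\<close> is increasing, it is dominated for \<open>q \<le> 1\<close> by its value at \<open>1\<close>, if it is
decreasing by its limit at \<open>0\<close>; the sum of both is integrable.\<close>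

lemma hq_limit_long_exc:
 fixes \<gamma> :: "path => real"
 assumes B: hq_controlled
  and u: "0 < u" and \<gamma>: "\<gamma> \<in> bm path_space" "!!w. 0 <= \<gamma> w" "!!w. \<gamma> w <= 1"
  and q: "!!n. 0 < q n" "!!n. q n <= 1" "filterlim q (at_right 0) sequentially"
 shows "(%n. NN w. ennreal (\<gamma> (stop u w) * hqq (q n) (pos u w)) \<partial>long_exc u)
   \<longlonglongrightarrow> (NN w. ennreal (\<gamma> (stop u w) * hl (pos u w)) \<partial>long_exc u)"
proof -
 let ?C = "completion (long_exc u)"
 have hqm: "(%w. hqq r (pos u w)) \<in> bm ?C" if "0 < r" for r
  using u that by (intro completion_long_exc measurable_hq_pos) simp_all
 have hm: "(%w. hl (pos u w)) \<in> bm ?C"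
  using u by (intro completion_long_exc measurable_hlim_pos) simp_all
 have gm: "(%w. \<gamma> (stop u w)) \<in> bm ?C"
  using measurable_compose[OF measurable_stop_const \<gamma>(1)] u by (intro completion_long_exc measurable_ucomplI) simp_all
 have "\<exists>wt. wt \<in> bm ?C & (NN w. wt w \<partial>?C) < top & (\<forall>w n. ennreal (hqq (q n) (pos u w)) <= wt w)"
  using B
 proof
  assume "\<exists>H \<in> bm borel.
        (\<forall>q>0. \<forall>y. \<bar>hqq q y\<bar> <= H y) &
        (SUP t\<in>{0..}. NN ex. ennreal (H (pos t ex))
          * ind {ex. ennreal t < exc_length ex} ex \<partial>\<eta>) < top"
  then obtain H where H: "H \<in> bm borel" "!!q y. 0 < q ==> \<bar>hqq q y\<bar> <= H y"
   "(SUP t\<in>{0..}. NN ex. ennreal (H (pos t ex)) * ind {ex. ennreal t < exc_length ex} ex \<partial>\<eta>) < top" by blast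
  have Hm: "(%w. ennreal (H (pos u w))) \<in> bm path_space"
   using measurable_compose[OF measurable_pos[of u top] H(1)] u by simp
  have "(NN w. ennreal (H (pos u w)) \<partial>?C) = (NN ex. ennreal (H (pos u ex)) * ind (longer u) ex \<partial>\<eta>)"
   unfolding nn_integral_completion by (rule nn_integral_long_exc[OF u Hm])
  also have "... <= (SUP t\<in>{0..}. NN ex. ennreal (H (pos t ex)) * ind {ex. ennreal t < exc_length ex} ex \<partial>\<eta>)"
   using u by (intro SUP_upper) simp
  finally have fin: "(NN w. ennreal (H (pos u w)) \<partial>?C) < top" using H(3) by (rule le_less_trans)
  have le: "ennreal (hqq (q n) (pos u w)) <= ennreal (H (pos u w))" for n w
   using H(2)[OF q(1)[of n], of "pos u w"] by (intro ennreal_leI) simp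
  have "(%w. ennreal (H (pos u w))) \<in> bm ?C"
   using Hm by (intro completion_long_exc[OF u] measurable_ucomplI) simp
  then show ?thesis using fin le by blast
 next
  assume mono: "\<forall>y. mono_on {0<..} (%q. hqq q y) \<or> antimono_on {0<..} (%q. hqq q y)"
  let ?wt = "%w. ennreal (hqq 1 (pos u w)) + ennreal (hl (pos u w))"
  have le: "ennreal (hqq (q n) y) <= ennreal (hqq 1 y) + ennreal (hl y)" for n y
  proof (cases "mono_on {0<..} (%q. hqq q y)")
   case True
   then have "hqq (q n) y <= hqq 1 y" using q(1,2)[of n] by (auto simp: monotone_on_def)
   from add_increasing2[OF _ ennreal_leI[OF this]] show ?thesis by simp
  next
   case False
   then have anti: "antimono_on {0<..} (%q. hqq q y)" using mono by blast
   have "eventually (%r. hqq (q n) y <= hqq r y) (at_right 0)"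
    using eventually_at_right_real[OF q(1)[of n]]
    by eventually_elim (use anti in "auto simp: monotone_on_def")
   then have "hqq (q n) y <= hl y" by (intro tendsto_lowerbound[OF hlim_tendsto]) auto
   from add_increasing[OF _ ennreal_leI[OF this]] show ?thesis by simp
  qed
  have m: "(%w. ennreal (hqq 1 (pos u w))) \<in> bm ?C" "(%w. ennreal (hl (pos u w))) \<in> bm ?C"
   using hqm[of 1] hm by measurable
  have "(NN w. ?wt w \<partial>?C) = (NN w. ennreal (hqq 1 (pos u w)) \<partial>?C) + (NN w. ennreal (hl (pos u w)) \<partial>?C)"
   by (rule nn_integral_add[OF m])
  also have "... < top"
   using hlim_long_exc_finite[OF u] le_less_trans[OF hq_long_exc_le[OF _ u, of 1]] by (simp add: nn_integral_completion)
  finally show ?thesis using le m by (intro exI[of _ ?wt]) auto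
 qed
 then obtain wt where wt: "wt \<in> bm ?C" "(NN w. wt w \<partial>?C) < top" "!!w n. ennreal (hqq (q n) (pos u w)) <= wt w" by blast
 have "(%n. NN w. ennreal (\<gamma> (stop u w) * hqq (q n) (pos u w)) \<partial>?C)
   \<longlonglongrightarrow> (NN w. ennreal (\<gamma> (stop u w) * hl (pos u w)) \<partial>?C)"
 proof (rule nn_integral_dominated_convergence[where w = wt])
  show "(%w. ennreal (\<gamma> (stop u w) * hqq (q n) (pos u w))) \<in> bm ?C" for n
   using hqm[OF q(1)[of n]] gm by measurable
  show "(%w. ennreal (\<gamma> (stop u w) * hl (pos u w))) \<in> bm ?C"
   using hm gm by measurable
  show "AE w in ?C. ennreal (\<gamma> (stop u w) * hqq (q n) (pos u w)) <= wt w" for n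
  proof (rule AE_I2)
   fix w
   have "\<gamma> (stop u w) * hqq (q n) (pos u w) <= hqq (q n) (pos u w)"
    using \<gamma>(2,3) hq_nonneg[OF q(1)] by (intro mult_left_le_one_le) auto
   then show "ennreal (\<gamma> (stop u w) * hqq (q n) (pos u w)) <= wt w"
    by (rule order_trans[OF ennreal_leI wt(3)])
  qed
  show "AE w in ?C. (%n. ennreal (\<gamma> (stop u w) * hqq (q n) (pos u w))) \<longlonglongrightarrow> ennreal (\<gamma> (stop u w) * hl (pos u w))"
   by (intro AE_I2 tendsto_ennrealI tendsto_mult tendsto_const hlim_sequence q)
 qed (use wt in auto)
 then show ?thesis by (simp only: nn_integral_completion)
qed

end

end

section \<open>The representation\<close>

context last_zero_law
begin

text \<open>The time is cut off at \<open>0\<close> because \<open>f\<close> is measurable on \<open>[0,\<infinity>)\<close> only.\<close>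

definition past :: "(path => real) => (real => real) => path \<times> real => ennreal" where
 "past F f z = ennreal (F (kill (snd z) (fst z)) * f (max 0 (snd z)))"

lemma measurable_past:
 assumes F: "F \<in> bm path_space" and f: "f \<in> bm (restrict_space borel {0..})"
 shows "past F f \<in> bm optional"
proof -
 have "(%z. F (kill (snd z) (fst z))) \<in> bm optional"
  by (rule measurable_compose[OF measurable_optional_kill F])
 moreover have "(%z. f (max 0 (snd z))) \<in> bm optional"
  by (rule measurable_compose[OF measurable_restrict_space2 f]) (use measurable_optional_snd in simp_all)
 ultimately show ?thesis unfolding past_def[abs_def] by measurable
qed

text \<open>Limits and null sets in \<open>\<phi>\<close> can thus be treated under a single integral.\<close>

lemma early_pot_measure:
 "\<exists>N. sets N = sets optional & (\<forall>\<phi>\<in>bm optional. pot 0 (%z. cutoff z * \<phi> z) = (NN z. cutoff z * \<phi> z \<partial>N))"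
proof -
 obtain N where N: "sets N = sets optional"
  "\<forall>\<phi>\<in>bm optional. 1 * (NN w. lt_int 0 \<phi> w \<partial>cP x) = (NN z. \<phi> z \<partial>N)"
  using local_time_functional[of 1 x 0] by blast
 have "pot 0 (%z. cutoff z * \<phi> z) = (NN z. cutoff z * \<phi> z \<partial>N)" if "\<phi> \<in> bm optional" for \<phi>
  using bspec[OF N(2) borel_measurable_times_ennreal[OF cutoff_measurable that]]
  by (simp add: pot_def nn_integral_completion)
 then show ?thesis using N(1) by blast
qed

text \<open>The local time has no atom at \<open>a\<close>, so that \<open>[0,a]\<close> and \<open>[0,a)\<close> carry the same mass.\<close>

lemma local_time_side:
 assumes F: "F \<in> bm path_space" and f: "f \<in> bm (restrict_space borel {0..})"
 shows "AE w in P x. (\<integral>\<^sup>+t\<in>{0..a}. ennreal (F (kill t w) * f t) * k \<partial>lt w)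
   = k * lt_int 0 (%z. cutoff z * past F f z) w"
 using regular_P[of x] AE_space
proof eventually_elim
 case (elim w)
 then have w: "w \<in> paths" by simp
 note m = measurable_optional_section[OF borel_measurable_times_ennreal[OF cutoff_measurable measurable_past[OF F f]] w]
 have "(\<integral>\<^sup>+t\<in>{0..a}. ennreal (F (kill t w) * f t) * k \<partial>lt w)
   = (NN t. k * (ind {0..} t * (cutoff (w, t) * past F f (w, t))) \<partial>lt w)"
  by (rule nn_integral_cong_AE, use lt_AE_ne[OF elim(1), of a] in eventually_elim) (auto simp: indicator_def past_def mult.commute)
 also have "... = k * (NN t. ind {0..} t * (cutoff (w, t) * past F f (w, t)) \<partial>lt w)"
  using m by (intro nn_integral_cmult) simp
 finally show ?case by (simp add: lt_int_def)
qed

lemma local_time_side_integral: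
 assumes F: "F \<in> bm path_space" and f: "f \<in> bm (restrict_space borel {0..})"
 shows "(NN w. (\<integral>\<^sup>+t\<in>{0..a}. ennreal (F (kill t w) * f t) * k \<partial>lt w) \<partial>P x) = k * pot 0 (%z. cutoff z * past F f z)"
proof -
 note m = borel_measurable_times_ennreal[OF cutoff_measurable measurable_past[OF F f]]
 have "(NN w. (\<integral>\<^sup>+t\<in>{0..a}. ennreal (F (kill t w) * f t) * k \<partial>lt w) \<partial>P x)
   = (NN w. k * lt_int 0 (%z. cutoff z * past F f z) w \<partial>P x)"
  by (rule nn_integral_cong_AE[OF local_time_side[OF F f]])
 also have "... = k * pot 0 (%z. cutoff z * past F f z)"
  unfolding pot_def using nn_integral_cmult[OF measurable_lt_int[OF m, of 0 x], of k]
  by (simp add: nn_integral_completion)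
 finally show ?thesis .
qed

lemma pot_zero: "pot 0 cutoff = 0 ==> \<phi> \<in> bm optional ==> pot 0 (%z. cutoff z * \<phi> z) = 0"
proof -
 assume z: "pot 0 cutoff = 0" and \<phi>: "\<phi> \<in> bm optional"
 obtain N where N: "sets N = sets optional"
  "!!\<phi>. \<phi> \<in> bm optional ==> pot 0 (%z. cutoff z * \<phi> z) = (NN z. cutoff z * \<phi> z \<partial>N)"
  using early_pot_measure by blast
 have c: "cutoff \<in> bm N" using cutoff_measurable N(1) by (simp cong: measurable_cong_sets)
 have "(NN z. cutoff z \<partial>N) = 0" using N(2)[of "%_. 1"] z by simp
 then have "AE z in N. cutoff z = 0" using nn_integral_0_iff_AE[OF c] by blast
 then have "(NN z. cutoff z * \<phi> z \<partial>N) = (NN z. 0 \<partial>N)" by (intro nn_integral_cong_AE) (auto elim!: eventually_mono)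
 then show ?thesis using N(2)[OF \<phi>] by simp
qed

text \<open>If \<open>V\<close> vanishes, the conditioning events are null for all \<open>q\<close>.  Conditional probabilities are then \<open>0\<close> by convention, so
the limit law is carried by paths of lifetime \<open>0\<close>.\<close>

lemma final_zero:
 assumes V0: "V P L 0 a x = 0" shows "AE w in Pa. final_value F f G u w = 0"
proof -
 interpret Pa: prob_space Pa by (rule Pa_prob)
 let ?T = "%_::path. 0::ennreal"
 let ?p = "%q. \<P>(z in with_exp_time P x q. (fst z \<in> paths & 0 < ennreal (snd z)) \<bar> last_zero (ennreal (snd z)) (fst z) < ennreal a)"
 have st: "stopping_time nat_filt ?T" by (rule stopping_time_const)
 have pre: "paths \<in> sets (filtration.pre_sigma paths nat_filt ?T)"
  by (rule filtration.sets_pre_sigmaI[OF filtration_nat_filt st]) (use sets.top[of "nat_filt _"] in simp)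
 have lim: "(?p \<longlongrightarrow> measure Pa {w \<in> paths. 0 < lifetime w}) (at_right 0)"
  using Pa_law st pre unfolding is_last_zero_law_def by blast
 have "?p q = 0" if q: "0 < q" for q
 proof -
  have "pot q cutoff <= pot 0 cutoff" using q by (intro pot_exp_bounds(1) cutoff_measurable) auto
  then have "joint x q (ind early) = 0" using V0 V_pot unfolding joint_early[OF q] by simp
  moreover have "early = {z \<in> paths \<times> UNIV. last_zero (ennreal (snd z)) (fst z) < ennreal a}" by (simp add: early_def)
  ultimately have "\<P>(z in with_exp_time P x q. last_zero (ennreal (snd z)) (fst z) < ennreal a) = 0"
   using measure_with_exp_time[OF q, of "%z. last_zero (ennreal (snd z)) (fst z) < ennreal a" x] early_sets by simp
  then show ?thesis by (simp add: cond_prob_def)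
 qed
 then have "(?p \<longlongrightarrow> 0) (at_right 0)"
  by (intro tendsto_eventually) (auto simp: eventually_at_filter)
 with lim have "measure Pa {w \<in> paths. 0 < lifetime w} = 0" using tendsto_unique trivial_limit_at_right_real by blast
 moreover have "{w \<in> space path_space. 0 < lifetime w} \<in> sets path_space" using measurable_lifetime by measurable
 ultimately have "{w \<in> paths. 0 < lifetime w} \<in> null_sets Pa"
  by (simp add: null_sets_def Pa.emeasure_eq_measure)
 from AE_not_in[OF this] AE_space show ?thesis
 proof eventually_elim
  case (elim w)
  then have "lifetime w = 0" by (simp add: not_less)
  then show ?case by (simp add: final_value_def)
 qed
qed

end

context last_zero_conditioned
begin

text \<open>The last exit formula for numerator and denominator: the factor \<open>kappa q\<close> cancels, except for the one that turns escape
probabilities into \<open>h\<^sub>q\<close>.\<close>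

lemma cond_int_exit:
 assumes F: "F \<in> bm path_space" "!!w. w \<in> paths ==> 0 <= F w"
  and G: "G \<in> bm path_space" "!!w. 0 <= G w" "!!w. G w <= 1"
  and f: "f \<in> bm (restrict_space borel {0..})" "!!t. 0 <= t ==> 0 <= f t"
  and u: "0 < u"
 shows "cond_int n (%z. ennreal (exit_value F f G u (fst z) (snd z)))
  = ennreal (exp (qs n * - u)) * ((NN w. ennreal (G (stop u w) * hqq (qs n) (pos u w)) \<partial>long_exc u)
    * (pot (qs n) (%z. cutoff z * past F f z) * inverse (pot (qs n) cutoff)))"
proof -
 let ?q = "qs n" and ?\<gamma> = "%w. ennreal (G w)"
 let ?\<Gamma> = "post_exit u ?\<gamma>" and ?J = "NN w. ennreal (G (stop u w)) * escape (qs n) (pos u w) \<partial>long_exc u"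
 have q: "0 < ?q" by (rule qs_pos)
 have u0: "0 <= u" using u by simp
 note \<phi> = measurable_past[OF F(1) f(1)]
 have \<gamma>: "?\<gamma> \<in> bm path_space" using G(1) by measurable
 have "joint x ?q (%z. ind early z * ennreal (exit_value F f G u (fst z) (snd z)))
   = joint x ?q (%z. ind early z * exit_fun ?\<Gamma> (past F f) z)"
  unfolding joint_def
 proof (rule nn_integral_cong_AE, use zeros_closed[of x] AE_space in eventually_elim)
  case (elim w)
  then have w: "w \<in> paths" by simp
  show ?case
  proof (rule nn_integral_cong_AE, use AE_exp_law_nonneg[of ?q] in eventually_elim)
   case (elim s)
   show ?case
   proof (cases "(w, s) \<in> early")
    case True
    then have "last_zero (ennreal s) w < top" using early_iff[OF w] by (auto simp: less_top[symmetric])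
    then have hit: "hit0 w <= ennreal s"
     using last_zero_less_top_iff[OF w, of s] hit0_le_iff[OF w, of "ennreal s"] by blast
    let ?g = "gz s w"
    note g = gz_attained(4)[OF w \<open>closed (zeros w)\<close> elim hit] gz_nonneg[of s w]
    have iff: "last_zero (ennreal s) w + ennreal u < ennreal s \<longleftrightarrow> u < s - ?g"
     using g u elim by (simp add: ennreal_less_iff less_diff_eq add.commute flip: ennreal_plus)
    have nn: "0 <= F (kill ?g w) * f ?g" using F(2)[OF kill_paths[OF w]] f(2)[OF g(2)] by simp
    have "ennreal (exit_value F f G u w s) = exit_fun ?\<Gamma> (past F f) (w, s)"
     using hit g(2) nn G(2) by (auto simp: exit_value_def exit_fun_def iff post_exit_def past_def ennreal_mult)
    then show ?thesis by simp
   qed simp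
  qed
 qed
 also have "... = kappa ?q * exit_weight ?q ?\<Gamma> * pot ?q (%z. cutoff z * past F f z)"
 proof (rule last_exit_early[OF q measurable_post_exit[OF u0 \<gamma>] _ \<phi>])
  show "?\<Gamma> z <= 1" for z using G(3) by (simp add: post_exit_def indicator_def)
 qed
 also have "exit_weight ?q ?\<Gamma> = total_potential ?q * (ennreal (exp (- ?q * u)) * ?J)"
  unfolding exit_weight_excursion[OF q u0 G(1,2)] exc_tail_markov[OF q u \<gamma>] ..
 finally have j: "joint x ?q (%z. ind early z * ennreal (exit_value F f G u (fst z) (snd z)))
   = kappa ?q * (total_potential ?q * (ennreal (exp (- ?q * u)) * ?J)) * pot ?q (%z. cutoff z * past F f z)" .
 have k: "0 < kappa ?q" "kappa ?q < top" by (rule kappa_bounds[OF q])+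
 have p: "pot ?q cutoff ~= 0" "pot ?q cutoff < top"
  using pot_cutoff_pos[of n] le_less_trans[OF pot_exp_bounds(1)[OF less_imp_le[OF q] cutoff_measurable] pot_finite] by auto
 have ik: "inverse (kappa ?q) * kappa ?q = 1" using k ennreal_divide_self[of "kappa ?q"] by (auto simp: divide_ennreal_def mult.commute)
 have ip: "inverse (pot ?q cutoff) * pot ?q cutoff = 1" using p ennreal_divide_self[of "pot ?q cutoff"] by (auto simp: divide_ennreal_def mult.commute)
 have tp: "total_potential ?q = inverse (kappa ?q)"
 proof -
  have "total_potential ?q = total_potential ?q * (kappa ?q * inverse (kappa ?q))" using ik by (simp add: mult.commute)
  also have "... = total_potential ?q * kappa ?q * inverse (kappa ?q)" by (simp only: mult.assoc)
  finally show ?thesis unfolding total_potential_kappa[OF q] by simp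
 qed
 have pk: "inverse (pn n) * kappa ?q = inverse (pot ?q cutoff)"
 proof -
  have "inverse (pn n) * kappa ?q = (inverse (pn n) * kappa ?q) * (inverse (pot ?q cutoff) * pot ?q cutoff)" unfolding ip by simp
  also have "... = inverse (pn n) * pn n * inverse (pot ?q cutoff)" unfolding pn_eq by (simp only: ac_simps)
  finally show ?thesis unfolding inverse_pn(2) by simp
 qed
 have J: "(NN w. ennreal (G (stop u w) * hqq ?q (pos u w)) \<partial>long_exc u) = inverse (kappa ?q) * ?J"
 proof -
  have "pos u \<in> ucompl path_space \<rightarrow>\<^sub>M ucompl borel"
   using measurable_pos[of u top] u0 by (intro measurable_ucompl_lift measurable_ucomplI) simp
  from measurable_compose[OF this measurable_escape[of ?q]]
  have e: "(%w. escape ?q (pos u w)) \<in> bm (completion (long_exc u))" by (rule completion_long_exc[OF u])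
  have "(%w. ?\<gamma> (stop u w)) \<in> bm (completion (long_exc u))"
   by (rule completion_long_exc[OF u measurable_ucomplI[OF measurable_compose[OF measurable_stop_const[OF u0] \<gamma>]]])
  from nn_integral_cmult[OF borel_measurable_times_ennreal[OF this e], of "inverse (kappa ?q)"]
  show ?thesis
   by (simp add: nn_integral_completion ennreal_mult ennreal_hq[OF q] hq_nonneg[OF q] G(2) mult.left_commute)
 qed
 show ?thesis
  unfolding cond_int_def j tp J
  using pk by (simp add: ac_simps) (simp flip: pk add: ac_simps)
qed

text \<open>The limit of the closed form is a product of three limits, which are finite, and \<open>final_limit\<close> identifies it as the left
side.\<close>

theorem last_zero_representation_bounded:
 assumes A: "!!y. \<exists>l. ((%q. hqq q y) \<longlongrightarrow> l) (at_right 0)"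
  and B: hq_controlled
  and F: "F \<in> bm path_space" "!!w. w \<in> paths ==> 0 <= F w"
  and G: "G \<in> bm path_space" "!!w. 0 <= G w" "!!w. G w <= 1"
  and f: "f \<in> bm (restrict_space borel {0..})" "!!t. 0 <= t ==> 0 <= f t"
  and Ff: "!!w t. w \<in> paths ==> 0 <= t ==> F w * f t <= K"
  and u: "0 < u"
 shows "(NN w. ennreal (final_value F f G u w) \<partial>Pa)
  = inverse (V P L 0 a x) * (pot 0 (%z. cutoff z * past F f z)
    * (NN w. ennreal (G (stop u w) * hl (pos u w)) \<partial>long_exc u))"
proof -
 let ?p = "%q. pot q (%z. cutoff z * past F f z)" and ?k = "NN w. ennreal (G (stop u w) * hl (pos u w)) \<partial>long_exc u"
 note \<phi> = measurable_past[OF F(1) f(1)]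
 note c\<phi> = borel_measurable_times_ennreal[OF cutoff_measurable \<phi>]
 have p: "(%n. ?p (qs n)) \<longlonglongrightarrow> ?p 0" by (rule pot_tendsto[OF c\<phi>]) simp
 have pc: "(%n. pot (qs n) cutoff) \<longlonglongrightarrow> V P L 0 a x" unfolding V_pot by (rule pot_tendsto[OF cutoff_measurable]) simp
 have ipc: "(%n. inverse (pot (qs n) cutoff)) \<longlonglongrightarrow> inverse (V P L 0 a x)"
  using continuous_on_tendsto_compose[OF continuous_on_inverse_ennreal[OF continuous_on_id] pc, of UNIV] by simp
 have ifin: "inverse (V P L 0 a x) ~= top" using V_pos by auto
 have pfin: "?p 0 ~= top"
 proof -
  obtain N where N: "sets N = sets optional"
   "!!\<phi>. \<phi> \<in> bm optional ==> pot 0 (%z. cutoff z * \<phi> z) = (NN z. cutoff z * \<phi> z \<partial>N)"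
   using early_pot_measure by blast
  have c: "cutoff \<in> bm N" using cutoff_measurable N(1) by (simp cong: measurable_cong_sets)
  have "past F f z <= ennreal K" if "z \<in> space optional" for z
   unfolding past_def using that by (intro ennreal_leI Ff kill_paths) auto
  then have "?p 0 <= (NN z. ennreal K * cutoff z \<partial>N)"
   unfolding N(2)[OF \<phi>] using sets_eq_imp_space_eq[OF N(1)] by (intro nn_integral_mono) (auto simp: indicator_def)
  also have "... = ennreal K * pot 0 cutoff" using N(2)[of "%_. 1"] by (simp add: nn_integral_cmult[OF c])
  also have "... < top" using pot_finite by (simp add: ennreal_mult_less_top)
  finally show ?thesis by simp
 qed
 have k: "(%n. NN w. ennreal (G (stop u w) * hqq (qs n) (pos u w)) \<partial>long_exc u) \<longlonglongrightarrow> ?k"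
  by (rule hq_limit_long_exc[OF A B u G qs_pos qs_le_1 qs_at_right])
 have "?k <= (NN w. ennreal (hl (pos u w)) \<partial>long_exc u)"
  using G(2,3) hlim_nonneg[OF A] by (intro nn_integral_mono ennreal_leI mult_left_le_one_le)
 also have "... < top" by (rule hlim_long_exc_finite[OF A u])
 finally have kfin: "?k ~= top" by simp
 have r: "(%n. ?p (qs n) * inverse (pot (qs n) cutoff)) \<longlonglongrightarrow> ?p 0 * inverse (V P L 0 a x)"
  by (rule tendsto_mult_ennreal[OF p ipc]) (use ifin pfin in "unfold infinity_ennreal_def, blast")
 have rfin: "?p 0 * inverse (V P L 0 a x) ~= top" using ifin pfin by (simp add: ennreal_mult_eq_top_iff)
 have kr: "(%n. (NN w. ennreal (G (stop u w) * hqq (qs n) (pos u w)) \<partial>long_exc u) * (?p (qs n) * inverse (pot (qs n) cutoff)))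
   \<longlonglongrightarrow> ?k * (?p 0 * inverse (V P L 0 a x))"
  by (rule tendsto_mult_ennreal[OF k r]) (simp add: kfin rfin)
 have krfin: "?k * (?p 0 * inverse (V P L 0 a x)) ~= top" using kfin rfin by (simp add: ennreal_mult_eq_top_iff)
 have "(%n. cond_int n (%z. ennreal (exit_value F f G u (fst z) (snd z)))) \<longlonglongrightarrow> 1 * (?k * (?p 0 * inverse (V P L 0 a x)))"
 proof -
  have eq: "(%n. cond_int n (%z. ennreal (exit_value F f G u (fst z) (snd z)))) = (%n. ennreal (exp (qs n * - u)) * ((NN w. ennreal (G (stop u w) * hqq (qs n) (pos u w)) \<partial>long_exc u) * (?p (qs n) * inverse (pot (qs n) cutoff))))"
   by (rule ext, rule cond_int_exit[OF F G f u])
  show ?thesis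
   unfolding eq by (rule tendsto_mult_ennreal[OF exp_qs_tendsto kr]) (simp add: krfin)
 qed
 from LIMSEQ_unique[OF final_limit[OF F G(1,2,3) f Ff u] this]
 show ?thesis by (simp add: ac_simps)
qed

end

section \<open>Unbounded and signed functionals\<close>

text \<open>If the product of the outer factors is negative, then all terms are \<open>0\<close>, so the sequence increases in any case.\<close>

lemma ennreal_truncation:
 assumes "0 <= (v::real)"
 shows "incseq (%k. ennreal (A * min v (real k) * B))" "(%k. ennreal (A * min v (real k) * B)) \<longlonglongrightarrow> ennreal (A * v * B)"
proof -
 show "incseq (%k. ennreal (A * min v (real k) * B))"
 proof (rule incseq_SucI)
  fix k
  have m: "min v (real k) <= min v (real (Suc k))" "0 <= min v (real k)" using assms by auto
  have e: "A * y * B = (A * B) * y" for y by simp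
  show "ennreal (A * min v (real k) * B) <= ennreal (A * min v (real (Suc k)) * B)"
  proof (cases "0 <= A * B")
   case True
   then show ?thesis unfolding e using m by (intro ennreal_leI mult_left_mono)
  next
   case False
   then have "(A * B) * min v (real k) <= 0" using m(2) by (intro mult_nonpos_nonneg[of "A * B"]) (simp_all only: not_le less_imp_le)
   then have "A * min v (real k) * B <= 0" by (simp only: e)
   then show ?thesis by (simp add: ennreal_neg)
  qed
 qed
 obtain n where n: "v <= real n" using real_arch_simple by blast
 have "\<forall>\<^sub>F k in sequentially. ennreal (A * min v (real k) * B) = ennreal (A * v * B)"
  using eventually_ge_at_top[of n] by eventually_elim (use n in "simp add: min_absorb1")
 then show "(%k. ennreal (A * min v (real k) * B)) \<longlonglongrightarrow> ennreal (A * v * B)" by (rule tendsto_eventually)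
qed

lemma ennreal_sign_split:
 fixes A B v i :: real
 assumes "0 <= v" "0 <= i"
 shows "ennreal (A * v * B * i) = ennreal (max 0 A * v * max 0 B * i) + ennreal (max 0 (- A) * v * max 0 (- B) * i)"
  and "ennreal (- (A * v * B * i)) = ennreal (max 0 A * v * max 0 (- B) * i) + ennreal (max 0 (- A) * v * max 0 B * i)"
proof -
 have *: "0 <= v * i" using assms by simp
 have e: "A * v * B * i = A * B * (v * i)" for A B by simp
 have "A * B * (v * i) <= 0" if "A * B <= 0" for A B using that * by (rule mult_nonpos_nonneg)
 then have neg: "ennreal (A * B * (v * i)) = 0" if "A * B <= 0" for A B using that by (simp add: ennreal_neg)
 show 1: "ennreal (A * v * B * i) = ennreal (max 0 A * v * max 0 B * i) + ennreal (max 0 (- A) * v * max 0 (- B) * i)" for B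
  unfolding e by (cases "0 <= A"; cases "0 <= B") (auto simp: max_def neg mult_nonneg_nonpos mult_nonpos_nonneg)
 show "ennreal (- (A * v * B * i)) = ennreal (max 0 A * v * max 0 (- B) * i) + ennreal (max 0 (- A) * v * max 0 B * i)"
  using 1[of "- B"] by simp
qed

lemma integral_enn2real:
 assumes A: "A \<in> bm M" "(NN x. A x \<partial>M) < top"
 shows "integrable M (%x. enn2real (A x))" "(\<integral>x. enn2real (A x) \<partial>M) = enn2real (NN x. A x \<partial>M)"
proof -
 have m: "(%x. enn2real (A x)) \<in> bm M" using A(1) by measurable
 have "AE x in M. A x ~= \<infinity>" using A by (intro nn_integral_noteq_infinite) auto
 then have e: "(NN x. ennreal (enn2real (A x)) \<partial>M) = (NN x. A x \<partial>M)"
  by (intro nn_integral_cong_AE) (auto elim!: eventually_mono simp: less_top)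
 show "integrable M (%x. enn2real (A x))" using m e A(2) by (intro integrableI_nonneg) auto
 show "(\<integral>x. enn2real (A x) \<partial>M) = enn2real (NN x. A x \<partial>M)"
  using m e by (subst integral_eq_nn_integral) auto
qed

context last_zero_law
begin

lemma last_zero_path: "w \<in> paths ==> 0 <= u ==> stop u (shift (enn2real (last_zero top w)) w) \<in> paths"
 by (intro stop_paths shift_paths) simp_all

lemma measurable_final_Pa:
 assumes "F \<in> bm path_space" "G \<in> bm path_space"
  "f \<in> bm (restrict_space borel {0..})" "0 <= u"
 shows "final_value F f G u \<in> bm (completion Pa)"
 by (rule measurable_ucompl_completion[OF measurable_final_value[OF assms]]) (use Pa_prob in "simp_all add: prob_space_def")

definition future :: "(path => real) => real => ennreal" where
 "future G u = (NN ex. ennreal (G (stop u ex) * hl (pos u ex)) * ind (longer u) ex \<partial>\<eta>)"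

context
 assumes A: "!!y. \<exists>l. ((%q. hqq q y) \<longlongrightarrow> l) (at_right 0)"
begin

lemma measurable_future:
 assumes u: "0 < u" and G: "G \<in> bm path_space"
 shows "(%w. ennreal (G (stop u w) * hl (pos u w))) \<in> bm (ucompl path_space)"
proof -
 have "(%w. G (stop u w)) \<in> bm (ucompl path_space)"
  using measurable_compose[OF measurable_stop_const G] u by (intro measurable_ucomplI) simp
 then show ?thesis using measurable_hlim_pos[OF A less_imp_le[OF u]] by measurable
qed

lemma future_long_exc:
 assumes "0 < u" "G \<in> bm path_space"
 shows "future G u = (NN w. ennreal (G (stop u w) * hl (pos u w)) \<partial>long_exc u)"
  and "(%ex. ennreal (G (stop u ex) * hl (pos u ex)) * ind (longer u) ex) \<in> bm (completion \<eta>)"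
 unfolding future_def
 by (rule long_exc_ucompl(1)[OF assms(1) measurable_future[OF assms], symmetric])
  (rule long_exc_ucompl(2)[OF assms(1) measurable_future[OF assms]])

lemma future_finite:
 assumes u: "0 < u" and G: "G \<in> bm path_space" "!!w. w \<in> paths ==> G w <= K"
 shows "future G u < top"
proof -
 have "future G u <= (NN w. ennreal \<bar>K\<bar> * ennreal (hl (pos u w)) \<partial>completion (long_exc u))"
  unfolding future_long_exc(1)[OF u G(1)] nn_integral_completion
 proof (rule nn_integral_mono)
  fix w assume "w \<in> space (long_exc u)"
  then have "stop u w \<in> paths" using sets_eq_imp_space_eq[OF sets_long_exc[of u]] u by (intro stop_paths) auto
  then have "G (stop u w) <= \<bar>K\<bar>" using G(2)[of "stop u w"] by simp
  then have "G (stop u w) * hl (pos u w) <= \<bar>K\<bar> * hl (pos u w)"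
   using hlim_nonneg[OF A] by (rule mult_right_mono)
  then show "ennreal (G (stop u w) * hl (pos u w)) <= ennreal \<bar>K\<bar> * ennreal (hl (pos u w))"
   using hlim_nonneg[OF A] by (simp add: ennreal_leI flip: ennreal_mult)
 qed
 also have "... = ennreal \<bar>K\<bar> * (NN w. ennreal (hl (pos u w)) \<partial>completion (long_exc u))"
 proof (rule nn_integral_cmult)
  have "(%w. hl (pos u w)) \<in> bm (completion (long_exc u))"
   using measurable_hlim_pos[OF A] u by (intro completion_long_exc) simp_all
  then show "(%w. ennreal (hl (pos u w))) \<in> bm (completion (long_exc u))" by measurable
 qed
 also have "... < top" using hlim_long_exc_finite[OF A u] by (simp add: nn_integral_completion ennreal_mult_less_top)
 finally show ?thesis .
qed

context
 assumes B: hq_controlled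
begin

text \<open>Truncation of \<open>f\<close> and monotone convergence on both sides, after scaling \<open>G\<close> into \<open>[0,1]\<close>.  The constants are kept inside the
integral, so that products of \<open>0\<close> and \<open>\<infinity>\<close> need no separate treatment.\<close>

theorem last_zero_representation:
 assumes F: "F \<in> bm path_space" "!!w. w \<in> paths ==> 0 <= F w" "!!w. w \<in> paths ==> F w <= KF"
  and G: "G \<in> bm path_space" "!!w. w \<in> paths ==> 0 <= G w" "!!w. w \<in> paths ==> G w <= KG"
  and f: "f \<in> bm (restrict_space borel {0..})" "!!t. 0 <= t ==> 0 <= f t"
  and u: "0 < u"
 shows "(NN w. ennreal (final_value F f G u w) \<partial>Pa)
  = 1 / V P L 0 a x * (future G u * pot 0 (%z. cutoff z * past F f z))"
proof (cases "V P L 0 a x = 0")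
 case True
 have "(NN w. ennreal (final_value F f G u w) \<partial>Pa) = (NN w. 0 \<partial>Pa)"
  by (rule nn_integral_cong_AE, use final_zero[OF True, of F f G u] in eventually_elim) simp
 moreover have "pot 0 (%z. cutoff z * past F f z) = 0"
  using True V_pot by (intro pot_zero measurable_past F f) simp
 ultimately show ?thesis by simp
next
 case False
 interpret C: last_zero_conditioned P L \<beta> \<eta> a x Pa
  by unfold_locales (use False in "simp add: zero_less_iff_neq_zero")
 (* the bound is made positive so that G can be divided by it *)
 define K where "K = max 1 KG"
 have K: "0 < K" "!!w. w \<in> paths ==> G w <= K" by (simp_all add: K_def max.coboundedI2 G(3))
 define G1 where "G1 w = max 0 (min 1 (G w / K))" for w
 have G1m: "G1 \<in> bm path_space" unfolding G1_def[abs_def] using G(1) by measurable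
 have G1: "G w = K * G1 w" if "w \<in> paths" for w using K G(2)[OF that] that by (simp add: G1_def)
 have Gb: "0 <= G1 w" "G1 w <= 1" for w by (auto simp: G1_def)
 define fk where "fk k t = min (f t) (real k)" for k t
 have fkm: "fk k \<in> bm (restrict_space borel {0..})" for k unfolding fk_def[abs_def] using f(1) by measurable
 have u0: "0 <= u" using u by simp
 obtain N where N: "sets N = sets optional"
  "!!\<phi>. \<phi> \<in> bm optional ==> pot 0 (%z. cutoff z * \<phi> z) = (NN z. cutoff z * \<phi> z \<partial>N)"
  using early_pot_measure by blast
 have cm: "(%z. cutoff z * past F f z) \<in> bm N" if "f \<in> bm (restrict_space borel {0..})" for f
  using borel_measurable_times_ennreal[OF cutoff_measurable measurable_past[OF F(1) that]] N(1) by (simp cong: measurable_cong_sets)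
 let ?c = "inverse (V P L 0 a x) * future G1 u"
 have step: "(NN w. ennreal (final_value F (fk k) G1 u w) \<partial>completion Pa) = (NN z. ?c * (cutoff z * past F (fk k) z) \<partial>N)" for k
 proof -
  have "(NN w. ennreal (final_value F (fk k) G1 u w) \<partial>Pa) = inverse (V P L 0 a x) * (pot 0 (%z. cutoff z * past F (fk k) z) * future G1 u)"
   unfolding future_long_exc(1)[OF u G1m]
  proof (rule C.last_zero_representation_bounded[OF A B F(1,2) G1m Gb fkm _ _ u, where K = "KF * real k"])
   show "0 <= fk k t" if "0 <= t" for t using f(2)[OF that] by (simp add: fk_def)
   show "F w * fk k t <= KF * real k" if "w \<in> paths" "0 <= t" for w t
    using F(2,3)[OF that(1)] f(2)[OF that(2)] by (intro mult_mono) (auto simp: fk_def)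
  qed
  also have "... = ?c * pot 0 (%z. cutoff z * past F (fk k) z)" by (simp only: ac_simps)
  also have "... = (NN z. ?c * (cutoff z * past F (fk k) z) \<partial>N)"
   unfolding N(2)[OF measurable_past[OF F(1) fkm]] by (rule nn_integral_cmult[OF cm[OF fkm], symmetric])
  finally show ?thesis by (simp only: nn_integral_completion)
 qed
 have "(%k. NN w. ennreal (final_value F (fk k) G1 u w) \<partial>completion Pa) \<longlonglongrightarrow> (NN w. ennreal (final_value F f G1 u w) \<partial>completion Pa)"
 proof (rule nn_integral_LIMSEQ)
  let ?g = "%w. enn2real (last_zero top w)"
  have e: "final_value F f' G1 u w = F (kill (?g w) w) * f' (?g w) * (G1 (stop u (shift (?g w) w)) * ind {w. last_zero top w + ennreal u < lifetime w} w)" for f' w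
   by (simp add: final_value_def)
  note t = ennreal_truncation[OF f(2)[OF enn2real_nonneg]]
  show "incseq (%k w. ennreal (final_value F (fk k) G1 u w))"
   unfolding e fk_def using incseqD[OF t(1)] by (auto simp: incseq_def le_fun_def)
  show "(%k. ennreal (final_value F (fk k) G1 u w)) \<longlonglongrightarrow> ennreal (final_value F f G1 u w)" for w
   unfolding e fk_def by (rule t(2))
  show "(%w. ennreal (final_value F (fk k) G1 u w)) \<in> bm (completion Pa)" for k
   using measurable_final_Pa[OF F(1) G1m fkm u0] by measurable
 qed
 moreover have "(%k. NN z. ?c * (cutoff z * past F (fk k) z) \<partial>N) \<longlonglongrightarrow> (NN z. ?c * (cutoff z * past F f z) \<partial>N)"
 proof (rule nn_integral_LIMSEQ)
  have nn: "0 <= f (max 0 t)" for t by (rule f(2)) simp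
  note t = ennreal_truncation[OF nn, of _ _ 1, unfolded mult_1_right]
  show "incseq (%k z. ?c * (cutoff z * past F (fk k) z))"
   unfolding past_def fk_def using incseqD[OF t(1)] by (auto simp: incseq_def le_fun_def intro!: mult_left_mono)
  show "(%z. ?c * (cutoff z * past F (fk k) z)) \<in> bm N" for k
   by (rule borel_measurable_times_ennreal[OF _ cm[OF fkm]]) simp
  fix z :: "path \<times> real"
  obtain n where n: "f (max 0 (snd z)) <= real n" using real_arch_simple by blast
  have "\<forall>\<^sub>F k in sequentially. ?c * (cutoff z * past F (fk k) z) = ?c * (cutoff z * past F f z)"
   using eventually_ge_at_top[of n] by eventually_elim (use n in "simp add: past_def fk_def min_absorb1")
  then show "(%k. ?c * (cutoff z * past F (fk k) z)) \<longlonglongrightarrow> ?c * (cutoff z * past F f z)" by (rule tendsto_eventually)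
 qed
 ultimately have 1: "(NN w. ennreal (final_value F f G1 u w) \<partial>completion Pa) = (NN z. ?c * (cutoff z * past F f z) \<partial>N)"
  unfolding step by (rule LIMSEQ_unique)
 have 2: "(NN z. ?c * (cutoff z * past F f z) \<partial>N) = ?c * pot 0 (%z. cutoff z * past F f z)"
  unfolding N(2)[OF measurable_past[OF F(1) f(1)]] by (rule nn_integral_cmult[OF cm[OF f(1)]])
 have 3: "(NN w. ennreal (final_value F f G u w) \<partial>Pa) = ennreal K * (NN w. ennreal (final_value F f G1 u w) \<partial>completion Pa)"
 proof -
  have "(NN w. ennreal (final_value F f G u w) \<partial>Pa) = (NN w. ennreal K * ennreal (final_value F f G1 u w) \<partial>completion Pa)"
   unfolding nn_integral_completion
  proof (rule nn_integral_cong)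
   fix w assume "w \<in> space Pa"
   then have "final_value F f G u w = K * final_value F f G1 u w"
    using G1[OF last_zero_path[of w u]] u0 by (simp add: final_value_def)
   then show "ennreal (final_value F f G u w) = ennreal K * ennreal (final_value F f G1 u w)"
    using K(1) by (simp add: ennreal_mult')
  qed
  also have "... = ennreal K * (NN w. ennreal (final_value F f G1 u w) \<partial>completion Pa)"
   by (rule nn_integral_cmult) (use measurable_final_Pa[OF F(1) G1m f(1) u0] in measurable)
  finally show ?thesis .
 qed
 have 4: "future G u = ennreal K * future G1 u"
 proof -
  have "future G u = (NN ex. ennreal K * (ennreal (G1 (stop u ex) * hl (pos u ex)) * ind (longer u) ex) \<partial>completion \<eta>)"
   unfolding future_def nn_integral_completion
  proof (rule nn_integral_cong)
   fix ex assume "ex \<in> space \<eta>"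
   then have "G (stop u ex) = K * G1 (stop u ex)" using G1[OF stop_paths[OF u0]] space_\<eta> by auto
   then show "ennreal (G (stop u ex) * hl (pos u ex)) * ind (longer u) ex
     = ennreal K * (ennreal (G1 (stop u ex) * hl (pos u ex)) * ind (longer u) ex)"
    using K(1) by (simp add: ennreal_mult' mult.assoc)
  qed
  also have "... = ennreal K * future G1 u"
   unfolding future_def using nn_integral_cmult[OF future_long_exc(2)[OF u G1m]] by (simp only: nn_integral_completion)
  finally show ?thesis .
 qed
 show ?thesis unfolding 3 1 2 4 by (simp only: divide_ennreal_def mult_1 ac_simps)
qed

text \<open>The positive and the negative part of the functional are sums of two products of positive and negative parts of \<open>F\<close> and
\<open>G\<close>.  By the nonnegative case finiteness of the left side forces the local time potentials of both parts of \<open>F\<close> to be finite,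
unless \<open>V\<close> or both excursion integrals vanish; in the exceptional cases both sides are \<open>0\<close>.\<close>

theorem last_zero_representation_signed:
 assumes F: "F \<in> bm path_space" "!!w. w \<in> paths ==> \<bar>F w\<bar> <= KF"
  and G: "G \<in> bm path_space" "!!w. w \<in> paths ==> \<bar>G w\<bar> <= KG"
  and f: "f \<in> bm (restrict_space borel {0..})" "!!t. 0 <= t ==> 0 <= f t"
  and u: "0 < u"
  and fin: "(NN w. ennreal \<bar>final_value F f G u w\<bar> \<partial>Pa) < top"
 shows "integrable (completion Pa) (final_value F f G u)"
  and "(\<integral>w. final_value F f G u w \<partial>completion Pa) =
    1 / enn2real (V P L 0 a x) *
     (\<integral>w. (LINT t:{0..a}|completion (lt w). F (kill t w) * f t
       * (LINT ex:(longer u)|completion \<eta>. G (stop u ex) * hl (pos u ex)))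
      \<partial>cP x)" (is ?eq)
proof -
 let ?V = "V P L 0 a x" and ?h = "%ex. hl (pos u ex)" and ?\<Phi> = "final_value F f G u"
 have u0: "0 <= u" using u by simp
 define pp where "pp F w = max 0 (F w)" for F :: "path => real" and w
 let ?Fm = "%w. - F w" and ?Gm = "%w. - G w"
 have Fm: "?Fm \<in> bm path_space" and Gm: "?Gm \<in> bm path_space" using F(1) G(1) by measurable
 have ppm: "pp F \<in> bm path_space" if "F \<in> bm path_space" for F
  using that unfolding pp_def[abs_def] by measurable
 have ppb: "0 <= pp F w" "\<bar>F w\<bar> <= K ==> pp F w <= K" for F w K by (auto simp: pp_def)
 define k where "k G = future (pp G) u" for G
 define p where "p F = pot 0 (%z. cutoff z * past (pp F) f z)" for F
 define N where "N F G = (NN w. ennreal (final_value (pp F) f (pp G) u w) \<partial>Pa)" for F G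
 have rep: "N F' G' = 1 / ?V * (k G' * p F')"
  if "F' \<in> bm path_space" "!!w. w \<in> paths ==> \<bar>F' w\<bar> <= KF"
   "G' \<in> bm path_space" "!!w. w \<in> paths ==> \<bar>G' w\<bar> <= KG" for F' G'
  unfolding N_def k_def p_def
  by (rule last_zero_representation[OF ppm[OF that(1)] ppb(1) ppb(2)[OF that(2)] ppm[OF that(3)] ppb(1) ppb(2)[OF that(4)] f u])
 have F': "\<bar>- F w\<bar> <= KF" and G': "\<bar>- G w\<bar> <= KG" if "w \<in> paths" for w using F(2)[OF that] G(2)[OF that] by auto
 have rep': "N F G = 1 / ?V * (k G * p F)" "N F ?Gm = 1 / ?V * (k ?Gm * p F)"
  "N ?Fm G = 1 / ?V * (k G * p ?Fm)" "N ?Fm ?Gm = 1 / ?V * (k ?Gm * p ?Fm)"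
  by (intro rep F G Fm Gm F' G'; assumption)+
 have \<Phi>m: "?\<Phi> \<in> bm (completion Pa)" by (rule measurable_final_Pa[OF F(1) G(1) f(1) u0])
 let ?g = "%w. enn2real (last_zero top w)"
 have f0: "0 <= f (?g w)" for w by (rule f(2)) simp
 have i0: "0 <= (ind S w :: real)" for S and w :: path by simp
 note split = ennreal_sign_split[OF f0 i0]
 have fm: "(%w. ennreal (final_value (pp F') f (pp G') u w)) \<in> bm (completion Pa)"
  if "F' \<in> bm path_space" "G' \<in> bm path_space" for F' G'
  using measurable_final_Pa[OF ppm[OF that(1)] ppm[OF that(2)] f(1) u0] by measurable
 have plus: "(NN w. ennreal (?\<Phi> w) \<partial>completion Pa) = N F G + N ?Fm ?Gm"
 proof -
  have "(NN w. ennreal (?\<Phi> w) \<partial>completion Pa) = (NN w. ennreal (final_value (pp F) f (pp G) u w) + ennreal (final_value (pp ?Fm) f (pp ?Gm) u w) \<partial>completion Pa)"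
   unfolding final_value_def pp_def by (intro nn_integral_cong split(1))
  then show ?thesis using nn_integral_add[OF fm[OF F(1) G(1)] fm[OF Fm Gm]] by (simp add: N_def nn_integral_completion)
 qed
 have minus: "(NN w. ennreal (- ?\<Phi> w) \<partial>completion Pa) = N F ?Gm + N ?Fm G"
 proof -
  have "(NN w. ennreal (- ?\<Phi> w) \<partial>completion Pa) = (NN w. ennreal (final_value (pp F) f (pp ?Gm) u w) + ennreal (final_value (pp ?Fm) f (pp G) u w) \<partial>completion Pa)"
   unfolding final_value_def pp_def by (intro nn_integral_cong split(2))
  then show ?thesis using nn_integral_add[OF fm[OF F(1) Gm] fm[OF Fm G(1)]] by (simp add: N_def nn_integral_completion)
 qed
 have le: "(NN w. ennreal (?\<Phi> w) \<partial>Pa) <= (NN w. ennreal \<bar>?\<Phi> w\<bar> \<partial>Pa)" "(NN w. ennreal (- ?\<Phi> w) \<partial>Pa) <= (NN w. ennreal \<bar>?\<Phi> w\<bar> \<partial>Pa)"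
  by (intro nn_integral_mono ennreal_leI; simp)+
 have fin2: "N F G + N ?Fm ?Gm < top" "N F ?Gm + N ?Fm G < top"
  using le_less_trans[OF le(1) fin] le_less_trans[OF le(2) fin] plus minus by (simp_all only: nn_integral_completion)
 show int: "integrable (completion Pa) ?\<Phi>"
  unfolding real_integrable_def using \<Phi>m plus minus fin2 by (auto simp: less_top[symmetric])
 have lhs: "(\<integral>w. ?\<Phi> w \<partial>completion Pa) = enn2real (N F G + N ?Fm ?Gm) - enn2real (N F ?Gm + N ?Fm G)"
  unfolding real_lebesgue_integral_def[OF int] plus minus ..
 have kfin: "k G < top" "k ?Gm < top"
  unfolding k_def using G G' Gm by (auto intro!: future_finite[OF u ppm] ppb(2))
 define \<kappa> where "\<kappa> = (LINT ex:(longer u)|completion \<eta>. G (stop u ex) * ?h ex)"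
 have \<kappa>: "\<kappa> = enn2real (k G) - enn2real (k ?Gm)"
 proof -
  let ?i = "%ex. indicat_real (longer u) ex *\<^sub>R (G (stop u ex) * ?h ex)"
  have e: "ennreal (?i ex) = ennreal (pp G (stop u ex) * ?h ex) * ind (longer u) ex"
   "ennreal (- ?i ex) = ennreal (pp ?Gm (stop u ex) * ?h ex) * ind (longer u) ex" for ex
   using ennreal_sign_split[OF hlim_nonneg[OF A] zero_le_one, of "G (stop u ex)" "pos u ex" 1]
   by (auto simp: pp_def indicator_def)
  note m = future_long_exc(2)[OF u ppm[OF G(1)]] future_long_exc(2)[OF u ppm[OF Gm]]
  have i: "?i ex = enn2real (ennreal (?i ex)) - enn2real (ennreal (- ?i ex))" for ex by (cases "0 <= ?i ex") (auto simp: ennreal_neg)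
  have im: "?i \<in> bm (completion \<eta>)" by (subst i) (unfold e, use m in measurable)
  have I: "(NN ex. ennreal (?i ex) \<partial>completion \<eta>) = k G" "(NN ex. ennreal (- ?i ex) \<partial>completion \<eta>) = k ?Gm"
   unfolding e k_def future_def by (rule nn_integral_completion)+
  have "integrable (completion \<eta>) ?i" unfolding real_integrable_def using im I kfin by (auto simp: less_top[symmetric])
  from real_lebesgue_integral_def[OF this] show ?thesis unfolding I \<kappa>_def set_lebesgue_integral_def .
 qed
 let ?J = "%w. LINT t:{0..a}|completion (lt w). F (kill t w) * f t * \<kappa>"
 have "(\<integral>w. ?\<Phi> w \<partial>completion Pa) = 1 / enn2real ?V * (\<integral>w. ?J w \<partial>cP x)"
 proof (cases "?V = 0 \<or> k G = 0 & k ?Gm = 0")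
  case True
  have "N F G = 0" "N ?Fm ?Gm = 0" "N F ?Gm = 0" "N ?Fm G = 0"
  proof -
   have "p F' = 0" if "?V = 0" "F' \<in> bm path_space" for F'
    unfolding p_def using that V_pot by (intro pot_zero measurable_past ppm f) simp_all
   then show "N F G = 0" "N ?Fm ?Gm = 0" "N F ?Gm = 0" "N ?Fm G = 0" unfolding rep' using True F(1) Fm by auto
  qed
  then have "(\<integral>w. ?\<Phi> w \<partial>completion Pa) = 0" unfolding lhs by simp
  moreover have "1 / enn2real ?V * (\<integral>w. ?J w \<partial>cP x) = 0"
  proof (cases "?V = 0")
   case False
   then have "\<kappa> = 0" using True \<kappa> by simp
   then show ?thesis by (simp add: set_lebesgue_integral_def)
  qed simp
  ultimately show ?thesis by simp
 next
  case False
  have Vf: "?V < top" unfolding V_pot by (rule pot_finite)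
  have iV: "1 / ?V ~= 0" using Vf by (simp add: divide_ennreal_def)
  have pfin: "p F < top" "p ?Fm < top"
  proof -
   have *: "y < top" if "c * (k' * y) < top" "c ~= 0" "k' ~= 0" for c k' y :: ennreal
    using that by (auto simp: less_top[symmetric] ennreal_mult_eq_top_iff)
   have "k G ~= 0 \<or> k ?Gm ~= 0" using False by blast
   moreover have "1 / ?V * (k G * p F) < top" "1 / ?V * (k ?Gm * p F) < top" "1 / ?V * (k G * p ?Fm) < top" "1 / ?V * (k ?Gm * p ?Fm) < top"
    using fin2 unfolding rep' by simp_all
   ultimately show "p F < top" "p ?Fm < top" using *[OF _ iV] by blast+
  qed
  define A where "A F w = lt_int 0 (%z. cutoff z * past (pp F) f z) w" for F w
  have Am: "A F' \<in> bm (cP x)" if "F' \<in> bm path_space" for F'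
   unfolding A_def[abs_def]
   by (rule measurable_lt_int[OF borel_measurable_times_ennreal[OF cutoff_measurable measurable_past[OF ppm[OF that] f(1)]]])
  have Ai: "(NN w. A F' w \<partial>cP x) = p F'" for F' by (simp add: A_def p_def pot_def nn_integral_completion)
  have I: "integrable (cP x) (%w. enn2real (A F' w))" "(\<integral>w. enn2real (A F' w) \<partial>cP x) = enn2real (p F')"
   if "F' \<in> bm path_space" "p F' < top" for F'
   using integral_enn2real[OF Am[OF that(1)]] that(2) unfolding Ai by auto
  have ae: "AE w in P x. A F' w < top" if "F' \<in> bm path_space" "p F' < top" for F'
  proof -
   have "AE w in cP x. A F' w ~= \<infinity>" using Am[OF that(1)] Ai[of F'] that(2) by (intro nn_integral_noteq_infinite) auto
   then show ?thesis by (simp add: AE_completion_iff less_top)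
  qed
  have J: "AE w in P x. ?J w = \<kappa> * (enn2real (A F w) - enn2real (A ?Fm w))"
   using ae[OF F(1) pfin(1)] ae[OF Fm pfin(2)] local_time_side[OF ppm[OF F(1)] f(1), of 1] local_time_side[OF ppm[OF Fm] f(1), of 1] AE_space
  proof eventually_elim
   case (elim w)
   then have w: "w \<in> paths" by simp
   let ?j = "%t. indicat_real {0..a} t *\<^sub>R (F (kill t w) * f t)"
   have e: "ennreal (?j t) = ennreal (pp F (kill t w) * f t) * 1 * ind {0..a} t"
    "ennreal (- ?j t) = ennreal (pp ?Fm (kill t w) * f t) * 1 * ind {0..a} t" for t
    using ennreal_sign_split[OF f(2) zero_le_one, of t "F (kill t w)" 1] by (auto simp: pp_def indicator_def)
   have m: "(%t. ennreal (pp F' (kill t w) * f t) * 1 * ind {0..a} t) \<in> bm borel"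
    if "F' \<in> bm path_space" for F'
   proof -
    have "(%t. ind {0..} t * past (pp F') f (w, t) * ind {..a} t) \<in> bm borel"
     by (rule borel_measurable_times_ennreal[OF measurable_optional_section[OF measurable_past[OF ppm[OF that] f(1)] w]]) simp
    then show ?thesis by (rule measurable_cong[THEN iffD1, rotated]) (auto simp: past_def indicator_def)
   qed
   have i: "?j t = enn2real (ennreal (?j t)) - enn2real (ennreal (- ?j t))" for t by (cases "0 <= ?j t") (auto simp: ennreal_neg)
   have jm: "?j \<in> bm (lt w)"
    by (subst i) (unfold e, use m[OF F(1)] m[OF Fm] in simp)
   have II: "(NN t. ennreal (?j t) \<partial>lt w) = A F w" "(NN t. ennreal (- ?j t) \<partial>lt w) = A ?Fm w"
    unfolding e using elim(3,4) by (simp_all add: A_def)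
   have "integrable (lt w) ?j" unfolding real_integrable_def using jm II elim(1,2) by (auto simp: less_top[symmetric])
   then have "(LINT t|lt w. ?j t) = enn2real (A F w) - enn2real (A ?Fm w)"
    using real_lebesgue_integral_def II by metis
   then have "(LINT t|completion (lt w). ?j t) = enn2real (A F w) - enn2real (A ?Fm w)"
    using integral_completion[OF jm] by simp
   moreover have "?J w = (LINT t|completion (lt w). ?j t * \<kappa>)" by (simp add: set_lebesgue_integral_def mult.assoc)
   ultimately show ?case by simp
  qed
  let ?D = "%w. \<kappa> * (enn2real (A F w) - enn2real (A ?Fm w))"
  have Dm: "?D \<in> bm (cP x)" using Am[OF F(1)] Am[OF Fm] by measurable
  have Jm: "?J \<in> bm (cP x)" by (rule completion_measurable_AE[OF Dm J]) simp
  have "(\<integral>w. ?J w \<partial>cP x) = (\<integral>w. ?D w \<partial>cP x)"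
   by (intro integral_cong_AE Jm Dm AE_completion[OF J])
  also have "... = \<kappa> * (enn2real (p F) - enn2real (p ?Fm))"
   using I[OF F(1) pfin(1)] I[OF Fm pfin(2)] by simp
  finally have rhs: "(\<integral>w. ?J w \<partial>cP x) = \<kappa> * (enn2real (p F) - enn2real (p ?Fm))" .
  have sums: "enn2real (N F G + N ?Fm ?Gm) = enn2real (N F G) + enn2real (N ?Fm ?Gm)" "enn2real (N F ?Gm + N ?Fm G) = enn2real (N F ?Gm) + enn2real (N ?Fm G)"
   using fin2 by (auto intro!: enn2real_plus)
  have iv: "enn2real (1 / ?V) = 1 / enn2real ?V"
   using Vf False by (cases ?V) (auto simp: divide_ennreal simp flip: ennreal_1)
  have "(\<integral>w. ?\<Phi> w \<partial>completion Pa) = 1 / enn2real ?V * (\<kappa> * (enn2real (p F) - enn2real (p ?Fm)))"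
   unfolding lhs sums unfolding rep' enn2real_mult iv \<kappa> by (simp add: algebra_simps)
  then show ?thesis unfolding rhs .
 qed
 then show ?eq
  unfolding \<kappa>_def .
qed

end

end

end

theorem theorem3p2:
  fixes P :: "real \<Rightarrow> path measure" and L :: "real \<Rightarrow> path \<Rightarrow> real"
    and \<beta> :: real and \<eta> :: "path measure"
    and a x u :: real and Pa :: "path measure"
    and F G :: "path \<Rightarrow> real" and f :: "real \<Rightarrow> real"
  assumes process: "nice_markov_process P L \<beta> \<eta>"
    and hits_zero: "\<And>y. \<P>(\<omega> in completion (P y). hit0 \<omega> < \<top>) > 0"
    and A: "\<And>y. \<exists>l. ((\<lambda>q. hq P \<beta> \<eta> q y) \<longlongrightarrow> l) (at_right 0)"
    and B: "(\<exists>H \<in> borel_measurable borel.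
                (\<forall>q>0. \<forall>y. \<bar>hq P \<beta> \<eta> q y\<bar> \<le> H y) \<and>
                (SUP t\<in>{0..}. \<integral>\<^sup>+\<epsilon>. ennreal (H (pos t \<epsilon>))
                    * indicator {\<epsilon>. ennreal t < exc_length \<epsilon>} \<epsilon> \<partial>\<eta>) < \<top>)
            \<or> (\<forall>y. mono_on {0<..} (\<lambda>q. hq P \<beta> \<eta> q y) \<or> antimono_on {0<..} (\<lambda>q. hq P \<beta> \<eta> q y))"
    and a: "0 < a" and u: "0 < u"
    and Pa: "is_last_zero_law P a x Pa"
    and F: "F \<in> borel_measurable path_space" "bounded (F ` paths)"
    and G: "G \<in> borel_measurable path_space" "bounded (G ` paths)"
    and f: "f \<in> borel_measurable (restrict_space borel {0..})" "\<And>t. 0 \<le> t \<Longrightarrow> 0 \<le> f t"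
  defines "g \<equiv> last_zero \<top>"
    and "h \<equiv> hlim P \<beta> \<eta>"
  defines "\<Phi> \<equiv> (\<lambda>\<omega>. F (kill (enn2real (g \<omega>)) \<omega>) * f (enn2real (g \<omega>))
                    * G (stop u (shift (enn2real (g \<omega>)) \<omega>))
                    * indicator {\<omega>. g \<omega> + ennreal u < lifetime \<omega>} \<omega>)"
  shows
    "((\<forall>\<omega>\<in>paths. 0 \<le> F \<omega> \<and> 0 \<le> G \<omega>) \<longrightarrow>
       (\<integral>\<^sup>+\<omega>. ennreal (\<Phi> \<omega>) \<partial>Pa) =
       1 / V P L 0 a x *
         (\<integral>\<^sup>+\<omega>. (\<integral>\<^sup>+t\<in>{0..a}. ennreal (F (kill t \<omega>) * f t)
             * (\<integral>\<^sup>+\<epsilon>. ennreal (G (stop u \<epsilon>) * h (pos u \<epsilon>))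
                    * indicator {\<epsilon>. ennreal u < exc_length \<epsilon>} \<epsilon> \<partial>\<eta>)
           \<partial>local_time_measure L \<omega>) \<partial>P x))
    \<and>
     ((\<integral>\<^sup>+\<omega>. ennreal \<bar>\<Phi> \<omega>\<bar> \<partial>Pa) < \<top> \<longrightarrow>
       integrable (completion Pa) \<Phi> \<and>
       (\<integral>\<omega>. \<Phi> \<omega> \<partial>completion Pa) =
       1 / enn2real (V P L 0 a x) *
         (\<integral>\<omega>. (LINT t:{0..a}|completion (local_time_measure L \<omega>). F (kill t \<omega>) * f t
             * (LINT \<epsilon>:{\<epsilon>. ennreal u < exc_length \<epsilon>}|completion \<eta>. G (stop u \<epsilon>) * h (pos u \<epsilon>)))
           \<partial>completion (P x)))"
proof -
  interpret nice_markov_process P L \<beta> \<eta> by (rule process)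
  interpret last_zero_law P L \<beta> \<eta> a x Pa by unfold_locales (rule a, rule Pa)
  have \<Phi>: "\<Phi> = final_value F f G u" by (simp add: \<Phi>_def g_def final_value_def fun_eq_iff)
  obtain KF where KF: "\<And>\<omega>. \<omega> \<in> paths \<Longrightarrow> \<bar>F \<omega>\<bar> \<le> KF" using F(2) by (auto simp: bounded_iff)
  obtain KG where KG: "\<And>\<omega>. \<omega> \<in> paths \<Longrightarrow> \<bar>G \<omega>\<bar> \<le> KG" using G(2) by (auto simp: bounded_iff)
  show ?thesis
  proof (intro conjI impI, goal_cases)
    case 1
    have "(\<integral>\<^sup>+\<omega>. ennreal (\<Phi> \<omega>) \<partial>Pa) = 1 / V P L 0 a x * (future G u * pot 0 (\<lambda>z. cutoff z * past F f z))"
      unfolding \<Phi> by (rule last_zero_representation[OF A B F(1) _ _ G(1) _ _ f u]) (use 1 KF KG in \<open>auto simp: abs_le_iff\<close>)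
    then show ?case
      unfolding h_def future_def[symmetric] local_time_side_integral[OF F(1) f(1)] .
  next
    case 2
    show ?case
      unfolding \<Phi> by (rule last_zero_representation_signed(1)[OF A B F(1) KF G(1) KG f u 2[unfolded \<Phi>]])
  next
    case 3
    show ?case
      unfolding \<Phi> h_def by (rule last_zero_representation_signed(2)[OF A B F(1) KF G(1) KG f u 3[unfolded \<Phi>]])
  qed
qed

end
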